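(* Let $k \ge 2$ be an integer and let $\mathbb{F}_k$ be the free group of rank $k$. Then there exists a subgroup $H$ of type $\mathrm{F}_{\lfloor k/2 \rfloor - 1}$ of $\mathrm{Aut}(\mathbb{F}_k)$ such that $H$ contains infinitely many conjugacy classes of elements of order $2$.
   Context: $\lfloor k/2 \rfloor$ denotes the floor of $k/2$. A group $H$ is of type $\mathrm{F}_n$ ($n \ge 0$) if there is a $K(H,1)$ CW-complex with finite $n$-skeleton; in particular every group is of type $\mathrm{F}_0$. Conjugacy classes in $H$ are taken with respect to conjugation by elements of $H$ itself. *)

theory Defs
  imports "HOL-Analysis.Analysis" "HOL-Algebra.Bij" "HOL-Algebra.Elementary_Groups" "HOL-Algebra.Multiplicative_Group"
begin

section \<open>Free groups of finite rank\<close>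

text \<open>A letter \<open>(b, i)\<close> stands for the generator \<open>x\<^sub>i\<close> if \<open>b\<close> is true and for its inverse otherwise.\<close>

type_synonym letter = "bool \<times> nat"

definition inv_letter :: "letter \<Rightarrow> letter" where
  "inv_letter a = (\<not> fst a, snd a)"

definition reduced_word :: "letter list \<Rightarrow> bool" where
  "reduced_word w \<longleftrightarrow> successively (\<lambda>a b. b \<noteq> inv_letter a) w"

fun reduced_cons :: "letter \<Rightarrow> letter list \<Rightarrow> letter list" where
  "reduced_cons a [] = [a]"
| "reduced_cons a (b # w) = (if b = inv_letter a then w else a # b # w)"

definition free_group :: "nat \<Rightarrow> letter list monoid" where
  "free_group k =
    \<lparr>carrier = {w. set w \<subseteq> UNIV \<times> {..<k} \<and> reduced_word w},
     mult = (\<lambda>u v. foldr reduced_cons u v),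
     one = []\<rparr>"


section \<open>Conjugacy classes\<close>

definition conjugacy_class :: "('a, 'b) monoid_scheme \<Rightarrow> 'a \<Rightarrow> 'a set" where
  "conjugacy_class G x = (\<lambda>g. g \<otimes>\<^bsub>G\<^esub> x \<otimes>\<^bsub>G\<^esub> inv\<^bsub>G\<^esub> g) ` carrier G"


section \<open>CW complexes\<close>

definition unit_disc :: "nat \<Rightarrow> (nat \<Rightarrow> real) set" where
  "unit_disc n = {x \<in> topspace (Euclidean_space n). (\<Sum>i<n. (x i)\<^sup>2) \<le> 1}"

definition open_unit_disc :: "nat \<Rightarrow> (nat \<Rightarrow> real) set" where
  "open_unit_disc n = {x \<in> topspace (Euclidean_space n). (\<Sum>i<n. (x i)\<^sup>2) < 1}"

text \<open>The library's \<open>nsphere (n - 1)\<close> is not used because the boundary of the 0-disc must be empty.\<close>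

definition disc_boundary :: "nat \<Rightarrow> (nat \<Rightarrow> real) set" where
  "disc_boundary n = {x \<in> topspace (Euclidean_space n). (\<Sum>i<n. (x i)\<^sup>2) = 1}"

text \<open>
  Whitehead's definition: \<open>C n\<close> is the set of characteristic maps of the \<open>n\<close>-cells.
  Values of a characteristic map outside \<open>unit_disc n\<close> are irrelevant; since the open cells of
  different members of \<open>C\<close> are required to be disjoint, every cell is still listed only once.
\<close>

definition CW_complex :: "'x topology \<Rightarrow> (nat \<Rightarrow> ((nat \<Rightarrow> real) \<Rightarrow> 'x) set) \<Rightarrow> bool" where
  "CW_complex X C \<longleftrightarrow>
     Hausdorff_space X \<and>
     (\<forall>n. \<forall>\<Phi> \<in> C n.
        continuous_map (subtopology (Euclidean_space n) (unit_disc n)) X \<Phi> \<and>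
        embedding_map (subtopology (Euclidean_space n) (open_unit_disc n)) X \<Phi>) \<and>
     disjoint_family_on (\<lambda>(n, \<Phi>). \<Phi> ` open_unit_disc n) (SIGMA n:UNIV. C n) \<and>
     (\<Union>(n, \<Phi>) \<in> (SIGMA n:UNIV. C n). \<Phi> ` open_unit_disc n) = topspace X \<and>
     (\<forall>n. \<forall>\<Phi> \<in> C n. \<exists>F. finite F \<and> F \<subseteq> (SIGMA m:{..<n}. C m) \<and>
        \<Phi> ` disc_boundary n \<subseteq> (\<Union>(m, \<Psi>) \<in> F. \<Psi> ` open_unit_disc m)) \<and>
     (\<forall>A \<subseteq> topspace X.
        closedin X A \<longleftrightarrow> (\<forall>n. \<forall>\<Phi> \<in> C n. closedin X (A \<inter> \<Phi> ` unit_disc n)))"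

definition finite_skeleton :: "nat \<Rightarrow> (nat \<Rightarrow> ((nat \<Rightarrow> real) \<Rightarrow> 'x) set) \<Rightarrow> bool" where
  "finite_skeleton n C \<longleftrightarrow> finite (SIGMA m:{..n}. C m)"


section \<open>Homotopy groups\<close>

definition cube :: "nat \<Rightarrow> (nat \<Rightarrow> real) set" where
  "cube n = {x \<in> topspace (Euclidean_space n). \<forall>i<n. 0 \<le> x i \<and> x i \<le> 1}"

definition cube_boundary :: "nat \<Rightarrow> (nat \<Rightarrow> real) set" where
  "cube_boundary n = {x \<in> cube n. \<exists>i<n. x i = 0 \<or> x i = 1}"

definition cube_loops :: "nat \<Rightarrow> 'x topology \<Rightarrow> 'x \<Rightarrow> ((nat \<Rightarrow> real) \<Rightarrow> 'x) set" where
  "cube_loops n X x0 =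
     {f. continuous_map (subtopology (Euclidean_space n) (cube n)) X f \<and>
         (\<forall>z \<in> cube_boundary n. f z = x0)}"

definition loop_homotopy :: "nat \<Rightarrow> 'x topology \<Rightarrow> 'x \<Rightarrow> ((nat \<Rightarrow> real) \<Rightarrow> 'x) rel" where
  "loop_homotopy n X x0 =
     {(f, g). f \<in> cube_loops n X x0 \<and> g \<in> cube_loops n X x0 \<and>
        homotopic_with (\<lambda>h. \<forall>z \<in> cube_boundary n. h z = x0)
          (subtopology (Euclidean_space n) (cube n)) X f g}"

text \<open>Concatenation in the first coordinate.\<close>

definition loop_concat ::
    "((nat \<Rightarrow> real) \<Rightarrow> 'x) \<Rightarrow> ((nat \<Rightarrow> real) \<Rightarrow> 'x) \<Rightarrow> (nat \<Rightarrow> real) \<Rightarrow> 'x" where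
  "loop_concat f g =
     (\<lambda>z. if z 0 \<le> 1/2 then f (z(0 := 2 * z 0)) else g (z(0 := 2 * z 0 - 1)))"

text \<open>Only meaningful for \<open>n \<ge> 1\<close> and \<open>x0 \<in> topspace X\<close>.\<close>

definition homotopy_group :: "nat \<Rightarrow> 'x topology \<Rightarrow> 'x \<Rightarrow> ((nat \<Rightarrow> real) \<Rightarrow> 'x) set monoid" where
  "homotopy_group n X x0 =
    \<lparr>carrier = cube_loops n X x0 // loop_homotopy n X x0,
     mult = (\<lambda>A B. \<Union>f \<in> A. \<Union>g \<in> B. loop_homotopy n X x0 `` {loop_concat f g}),
     one = loop_homotopy n X x0 `` {\<lambda>_. x0}\<rparr>"


section \<open>The finiteness properties F\<close>

definition Eilenberg_MacLane_1 :: "'x topology \<Rightarrow> ('a, 'b) monoid_scheme \<Rightarrow> bool" where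
  "Eilenberg_MacLane_1 X G \<longleftrightarrow>
     path_connected_space X \<and>
     (\<exists>x0 \<in> topspace X.
        homotopy_group 1 X x0 \<cong> G \<and>
        (\<forall>n \<ge> 2. trivial_group (homotopy_group n X x0)))"

text \<open>
  HOL cannot quantify over the type of points of the complex. The type chosen here loses no
  generality: a \<open>K(G,1)\<close> complex with finite \<open>n\<close>-skeleton can be replaced by one with the same
  \<open>n\<close>-skeleton and at most \<open>max \<bar>G\<bar> \<aleph>\<^sub>0\<close> cells (add cells of dimension greater than \<open>n\<close> to kill
  homotopy; for \<open>n = 0\<close> take the bar construction), so its cells can be labelled by lists over
  the type of elements of \<open>G\<close>, and its points by a label and a point of an open disc.
\<close>

definition type_F :: "nat \<Rightarrow> ('a, 'b) monoid_scheme \<Rightarrow> bool" where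
  "type_F n G \<longleftrightarrow>
     (\<exists>(X :: ('a list \<times> (nat \<Rightarrow> real)) topology) C.
        CW_complex X C \<and> Eilenberg_MacLane_1 X G \<and> finite_skeleton n C)"

end

theory Submission
  imports Defs
begin

text \<open>
  Let \<open>m = k div 2\<close> and let \<open>G\<close> be the semidirect product of the \<open>m\<close>-th power of the free group of
  rank 2 with the group of order 2 that swaps the two generators in every factor. Splitting \<open>2 m\<close> of
  the generators of the free group of rank \<open>k\<close> into pairs, conjugations within the pairs and the
  simultaneous swap embed \<open>G\<close> into the automorphism group. \<open>H\<close> is the kernel of the total exponent sum.
  The swap fixes only the trivial word, so an element that conjugates \<open>(a\<^sup>j b\<^sup>-\<^sup>j, 1, \<dots>, 1; swap)\<close> to
  \<open>(a\<^sup>l b\<^sup>-\<^sup>l, 1, \<dots>, 1; swap)\<close> has exponent sum \<open>l - j\<close>. These involutions are therefore pairwise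
  non-conjugate in \<open>H\<close>.

  A classifying space of \<open>H\<close> is the quotient of a zero level set in the spirit of Bestvina and Brady.
  It is built by recursion on \<open>m\<close> as a tree of spaces over the tree whose vertices are the cosets of
  the two generators (\<open>line\<close>) and whose edges are the words: a vertex carries a contractible space
  of step functions with values in \<open>G\<close>, an edge carries the previous space, attached by \<open>phi\<close>. Each
  level set is a directed union of finite subtrees of open stars, any new star meeting the old ones in
  a product of an interval with a level set of the previous space, so all level sets are weakly contractible.
  Step functions with fewer than \<open>m\<close> jumps form finitely many orbits of cells because consecutive values
  are close, which makes the \<open>(m - 1)\<close>-skeleton of the quotient finite.
\<close>

section \<open>Continuous maps on boxes\<close>

text \<open>A level set in a product of \<open>m\<close> trees is only (m - 2)-connected, so it
  cannot itself be the universal cover of a classifying space. The recursion repairs this one factor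
  at a time. In the group for \<open>m + 1\<close> factors, an element of \<open>H\<close> that
  fixes a vertex of the first tree has its first entry determined by the exponent sum of the other
  entries, so the vertex stabiliser is a copy of the \<open>m\<close>-th power of the free group;
  the stabiliser of an edge is a copy of the group \<open>H\<close> for \<open>m\<close> factors. A
  contractible space over each vertex therefore costs finitely many orbits of cells in every
  dimension, and the product with an edge raises the dimension of the remaining cells by one: this
  is the gain of one finiteness property per factor. Torsion and the inversion of edges by the swap
  rule out a free action on the trees themselves; multiplication on the values of step functions is
  free, because the cells are ordered tuples of group elements. Weak contractibility is stated as
  extension of maps from boundaries of boxes, which keeps the gluing elementary: no homology
  enters.\<close>

abbreviation cmap :: "'x::topological_space set => 'y topology => ('x => 'y) => bool" where
 "cmap S Y f \<equiv> continuous_map (top_of_set S) Y f"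

lemma cmap_paste:
 assumes "finite I" "\<And>i. i \<in> I ==> closedin (top_of_set S) (T i)"
  and "\<And>i. i \<in> I ==> cmap (T i) Y f" "S \<subseteq> (\<Union>i\<in>I. T i)"
 shows "cmap S Y f"
proof (rule pasting_lemma_closed[where I=I and T=T and f="\<lambda>_. f"])
 fix i assume "i \<in> I"
 hence "subtopology (top_of_set S) (T i) = top_of_set (T i)"
  using assms(2) closedin_imp_subset by (metis inf.absorb_iff2 subtopology_subtopology)
 thus "continuous_map (subtopology (top_of_set S) (T i)) Y f"
  using assms(3) \<open>i \<in> I\<close> by simp
qed (use assms in auto)

lemma cmap_Un:
 assumes "closed A" "closed B" "cmap A Y f" "cmap B Y f"
 shows "cmap (A \<union> B) Y f"
proof (rule cmap_paste[of "{A,B}" _ id])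
 show "\<And>i. i \<in> {A, B} ==> closedin (top_of_set (A \<union> B)) (id i)"
  using assms by (auto intro: closed_subset)
qed (use assms in auto)

lemma cmap_compose:
 "cmap S Y f ==> continuous_on S' g ==> g ` S' \<subseteq> S ==> cmap S' Y (\<lambda>x. f (g x))"
 using continuous_map_compose[of "top_of_set S'" "top_of_set S" g Y f]
 by (auto simp: o_def continuous_map_in_subtopology)

lemma cmap_subset: "cmap S Y f ==> T \<subseteq> S ==> cmap T Y f"
 by (rule continuous_map_from_subtopology_mono)

lemma cmap_cong: "cmap S Y f ==> (\<And>x. x \<in> S ==> f x = g x) ==> cmap S Y g"
 by (rule continuous_map_eq[of _ _ f]) auto

lemma cmap_in: "cmap S Y f ==> x \<in> S ==> f x \<in> topspace Y"
 using continuous_map_funspace by fastforce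

lemma cmap_subtopology:
 "cmap S (subtopology Y A) f \<longleftrightarrow> cmap S Y f \<and> f ` S \<subseteq> A"
 by (auto simp: continuous_map_in_subtopology)

type_synonym rvec = "nat => real"

lemma continuous_on_fun_upd:
 fixes g :: "'x::topological_space => rvec"
 assumes "continuous_on S g" "continuous_on S h"
 shows "continuous_on S (\<lambda>x. (g x)(i := h x))"
proof (rule continuous_on_coordinatewise_then_product)
 fix j
 show "continuous_on S (\<lambda>x. ((g x)(i := h x)) j)"
  using assms continuous_on_product_then_coordinatewise[of S g j] by (cases "j = i") auto
qed

lemma continuous_on_proj [continuous_intros]:
 "continuous_on S (\<lambda>x::rvec. x i)"
 using continuous_on_product_then_coordinatewise[OF continuous_on_id] .

lemma continuous_on_coord:
 fixes g :: "'x::topological_space => rvec"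
 shows "continuous_on S g ==> continuous_on S (\<lambda>x. g x i)"
 by (rule continuous_on_product_then_coordinatewise)

lemma compact_box: "compact {a..b::rvec}"
proof -
 have "{a..b} = PiE UNIV (\<lambda>i. {a i..b i})"
  by (auto simp: le_fun_def PiE_def Pi_def)
 thus ?thesis
  using compactin_PiE[of "\<lambda>_. euclideanreal" UNIV "\<lambda>i. {a i..b i}"]
  by (simp add: euclidean_product_topology)
qed

lemma closed_box: "closed {a..b::rvec}"
 by (simp add: compact_box compact_imp_closed)

text \<open>The metric on functions is at most twice the largest distance over finitely many
  coordinates plus a geometric tail. This gives the factor 2, and the tail is sent to 0.\<close>

lemma dist_rvec_le:
 fixes x y :: rvec
 assumes "\<And>i. \<bar>x i - y i\<bar> <= e"
 shows "dist x y <= 2 * e"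
proof (rule field_le_epsilon)
 fix d :: real assume "d > 0"
 obtain N where N: "(1/2::real)^N < d"
  using \<open>d > 0\<close> real_arch_pow_inv[of d "1/2"] by auto
 have "dist x y <= 2 * Max {dist (x (from_nat n)) (y (from_nat n))|n. n <= N} + (1/2)^N"
  by (rule dist_fun_le_dist_first_terms)
 moreover have "Max {dist (x (from_nat n)) (y (from_nat n))|n. n <= N} <= e"
  using assms by (subst Max_le_iff) (auto simp: dist_real_def)
 ultimately show "dist x y <= 2 * e + d"
  using N by linarith
qed

text \<open>Grids control coordinates rather than distances, so the Lebesgue number is translated:
  coordinates within a quarter of it keep the diameter at half of it.\<close>

lemma box_lebesgue:
 fixes a b :: rvec
 assumes "a <= b" "S \<subseteq> {a..b}" "closed S" "\<And>U. U \<in> \<U> ==> open U" "S \<subseteq> \<Union>\<U>"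
 shows "\<exists>\<epsilon>>0. \<forall>T. T ~= {} --> T \<subseteq> S --> (\<forall>x\<in>T. \<forall>y\<in>T. \<forall>i. \<bar>x i - y i\<bar> <= \<epsilon>) --> (\<exists>U\<in>\<U>. T \<subseteq> U)"
proof (cases "S = {}")
 case True
 thus ?thesis by (intro exI[of _ 1]) auto
next
 case False
 have "compact S"
  using assms compact_box[of a b] compact_Int_closed[of "{a..b}" S] by (simp add: inf.absorb2)
 moreover have "\<U> ~= {}" using assms(5) False by auto
 ultimately obtain \<delta> where \<delta>: "\<delta> > 0" "\<And>T. [|T \<subseteq> S; diameter T < \<delta>|] ==> \<exists>B \<in> \<U>. T \<subseteq> B"
  using Lebesgue_number_lemma[of "S" \<U>] assms by metis
 show ?thesis
 proof (intro exI[of _ "\<delta>/4"] conjI allI impI)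
  fix T assume h: "T ~= {}" "T \<subseteq> S" "\<forall>x\<in>T. \<forall>y\<in>T. \<forall>i. \<bar>x i - y i\<bar> <= \<delta> / 4"
  have "dist x y <= \<delta>/2" if "x \<in> T" "y \<in> T" for x y
   using dist_rvec_le[of x y "\<delta>/4"] h that by simp
  hence "(SUP (x,y)\<in>T \<times> T. dist x y) <= \<delta>/2"
   using h(1) by (intro cSUP_least) auto
  hence "diameter T <= \<delta>/2"
   using h(1) by (simp add: diameter_def)
  thus "\<exists>U\<in>\<U>. T \<subseteq> U"
   using \<delta> h by auto
 qed (use \<delta> in auto)
qed

text \<open>This is the boundary relative to the affine hull, since only directions with
  \<open>a i < b i\<close> count. Faces and walls of a box are thus boxes of the same kind, a
  one-point box has empty boundary, and boxes of all finite dimensions live in one type.\<close>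

definition rbd :: "rvec => rvec => rvec set" where
 "rbd a b = {x \<in> {a..b}. \<exists>i. a i < b i \<and> (x i = a i \<or> x i = b i)}"

lemma closed_rbd:
 assumes "finite {i. a i < b i}"
 shows "closed (rbd a b)"
proof -
 have "rbd a b = {a..b} \<inter> (\<Union>i\<in>{i. a i < b i}. {x. x i = a i} \<union> {x. x i = b i})"
  unfolding rbd_def by auto
 moreover have "closed {x::rvec. x i = c}" for i c
  by (intro closed_Collect_eq continuous_intros continuous_on_product_coordinates)
 ultimately show ?thesis
  using assms by (auto intro!: closed_Int closed_UN closed_Un closed_box)
qed

lemma rbd_subset: "rbd a b \<subseteq> {a..b}"
 by (auto simp: rbd_def)

text \<open>The set \<open>T\<close> collects the directions in which a box may still be long, and
  \<open>N\<close> bounds the number of strips of width \<epsilon> needed in the direction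
  \<open>j\<close>. One strip is cut off at a time. Degenerate directions have length 0 and never
  need a cut.\<close>

lemma box_split_induct:
 fixes a b :: rvec
 assumes ab: "a <= b" "finite {i. a i < b i}" and "\<epsilon> > 0"
  and small: "\<And>a' b'. a <= a' ==> a' <= b' ==> b' <= b ==> (\<And>i. b' i - a' i <= \<epsilon>) ==> P a' b'"
  and split: "\<And>a' b' i c. a <= a' ==> a' <= b' ==> b' <= b ==> a' i <= c ==> c <= b' i ==>
     P a' (b'(i := c)) ==> P (a'(i := c)) b' ==> P a' b'"
 shows "P a b"
proof -
 have "\<forall>a' b'. a <= a' --> a' <= b' --> b' <= b --> (\<forall>i. i \<notin> T --> b' i - a' i <= \<epsilon>) --> P a' b'"
  if "finite T" for T
  using that
 proof (induction T rule: finite_induct)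
  case empty
  thus ?case using small by blast
 next
  case (insert j T)
  have "\<forall>a' b'. a <= a' --> a' <= b' --> b' <= b --> (\<forall>i. i \<notin> insert j T --> b' i - a' i <= \<epsilon>)
     --> b' j - a' j <= real N * \<epsilon> --> P a' b'" for N
  proof (induction N)
   case 0
   show ?case
   proof (intro allI impI)
    fix a' b' :: rvec
    assume h: "a <= a'" "a' <= b'" "b' <= b" "\<forall>i. i \<notin> insert j T --> b' i - a' i <= \<epsilon>"
     "b' j - a' j <= real 0 * \<epsilon>"
    have "\<forall>i. i \<notin> T --> b' i - a' i <= \<epsilon>"
    proof (intro allI impI)
     fix i assume "i \<notin> T"
     thus "b' i - a' i <= \<epsilon>"
      using h(4,5) \<open>\<epsilon> > 0\<close> by (cases "i = j") auto
    qed
    thus "P a' b'" using insert.IH h by blast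
   qed
  next
   case (Suc N)
   show ?case
   proof (intro allI impI)
    fix a' b' :: rvec
    assume h: "a <= a'" "a' <= b'" "b' <= b" "\<forall>i. i \<notin> insert j T --> b' i - a' i <= \<epsilon>"
     "b' j - a' j <= real (Suc N) * \<epsilon>"
    show "P a' b'"
    proof (cases "b' j - a' j <= \<epsilon>")
     case True
     thus ?thesis using insert.IH h by (metis insert_iff)
    next
     case False
     define c where "c = a' j + \<epsilon>"
     have c: "a' j <= c" "c <= b' j" using False \<open>\<epsilon> > 0\<close> by (auto simp: c_def)
     have "P a' (b'(j := c))"
     proof -
      have "a' <= b'(j := c)" "b'(j := c) <= b"
       using h c by (auto simp: le_fun_def intro: order_trans)
      moreover have "\<forall>i. i \<notin> T --> (b'(j := c)) i - a' i <= \<epsilon>"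
       using h by (auto simp: c_def)
      ultimately show ?thesis using insert.IH h(1) by blast
     qed
     moreover have "P (a'(j := c)) b'"
     proof -
      have "a <= a'(j := c)" "a'(j := c) <= b'"
       using h c by (auto simp: le_fun_def intro: order_trans)
      moreover have "\<forall>i. i \<notin> insert j T --> b' i - (a'(j := c)) i <= \<epsilon>"
       using h by auto
      moreover have "b' j - (a'(j := c)) j <= real N * \<epsilon>"
       using h(5) by (simp add: c_def algebra_simps)
      ultimately show ?thesis using Suc.IH h(3) by blast
     qed
     ultimately show ?thesis using split h c by blast
    qed
   qed
  qed
  note N = this
  show ?case
  proof (intro allI impI)
   fix a' b' :: rvec
   assume h: "a <= a'" "a' <= b'" "b' <= b" "\<forall>i. i \<notin> insert j T --> b' i - a' i <= \<epsilon>"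
   obtain N :: nat where "b' j - a' j <= real N * \<epsilon>"
    using \<open>\<epsilon> > 0\<close> ex_less_of_nat_mult less_imp_le by blast
   thus "P a' b'" using N h by blast
  qed
 qed
 from this[OF ab(2)] show ?thesis
  using ab \<open>\<epsilon> > 0\<close> by (smt (verit, ccfv_threshold) mem_Collect_eq order_refl)
qed

section \<open>Weakly contractible spaces\<close>

lemma continuous_on_Max_finite:
 fixes g :: "'i => 'x::topological_space => real"
 assumes "finite D" "D ~= {}" "\<And>i. i \<in> D ==> continuous_on S (g i)"
 shows "continuous_on S (\<lambda>x. Max ((\<lambda>i. g i x) ` D))"
 using assms
proof (induction rule: finite_ne_induct)
 case (singleton i)
 thus ?case by simp
next
 case (insert i D)
 have "continuous_on S (\<lambda>x. max (g i x) (Max ((\<lambda>i. g i x) ` D)))"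
  using insert by (intro continuous_on_max) auto
 thus ?case using insert.hyps by simp
qed

lemma top_of_set_Times:
 "top_of_set (S \<times> T) = prod_topology (top_of_set S) (top_of_set T)"
 by (simp add: prod_topology_subtopology subtopology_subtopology Times_Int_Times)

text \<open>Whether a map on the boundary extends depends only on its homotopy class. The filling of
  the time-1 map is shrunk to the concentric box of half the size, and the homotopy runs across the
  remaining collar, reaching time 0 on the outer boundary.\<close>

lemma extension_homotopy:
 fixes a b :: rvec
 assumes ab: "a <= b" and fin: "finite {i. a i < b i}"
  and F: "cmap ({0..1::real} \<times> rbd a b) Y (\<lambda>(t,x). F t x)"
  and g: "cmap {a..b} Y g" "\<And>x. x \<in> rbd a b ==> g x = F 1 x"
 shows "\<exists>g'. cmap {a..b} Y g' \<and> (\<forall>x\<in>rbd a b. g' x = F 0 x)"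
proof (cases "{i. a i < b i} = {}")
 case True
 hence "rbd a b = {}" by (auto simp: rbd_def)
 thus ?thesis using g by auto
next
 case False
 define D where "D = {i. a i < b i}"
 define m where "m = (\<lambda>i. (a i + b i) / 2)"
 define l where "l = (\<lambda>i. (b i - a i) / 2)"
 \<comment> \<open>\<nu> is the supremum norm around the midpoint, scaled to be 1 on the boundary.
   \<open>R\<close> is the radial projection to the boundary and \<open>Q\<close> expands the
   half-size box to the full one; both coincide where \<nu> is 1/2.\<close>
 define \<nu> where "\<nu> = (\<lambda>x::rvec. Max ((\<lambda>i. \<bar>x i - m i\<bar> / l i) ` D))"
 define R where "R = (\<lambda>x::rvec. (\<lambda>i. m i + (x i - m i) / \<nu> x))"
 define Q where "Q = (\<lambda>x::rvec. (\<lambda>i. m i + 2 * (x i - m i)))"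
 have D: "finite D" "D ~= {}" using fin False by (auto simp: D_def)
 have l: "l i > 0" if "i \<in> D" for i using that by (auto simp: D_def l_def)
 have abi: "a i <= b i" for i using ab by (simp add: le_fun_def)
 have nD: "a i = b i" "m i = a i" if "i \<notin> D" for i
  using that abi[of i] by (auto simp: D_def m_def)
 have aml: "a i = m i - l i" "b i = m i + l i" for i by (auto simp: m_def l_def field_simps)
 have inbox: "x \<in> {a..b} \<longleftrightarrow> (\<forall>i. \<bar>x i - m i\<bar> <= l i)" for x
  unfolding atLeastAtMost_iff le_fun_def aml by (auto simp: abs_le_iff algebra_simps)
 have l0: "l i = 0" if "i \<notin> D" for i using nD[OF that] by (simp add: l_def)
 have \<nu>ge: "\<bar>x i - m i\<bar> <= \<nu> x * l i" if "x \<in> {a..b}" for x i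
 proof (cases "i \<in> D")
  case True
  hence "\<bar>x i - m i\<bar> / l i <= \<nu> x" using D by (auto simp: \<nu>_def)
  thus ?thesis using l[OF True] by (simp add: field_simps)
 next
  case False
  thus ?thesis using that inbox l0 by (metis mult_zero_right)
 qed
 have \<nu>ex: "\<exists>i\<in>D. \<nu> x = \<bar>x i - m i\<bar> / l i" for x
 proof -
  have "\<nu> x \<in> (\<lambda>i. \<bar>x i - m i\<bar> / l i) ` D"
   unfolding \<nu>_def using D by (intro Max_in) auto
  thus ?thesis by auto
 qed
 have \<nu>1: "\<nu> x <= 1" if "x \<in> {a..b}" for x
  using \<nu>ex[of x] that l inbox by (auto simp: field_simps)
 have rbdx: "x \<in> rbd a b \<longleftrightarrow> x \<in> {a..b} \<and> (\<exists>i\<in>D. \<bar>x i - m i\<bar> = l i)" for x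
  unfolding rbd_def D_def aml using l D_def aml by (auto simp: abs_if)
 have \<nu>r: "\<nu> x = 1" if "x \<in> rbd a b" for x
 proof -
  have x: "x \<in> {a..b}" using that rbd_subset by blast
  have "\<exists>i\<in>D. \<bar>x i - m i\<bar> = l i" using that rbdx[of x] by blast
  then obtain i where "i \<in> D" "\<bar>x i - m i\<bar> = l i" by blast
  hence "1 <= \<nu> x" using \<nu>ge[OF x, of i] l[of i] by simp
  thus ?thesis using \<nu>1[OF x] by linarith
 qed
 have Rr: "R x \<in> rbd a b" if "x \<in> {a..b}" "\<nu> x > 0" for x
 proof -
  have "\<bar>R x i - m i\<bar> <= l i" for i
   using \<nu>ge[OF that(1), of i] that(2) by (simp add: R_def abs_divide divide_le_eq mult.commute)
  moreover obtain i where "i \<in> D" "\<nu> x = \<bar>x i - m i\<bar> / l i" using \<nu>ex by blast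
  hence i: "i \<in> D" "\<nu> x * l i = \<bar>x i - m i\<bar>"
   using l[of i] by simp_all
  have "\<bar>R x i - m i\<bar> = \<bar>x i - m i\<bar> / \<nu> x"
   using that(2) by (simp add: R_def abs_divide)
  with i have "\<bar>R x i - m i\<bar> = l i" "i \<in> D"
   using that(2) by (simp_all add: nonzero_eq_divide_eq flip: i(2))
  ultimately show ?thesis using rbdx[of "R x"] inbox[of "R x"] by metis
 qed
 have Qb: "Q x \<in> {a..b}" if "x \<in> {a..b}" "\<nu> x <= 1/2" for x
  unfolding inbox
 proof
  fix i
  have "\<bar>x i - m i\<bar> <= 1/2 * l i"
  proof -
   have "\<nu> x * l i <= 1/2 * l i"
    using that(2) l[of i] l0[of i] by (intro mult_right_mono) (cases "i \<in> D"; simp)+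
   thus ?thesis using \<nu>ge[OF that(1), of i] by linarith
  qed
  moreover have "Q x i - m i = 2 * (x i - m i)" by (simp add: Q_def)
  ultimately show "\<bar>Q x i - m i\<bar> <= l i" by (simp only: abs_mult) simp
 qed
 have c\<nu>: "continuous_on S \<nu>" for S
  unfolding \<nu>_def
 proof (rule continuous_on_Max_finite[OF D])
  fix i assume "i \<in> D"
  hence "l i ~= 0" using l[of i] by simp
  thus "continuous_on S (\<lambda>x. \<bar>x i - m i\<bar> / l i)"
   by (intro continuous_intros) simp
 qed
 let ?A = "{x \<in> {a..b}. 1/2 <= \<nu> x}" and ?B = "{x \<in> {a..b}. \<nu> x <= 1/2}"
 have clA: "closed ?A" and clB: "closed ?B"
  by (intro continuous_on_closed_Collect_le c\<nu> closed_box continuous_on_const)+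
 have cR: "continuous_on ?A R"
  unfolding R_def
  by (intro continuous_on_coordinatewise_then_product continuous_intros c\<nu>) auto
 have cQ: "continuous_on ?B Q"
  unfolding Q_def
  by (intro continuous_on_coordinatewise_then_product continuous_intros)
 define g' where "g' = (\<lambda>x. if 1/2 <= \<nu> x then F (2 - 2 * \<nu> x) (R x) else g (Q x))"
 have "cmap ?A Y (\<lambda>x. (\<lambda>(t,x). F t x) (2 - 2 * \<nu> x, R x))"
 proof (rule cmap_compose[OF F])
  show "continuous_on ?A (\<lambda>x. (2 - 2 * \<nu> x, R x))"
   by (intro continuous_intros c\<nu> cR)
  have "(2 - 2 * \<nu> x, R x) \<in> {0..1} \<times> rbd a b" if "x \<in> ?A" for x
   using Rr[of x] \<nu>1[of x] that by simp
  thus "(\<lambda>x. (2 - 2 * \<nu> x, R x)) ` ?A \<subseteq> {0..1} \<times> rbd a b"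
   by blast
 qed
 hence 1: "cmap ?A Y g'"
  by (rule cmap_cong) (auto simp: g'_def)
 have "cmap ?B Y (\<lambda>x. g (Q x))"
  by (rule cmap_compose[OF g(1) cQ]) (use Qb in blast)
 hence 2: "cmap ?B Y g'"
 proof (rule cmap_cong)
  fix x assume x: "x \<in> ?B"
  show "g (Q x) = g' x"
  proof (cases "\<nu> x = 1/2")
   case True
   have "R x = Q x" unfolding R_def Q_def True by (simp add: fun_eq_iff mult.commute)
   moreover have "R x \<in> rbd a b" using Rr x True by simp
   moreover have "2 - 2 * \<nu> x = 1" "1/2 <= \<nu> x" using True by simp_all
   ultimately show ?thesis using g(2) by (simp add: g'_def)
  next
   case False
   thus ?thesis using x by (simp add: g'_def)
  qed
 qed
 have "?A \<union> ?B = {a..b}" by fastforce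
 with cmap_Un[OF clA clB 1 2] have g': "cmap {a..b} Y g'" by (simp only:)
 have "g' x = F 0 x" if "x \<in> rbd a b" for x
 proof -
  have "R x = x" using \<nu>r[OF that] by (simp add: R_def)
  thus ?thesis using \<nu>r[OF that] by (simp add: g'_def)
 qed
 with g' show ?thesis by blast
qed

text \<open>A box with n nondegenerate directions is an n-disc, so all homotopy groups vanish at
  once: n = 0 says that the space is nonempty, n = 1 that it is path connected, and n + 1 that every
  n-sphere bounds.\<close>

definition weakly_contractible :: "'y topology => bool" where
 "weakly_contractible Y \<longleftrightarrow> (\<forall>(a::rvec) b f. a <= b --> finite {i. a i < b i} --> cmap (rbd a b) Y f -->
   (\<exists>g. cmap {a..b} Y g \<and> (\<forall>x\<in>rbd a b. g x = f x)))"

lemma weakly_contractibleD: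
 "weakly_contractible Y ==> a <= b ==> finite {i. a i < b i} ==> cmap (rbd a b) Y f ==>
   (\<exists>g. cmap {a..b} Y g \<and> (\<forall>x\<in>rbd a b. g x = f x))"
 unfolding weakly_contractible_def by blast

lemma weakly_contractible_nonempty:
 assumes "weakly_contractible Y"
 shows "topspace Y ~= {}"
proof -
 define z :: rvec where "z = (\<lambda>_. 0)"
 have "rbd z z = {}" by (auto simp: rbd_def)
 hence "cmap (rbd z z) Y undefined" by (simp add: continuous_map_def)
 then obtain g where "cmap {z..z} Y g"
  using weakly_contractibleD[OF assms, of z z] by auto
 hence "g z \<in> topspace Y" by (rule cmap_in) simp
 thus ?thesis by blast
qed

text \<open>The boundary map is pushed to \<open>Z\<close> by \<open>r\<close>, filled there, and
  the filling is brought back by \<open>i\<close>. Its boundary values are then wrong only by the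
  homotopy \<open>K\<close>, which \<open>extension_homotopy\<close> undoes.\<close>

lemma weakly_contractible_dominated:
 assumes "weakly_contractible Z" "continuous_map Y Z r" "continuous_map Z Y i"
  and K: "continuous_map (prod_topology (top_of_set {0..1::real}) Y) Y K"
  and K01: "\<And>y. y \<in> topspace Y ==> K (0, y) = y" "\<And>y. y \<in> topspace Y ==> K (1, y) = i (r y)"
 shows "weakly_contractible Y"
 unfolding weakly_contractible_def
proof (intro allI impI)
 fix a b :: rvec and f
 assume h: "a <= b" "finite {i. a i < b i}" "cmap (rbd a b) Y f"
 have "cmap (rbd a b) Z (\<lambda>x. r (f x))"
  using continuous_map_compose[OF h(3) assms(2)] by (simp add: o_def)
 then obtain g where g: "cmap {a..b} Z g" "\<forall>x\<in>rbd a b. g x = r (f x)"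
  using weakly_contractibleD[OF assms(1) h(1,2)] by blast
 have gi: "cmap {a..b} Y (\<lambda>x. i (g x))"
  using continuous_map_compose[OF g(1) assms(3)] by (simp add: o_def)
 have "continuous_map (prod_topology (top_of_set {0..1::real}) (top_of_set (rbd a b)))
    (prod_topology (top_of_set {0..1::real}) Y) (\<lambda>(t,x). (t, f x))"
  unfolding case_prod_unfold
  by (rule continuous_map_pairedI[OF continuous_map_fst
     continuous_map_compose[OF continuous_map_snd h(3), unfolded o_def]])
 hence F: "cmap ({0..1::real} \<times> rbd a b) Y (\<lambda>(t,x). K (t, f x))"
  unfolding top_of_set_Times
  by (rule continuous_map_eq[OF continuous_map_compose[OF _ K]]) auto
 have eq: "i (g x) = K (1, f x)" "K (0, f x) = f x" if "x \<in> rbd a b" for x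
  using that g(2) K01 cmap_in[OF h(3) that] by auto
 show "\<exists>g. cmap {a..b} Y g \<and> (\<forall>x\<in>rbd a b. g x = f x)"
  using extension_homotopy[of a b Y "\<lambda>t x. K (t, f x)" "\<lambda>x. i (g x)", OF h(1,2) F gi eq(1)] eq(2)
  by simp
qed

lemma weakly_contractible_singleton:
 assumes "topspace Y = {y}"
 shows "weakly_contractible Y"
 unfolding weakly_contractible_def
proof (intro allI impI)
 fix a b :: rvec and f
 assume h: "cmap (rbd a b) Y f"
 hence "\<forall>x\<in>rbd a b. y = f x" using assms cmap_in by force
 moreover have "cmap {a..b} Y (\<lambda>_. y)" using assms by simp
 ultimately show "\<exists>g. cmap {a..b} Y g \<and> (\<forall>x\<in>rbd a b. g x = f x)" by metis
qed

lemma weakly_contractible_contractible: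
 assumes "y0 \<in> topspace Y"
  and K: "continuous_map (prod_topology (top_of_set {0..1::real}) Y) Y K"
  and K01: "\<And>y. y \<in> topspace Y ==> K (0, y) = y" "\<And>y. y \<in> topspace Y ==> K (1, y) = y0"
 shows "weakly_contractible Y"
proof (rule weakly_contractible_dominated[OF _ _ _ K K01(1)])
 show "weakly_contractible (discrete_topology {y0})"
  by (rule weakly_contractible_singleton) simp
 show "continuous_map Y (discrete_topology {y0}) (\<lambda>_. y0)" by simp
 show "continuous_map (discrete_topology {y0}) Y (\<lambda>_. y0)" using assms(1) by simp
qed (use K01 in auto)

text \<open>The image of a boundary is compact, hence covered by finitely many of the open sets and
  so, by directedness, contained in a single one. The filling takes place there.\<close>

lemma weakly_contractible_Union:
 assumes op: "\<And>U. U \<in> \<U> ==> openin Y U" and wc: "\<And>U. U \<in> \<U> ==> weakly_contractible (subtopology Y U)"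
  and cov: "topspace Y \<subseteq> \<Union>\<U>" and ne: "\<U> ~= {}"
  and dir: "\<And>U V. U \<in> \<U> ==> V \<in> \<U> ==> \<exists>W\<in>\<U>. U \<union> V \<subseteq> W"
 shows "weakly_contractible Y"
 unfolding weakly_contractible_def
proof (intro allI impI)
 fix a b :: rvec and f
 assume h: "a <= b" "finite {i. a i < b i}" "cmap (rbd a b) Y f"
 have ub: "\<exists>W\<in>\<U>. \<Union>\<F> \<subseteq> W" if "finite \<F>" "\<F> \<subseteq> \<U>" for \<F>
  using that
 proof (induction \<F> rule: finite_induct)
  case empty
  thus ?case using ne by auto
 next
  case (insert U \<F>)
  then obtain W where "W \<in> \<U>" "\<Union>\<F> \<subseteq> W" by auto
  moreover obtain W' where "W' \<in> \<U>" "U \<union> W \<subseteq> W'" using dir[of U W] insert.prems \<open>W \<in> \<U>\<close> by auto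
  ultimately show ?case by auto
 qed
 have "compact (rbd a b)"
  using compact_Int_closed[OF compact_box closed_rbd[OF h(2)], of a b] rbd_subset[of a b]
  by (simp add: inf.absorb2)
 hence "compactin Y (f ` rbd a b)"
  using image_compactin[OF _ h(3), of "rbd a b"] by (simp add: compactin_subtopology)
 then obtain \<F> where \<F>: "finite \<F>" "\<F> \<subseteq> \<U>" "f ` rbd a b \<subseteq> \<Union>\<F>"
  using compactinD[of Y "f ` rbd a b" \<U>] op cov compactin_subset_topspace[of Y "f ` rbd a b"]
  by (meson order_trans)
 then obtain W where W: "W \<in> \<U>" "f ` rbd a b \<subseteq> W" using ub[of \<F>] by auto
 then obtain g where "cmap {a..b} (subtopology Y W) g" "\<forall>x\<in>rbd a b. g x = f x"
  using weakly_contractibleD[OF wc h(1,2), of W f] h(3) by (auto simp: cmap_subtopology)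
 thus "\<exists>g. cmap {a..b} Y g \<and> (\<forall>x\<in>rbd a b. g x = f x)"
  by (auto simp: cmap_subtopology)
qed

lemma le_fun_upd_iff:
 fixes b :: rvec
 assumes "\<mu> <= b i"
 shows "z <= b(i := \<mu>) \<longleftrightarrow> z <= b \<and> z i <= \<mu>"
proof
 assume *: "z <= b(i := \<mu>)"
 have "z j <= b j" for j using le_funD[OF *, of j] assms by (cases "j = i") auto
 thus "z <= b \<and> z i <= \<mu>" using le_funD[OF *, of i] by (simp add: le_fun_def)
qed (auto simp: le_fun_def)

lemma fun_upd_le_iff:
 fixes a :: rvec
 assumes "a i <= \<mu>"
 shows "a(i := \<mu>) <= z \<longleftrightarrow> a <= z \<and> \<mu> <= z i"
proof
 assume *: "a(i := \<mu>) <= z"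
 have "a j <= z j" for j using le_funD[OF *, of j] assms by (cases "j = i") auto
 thus "a <= z \<and> \<mu> <= z i" using le_funD[OF *, of i] by (simp add: le_fun_def)
qed (auto simp: le_fun_def)

text \<open>Direction \<open>p\<close> is the time of a homotopy and is never cut;
  \<open>T z\<close> is the set in which the value at \<open>z\<close> must lie, and
  \<open>Z\<close> is the part of the box that matters. A box crossed by a grid value is cut along a
  wall; the wall is filled first, then both halves. For an uncut box the hypothesis leaves two
  cases: \<open>Z\<close> meets it only in its sides, where everything is prescribed already, or the
  box can be filled inside one weakly contractible set \<open>S\<close>. Filling inside
  \<open>S\<close> respects \<open>T\<close> because \<open>T z\<close> is all of \<open>S\<close>
  away from the sides.\<close>

lemma grid_extension:
 fixes a b :: rvec and \<Lambda> :: "nat => real set" and T :: "rvec => 'y set"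
 assumes fin\<Lambda>: "\<And>i. finite (\<Lambda> i)" and clZ: "closed Z" and ab: "finite {i. a i < b i}"
  and el: "\<And>a' b'. a <= a' ==> a' <= b' ==> b' <= b ==> a' p = 0 ==> b' p = 1 ==>
    (\<And>i. i ~= p ==> a' i \<in> \<Lambda> i \<and> b' i \<in> \<Lambda> i) ==>
    (\<And>i \<mu>. i ~= p ==> \<mu> \<in> \<Lambda> i ==> \<mu> <= a' i \<or> b' i <= \<mu>) ==>
    (\<forall>z\<in>{a'..b'} \<inter> Z. \<exists>i. i ~= p \<and> a' i < b' i \<and> (z i = a' i \<or> z i = b' i)) \<or>
    ({a'..b'} \<subseteq> Z \<and> (\<exists>S. weakly_contractible (subtopology Y S) \<and> (\<forall>z\<in>{a'..b'}. T z \<subseteq> S) \<and>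
     (\<forall>z\<in>{a'..b'}. (\<forall>i. i ~= p --> a' i < b' i --> a' i < z i \<and> z i < b' i) --> T z = S)))"
 shows "a <= a' ==> a' <= b' ==> b' <= b ==> a' p = 0 ==> b' p = 1 ==>
    (\<And>i. i ~= p ==> a' i \<in> \<Lambda> i \<and> b' i \<in> \<Lambda> i) ==>
    cmap (rbd a' b' \<inter> Z) Y F ==> (\<And>z. z \<in> rbd a' b' \<inter> Z ==> F z \<in> T z) ==>
    \<exists>G. cmap ({a'..b'} \<inter> Z) Y G \<and> (\<forall>z\<in>rbd a' b' \<inter> Z. G z = F z) \<and> (\<forall>z\<in>{a'..b'} \<inter> Z. G z \<in> T z)"
proof (induction "\<Sum>i\<in>{i. a i < b i} - {p}. card (\<Lambda> i \<inter> {a' i..b' i})" arbitrary: a' b' F rule: less_induct)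
 case (less a' b' F)
 note h = less.prems
 have abi: "a i <= a' i" "a' i <= b' i" "b' i <= b i" for i
  using h(1,2,3) by (auto simp: le_fun_def)
 have fD: "finite {i. a' i < b' i}"
  by (rule finite_subset[OF _ ab]) (use abi in \<open>force intro: le_less_trans less_le_trans\<close>)
 show ?case
 proof (cases "\<exists>i \<mu>. i ~= p \<and> \<mu> \<in> \<Lambda> i \<and> a' i < \<mu> \<and> \<mu> < b' i")
  case False
  hence "\<And>i \<mu>. i ~= p ==> \<mu> \<in> \<Lambda> i ==> \<mu> <= a' i \<or> b' i <= \<mu>" by force
  from el[OF h(1-6) this] show ?thesis
  proof
   assume *: "\<forall>z\<in>{a'..b'} \<inter> Z. \<exists>i. i ~= p \<and> a' i < b' i \<and> (z i = a' i \<or> z i = b' i)"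
   hence eq: "rbd a' b' \<inter> Z = {a'..b'} \<inter> Z"
    unfolding rbd_def by blast
   show ?thesis
    using h(7,8) unfolding eq by (intro exI[of _ F]) blast
  next
   assume "{a'..b'} \<subseteq> Z \<and> (\<exists>S. weakly_contractible (subtopology Y S) \<and> (\<forall>z\<in>{a'..b'}. T z \<subseteq> S) \<and>
     (\<forall>z\<in>{a'..b'}. (\<forall>i. i ~= p --> a' i < b' i --> a' i < z i \<and> z i < b' i) --> T z = S))"
   then obtain S where S: "{a'..b'} \<subseteq> Z" "weakly_contractible (subtopology Y S)" "\<forall>z\<in>{a'..b'}. T z \<subseteq> S"
    "\<And>z. z \<in> {a'..b'} ==> (\<forall>i. i ~= p --> a' i < b' i --> a' i < z i \<and> z i < b' i) ==> T z = S" by metis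
   have eq: "rbd a' b' \<inter> Z = rbd a' b'" "{a'..b'} \<inter> Z = {a'..b'}"
    using S(1) rbd_subset[of a' b'] by blast+
   have FT: "F z \<in> T z" if "z \<in> rbd a' b'" for z using h(8) that eq by blast
   have "F ` rbd a' b' \<subseteq> S"
    using FT S(3) rbd_subset[of a' b'] by blast
   hence "cmap (rbd a' b') (subtopology Y S) F"
    using h(7) eq by (simp add: cmap_subtopology)
   then obtain G where G: "cmap {a'..b'} (subtopology Y S) G" "\<forall>x\<in>rbd a' b'. G x = F x"
    using weakly_contractibleD[OF S(2) h(2) fD] by blast
   have "G z \<in> T z" if z: "z \<in> {a'..b'}" for z
   proof (cases "z \<in> rbd a' b'")
    case True
    thus ?thesis using FT G(2) by simp
   next
    case False
    have zi: "a' i <= z i" "z i <= b' i" for i using z by (auto simp: le_fun_def)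
    have "\<forall>i. i ~= p --> a' i < b' i --> a' i < z i \<and> z i < b' i"
     using False z zi unfolding rbd_def by (auto simp: less_le)
    hence "T z = S" using S(4) z by blast
    thus ?thesis using G(1) z by (auto simp: cmap_subtopology)
   qed
   moreover have "cmap {a'..b'} Y G" using G(1) by (simp add: cmap_subtopology)
   ultimately show ?thesis using G(2) unfolding eq by blast
  qed
 next
  case True
  then obtain i \<mu> where \<mu>: "i ~= p" "\<mu> \<in> \<Lambda> i" "a' i < \<mu>" "\<mu> < b' i" by blast
  define b1 where "b1 = b'(i := \<mu>)"
  define a2 where "a2 = a'(i := \<mu>)"
  let ?D = "{i. a i < b i} - {p}"
  have iD: "i \<in> ?D" using \<mu> abi[of i] by simp
  have le: "a' <= b1" "b1 <= b'" "a' <= a2" "a2 <= b'" "a2 <= b1"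
   using abi \<mu> by (auto simp: le_fun_def b1_def a2_def less_imp_le)
  have le': "a <= a2" "b1 <= b" using h(1,3) le by (meson order_trans)+
  have p: "a2 p = 0" "b1 p = 1" using \<mu>(1) h(4,5) by (auto simp: a2_def b1_def)
  have al: "a2 j \<in> \<Lambda> j" "b1 j \<in> \<Lambda> j" "a' j \<in> \<Lambda> j" "b' j \<in> \<Lambda> j" if "j ~= p" for j
   using h(6)[OF that] \<mu>(2) by (auto simp: a2_def b1_def)
  \<comment> \<open>The cut value survives in the wall and in both halves, but each of these boxes
    loses at least one of the end values \<open>a' i\<close> and \<open>b' i\<close>, which are grid
    values themselves. So the number of grid values drops.\<close>
  have meas: "(\<Sum>j\<in>?D. card (\<Lambda> j \<inter> {a'' j..b'' j})) < (\<Sum>j\<in>?D. card (\<Lambda> j \<inter> {a' j..b' j}))"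
   if "a' <= a''" "b'' <= b'" "a' i < a'' i \<or> b'' i < b' i" for a'' b''
  proof (rule sum_strict_mono_ex1)
   show "finite ?D" using ab by simp
   have sub: "\<Lambda> j \<inter> {a'' j..b'' j} \<subseteq> \<Lambda> j \<inter> {a' j..b' j}" for j
    using le_funD[OF that(1), of j] le_funD[OF that(2), of j] by auto
   thus "\<forall>j\<in>?D. card (\<Lambda> j \<inter> {a'' j..b'' j}) <= card (\<Lambda> j \<inter> {a' j..b' j})"
    using fin\<Lambda> by (auto intro!: card_mono)
   have "\<Lambda> i \<inter> {a'' i..b'' i} ~= \<Lambda> i \<inter> {a' i..b' i}"
   proof (cases "a' i < a'' i")
    case True
    hence "a' i \<notin> \<Lambda> i \<inter> {a'' i..b'' i}" "a' i \<in> \<Lambda> i \<inter> {a' i..b' i}"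
     using al[OF \<mu>(1)] abi(2)[of i] by auto
    thus ?thesis by blast
   next
    case False
    hence "b' i \<notin> \<Lambda> i \<inter> {a'' i..b'' i}" "b' i \<in> \<Lambda> i \<inter> {a' i..b' i}"
     using al[OF \<mu>(1)] abi(2)[of i] that(3) by auto
    thus ?thesis by blast
   qed
   hence "card (\<Lambda> i \<inter> {a'' i..b'' i}) < card (\<Lambda> i \<inter> {a' i..b' i})"
    using fin\<Lambda> sub[of i] by (intro psubset_card_mono) auto
   thus "\<exists>j\<in>?D. card (\<Lambda> j \<inter> {a'' j..b'' j}) < card (\<Lambda> j \<inter> {a' j..b' j})"
    using iD by blast
  qed
  have boxC: "{a2..b1} = {z \<in> {a'..b'}. z i = \<mu>}"
   using \<mu> by (auto simp: a2_def b1_def le_fun_upd_iff fun_upd_le_iff less_imp_le)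
  have rC: "rbd a2 b1 = {z \<in> rbd a' b'. z i = \<mu>}"
  proof -
   have "a2 j < b1 j \<and> (z j = a2 j \<or> z j = b1 j) \<longleftrightarrow> a' j < b' j \<and> (z j = a' j \<or> z j = b' j)"
    if "z i = \<mu>" for z j
    using that \<mu> by (cases "j = i") (auto simp: a2_def b1_def)
   thus ?thesis unfolding rbd_def boxC by blast
  qed
  have "cmap (rbd a2 b1 \<inter> Z) Y F" by (rule cmap_subset[OF h(7)]) (auto simp: rC)
  moreover have "F z \<in> T z" if "z \<in> rbd a2 b1 \<inter> Z" for z using h(8) that rC by blast
  moreover have ai: "a' i < a2 i \<or> b1 i < b' i" using \<mu> by (simp add: a2_def)
  ultimately have "\<exists>G. cmap ({a2..b1} \<inter> Z) Y G \<and> (\<forall>z\<in>rbd a2 b1 \<inter> Z. G z = F z) \<and> (\<forall>z\<in>{a2..b1} \<inter> Z. G z \<in> T z)"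
   by (intro less.hyps[OF meas[OF le(3,2)]] le le' p al conjI)
  then obtain GC where GC: "cmap ({a2..b1} \<inter> Z) Y GC" "\<forall>z\<in>rbd a2 b1 \<inter> Z. GC z = F z"
   "\<forall>z\<in>{a2..b1} \<inter> Z. GC z \<in> T z"
   by blast
  define F1 where "F1 = (\<lambda>z. if z i = \<mu> then GC z else F z)"
  have F1C: "F1 z = GC z" if "z \<in> {a2..b1}" for z using that boxC by (auto simp: F1_def)
  have F1F: "F1 z = F z" if "z \<in> rbd a' b' \<inter> Z" for z
   using that rC GC(2) by (auto simp: F1_def)
  have cF1: "cmap (({a2..b1} \<inter> Z) \<union> (rbd a' b' \<inter> Z)) Y F1"
  proof (rule cmap_Un)
   show "cmap ({a2..b1} \<inter> Z) Y F1" by (rule cmap_cong[OF GC(1)]) (simp add: F1C)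
   show "cmap (rbd a' b' \<inter> Z) Y F1" by (rule cmap_cong[OF h(7)]) (simp add: F1F)
  qed (use clZ closed_box closed_rbd[OF fD] in auto)
  have F1T: "F1 z \<in> T z" if "z \<in> ({a2..b1} \<inter> Z) \<union> (rbd a' b' \<inter> Z)" for z
   using that F1C F1F GC(3) h(8) by (metis UnE IntD1)
  have r1: "rbd a' b1 \<inter> Z \<subseteq> ({a2..b1} \<inter> Z) \<union> (rbd a' b' \<inter> Z)"
  proof
   fix z assume z: "z \<in> rbd a' b1 \<inter> Z"
   then obtain j where j: "a' j < b1 j" "z j = a' j \<or> z j = b1 j" by (auto simp: rbd_def)
   have zb: "z \<in> {a'..b'}" using subsetD[OF rbd_subset, of z a' b1] z order_trans[OF _ le(2), of z] by simp
   show "z \<in> ({a2..b1} \<inter> Z) \<union> (rbd a' b' \<inter> Z)"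
   proof (cases "z i = \<mu>")
    case True
    thus ?thesis using boxC zb z by blast
   next
    case False
    hence "a' j < b' j \<and> (z j = a' j \<or> z j = b' j)"
     using j \<mu> by (cases "j = i") (auto simp: b1_def)
    thus ?thesis using zb z unfolding rbd_def by blast
   qed
  qed
  have r2: "rbd a2 b' \<inter> Z \<subseteq> ({a2..b1} \<inter> Z) \<union> (rbd a' b' \<inter> Z)"
  proof
   fix z assume z: "z \<in> rbd a2 b' \<inter> Z"
   then obtain j where j: "a2 j < b' j" "z j = a2 j \<or> z j = b' j" by (auto simp: rbd_def)
   have zb: "z \<in> {a'..b'}" using subsetD[OF rbd_subset, of z a2 b'] z order_trans[OF le(3), of z] by simp
   show "z \<in> ({a2..b1} \<inter> Z) \<union> (rbd a' b' \<inter> Z)"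
   proof (cases "z i = \<mu>")
    case True
    thus ?thesis using boxC zb z by blast
   next
    case False
    hence "a' j < b' j \<and> (z j = a' j \<or> z j = b' j)"
     using j \<mu> by (cases "j = i") (auto simp: a2_def)
    thus ?thesis using zb z unfolding rbd_def by blast
   qed
  qed
  have "b1 i < b' i" "a' i < a2 i" using \<mu> by (auto simp: a2_def b1_def)
  have "\<exists>G. cmap ({a'..b1} \<inter> Z) Y G \<and> (\<forall>z\<in>rbd a' b1 \<inter> Z. G z = F1 z) \<and> (\<forall>z\<in>{a'..b1} \<inter> Z. G z \<in> T z)"
   using \<open>b1 i < b' i\<close> F1T[OF subsetD[OF r1]]
   by (intro less.hyps[OF meas[OF order_refl le(2)]] le le' p al h(1,4) conjI disjI2 cmap_subset[OF cF1 r1])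
  then obtain G1 where G1: "cmap ({a'..b1} \<inter> Z) Y G1" "\<forall>z\<in>rbd a' b1 \<inter> Z. G1 z = F1 z" "\<forall>z\<in>{a'..b1} \<inter> Z. G1 z \<in> T z"
   by blast
  have "\<exists>G. cmap ({a2..b'} \<inter> Z) Y G \<and> (\<forall>z\<in>rbd a2 b' \<inter> Z. G z = F1 z) \<and> (\<forall>z\<in>{a2..b'} \<inter> Z. G z \<in> T z)"
   using \<open>a' i < a2 i\<close> F1T[OF subsetD[OF r2]]
   by (intro less.hyps[OF meas[OF le(3) order_refl]] le le' p al h(3,5) conjI disjI1 cmap_subset[OF cF1 r2])
  then obtain G2 where G2: "cmap ({a2..b'} \<inter> Z) Y G2" "\<forall>z\<in>rbd a2 b' \<inter> Z. G2 z = F1 z" "\<forall>z\<in>{a2..b'} \<inter> Z. G2 z \<in> T z"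
   by blast
  define G where "G = (\<lambda>z. if z i <= \<mu> then G1 z else G2 z)"
  have box1: "{a'..b1} = {z \<in> {a'..b'}. z i <= \<mu>}"
   using \<mu> by (auto simp: b1_def le_fun_upd_iff less_imp_le)
  have box2: "{a2..b'} = {z \<in> {a'..b'}. \<mu> <= z i}"
   using \<mu> by (auto simp: a2_def fun_upd_le_iff less_imp_le)
  have GG1: "G z = G1 z" if "z \<in> {a'..b1}" for z using that box1 by (auto simp: G_def)
  have mid: "G1 z = F1 z \<and> G2 z = F1 z" if "z \<in> {a'..b'} \<inter> Z" "z i = \<mu>" for z
  proof -
   have "z \<in> rbd a' b1" using that box1 \<mu> unfolding rbd_def by (auto simp: b1_def intro!: exI[of _ i])
   moreover have "z \<in> rbd a2 b'" using that box2 \<mu> unfolding rbd_def by (auto simp: a2_def intro!: exI[of _ i])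
   ultimately show ?thesis using that G1(2) G2(2) by blast
  qed
  have GG2: "G z = G2 z" if "z \<in> {a2..b'} \<inter> Z" for z
   using that box2 mid[of z] by (cases "z i = \<mu>") (auto simp: G_def)
  have "cmap (({a'..b1} \<inter> Z) \<union> ({a2..b'} \<inter> Z)) Y G"
  proof (rule cmap_Un)
   show "cmap ({a'..b1} \<inter> Z) Y G" by (rule cmap_cong[OF G1(1)]) (simp add: GG1)
   show "cmap ({a2..b'} \<inter> Z) Y G" by (rule cmap_cong[OF G2(1)]) (simp add: GG2)
  qed (use clZ closed_box in auto)
  moreover have un: "({a'..b1} \<inter> Z) \<union> ({a2..b'} \<inter> Z) = {a'..b'} \<inter> Z"
   unfolding box1 box2 by fastforce
  ultimately have "cmap ({a'..b'} \<inter> Z) Y G" by simp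
  moreover have "G z = F z" if z: "z \<in> rbd a' b' \<inter> Z" for z
  proof -
   have zb: "z \<in> {a'..b'}" using z rbd_subset by blast
   obtain j where j: "a' j < b' j" "z j = a' j \<or> z j = b' j" using z by (auto simp: rbd_def)
   consider "z i = \<mu>" | "z i < \<mu>" | "z i > \<mu>" by linarith
   thus ?thesis
   proof cases
    case 1
    thus ?thesis using mid[of z] zb z F1F by (auto simp: G_def)
   next
    case 2
    hence "z \<in> {a'..b1}" using box1 zb by simp
    moreover have "a' j < b1 j \<and> (z j = a' j \<or> z j = b1 j)"
     using j 2 \<mu> by (cases "j = i") (auto simp: b1_def)
    ultimately have "z \<in> rbd a' b1 \<inter> Z" using z unfolding rbd_def by blast
    thus ?thesis using G1(2) F1F z 2 by (simp add: G_def)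
   next
    case 3
    hence "z \<in> {a2..b'}" using box2 zb by simp
    moreover have "a2 j < b' j \<and> (z j = a2 j \<or> z j = b' j)"
     using j 3 \<mu> by (cases "j = i") (auto simp: a2_def)
    ultimately have "z \<in> rbd a2 b' \<inter> Z" using z unfolding rbd_def by blast
    thus ?thesis using G2(2) F1F z 3 by (simp add: G_def)
   qed
  qed
  moreover have "G z \<in> T z" if z: "z \<in> {a'..b'} \<inter> Z" for z
   using z un GG1 GG2 G1(3) G2(3) by (metis IntD1 UnE)
  ultimately show ?thesis by blast
 qed
qed

lemma real_grid_exists:
 fixes a b :: real
 assumes "a <= b" "\<epsilon> > 0"
 shows "\<exists>L. finite L \<and> {a - 1, a, b, b + 1} \<subseteq> L \<and>
  (\<forall>t. a <= t --> t <= b --> (\<exists>\<mu>\<in>L. \<exists>\<mu>'\<in>L. \<mu> <= t \<and> t <= \<mu>' \<and> \<mu>' - \<mu> <= \<epsilon>))"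
proof -
 obtain N :: nat where "b <= a + real N * \<epsilon>"
  using ex_less_of_nat_mult[OF assms(2), of "b - a"] by (metis add.commute diff_less_eq less_imp_le)
 have *: "\<exists>k\<le>N. a + real k * \<epsilon> <= t \<and> t <= a + real (Suc k) * \<epsilon>" if "a <= t" "t <= a + real N * \<epsilon>" for t N
  using that
 proof (induction N)
  case 0
  thus ?case using assms(2) by auto
 next
  case (Suc N)
  show ?case
  proof (cases "t <= a + real N * \<epsilon>")
   case True
   thus ?thesis using Suc by (metis le_SucI)
  next
   case False
   thus ?thesis using Suc.prems by (intro exI[of _ N]) auto
  qed
 qed
 show ?thesis
 proof (intro exI[of _ "{a - 1, a, b, b + 1} \<union> (\<lambda>k. a + real k * \<epsilon>) ` {..Suc N}"] conjI allI impI)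
  fix t assume t: "a <= t" "t <= b"
  then obtain k where k: "k <= N" "a + real k * \<epsilon> <= t" "t <= a + real (Suc k) * \<epsilon>"
   using *[of t N] \<open>b <= a + real N * \<epsilon>\<close> by auto
  show "\<exists>\<mu>\<in>{a - 1, a, b, b + 1} \<union> (\<lambda>k. a + real k * \<epsilon>) ` {..Suc N}.
     \<exists>\<mu>'\<in>{a - 1, a, b, b + 1} \<union> (\<lambda>k. a + real k * \<epsilon>) ` {..Suc N}. \<mu> <= t \<and> t <= \<mu>' \<and> \<mu>' - \<mu> <= \<epsilon>"
  proof (rule bexI[of _ "a + real k * \<epsilon>"], rule bexI[of _ "a + real (Suc k) * \<epsilon>"])
   show "a + real k * \<epsilon> <= t \<and> t <= a + real (Suc k) * \<epsilon> \<and> a + real (Suc k) * \<epsilon> - (a + real k * \<epsilon>) <= \<epsilon>"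
    using k by (simp add: algebra_simps)
   show "a + real (Suc k) * \<epsilon> \<in> {a - 1, a, b, b + 1} \<union> (\<lambda>k. a + real k * \<epsilon>) ` {..Suc N}"
    using k(1) by (intro UnI2 imageI) simp
   show "a + real k * \<epsilon> \<in> {a - 1, a, b, b + 1} \<union> (\<lambda>k. a + real k * \<epsilon>) ` {..Suc N}"
    using k(1) by (intro UnI2 imageI) simp
  qed
 qed auto
qed

text \<open>The boundary map \<open>f\<close> is deformed to the constant \<open>c\<close> in the
  intersection, over a grid so fine that \<open>f\<close> maps each cell into \<open>A\<close> or
  into \<open>B\<close>. During the deformation each cell stays inside the smallest of the
  intersection, \<open>A\<close> and \<open>B\<close> that contains its image, so only these three
  weakly contractible sets have to be filled. A constant map extends, hence so does \<open>f\<close>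
  by \<open>extension_homotopy\<close>.\<close>

theorem weakly_contractible_Un:
 assumes op: "openin Y A" "openin Y B" and cov: "A \<union> B = topspace Y"
  and wcA: "weakly_contractible (subtopology Y A)" and wcB: "weakly_contractible (subtopology Y B)"
  and wcAB: "weakly_contractible (subtopology Y (A \<inter> B))"
 shows "weakly_contractible Y"
 unfolding weakly_contractible_def
proof (intro allI impI)
 fix a b :: rvec and f
 assume h: "a <= b" "finite {i. a i < b i}" "cmap (rbd a b) Y f"
 define D where "D = {i. a i < b i}"
 have finD: "finite D" using h(2) by (simp add: D_def)
 have "topspace (subtopology Y (A \<inter> B)) ~= {}" by (rule weakly_contractible_nonempty[OF wcAB])
 then obtain c where c: "c \<in> A \<inter> B" "c \<in> topspace Y" by auto
 obtain p where p: "p \<notin> D" using ex_new_if_finite[OF infinite_UNIV_nat finD] by blast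
 have abp: "a p = b p" using p h(1) by (metis D_def le_funD mem_Collect_eq order_le_less)
 have abD: "a i = b i" if "i \<notin> D" for i using that h(1) by (metis D_def le_funD mem_Collect_eq order_le_less)
 obtain UA where UA: "open UA" "{x \<in> rbd a b. f x \<in> A} = rbd a b \<inter> UA"
  using openin_continuous_map_preimage[OF h(3) op(1)] by (auto simp: openin_open)
 obtain UB where UB: "open UB" "{x \<in> rbd a b. f x \<in> B} = rbd a b \<inter> UB"
  using openin_continuous_map_preimage[OF h(3) op(2)] by (auto simp: openin_open)
 have fY: "f x \<in> A \<union> B" if "x \<in> rbd a b" for x using cmap_in[OF h(3) that] cov by simp
 have UAB: "x \<in> UA \<longleftrightarrow> f x \<in> A" "x \<in> UB \<longleftrightarrow> f x \<in> B" if "x \<in> rbd a b" for x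
  using that UA(2) UB(2) by (metis (no_types, lifting) IntD2 IntI mem_Collect_eq)+
 have cover: "rbd a b \<subseteq> \<Union>{UA, UB}"
 proof
  fix x assume x: "x \<in> rbd a b"
  show "x \<in> \<Union>{UA, UB}" using UAB[OF x] fY[OF x] by simp
 qed
 have opU: "\<And>U. U \<in> {UA, UB} ==> open U" using UA(1) UB(1) by auto
 obtain \<epsilon> where \<epsilon>: "\<epsilon> > 0" "\<forall>T. T ~= {} --> T \<subseteq> rbd a b -->
   (\<forall>x\<in>T. \<forall>y\<in>T. \<forall>i. \<bar>x i - y i\<bar> <= \<epsilon>) --> (\<exists>U\<in>{UA, UB}. T \<subseteq> U)"
  using box_lebesgue[OF h(1) rbd_subset closed_rbd[OF h(2)] opU cover] by meson
 have "\<exists>L. finite L \<and> {a i - 1, a i, b i, b i + 1} \<subseteq> L \<and>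
  (\<forall>t. a i <= t --> t <= b i --> (\<exists>\<mu>\<in>L. \<exists>\<mu>'\<in>L. \<mu> <= t \<and> t <= \<mu>' \<and> \<mu>' - \<mu> <= \<epsilon>))" for i
 proof -
  have "a i <= b i" using h(1) by (simp add: le_fun_def)
  from real_grid_exists[OF this \<epsilon>(1)] show ?thesis .
 qed
 then obtain L where L: "\<And>i. finite (L i)" "\<And>i. {a i - 1, a i, b i, b i + 1} \<subseteq> L i"
   "\<And>i t. a i <= t ==> t <= b i ==> \<exists>\<mu>\<in>L i. \<exists>\<mu>'\<in>L i. \<mu> <= t \<and> t <= \<mu>' \<and> \<mu>' - \<mu> <= \<epsilon>"
  by metis
 define \<Lambda> where "\<Lambda> = (\<lambda>i. if i \<in> D then L i else {a i})"
 have \<Lambda>ab: "a i \<in> \<Lambda> i" "b i \<in> \<Lambda> i" for i using L(2)[of i] abD[of i] by (auto simp: \<Lambda>_def)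
 define Z where "Z = {z. z(p := a p) \<in> rbd a b}"
 \<comment> \<open>\<open>Z\<close> is the cylinder over the boundary. The box is widened by 1 in
   every direction of \<open>D\<close> so that its sides miss this cylinder; the prescribed values
   are then exactly those at the times 0 and 1.\<close>
 define a0 where "a0 = (\<lambda>i. if i \<in> D then a i - 1 else if i = p then 0 else a i)"
 define b0 where "b0 = (\<lambda>i. if i \<in> D then b i + 1 else if i = p then 1 else b i)"
 \<comment> \<open>\<open>e z\<close> is the smallest closed grid cell containing \<open>z\<close>,
   with the time forgotten. It becomes smaller as \<open>z\<close> moves to a face, and
   \<open>Ty\<close> becomes smaller with it; this monotonicity is what makes the fillings of
   neighbouring cells compatible.\<close>
 define e where "e = (\<lambda>z. {y. y p = a p \<and> (\<forall>i \<mu>. i ~= p --> \<mu> \<in> \<Lambda> i --> (\<mu> <= z i --> \<mu> <= y i) \<and> (z i <= \<mu> --> y i <= \<mu>))})"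
 define Ty where "Ty = (\<lambda>W. if f ` W \<subseteq> A \<inter> B then A \<inter> B else if f ` W \<subseteq> A then A else B)"
 define T where "T = (\<lambda>z. Ty (e z))"
 have Tymono: "Ty W1 \<subseteq> Ty W2" if "W1 \<subseteq> W2" "f ` W2 \<subseteq> A \<or> f ` W2 \<subseteq> B" for W1 W2
 proof -
  have "f ` W1 \<subseteq> f ` W2" using that(1) by blast
  thus ?thesis using that(2) unfolding Ty_def by (smt (verit) Int_greatest Int_lower1 Int_lower2 order_refl order_trans)
 qed
 have Tyc: "c \<in> Ty W" for W using c by (auto simp: Ty_def)
 have Tywc: "weakly_contractible (subtopology Y (Ty W))" for W
  using wcA wcB wcAB by (simp add: Ty_def)
 have Zab: "a i <= z i \<and> z i <= b i" if "z \<in> Z" "i ~= p" for z i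
  using that by (auto simp: Z_def rbd_def le_fun_def dest!: spec[of _ i])
 have Zex: "\<exists>i\<in>D. z i = a i \<or> z i = b i" if "z \<in> Z" for z
 proof -
  from that obtain i where "i \<in> D" "(z(p := a p)) i = a i \<or> (z(p := a p)) i = b i"
   by (auto simp: Z_def rbd_def D_def)
  thus ?thesis using p by (metis fun_upd_other)
 qed
 have ZI: "z \<in> Z" if "\<And>i. i ~= p ==> a i <= z i \<and> z i <= b i" "\<exists>i\<in>D. z i = a i \<or> z i = b i" for z
 proof -
  have "z(p := a p) \<in> {a..b}" using that(1) abp by (auto simp: le_fun_def)
  moreover from that(2) obtain i where i: "i \<in> D" "z i = a i \<or> z i = b i" by blast
  hence "a i < b i \<and> ((z(p := a p)) i = a i \<or> (z(p := a p)) i = b i)" using p by (auto simp: D_def)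
  ultimately show ?thesis unfolding Z_def rbd_def by blast
 qed
 have eself: "z(p := a p) \<in> e z" for z by (auto simp: e_def)
 have esub: "e z \<subseteq> rbd a b" if "z \<in> Z" for z
 proof
  fix y assume y: "y \<in> e z"
  have b: "a i <= y i \<and> y i <= b i" if "i ~= p" for i
   using y that \<Lambda>ab[of i] Zab[OF \<open>z \<in> Z\<close> that] by (auto simp: e_def)
  from Zex[OF that] obtain i where i: "i \<in> D" "z i = a i \<or> z i = b i" by blast
  hence "y i = z i" using y p \<Lambda>ab[of i] by (force simp: e_def)
  hence "y \<in> Z" by (intro ZI b) (use i in auto)
  moreover have "y(p := a p) = y" using y by (auto simp: e_def)
  ultimately show "y \<in> rbd a b" by (simp add: Z_def)
 qed
 have ediam: "\<bar>x i - y i\<bar> <= \<epsilon>" if "z \<in> Z" "x \<in> e z" "y \<in> e z" for z x y i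
 proof (cases "i = p")
  case True
  thus ?thesis using that \<epsilon>(1) by (simp add: e_def)
 next
  case False
  show ?thesis
  proof (cases "i \<in> D")
   case True
   from L(3)[of i "z i"] Zab[OF that(1) False] obtain \<mu> \<mu>'
    where m: "\<mu> \<in> L i" "\<mu>' \<in> L i" "\<mu> <= z i" "z i <= \<mu>'" "\<mu>' - \<mu> <= \<epsilon>" by blast
   hence "\<mu> <= x i" "x i <= \<mu>'" "\<mu> <= y i" "y i <= \<mu>'"
    using that(2,3) False True by (auto simp: e_def \<Lambda>_def)
   thus ?thesis using m(5) by linarith
  next
   case F: False
   have "z i = a i" using Zab[OF that(1) False] abD[OF F] by linarith
   hence "x i = a i" "y i = a i" using that(2,3) False F by (force simp: e_def \<Lambda>_def)+
   thus ?thesis using \<epsilon>(1) by simp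
  qed
 qed
 have eAB: "f ` e z \<subseteq> A \<or> f ` e z \<subseteq> B" if "z \<in> Z" for z
 proof -
  have "\<exists>U\<in>{UA, UB}. e z \<subseteq> U"
   using eself[of z] by (intro \<epsilon>(2)[rule_format] esub[OF that] ediam[OF that]) auto
  thus ?thesis using UAB esub[OF that] by blast
 qed
 have fT: "f (z(p := a p)) \<in> T z" if "z \<in> Z" for z
  using eAB[OF that] eself[of z] unfolding T_def Ty_def by auto
 have ab0: "a0 <= b0" using h(1) by (auto simp: a0_def b0_def le_fun_def intro: order_trans)
 have a0p: "a0 p = 0" "b0 p = 1" using p by (auto simp: a0_def b0_def)
 have fD0: "finite {i. a0 i < b0 i}"
  by (rule finite_subset[of _ "insert p D"]) (use finD abD in \<open>auto simp: a0_def b0_def\<close>)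
 have clZ: "closed Z"
 proof -
  have "continuous_on UNIV (\<lambda>z::rvec. z(p := a p))"
   by (intro continuous_on_fun_upd continuous_intros)
  moreover have "Z = (\<lambda>z. z(p := a p)) -` rbd a b" by (auto simp: Z_def)
  ultimately show ?thesis using closed_rbd[OF h(2)] by (simp add: closed_vimage)
 qed
 define F where "F = (\<lambda>z. if z p = 0 then f (z(p := a p)) else c)"
 have rF: "z p = 0 \<or> z p = 1" if "z \<in> rbd a0 b0 \<inter> Z" for z
 proof -
  obtain i where i: "a0 i < b0 i" "z i = a0 i \<or> z i = b0 i" using \<open>z \<in> rbd a0 b0 \<inter> Z\<close> by (auto simp: rbd_def)
  have "i = p"
  proof (rule ccontr)
   assume "i ~= p"
   hence "i \<in> D" using i(1) abD[of i] by (auto simp: a0_def b0_def split: if_splits)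
   thus False using i(2) Zab[of z i] that \<open>i ~= p\<close> by (auto simp: a0_def b0_def)
  qed
  thus ?thesis using i(2) a0p by simp
 qed
 have clp: "closed {z::rvec. z p = t}" for t
  by (intro closed_Collect_eq continuous_intros)
 have cF: "cmap (rbd a0 b0 \<inter> Z) Y F"
 proof (rule cmap_subset)
  show "rbd a0 b0 \<inter> Z \<subseteq> ({z. z p = 0} \<inter> Z) \<union> ({z. z p = 1} \<inter> Z)" using rF by blast
  show "cmap (({z. z p = 0} \<inter> Z) \<union> ({z. z p = 1} \<inter> Z)) Y F"
  proof (rule cmap_Un)
   have "cmap ({z. z p = 0} \<inter> Z) Y (\<lambda>z. f (z(p := a p)))"
   proof (rule cmap_compose[OF h(3)])
    show "continuous_on ({z. z p = 0} \<inter> Z) (\<lambda>z. z(p := a p))"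
     by (intro continuous_on_fun_upd continuous_on_id continuous_on_const)
   qed (auto simp: Z_def)
   thus "cmap ({z. z p = 0} \<inter> Z) Y F" by (rule cmap_cong) (simp add: F_def)
   have "cmap ({z. z p = 1} \<inter> Z) Y (\<lambda>z. c)" using c by simp
   thus "cmap ({z. z p = 1} \<inter> Z) Y F" by (rule cmap_cong) (simp add: F_def)
  qed (use clZ clp in auto)
 qed
 have "\<exists>G. cmap ({a0..b0} \<inter> Z) Y G \<and> (\<forall>z\<in>rbd a0 b0 \<inter> Z. G z = F z) \<and> (\<forall>z\<in>{a0..b0} \<inter> Z. G z \<in> T z)"
 proof (rule grid_extension[where \<Lambda>=\<Lambda> and p=p and a=a0 and b=b0, OF _ clZ fD0 _ order_refl ab0 order_refl a0p _ cF])
  show "finite (\<Lambda> i)" for i using L(1) by (simp add: \<Lambda>_def)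
  show "a0 i \<in> \<Lambda> i \<and> b0 i \<in> \<Lambda> i" if "i ~= p" for i
   using L(2)[of i] that abD[of i] by (auto simp: \<Lambda>_def a0_def b0_def)
  show "F z \<in> T z" if "z \<in> rbd a0 b0 \<inter> Z" for z
   using fT[of z] that Tyc by (simp add: F_def T_def)
  fix a' b'
  assume h': "a0 <= a'" "a' <= b'" "b' <= b0" "a' p = 0" "b' p = 1"
   and \<Lambda>': "\<And>i. i ~= p ==> a' i \<in> \<Lambda> i \<and> b' i \<in> \<Lambda> i"
   and el: "\<And>i \<mu>. i ~= p ==> \<mu> \<in> \<Lambda> i ==> \<mu> <= a' i \<or> b' i <= \<mu>"
  have box: "a' i <= z i" "z i <= b' i" if "z \<in> {a'..b'}" for z i
   using that by (auto simp: le_fun_def)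
  have nD: "a' i = a i" "b' i = b i" if "i \<notin> D" "i ~= p" for i
   using \<Lambda>'[OF that(2)] that(1) abD[OF that(1)] by (auto simp: \<Lambda>_def)
  show "(\<forall>z\<in>{a'..b'} \<inter> Z. \<exists>i. i ~= p \<and> a' i < b' i \<and> (z i = a' i \<or> z i = b' i)) \<or>
    ({a'..b'} \<subseteq> Z \<and> (\<exists>S. weakly_contractible (subtopology Y S) \<and> (\<forall>z\<in>{a'..b'}. T z \<subseteq> S) \<and>
     (\<forall>z\<in>{a'..b'}. (\<forall>i. i ~= p --> a' i < b' i --> a' i < z i \<and> z i < b' i) --> T z = S)))"
  proof (cases "\<exists>i\<in>D. a' i < a i \<or> b i < b' i")
   case True
   then obtain i where i: "i \<in> D" "a' i < a i \<or> b i < b' i" by blast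
   hence "i ~= p" using p by blast
   have "a' i < b' i \<and> (z i = a' i \<or> z i = b' i)" if "z \<in> {a'..b'} \<inter> Z" for z
    using i(2) el[OF \<open>i ~= p\<close> \<Lambda>ab(1)] el[OF \<open>i ~= p\<close> \<Lambda>ab(2)] Zab[of z i] box[of z i] that \<open>i ~= p\<close>
    by auto
   thus ?thesis using \<open>i ~= p\<close> by blast
  next
   case F: False
   \<comment> \<open>A grid cell inside the original box belongs to the cylinder exactly when it is
     degenerate at an end of the box in some direction of \<open>D\<close>. Otherwise the cylinder
     meets only its sides.\<close>
   show ?thesis
   proof (cases "\<exists>i\<in>D. a' i = b' i \<and> (a' i = a i \<or> a' i = b i)")
    case False
    have "\<exists>i. i ~= p \<and> a' i < b' i \<and> (z i = a' i \<or> z i = b' i)" if z: "z \<in> {a'..b'} \<inter> Z" for z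
    proof -
     obtain i where i: "i \<in> D" "z i = a i \<or> z i = b i" using Zex z by blast
     have "a i <= a' i" "b' i <= b i" using F i(1) by force+
     moreover have "\<not> (a' i = b' i \<and> (a' i = a i \<or> a' i = b i))" using False i(1) by blast
     ultimately have "a' i < b' i \<and> (z i = a' i \<or> z i = b' i)" using i(2) box[of z i] z by force
     moreover have "i ~= p" using i(1) p by blast
     ultimately show ?thesis by blast
    qed
    thus ?thesis by blast
   next
    case True
    then obtain j where j: "j \<in> D" "a' j = b' j" "a' j = a j \<or> a' j = b j" by blast
    have sub: "{a'..b'} \<subseteq> Z"
    proof
     fix z assume z: "z \<in> {a'..b'}"
     show "z \<in> Z"
     proof (rule ZI)
      show "a i <= z i \<and> z i <= b i" if "i ~= p" for i
       using box[OF z, of i] F nD[of i] that by (cases "i \<in> D") force+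
      show "\<exists>i\<in>D. z i = a i \<or> z i = b i"
       using j box[OF z, of j] by (intro bexI[of _ j]) auto
     qed
    qed
    define W where "W = {y. y p = a p \<and> (\<forall>i. i ~= p --> a' i <= y i \<and> y i <= b' i)}"
    have eW: "e z \<subseteq> W" if "z \<in> {a'..b'}" for z
     using box[OF that] \<Lambda>' by (auto simp: e_def W_def)
    have We: "W \<subseteq> e z" if z: "z \<in> {a'..b'}" and "\<forall>i. i ~= p --> a' i < b' i --> a' i < z i \<and> z i < b' i" for z
    proof
     fix y assume y: "y \<in> W"
     have "(\<mu> <= z i --> \<mu> <= y i) \<and> (z i <= \<mu> --> y i <= \<mu>)" if "i ~= p" "\<mu> \<in> \<Lambda> i" for i \<mu>
     proof -
      have "a' i <= y i" "y i <= b' i" using y that(1) by (auto simp: W_def)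
      moreover have "a' i <= z i" "z i <= b' i" using box[OF z] by auto
      moreover have "a' i < b' i --> a' i < z i \<and> z i < b' i" using that(1) \<open>\<forall>i. i ~= p --> _ i\<close> by blast
      moreover have "\<mu> <= a' i \<or> b' i <= \<mu>" using el[OF that] .
      ultimately show ?thesis by (cases "a' i < b' i") auto
     qed
     thus "y \<in> e z" using y by (auto simp: e_def W_def)
    qed
    define z0 where "z0 = (\<lambda>i. (a' i + b' i) / 2)"
    have z0: "z0 \<in> {a'..b'}" using h'(2) by (auto simp: z0_def le_fun_def field_simps)
    have "W \<subseteq> e z0" by (rule We[OF z0]) (auto simp: z0_def)
    hence WAB: "f ` W \<subseteq> A \<or> f ` W \<subseteq> B" using eAB[of z0] sub z0 by blast
    have "T z \<subseteq> Ty W" if "z \<in> {a'..b'}" for z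
     unfolding T_def using Tymono[OF eW[OF that] WAB] .
    moreover have "T z = Ty W" if "z \<in> {a'..b'}" "\<forall>i. i ~= p --> a' i < b' i --> a' i < z i \<and> z i < b' i" for z
     unfolding T_def using eW[OF that(1)] We[OF that] by (metis subset_antisym)
    ultimately show ?thesis using sub Tywc by blast
   qed
  qed
 qed
 then obtain G where G: "cmap ({a0..b0} \<inter> Z) Y G" "\<forall>z\<in>rbd a0 b0 \<inter> Z. G z = F z" by blast
 have rbdp: "x p = a p" if "x \<in> rbd a b" for x
 proof -
  have "a p <= x p" "x p <= b p" using that unfolding rbd_def by (auto simp: le_fun_def)
  thus ?thesis using abp by simp
 qed
 have inZ: "x(p := t) \<in> {a0..b0} \<inter> Z" if "x \<in> rbd a b" "0 <= t" "t <= 1" for x t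
 proof -
  have xp: "x p = a p" using rbdp[OF that(1)] .
  hence "x(p := t) \<in> Z" using that(1) by (simp add: Z_def fun_upd_idem)
  moreover have "a i <= x i \<and> x i <= b i" for i using that(1) by (auto simp: rbd_def le_fun_def)
  hence "a0 i <= (x(p := t)) i \<and> (x(p := t)) i <= b0 i" for i
   using that(2,3) a0p by (cases "i = p") (auto simp: a0_def b0_def intro: order_trans[of _ "a i"] order_trans[of _ "b i"])
  hence "x(p := t) \<in> {a0..b0}" by (auto simp: le_fun_def)
  ultimately show ?thesis by simp
 qed
 have "cmap ({0..1::real} \<times> rbd a b) Y (\<lambda>tx. G ((snd tx)(p := fst tx)))"
 proof (rule cmap_compose[OF G(1)])
  show "continuous_on ({0..1} \<times> rbd a b) (\<lambda>tx. (snd tx)(p := fst tx))"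
   by (intro continuous_on_fun_upd continuous_intros)
 qed (use inZ in auto)
 hence FF: "cmap ({0..1::real} \<times> rbd a b) Y (\<lambda>(t,x). G (x(p := t)))"
  by (simp add: case_prod_unfold)
 have bd: "x(p := t) \<in> rbd a0 b0 \<inter> Z" if "x \<in> rbd a b" "t = 0 \<or> t = 1" for x t
 proof -
  have "x(p := t) \<in> {a0..b0} \<inter> Z" using inZ[OF that(1), of t] that(2) by auto
  moreover have "a0 p < b0 p \<and> ((x(p := t)) p = a0 p \<or> (x(p := t)) p = b0 p)" using a0p that(2) by auto
  ultimately show ?thesis unfolding rbd_def by blast
 qed
 have "\<exists>g'. cmap {a..b} Y g' \<and> (\<forall>x\<in>rbd a b. g' x = G (x(p := 0)))"
 proof (rule extension_homotopy[OF h(1,2) FF])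
  show "cmap {a..b} Y (\<lambda>_. c)" using c by simp
  show "c = G (x(p := 1))" if "x \<in> rbd a b" for x
   using G(2) bd[OF that, of 1] by (simp add: F_def)
 qed
 moreover have "G (x(p := 0)) = f x" if "x \<in> rbd a b" for x
 proof -
  have "x p = a p" using rbdp[OF that] .
  thus ?thesis using G(2) bd[OF that, of 0] by (simp add: F_def fun_upd_idem)
 qed
 ultimately show "\<exists>g. cmap {a..b} Y g \<and> (\<forall>x\<in>rbd a b. g x = f x)" by auto
qed

section \<open>Covering maps given by free actions\<close>

lemma connected_box: "connected {a..b::rvec}"
proof -
 have "{a..b} = PiE UNIV (\<lambda>i. {a i..b i})"
  by (auto simp: le_fun_def PiE_def Pi_def)
 thus ?thesis
  using connectedin_PiE[of "\<lambda>_. euclideanreal" UNIV "\<lambda>i. {a i..b i}"]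
  by (simp add: euclidean_product_topology)
qed

lemma cmap_continuous: "cmap S Y f ==> continuous_map Y Z g ==> cmap S Z (\<lambda>x. g (f x))"
 using continuous_map_compose[of "top_of_set S" Y f Z g] by (simp add: o_def)

text \<open>The condition \<open>PD\<close> does three jobs: for \<open>y = y'\<close> it yields a
  neighbourhood that nontrivial elements move off itself, for the neutral element it separates
  points of \<open>Y\<close>, and for points of different orbits it separates their images in
  \<open>X\<close>.\<close>

locale free_action = group G
 for G :: "('g, 'e) monoid_scheme" (structure) +
 fixes Y :: "'y topology" and X :: "'x topology" and p :: "'y => 'x" and act :: "'g => 'y => 'y"
 assumes act_cont: "g \<in> carrier G ==> continuous_map Y Y (act g)"
  and act_one: "y \<in> topspace Y ==> act \<one> y = y"
  and act_mult: "g \<in> carrier G ==> h \<in> carrier G ==> y \<in> topspace Y ==> act (g \<otimes> h) y = act g (act h y)"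
  and free: "g \<in> carrier G ==> y \<in> topspace Y ==> act g y = y ==> g = \<one>"
  and PD: "y \<in> topspace Y ==> y' \<in> topspace Y ==> \<exists>U U'. openin Y U \<and> openin Y U' \<and> y \<in> U \<and> y' \<in> U' \<and>
    (\<forall>g\<in>carrier G. \<forall>z\<in>U'. act g z \<in> U --> act g y' = y)"
  and quot: "quotient_map Y X p"
  and fib: "y \<in> topspace Y ==> y' \<in> topspace Y ==> p y = p y' \<longleftrightarrow> (\<exists>g\<in>carrier G. y' = act g y)"
begin

lemma act_in: "g \<in> carrier G ==> y \<in> topspace Y ==> act g y \<in> topspace Y"
 using act_cont[of g] continuous_map_image_subset_topspace by fastforce

lemma act_inv: "g \<in> carrier G ==> y \<in> topspace Y ==> act (inv g) (act g y) = y"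
 using act_mult[of "inv g" g y] act_one by simp

lemma act_inj: "g \<in> carrier G ==> h \<in> carrier G ==> y \<in> topspace Y ==> act g y = act h y ==> g = h"
proof -
 assume a: "g \<in> carrier G" "h \<in> carrier G" "y \<in> topspace Y" "act g y = act h y"
 hence "act (inv h \<otimes> g) y = y" by (simp add: act_mult act_inv)
 hence "inv h \<otimes> g = \<one>" using free a by auto
 thus "g = h" using a by (metis inv_equality inv_inv inv_closed)
qed

lemma p_cont: "continuous_map Y X p"
 using quot quotient_imp_continuous_map by blast

lemma p_in: "y \<in> topspace Y ==> p y \<in> topspace X"
 using quot by (auto simp: quotient_map_def)

lemma p_surj: "x \<in> topspace X ==> \<exists>y\<in>topspace Y. p y = x"
 using quot unfolding quotient_map_def by (metis imageE)

lemma p_act: "g \<in> carrier G ==> y \<in> topspace Y ==> p (act g y) = p y"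
 using fib[of y "act g y"] act_in by auto

lemma Hausdorff_Y: "Hausdorff_space Y"
 unfolding Hausdorff_space_def
proof (intro allI impI)
 fix y y' assume h: "y \<in> topspace Y \<and> y' \<in> topspace Y \<and> y ~= y'"
 then obtain U U' where U: "openin Y U" "openin Y U'" "y \<in> U" "y' \<in> U'"
  "\<forall>g\<in>carrier G. \<forall>z\<in>U'. act g z \<in> U --> act g y' = y" using PD[of y y'] by auto
 have "z \<notin> U" if z: "z \<in> U'" for z
 proof
  assume "z \<in> U"
  moreover have "z \<in> topspace Y" using openin_subset[OF U(2)] z by blast
  ultimately have "act \<one> z \<in> U" using act_one by simp
  hence "act \<one> y' = y" using U(5) z by blast
  thus False using h act_one by auto
 qed
 hence "disjnt U U'" by (auto simp: disjnt_def)
 thus "\<exists>U V. openin Y U \<and> openin Y V \<and> y \<in> U \<and> y' \<in> V \<and> disjnt U V" using U by blast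
qed

lemma small_nbhd:
 assumes "y \<in> topspace Y"
 shows "\<exists>U. openin Y U \<and> y \<in> U \<and> (\<forall>g\<in>carrier G. \<forall>z\<in>U. act g z \<in> U --> g = \<one>)"
proof -
 obtain U U' where U: "openin Y U" "openin Y U'" "y \<in> U" "y \<in> U'"
  "\<forall>g\<in>carrier G. \<forall>z\<in>U'. act g z \<in> U --> act g y = y" using PD[OF assms assms] by auto
 have "g = \<one>" if "g \<in> carrier G" "z \<in> U \<inter> U'" "act g z \<in> U \<inter> U'" for g z
  using U(5) that free[OF that(1) assms] by blast
 thus ?thesis using U by (intro exI[of _ "U \<inter> U'"]) auto
qed

lemma p_open:
 assumes "openin Y U"
 shows "openin X (p ` U)"
proof -
 have sub: "U \<subseteq> topspace Y" using assms openin_subset by blast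
 have "{y \<in> topspace Y. p y \<in> p ` U} = (\<Union>g\<in>carrier G. {y \<in> topspace Y. act g y \<in> U})"
 proof (intro equalityI subsetI)
  fix y assume "y \<in> {y \<in> topspace Y. p y \<in> p ` U}"
  then obtain u where "y \<in> topspace Y" "u \<in> U" "p y = p u" by auto
  thus "y \<in> (\<Union>g\<in>carrier G. {y \<in> topspace Y. act g y \<in> U})" using fib[of y u] sub by auto
 next
  fix y assume "y \<in> (\<Union>g\<in>carrier G. {y \<in> topspace Y. act g y \<in> U})"
  then obtain g where "g \<in> carrier G" "y \<in> topspace Y" "act g y \<in> U" by blast
  thus "y \<in> {y \<in> topspace Y. p y \<in> p ` U}" using p_act[of g y] by (metis (mono_tags, lifting) imageI mem_Collect_eq)
 qed
 moreover have "openin Y (\<Union>g\<in>carrier G. {y \<in> topspace Y. act g y \<in> U})"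
  using act_cont assms by (intro openin_Union) (auto simp: continuous_map_def)
 moreover have "p ` U \<subseteq> topspace X" using sub p_in by blast
 ultimately show ?thesis using quot unfolding quotient_map_def by auto
qed

lemma Hausdorff_X: "Hausdorff_space X"
 unfolding Hausdorff_space_def
proof (intro allI impI)
 fix x x' assume h: "x \<in> topspace X \<and> x' \<in> topspace X \<and> x ~= x'"
 then obtain y y' where y: "y \<in> topspace Y" "p y = x" "y' \<in> topspace Y" "p y' = x'" using p_surj by metis
 then obtain U U' where U: "openin Y U" "openin Y U'" "y \<in> U" "y' \<in> U'"
  "\<forall>g\<in>carrier G. \<forall>z\<in>U'. act g z \<in> U --> act g y' = y" using PD[of y y'] by auto
 have "disjnt (p ` U) (p ` U')"
 proof (rule ccontr)
  assume "\<not> disjnt (p ` U) (p ` U')"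
  then obtain u u' where u: "u \<in> U" "u' \<in> U'" "p u' = p u" by (auto simp: disjnt_def) metis
  moreover have "u \<in> topspace Y" "u' \<in> topspace Y" using u U openin_subset by blast+
  ultimately obtain g where "g \<in> carrier G" "u = act g u'" using fib by metis
  hence "act g y' = y" using U(5) u by blast
  thus False using h y p_act \<open>g \<in> carrier G\<close> by metis
 qed
 thus "\<exists>U V. openin X U \<and> openin X V \<and> x \<in> U \<and> x' \<in> V \<and> disjnt U V"
  using U p_open y by (intro exI[of _ "p ` U"] exI[of _ "p ` U'"]) auto
qed

text \<open>The set where two lifts agree is closed because \<open>Y\<close> is Hausdorff. It is
  open because two lifts that lie in a common small neighbourhood differ by a group element that
  must be neutral.\<close>

lemma lift_unique:
 assumes S: "connected S" and f: "cmap S Y f1" "cmap S Y f2"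
  and eq: "\<And>z. z \<in> S ==> p (f1 z) = p (f2 z)" and z0: "z0 \<in> S" "f1 z0 = f2 z0" and z: "z \<in> S"
 shows "f1 z = f2 z"
proof -
 let ?E = "{z \<in> S. f1 z = f2 z}"
 have "closedin (top_of_set S) ?E"
  using closedin_continuous_maps_eq[OF Hausdorff_Y f] by simp
 moreover have "openin (top_of_set S) ?E"
 proof (subst openin_subopen, intro ballI)
  fix z assume z: "z \<in> ?E"
  hence "f1 z \<in> topspace Y" using cmap_in[OF f(1), of z] by blast
  then obtain U where U: "openin Y U" "f1 z \<in> U" "\<forall>g\<in>carrier G. \<forall>z\<in>U. act g z \<in> U --> g = \<one>"
   using small_nbhd by blast
  let ?N = "{z \<in> S. f1 z \<in> U} \<inter> {z \<in> S. f2 z \<in> U}"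
  have "openin (top_of_set S) ?N"
   using openin_continuous_map_preimage[OF f(1) U(1)] openin_continuous_map_preimage[OF f(2) U(1)] by auto
  moreover have "?N \<subseteq> ?E"
  proof
   fix w assume w: "w \<in> ?N"
   hence "f1 w \<in> topspace Y" "f2 w \<in> topspace Y" using cmap_in[OF f(1)] cmap_in[OF f(2)] by auto
   moreover have "p (f1 w) = p (f2 w)" using eq w by blast
   ultimately obtain g where g: "g \<in> carrier G" "f2 w = act g (f1 w)" using fib by blast
   hence "g = \<one>" using U(3) w by auto
   thus "w \<in> ?E" using g act_one cmap_in[OF f(1), of w] w by simp
  qed
  ultimately show "\<exists>T. openin (top_of_set S) T \<and> z \<in> T \<and> T \<subseteq> ?E" using z U(2) by (intro exI[of _ ?N]) auto
 qed
 ultimately have "?E = {} \<or> ?E = S" using S connected_clopen by blast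
 thus ?thesis using z0 z by blast
qed

lemma local_section:
 assumes "y \<in> topspace Y"
 shows "\<exists>V s. openin X V \<and> p y \<in> V \<and> continuous_map (subtopology X V) Y s \<and> (\<forall>x\<in>V. p (s x) = x)"
proof -
 obtain U where U: "openin Y U" "y \<in> U" "\<forall>g\<in>carrier G. \<forall>z\<in>U. act g z \<in> U --> g = \<one>"
  using small_nbhd assms by blast
 have sub: "U \<subseteq> topspace Y" using U openin_subset by blast
 have inj: "inj_on p U"
 proof (rule inj_onI)
  fix u v assume uv: "u \<in> U" "v \<in> U" "p u = p v"
  then obtain g where g: "g \<in> carrier G" "v = act g u" using fib sub by (metis subsetD)
  hence "g = \<one>" using U(3) uv by blast
  thus "u = v" using g act_one uv sub by auto
 qed
 define s where "s = inv_into U p"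
 have s: "p (s x) = x" "s x \<in> U" if "x \<in> p ` U" for x
  using that by (auto simp: s_def f_inv_into_f inv_into_into)
 have sp: "s (p u) = u" if "u \<in> U" for u using that inj by (simp add: s_def)
 have "continuous_map (subtopology X (p ` U)) Y s"
  unfolding continuous_map_def
 proof (intro conjI allI impI)
  show "s \<in> topspace (subtopology X (p ` U)) \<rightarrow> topspace Y" using s sub by auto
  fix W assume W: "openin Y W"
  have "{x \<in> topspace (subtopology X (p ` U)). s x \<in> W} = p ` (U \<inter> W)"
  proof (intro equalityI subsetI)
   fix x assume "x \<in> {x \<in> topspace (subtopology X (p ` U)). s x \<in> W}"
   hence "x \<in> p ` U" "s x \<in> W" by auto
   thus "x \<in> p ` (U \<inter> W)" using s[of x] by (metis IntI imageI)
  next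
   fix x assume "x \<in> p ` (U \<inter> W)"
   thus "x \<in> {x \<in> topspace (subtopology X (p ` U)). s x \<in> W}" using sp sub p_in by auto
  qed
  moreover have "openin X (p ` (U \<inter> W))" using U(1) W by (intro p_open) auto
  ultimately show "openin (subtopology X (p ` U)) {x \<in> topspace (subtopology X (p ` U)). s x \<in> W}"
   using openin_subtopology_Int2[of X "p ` (U \<inter> W)" "p ` U"] by (simp add: Int_absorb1 image_mono)
 qed
 moreover have "openin X (p ` U)" "p y \<in> p ` U" using p_open[OF U(1)] U(2) by blast+
 ultimately show ?thesis using s(1) by blast
qed

text \<open>Boxes that map into the domain of a local section lift at once. To glue lifts over two
  halves, one of them is translated so that they match at one point of the common wall; the wall is
  a box, hence connected, so uniqueness of lifts makes them match on all of it.\<close>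

lemma lift_exists:
 fixes a b :: rvec
 assumes ab: "a <= b" "finite {i. a i < b i}" and f: "cmap {a..b} X f"
 shows "\<exists>g. cmap {a..b} Y g \<and> (\<forall>z\<in>{a..b}. p (g z) = f z)"
proof -
 define \<U> where "\<U> = {N. open N \<and> (\<exists>V s. openin X V \<and> continuous_map (subtopology X V) Y s \<and>
   (\<forall>x\<in>V. p (s x) = x) \<and> (\<forall>z\<in>{a..b} \<inter> N. f z \<in> V))}"
 have cov: "{a..b} \<subseteq> \<Union>\<U>"
 proof
  fix z assume z: "z \<in> {a..b}"
  then obtain y where y: "y \<in> topspace Y" "p y = f z" using p_surj cmap_in[OF f] by metis
  obtain V s where V: "openin X V" "f z \<in> V" "continuous_map (subtopology X V) Y s" "\<forall>x\<in>V. p (s x) = x"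
   using local_section[OF y(1)] y(2) by auto
  obtain N where N: "open N" "{z \<in> {a..b}. f z \<in> V} = {a..b} \<inter> N"
   using openin_continuous_map_preimage[OF f V(1)] by (auto simp: openin_open)
  have "N \<in> \<U>" unfolding \<U>_def using N V by blast
  thus "z \<in> \<Union>\<U>" using N(2) z V(2) by blast
 qed
 have "\<exists>\<epsilon>>0. \<forall>T. T ~= {} --> T \<subseteq> {a..b} -->
   (\<forall>x\<in>T. \<forall>y\<in>T. \<forall>i. \<bar>x i - y i\<bar> <= \<epsilon>) --> (\<exists>U\<in>\<U>. T \<subseteq> U)"
  by (rule box_lebesgue[OF ab(1) order_refl closed_box _ cov]) (simp add: \<U>_def)
 then obtain \<epsilon> where \<epsilon>: "\<epsilon> > 0" "\<forall>T. T ~= {} --> T \<subseteq> {a..b} -->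
   (\<forall>x\<in>T. \<forall>y\<in>T. \<forall>i. \<bar>x i - y i\<bar> <= \<epsilon>) --> (\<exists>U\<in>\<U>. T \<subseteq> U)"
  by (elim exE conjE)
 show ?thesis
 proof (rule box_split_induct[OF ab \<epsilon>(1), where P="\<lambda>a b. \<exists>g. cmap {a..b} Y g \<and> (\<forall>z\<in>{a..b}. p (g z) = f z)"])
  fix a' b' assume h: "a <= a'" "a' <= b'" "b' <= b" "\<And>i. b' i - a' i <= \<epsilon>"
  have sub: "{a'..b'} \<subseteq> {a..b}" using h by auto
  have "\<bar>x i - y i\<bar> <= \<epsilon>" if "x \<in> {a'..b'}" "y \<in> {a'..b'}" for x y i
  proof -
   have "a' i <= x i" "x i <= b' i" "a' i <= y i" "y i <= b' i" using that by (auto simp: le_fun_def)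
   thus ?thesis using h(4)[of i] by linarith
  qed
  then obtain N where "N \<in> \<U>" "{a'..b'} \<subseteq> N" using \<epsilon>(2) sub h(2) by (metis atLeastatMost_empty_iff2)
  then obtain V s where V: "continuous_map (subtopology X V) Y s" "\<forall>x\<in>V. p (s x) = x" "\<forall>z\<in>{a'..b'}. f z \<in> V"
   unfolding \<U>_def using sub by blast
  have "cmap {a'..b'} (subtopology X V) f"
   using cmap_subset[OF f sub] V(3) by (auto simp: cmap_subtopology)
  hence "cmap {a'..b'} Y (\<lambda>z. s (f z))" using cmap_continuous V(1) by blast
  thus "\<exists>g. cmap {a'..b'} Y g \<and> (\<forall>z\<in>{a'..b'}. p (g z) = f z)" using V(2,3) by blast
 next
  fix a' b' i c
  assume h: "a <= a'" "a' <= b'" "b' <= b" "a' i <= c" "c <= b' i"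
  assume "\<exists>g. cmap {a'..b'(i := c)} Y g \<and> (\<forall>z\<in>{a'..b'(i := c)}. p (g z) = f z)"
  then obtain g1 where g1: "cmap {a'..b'(i := c)} Y g1" "\<forall>z\<in>{a'..b'(i := c)}. p (g1 z) = f z" by blast
  assume "\<exists>g. cmap {a'(i := c)..b'} Y g \<and> (\<forall>z\<in>{a'(i := c)..b'}. p (g z) = f z)"
  then obtain g2 where g2: "cmap {a'(i := c)..b'} Y g2" "\<forall>z\<in>{a'(i := c)..b'}. p (g2 z) = f z" by blast
  have b1: "{a'..b'(i := c)} = {z \<in> {a'..b'}. z i <= c}" using h by (auto simp: le_fun_upd_iff)
  have b2: "{a'(i := c)..b'} = {z \<in> {a'..b'}. c <= z i}" using h by (auto simp: fun_upd_le_iff)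
  have bC: "{a'(i := c)..b'(i := c)} = {z \<in> {a'..b'}. z i = c}"
   using h by (auto simp: le_fun_upd_iff fun_upd_le_iff)
  define z0 where "z0 = a'(i := c)"
  have z0: "z0 \<in> {a'(i := c)..b'(i := c)}" using h by (auto simp: z0_def le_fun_def)
  have zz: "z0 \<in> {a'..b'(i := c)}" "z0 \<in> {a'(i := c)..b'}" using z0 bC b1 b2 by auto
  obtain k where k: "k \<in> carrier G" "g1 z0 = act k (g2 z0)"
   using fib[of "g2 z0" "g1 z0"] cmap_in[OF g1(1) zz(1)] cmap_in[OF g2(1) zz(2)] g1(2) g2(2) zz by auto
  have ck: "cmap {a'(i := c)..b'} Y (\<lambda>z. act k (g2 z))" using cmap_continuous[OF g2(1) act_cont[OF k(1)]] .
  have agree: "g1 z = act k (g2 z)" if "z \<in> {a'(i := c)..b'(i := c)}" for z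
  proof (rule lift_unique[where S="{a'(i := c)..b'(i := c)}", OF connected_box _ _ _ z0 _ that])
   show "g1 z0 = act k (g2 z0)" by (rule k(2))
   show "cmap {a'(i := c)..b'(i := c)} Y g1" by (rule cmap_subset[OF g1(1)]) (auto simp: bC b1)
   show "cmap {a'(i := c)..b'(i := c)} Y (\<lambda>z. act k (g2 z))" by (rule cmap_subset[OF ck]) (auto simp: bC b2)
   fix z assume "z \<in> {a'(i := c)..b'(i := c)}"
   hence z: "z \<in> {a'..b'(i := c)}" "z \<in> {a'(i := c)..b'}" using bC b1 b2 by auto
   thus "p (g1 z) = p (act k (g2 z))" using g1(2) g2(2) p_act[OF k(1) cmap_in[OF g2(1) z(2)]] by simp
  qed
  define g where "g = (\<lambda>z. if z i <= c then g1 z else act k (g2 z))"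
  have gg1: "g z = g1 z" if "z \<in> {a'..b'(i := c)}" for z using that b1 by (simp add: g_def)
  have gg2: "g z = act k (g2 z)" if z: "z \<in> {a'(i := c)..b'}" for z
  proof (cases "z i = c")
   case True
   hence "z \<in> {a'(i := c)..b'(i := c)}" using z b2 bC by blast
   thus ?thesis using agree by (simp add: g_def)
  next
   case False
   thus ?thesis using z b2 by (auto simp: g_def)
  qed
  have "cmap ({a'..b'(i := c)} \<union> {a'(i := c)..b'}) Y g"
   by (rule cmap_Un[OF closed_box closed_box cmap_cong[OF g1(1)] cmap_cong[OF ck]]) (simp_all add: gg1 gg2)
  moreover have "{a'..b'(i := c)} \<union> {a'(i := c)..b'} = {a'..b'}" unfolding b1 b2 by fastforce
  moreover have "p (g z) = f z" if "z \<in> {a'..b'}" for z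
  proof (cases "z i <= c")
   case True
   hence "z \<in> {a'..b'(i := c)}" using that b1 by simp
   thus ?thesis using gg1 g1(2) by simp
  next
   case False
   hence "z \<in> {a'(i := c)..b'}" using that b2 by simp
   thus ?thesis using gg2 g2(2) p_act[OF k(1) cmap_in[OF g2(1)]] by simp
  qed
  ultimately show "\<exists>g. cmap {a'..b'} Y g \<and> (\<forall>z\<in>{a'..b'}. p (g z) = f z)" by (intro exI[of _ g]) simp
 qed
qed

end

section \<open>Cubes as boxes\<close>

abbreviation vzero :: rvec where "vzero \<equiv> \<lambda>_. 0"

definition vone :: "nat => rvec" where "vone n = (\<lambda>i. if i < n then 1 else 0)"

lemma cube_iff: "x \<in> cube n \<longleftrightarrow> (\<forall>i. 0 <= x i \<and> x i <= 1) \<and> (\<forall>i\<ge>n. x i = 0)"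
 by (auto simp: cube_def topspace_Euclidean_space) (metis linorder_not_le order_refl zero_le_one)+

lemma cube_box: "cube n = {vzero..vone n}"
proof -
 have "(\<forall>i. 0 <= x i \<and> x i <= 1) \<and> (\<forall>i\<ge>n. x i = 0) \<longleftrightarrow> (\<forall>i. 0 <= x i) \<and> (\<forall>i. x i <= vone n i)" for x :: rvec
  unfolding vone_def by (smt (verit) linorder_not_le)
 thus ?thesis
  unfolding set_eq_iff cube_iff atLeastAtMost_iff le_fun_def by blast
qed

lemma vone_pos: "vzero i < vone n i \<longleftrightarrow> i < n"
 by (simp add: vone_def)

lemma finite_vone: "finite {i. vzero i < vone n i}"
 unfolding vone_pos by simp

lemma vzero_le_vone: "vzero <= vone n"
 by (simp add: vone_def le_fun_def)

lemma cube_boundary_rbd: "cube_boundary n = rbd vzero (vone n)"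
 unfolding cube_boundary_def rbd_def cube_box vone_pos by (auto simp: vone_def)

lemma subtopology_cube: "subtopology (Euclidean_space n) (cube n) = top_of_set (cube n)"
 unfolding Euclidean_space_def subtopology_subtopology euclidean_product_topology
 by (rule arg_cong[of _ _ "subtopology euclidean"]) (auto simp: cube_iff)

lemma closed_cube: "closed (cube n)" and connected_cube: "connected (cube n)" and compact_cube: "compact (cube n)"
 by (simp_all add: cube_box closed_box connected_box compact_box)

lemma closed_cube_boundary: "closed (cube_boundary n)"
 unfolding cube_boundary_rbd by (rule closed_rbd[OF finite_vone])

lemma cube_boundary_subset: "cube_boundary n \<subseteq> cube n"
 by (auto simp: cube_boundary_def)

lemma cube_Suc_upd: "w \<in> cube (Suc n) ==> w(n := 0) \<in> cube n"
 by (auto simp: cube_iff le_Suc_eq)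

lemma cube_upd_Suc: "z \<in> cube n ==> 0 <= t ==> t <= 1 ==> z(n := t) \<in> cube (Suc n)"
 by (auto simp: cube_iff)

lemma cube_upd0: "z \<in> cube n ==> z(n := 0) = z"
 by (rule fun_upd_idem) (simp add: cube_iff)

lemma vzero_boundary: "0 < n ==> vzero \<in> cube_boundary n"
 by (auto simp: cube_boundary_def cube_iff)

lemma cube_boundary_SucD:
 assumes "w \<in> cube_boundary (Suc n)"
 shows "w \<in> cube (Suc n)" "w n = 0 \<or> w n = 1 \<or> w(n := 0) \<in> cube_boundary n"
 using assms cube_Suc_upd[of w n] by (auto simp: cube_boundary_def less_Suc_eq)

lemma cube_boundary_SucI: "z \<in> cube_boundary n ==> 0 <= t ==> t <= 1 ==> z(n := t) \<in> cube_boundary (Suc n)"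
 using cube_upd_Suc[of z n t] unfolding cube_boundary_def by (auto intro: less_SucI)

lemma continuous_on_upd_const: "continuous_on S (\<lambda>w::rvec. w(n := c))"
 by (intro continuous_on_fun_upd continuous_on_id continuous_on_const)

lemma cube_loops_iff: "f \<in> cube_loops n X x0 \<longleftrightarrow> cmap (cube n) X f \<and> (\<forall>z\<in>cube_boundary n. f z = x0)"
 by (simp add: cube_loops_def subtopology_cube)

lemma weakly_contractible_cube:
 assumes "weakly_contractible Y" "cmap (cube_boundary n) Y f"
 shows "\<exists>g. cmap (cube n) Y g \<and> (\<forall>x\<in>cube_boundary n. g x = f x)"
 using weakly_contractibleD[OF assms(1) vzero_le_vone finite_vone] assms(2)
 unfolding cube_box cube_boundary_rbd by blast

lemma weakly_contractible_path:
 assumes "weakly_contractible Y" "y \<in> topspace Y" "y' \<in> topspace Y"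
 shows "\<exists>g. cmap (cube 1) Y g \<and> g vzero = y \<and> g (vone 1) = y'"
proof -
 define f where "f = (\<lambda>z::rvec. if z 0 = 0 then y else y')"
 have bd: "z 0 = 0 \<or> z 0 = 1" if "z \<in> cube_boundary 1" for z using that by (auto simp: cube_boundary_def)
 have cl: "closed {z::rvec. z 0 = t}" for t
  by (intro closed_Collect_eq continuous_intros)
 have "cmap {z. z 0 = 0} Y f" by (rule cmap_cong[of _ _ "\<lambda>_. y"]) (use assms in \<open>auto simp: f_def\<close>)
 moreover have "cmap {z. z 0 = 1} Y f" by (rule cmap_cong[of _ _ "\<lambda>_. y'"]) (use assms in \<open>auto simp: f_def\<close>)
 ultimately have "cmap ({z. z 0 = 0} \<union> {z. z 0 = 1}) Y f" by (intro cmap_Un cl)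
 hence "cmap (cube_boundary 1) Y f" by (rule cmap_subset) (use bd in blast)
 then obtain g where g: "cmap (cube 1) Y g" "\<forall>x\<in>cube_boundary 1. g x = f x"
  using weakly_contractible_cube[OF assms(1)] by blast
 moreover have "vzero \<in> cube_boundary 1" "vone 1 \<in> cube_boundary 1"
  by (auto simp: cube_boundary_def cube_iff vone_def)
 ultimately show ?thesis by (intro exI[of _ g]) (simp add: f_def vone_def)
qed

lemma weakly_contractible_path_connected:
 assumes "weakly_contractible Y"
 shows "path_connected_space Y"
 unfolding path_connected_space_def
proof (intro ballI)
 fix y y' assume y: "y \<in> topspace Y" "y' \<in> topspace Y"
 from weakly_contractible_path[OF assms y] obtain g where g: "cmap (cube 1) Y g" "g vzero = y" "g (vone 1) = y'"
  by (elim exE conjE)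
 have "cmap {0..1::real} Y (\<lambda>t. g (vzero(0 := t)))"
 proof (rule cmap_compose[OF g(1)])
  show "continuous_on {0..1::real} (\<lambda>t. vzero(0 := t))"
   by (intro continuous_on_fun_upd continuous_intros)
 qed (auto simp: cube_iff)
 moreover have "vzero(0 := 0) = vzero" "vzero(0 := 1) = vone 1" by (auto simp: vone_def)
 ultimately show "\<exists>g. pathin Y g \<and> g 0 = y \<and> g 1 = y'"
  using g unfolding pathin_def by (intro exI[of _ "\<lambda>t. g (vzero(0 := t))"]) simp
qed

section \<open>Homotopy groups of the quotient by a free action\<close>

locale wc_free_action = free_action +
 fixes y0
 assumes wc: "weakly_contractible Y" and y0: "y0 \<in> topspace Y"
begin

text \<open>The lifts form the bottom and the top of a cube of one dimension more, and since they
  agree on the boundary, the sides can be filled in constantly in time. Weak contractibility fills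
  this box, and the filling projects to a homotopy relative to the boundary.\<close>

lemma lift_homotopic:
 assumes f: "f \<in> cube_loops n X (p y0)" "f' \<in> cube_loops n X (p y0)"
  and g: "cmap (cube n) Y g" "\<And>z. z \<in> cube n ==> p (g z) = f z"
  and g': "cmap (cube n) Y g'" "\<And>z. z \<in> cube n ==> p (g' z) = f' z"
  and eq: "\<And>z. z \<in> cube_boundary n ==> g z = g' z"
 shows "(f, f') \<in> loop_homotopy n X (p y0)"
proof -
 define F where "F = (\<lambda>w. if w n = 0 then g (w(n := 0)) else g' (w(n := 0)))"
 let ?S0 = "cube (Suc n) \<inter> {w. w n = 0}"
 let ?S1 = "cube (Suc n) \<inter> ({w. w n = 1} \<union> {w. w(n := 0) \<in> cube_boundary n})"
 have cl: "closed {w::rvec. w n = t}" for t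
  by (intro closed_Collect_eq continuous_intros)
 have "{w::rvec. w(n := 0) \<in> cube_boundary n} = (\<lambda>w. w(n := 0)) -` cube_boundary n" by auto
 hence cl2: "closed {w::rvec. w(n := 0) \<in> cube_boundary n}"
  by (simp add: closed_vimage[OF closed_cube_boundary continuous_on_upd_const])
 have "cmap (?S0 \<union> ?S1) Y F"
 proof (rule cmap_Un)
  have "cmap ?S0 Y (\<lambda>w. g (w(n := 0)))"
   by (rule cmap_compose[OF g(1) continuous_on_upd_const]) (auto intro: cube_Suc_upd)
  thus "cmap ?S0 Y F" by (rule cmap_cong) (simp add: F_def)
  have "cmap ?S1 Y (\<lambda>w. g' (w(n := 0)))"
   by (rule cmap_compose[OF g'(1) continuous_on_upd_const]) (auto intro: cube_Suc_upd)
  thus "cmap ?S1 Y F" by (rule cmap_cong) (auto simp: F_def eq)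
 qed (intro closed_Int closed_Un closed_cube cl cl2)+
 hence "cmap (cube_boundary (Suc n)) Y F"
  by (rule cmap_subset) (use cube_boundary_SucD in blast)
 from weakly_contractible_cube[OF wc this]
 obtain H where H: "cmap (cube (Suc n)) Y H" "\<forall>x\<in>cube_boundary (Suc n). H x = F x"
  by (elim exE conjE)
 define h where "h = (\<lambda>tz. p (H ((snd tz)(n := fst tz))))"
 have "cmap ({0..1::real} \<times> cube n) Y (\<lambda>tz. H ((snd tz)(n := fst tz)))"
 proof (rule cmap_compose[OF H(1)])
  show "continuous_on ({0..1} \<times> cube n) (\<lambda>tz. (snd tz)(n := fst tz))"
   by (intro continuous_on_fun_upd continuous_intros)
 qed (auto intro: cube_upd_Suc)
 hence ch: "continuous_map (prod_topology (top_of_set {0..1}) (top_of_set (cube n))) X h"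
  unfolding h_def top_of_set_Times[symmetric] by (rule cmap_continuous[OF _ p_cont])
 have bd: "z(n := t) \<in> cube_boundary (Suc n)" if "z \<in> cube n" "t = 0 \<or> t = 1" for z t
  using cube_upd_Suc[OF that(1), of t] that(2) unfolding cube_boundary_def by auto
 have h0: "h (0, z) = f z" if "z \<in> cube n" for z
  using bspec[OF H(2) bd[OF that, of 0]] g(2)[OF that] cube_upd0[OF that] that
  by (simp add: h_def F_def cube_iff)
 have h1: "h (1, z) = f' z" if "z \<in> cube n" for z
  using bspec[OF H(2) bd[OF that, of 1]] g'(2)[OF that] cube_upd0[OF that] by (simp add: h_def F_def)
 have hb: "h (t, z) = p y0" if "z \<in> cube_boundary n" "t \<in> {0..1}" for t z
 proof -
  have z: "z \<in> cube n" using that(1) cube_boundary_subset by blast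
  have "z(n := t) \<in> cube_boundary (Suc n)" using cube_boundary_SucI[OF that(1)] that(2) by simp
  hence "H (z(n := t)) = F (z(n := t))" using H(2) by blast
  hence "H (z(n := t)) = g z" using eq[OF that(1)] cube_upd0[OF z] by (simp add: F_def)
  thus ?thesis using g(2)[OF z] f(1) that(1) by (simp add: h_def cube_loops_iff)
 qed
 have "homotopic_with (\<lambda>h. \<forall>z\<in>cube_boundary n. h z = p y0) (top_of_set (cube n)) X f f'"
 proof (subst homotopic_with)
  show "(\<forall>z\<in>cube_boundary n. h z = p y0) \<longleftrightarrow> (\<forall>z\<in>cube_boundary n. k z = p y0)"
   if "\<And>x. x \<in> topspace (top_of_set (cube n)) ==> h x = k x" for h k
   using that subsetD[OF cube_boundary_subset] by (intro ball_cong) auto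
  show "\<exists>h. continuous_map (prod_topology (top_of_set {0..1::real}) (top_of_set (cube n))) X h \<and>
    (\<forall>x\<in>topspace (top_of_set (cube n)). h (0, x) = f x) \<and> (\<forall>x\<in>topspace (top_of_set (cube n)). h (1, x) = f' x) \<and>
    (\<forall>t\<in>{0..1::real}. \<forall>z\<in>cube_boundary n. h (t, z) = p y0)"
   by (rule exI[of _ h]) (use ch h0 h1 hb in auto)
 qed
 thus ?thesis using f by (simp add: loop_homotopy_def subtopology_cube)
qed

lemma loop_lift:
 assumes "f \<in> cube_loops n X (p y0)" "0 < n"
 shows "\<exists>g. cmap (cube n) Y g \<and> (\<forall>z\<in>cube n. p (g z) = f z) \<and> g vzero = y0"
proof -
 have "cmap {vzero..vone n} X f" using assms(1) by (simp add: cube_loops_iff cube_box)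
 from lift_exists[OF vzero_le_vone finite_vone this]
 obtain g where g: "cmap (cube n) Y g" "\<forall>z\<in>cube n. p (g z) = f z"
  unfolding cube_box by (elim exE conjE)
 have v: "vzero \<in> cube n" "p (g vzero) = p y0"
  using g(2) vzero_boundary[OF assms(2)] assms(1) cube_boundary_subset[of n] by (auto simp: cube_loops_iff)
 then obtain k where k: "k \<in> carrier G" "y0 = act k (g vzero)"
  using fib[OF cmap_in[OF g(1) v(1)] y0] by auto
 show ?thesis
  using cmap_continuous[OF g(1) act_cont[OF k(1)]] g(2) p_act[OF k(1) cmap_in[OF g(1)]] k(2)
  by (intro exI[of _ "\<lambda>z. act k (g z)"]) simp
qed

text \<open>The homotopy itself is lifted. Over a boundary point of the cube it stays at the base
  point, so its lift is a path in one orbit and therefore constant.\<close>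

lemma lift_boundary:
 assumes "(f, f') \<in> loop_homotopy n X (p y0)" "0 < n"
  and g: "cmap (cube n) Y g" "\<And>z. z \<in> cube n ==> p (g z) = f z" "g vzero = y0"
  and g': "cmap (cube n) Y g'" "\<And>z. z \<in> cube n ==> p (g' z) = f' z" "g' vzero = y0"
  and z: "z \<in> cube_boundary n"
 shows "g z = g' z"
proof -
 have "homotopic_with (\<lambda>h. \<forall>z\<in>cube_boundary n. h z = p y0) (top_of_set (cube n)) X f f'"
  using assms(1) by (simp add: loop_homotopy_def subtopology_cube)
 then obtain h :: "real \<times> rvec => _" where h: "cmap ({0..1} \<times> cube n) X h" "\<And>x. h (0, x) = f x" "\<And>x. h (1, x) = f' x"
  "\<And>t z. t \<in> {0..1} ==> z \<in> cube_boundary n ==> h (t, z) = p y0"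
  unfolding homotopic_with_def top_of_set_Times by auto
 have "cmap (cube (Suc n)) X (\<lambda>w. h (w n, w(n := 0)))"
 proof (rule cmap_compose[OF h(1)])
  show "continuous_on (cube (Suc n)) (\<lambda>w. (w n, w(n := 0)))"
   by (intro continuous_on_Pair continuous_on_proj continuous_on_upd_const)
 qed (auto intro: cube_Suc_upd simp: cube_iff)
 hence "cmap {vzero..vone (Suc n)} X (\<lambda>w. h (w n, w(n := 0)))" by (simp add: cube_box)
 from lift_exists[OF vzero_le_vone finite_vone this]
 obtain L0 where L0: "cmap (cube (Suc n)) Y L0" "\<forall>w\<in>cube (Suc n). p (L0 w) = h (w n, w(n := 0))"
  unfolding cube_box by (elim exE conjE)
 have v: "vzero \<in> cube (Suc n)" "vzero \<in> cube n" by (auto simp: cube_iff)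
 have vb: "vzero \<in> cube_boundary n" by (rule vzero_boundary[OF assms(2)])
 have "p (L0 vzero) = p y0" using L0(2) v h(4)[of 0 vzero] vb by (simp add: fun_upd_idem)
 then obtain k where k: "k \<in> carrier G" "y0 = act k (L0 vzero)"
  using fib[OF cmap_in[OF L0(1) v(1)] y0] by auto
 define L where "L = (\<lambda>w. act k (L0 w))"
 have L: "cmap (cube (Suc n)) Y L" unfolding L_def by (rule cmap_continuous[OF L0(1) act_cont[OF k(1)]])
 have pL: "p (L (z(n := t))) = h (t, z)" if "z \<in> cube n" "0 <= t" "t <= 1" for z t
  using L0(2) cube_upd_Suc[OF that] p_act[OF k(1) cmap_in[OF L0(1) cube_upd_Suc[OF that]]] cube_upd0[OF that(1)]
  by (simp add: L_def)
 have cLz: "cmap {0..1} Y (\<lambda>t. L (z(n := t)))" if "z \<in> cube n" for z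
 proof (rule cmap_compose[OF L])
  show "continuous_on {0..1::real} (\<lambda>t. z(n := t))" by (intro continuous_on_fun_upd continuous_intros)
 qed (use cube_upd_Suc[OF that] in auto)
 have const: "L (z(n := 1)) = L (z(n := 0))" if "z \<in> cube_boundary n" for z
 proof -
  have zc: "z \<in> cube n" using that cube_boundary_subset by blast
  show ?thesis
  proof (rule lift_unique[of "{0..1::real}" "\<lambda>t. L (z(n := t))" "\<lambda>_. L (z(n := 0))" 0])
   show "cmap {0..1} Y (\<lambda>t. L (z(n := t)))" by (rule cLz[OF zc])
   show "cmap {0..1::real} Y (\<lambda>_. L (z(n := 0)))" using cmap_in[OF L cube_upd_Suc[OF zc]] by simp
   fix t :: real assume "t \<in> {0..1}"
   thus "p (L (z(n := t))) = p (L (z(n := 0)))"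
    using pL[OF zc] h(4)[of t z] h(4)[of 0 z] that by simp
  qed auto
 qed
 have zc: "z \<in> cube n" using z cube_boundary_subset by blast
 have cL: "cmap (cube n) Y (\<lambda>z. L (z(n := t)))" if "0 <= t" "t <= 1" for t
  by (rule cmap_compose[OF L continuous_on_upd_const]) (use cube_upd_Suc that in blast)
 have "L (z(n := 0)) = g z"
 proof (rule lift_unique[of "cube n" "\<lambda>z. L (z(n := 0))" g vzero])
  show "cmap (cube n) Y (\<lambda>z. L (z(n := 0)))" by (rule cL) auto
  show "p (L (z(n := 0))) = p (g z)" if "z \<in> cube n" for z using pL[OF that, of 0] g(2)[OF that] h(2) by simp
  show "L (vzero(n := 0)) = g vzero" using g(3) k(2) by (simp add: L_def fun_upd_idem)
 qed (use connected_cube g(1) v zc in auto)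
 moreover have "L (z(n := 1)) = g' z"
 proof (rule lift_unique[of "cube n" "\<lambda>z. L (z(n := 1))" g' vzero])
  show "cmap (cube n) Y (\<lambda>z. L (z(n := 1)))" by (rule cL) auto
  show "p (L (z(n := 1))) = p (g' z)" if "z \<in> cube n" for z using pL[OF that, of 1] g'(2)[OF that] h(3) by simp
  show "L (vzero(n := 1)) = g' vzero" using const[OF vb] g'(3) k(2) by (simp add: L_def fun_upd_idem)
 qed (use connected_cube g'(1) v zc in auto)
 ultimately show ?thesis using const[OF z] by simp
qed

lemma const_loop: "(\<lambda>_. p y0) \<in> cube_loops n X (p y0)"
 using p_in[OF y0] by (simp add: cube_loops_iff)

text \<open>A loop sends each face to the base point, so its lift is constant on each face. For
  \<open>n\<close> at least 2 any face can be joined to the origin through adjacent faces, so the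
  lift is constant on the whole boundary, and \<open>lift_homotopic\<close> applies to any two
  loops.\<close>

lemma higher_loops_homotopic:
 assumes "2 <= n" "f \<in> cube_loops n X (p y0)" "f' \<in> cube_loops n X (p y0)"
 shows "(f, f') \<in> loop_homotopy n X (p y0)"
proof -
 have bd: "g z = y0" if g: "cmap (cube n) Y g" "\<forall>z\<in>cube n. p (g z) = f z" "g vzero = y0"
   and f: "f \<in> cube_loops n X (p y0)" and z: "z \<in> cube_boundary n" for f g z
 proof -
  have const: "g w = g w'" if "w \<in> {a..b}" "w' \<in> {a..b}" "{a..b} \<subseteq> cube_boundary n" for w w' a b
  proof (rule lift_unique[OF connected_box _ _ _ that(2) _ that(1), of g "\<lambda>_. g w'"])
   have sub: "{a..b} \<subseteq> cube n" using that(3) cube_boundary_subset by blast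
   show "cmap {a..b} Y g" by (rule cmap_subset[OF g(1) sub])
   show "cmap {a..b} Y (\<lambda>_. g w')" using cmap_in[OF g(1)] sub that(2) by auto
   show "p (g u) = p (g w')" if "u \<in> {a..b}" for u
    using that \<open>w' \<in> {a..b}\<close> \<open>{a..b} \<subseteq> cube_boundary n\<close> g(2) f sub by (auto simp: cube_loops_iff subset_iff)
  qed simp
  obtain i where i: "i < n" "z i = 0 \<or> z i = 1" and zc: "z \<in> cube n" using z by (auto simp: cube_boundary_def)
  have "\<exists>j<n. j ~= i"
   by (rule exI[of _ "if i = 0 then 1 else 0"]) (use assms(1) in auto)
  then obtain j where j: "j < n" "j ~= i" by blast
  \<comment> \<open>This corner lies on the face through \<open>z\<close> in direction
    \<open>i\<close> and also on the face where coordinate \<open>j\<close> is 0, which contains the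
    origin.\<close>
  define q where "q = vzero(i := z i)"
  have zz: "0 <= z l" "z l <= vone n l" for l using zc by (auto simp: cube_box le_fun_def)
  have "g z = g q"
  proof (rule const)
   show "z \<in> {vzero(i := z i)..(vone n)(i := z i)}" using zz by (auto simp: le_fun_def)
   show "q \<in> {vzero(i := z i)..(vone n)(i := z i)}" by (auto simp: q_def le_fun_def vone_def)
   show "{vzero(i := z i)..(vone n)(i := z i)} \<subseteq> cube_boundary n"
   proof
    fix w assume w: "w \<in> {vzero(i := z i)..(vone n)(i := z i)}"
    hence wl: "(vzero(i := z i)) l <= w l" "w l <= ((vone n)(i := z i)) l" for l by (auto simp: le_fun_def)
    hence "w i = z i" using wl[of i] by simp
    moreover have "0 <= w l" "w l <= vone n l" for l using wl[of l] zz[of i] by (cases "l = i"; simp)+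
    hence "w \<in> cube n" by (auto simp: cube_box le_fun_def)
    ultimately show "w \<in> cube_boundary n" using i unfolding cube_boundary_def by auto
   qed
  qed
  also have "g q = g vzero"
  proof (rule const)
   show "q \<in> {vzero..(vone n)(j := 0)}"
    using zz(1)[of i] zz(2)[of i] j i(1) by (auto simp: le_fun_def q_def vone_def)
   show "vzero \<in> {vzero..(vone n)(j := 0)}" by (auto simp: le_fun_def vone_def)
   show "{vzero..(vone n)(j := 0)} \<subseteq> cube_boundary n"
   proof
    fix w assume w: "w \<in> {vzero..(vone n)(j := 0)}"
    hence wl: "0 <= w l" "w l <= ((vone n)(j := 0)) l" for l by (auto simp: le_fun_def)
    hence "w j = 0" using wl(1)[of j] wl(2)[of j] by (simp add: antisym)
    moreover have "w l <= vone n l" for l using wl(2)[of l] by (cases "l = j") (auto simp: vone_def)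
    hence "w \<in> cube n" using wl(1) by (auto simp: cube_box le_fun_def)
    ultimately show "w \<in> cube_boundary n" using j unfolding cube_boundary_def by auto
   qed
  qed
  finally show ?thesis using g(3) by simp
 qed
 have n: "0 < n" using assms(1) by simp
 from loop_lift[OF assms(2) n] obtain g where g: "cmap (cube n) Y g" "\<forall>z\<in>cube n. p (g z) = f z" "g vzero = y0" by blast
 from loop_lift[OF assms(3) n] obtain g' where g': "cmap (cube n) Y g'" "\<forall>z\<in>cube n. p (g' z) = f' z" "g' vzero = y0" by blast
 show ?thesis
  by (rule lift_homotopic[OF assms(2,3) g(1) _ g'(1)]) (use g g' bd[OF g assms(2)] bd[OF g' assms(3)] in auto)
qed

lemma homotopy_group_trivial:
 assumes "2 <= n"
 shows "trivial_group (homotopy_group n X (p y0))"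
proof -
 let ?L = "cube_loops n X (p y0)" and ?R = "loop_homotopy n X (p y0)"
 have RL: "?R = ?L \<times> ?L"
  using higher_loops_homotopic[OF assms] by (auto simp: loop_homotopy_def)
 have cls: "?R `` {f} = ?L" if "f \<in> ?L" for f using that RL by auto
 have car: "carrier (homotopy_group n X (p y0)) = {?L}"
  using cls const_loop[of n] by (auto simp: homotopy_group_def quotient_def)
 have one: "\<one>\<^bsub>homotopy_group n X (p y0)\<^esub> = ?L"
  using cls[OF const_loop] by (simp add: homotopy_group_def)
 have "loop_concat (\<lambda>_. p y0) (\<lambda>_. p y0) = (\<lambda>_. p y0)" by (auto simp: loop_concat_def)
 hence "?R `` {loop_concat (\<lambda>_. p y0) (\<lambda>_. p y0)} = ?L" using cls[OF const_loop] by simp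
 hence mult: "?L \<otimes>\<^bsub>homotopy_group n X (p y0)\<^esub> ?L = ?L"
  using const_loop[of n] RL by (auto simp: homotopy_group_def)
 have "group (homotopy_group n X (p y0))"
  by (rule groupI) (simp_all add: car one mult)
 thus ?thesis using car one by (simp add: trivial_group_def)
qed

end

lemma vone_boundary: "vone 1 \<in> cube_boundary 1"
 by (auto simp: cube_boundary_def cube_iff vone_def)

lemma cube_1_cases: "z \<in> cube_boundary 1 ==> z = vzero \<or> z = vone 1"
proof -
 assume "z \<in> cube_boundary 1"
 hence z: "z 0 = 0 \<or> z 0 = 1" "\<And>i. i \<ge> 1 ==> z i = 0" by (auto simp: cube_boundary_def cube_iff)
 have "z i = vzero i" if "z 0 = 0" for i using z(2)[of i] that by (cases i) auto
 moreover have "z i = vone 1 i" if "z 0 = 1" for i using z(2)[of i] that by (cases i) (auto simp: vone_def)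
 ultimately show ?thesis using z(1) by blast
qed

context wc_free_action
begin

definition is_lift where
 "is_lift f g \<longleftrightarrow> cmap (cube 1) Y g \<and> (\<forall>z\<in>cube 1. p (g z) = f z) \<and> g vzero = y0"

definition monodromy where
 "monodromy f = (THE k. k \<in> carrier G \<and> (\<exists>g. is_lift f g \<and> g (vone 1) = act k y0))"

lemma is_lift_unique:
 assumes "is_lift f g" "is_lift f g'" "z \<in> cube 1"
 shows "g z = g' z"
proof (rule lift_unique[OF connected_cube _ _ _ _ _ assms(3), of g g' vzero])
 show "vzero \<in> cube 1" by (simp add: cube_iff)
qed (use assms in \<open>auto simp: is_lift_def\<close>)

lemma monodromy_eqI:
 assumes "is_lift f g" "k \<in> carrier G" "g (vone 1) = act k y0"
 shows "monodromy f = k"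
 unfolding monodromy_def
proof (rule the_equality)
 show "k \<in> carrier G \<and> (\<exists>g. is_lift f g \<and> g (vone 1) = act k y0)" using assms by blast
 fix k' assume "k' \<in> carrier G \<and> (\<exists>g. is_lift f g \<and> g (vone 1) = act k' y0)"
 then obtain g' where g': "k' \<in> carrier G" "is_lift f g'" "g' (vone 1) = act k' y0" by blast
 have "vone 1 \<in> cube 1" using vone_boundary cube_boundary_subset by blast
 hence "act k' y0 = act k y0" using is_lift_unique[OF assms(1) g'(2)] assms(3) g'(3) by metis
 thus "k' = k" using act_inj[OF g'(1) assms(2) y0] by blast
qed

lemma is_lift_loop:
 assumes "is_lift f g" "k \<in> carrier G" "g (vone 1) = act k y0"
 shows "f \<in> cube_loops 1 X (p y0)"
 unfolding cube_loops_iff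
proof
 show "cmap (cube 1) X f"
  by (rule cmap_cong[OF cmap_continuous[OF _ p_cont, of _ g]]) (use assms(1) in \<open>auto simp: is_lift_def\<close>)
 show "\<forall>z\<in>cube_boundary 1. f z = p y0"
 proof
  fix z assume z: "z \<in> cube_boundary 1"
  hence zc: "z \<in> cube 1" using cube_boundary_subset by blast
  have "p (g z) = p y0" using cube_1_cases[OF z] assms p_act[OF assms(2) y0] by (auto simp: is_lift_def)
  thus "f z = p y0" using assms(1) zc by (simp add: is_lift_def)
 qed
qed

lemma monodromy_lift:
 assumes "f \<in> cube_loops 1 X (p y0)"
 shows "\<exists>g. is_lift f g \<and> monodromy f \<in> carrier G \<and> g (vone 1) = act (monodromy f) y0"
proof -
 from loop_lift[OF assms] obtain g where g: "is_lift f g" unfolding is_lift_def by auto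
 have v: "vone 1 \<in> cube 1" using vone_boundary cube_boundary_subset by blast
 have "p (g (vone 1)) = p y0" using g v assms vone_boundary by (simp add: is_lift_def cube_loops_iff)
 moreover have "g (vone 1) \<in> topspace Y" using g v cmap_in unfolding is_lift_def by blast
 ultimately obtain k where k: "k \<in> carrier G" "g (vone 1) = act k y0" using fib[OF y0, of "g (vone 1)"] by auto
 thus ?thesis using monodromy_eqI[OF g k] g by blast
qed

lemma monodromy_iff:
 assumes f: "f \<in> cube_loops 1 X (p y0)" "f' \<in> cube_loops 1 X (p y0)"
 shows "(f, f') \<in> loop_homotopy 1 X (p y0) \<longleftrightarrow> monodromy f = monodromy f'"
proof -
 obtain g where g: "is_lift f g" "monodromy f \<in> carrier G" "g (vone 1) = act (monodromy f) y0"
  using monodromy_lift[OF f(1)] by blast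
 obtain g' where g': "is_lift f' g'" "monodromy f' \<in> carrier G" "g' (vone 1) = act (monodromy f') y0"
  using monodromy_lift[OF f(2)] by blast
 show ?thesis
 proof
  assume "(f, f') \<in> loop_homotopy 1 X (p y0)"
  hence "g (vone 1) = g' (vone 1)"
   using lift_boundary[of f f' 1 g g' "vone 1"] g(1) g'(1) vone_boundary by (simp add: is_lift_def)
  thus "monodromy f = monodromy f'" using act_inj[OF g(2) g'(2) y0] g(3) g'(3) by simp
 next
  assume "monodromy f = monodromy f'"
  hence eq: "g z = g' z" if "z \<in> cube_boundary 1" for z
   using cube_1_cases[OF that] g g' by (auto simp: is_lift_def)
  show "(f, f') \<in> loop_homotopy 1 X (p y0)"
   by (rule lift_homotopic[OF f, of g g']) (use g(1) g'(1) eq in \<open>auto simp: is_lift_def\<close>)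
 qed
qed

lemma monodromy_surj:
 assumes "k \<in> carrier G"
 shows "\<exists>f\<in>cube_loops 1 X (p y0). monodromy f = k"
proof -
 from weakly_contractible_path[OF wc y0 act_in[OF assms y0]]
 obtain g where g: "cmap (cube 1) Y g" "g vzero = y0" "g (vone 1) = act k y0" by (elim exE conjE)
 hence l: "is_lift (\<lambda>z. p (g z)) g" by (simp add: is_lift_def)
 show ?thesis using is_lift_loop[OF l assms g(3)] monodromy_eqI[OF l assms g(3)] by blast
qed

text \<open>The lift of the second loop is translated by the monodromy of the first, so that it
  starts where the first lift ends. Its end point is then reached by the product in the same order,
  so monodromy is a homomorphism rather than an antihomomorphism.\<close>

lemma monodromy_concat:
 assumes f: "f \<in> cube_loops 1 X (p y0)" "f' \<in> cube_loops 1 X (p y0)"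
 shows "loop_concat f f' \<in> cube_loops 1 X (p y0)"
  "monodromy (loop_concat f f') = monodromy f \<otimes> monodromy f'"
proof -
 obtain g where g: "is_lift f g" "monodromy f \<in> carrier G" "g (vone 1) = act (monodromy f) y0"
  using monodromy_lift[OF f(1)] by blast
 obtain g' where g': "is_lift f' g'" "monodromy f' \<in> carrier G" "g' (vone 1) = act (monodromy f') y0"
  using monodromy_lift[OF f(2)] by blast
 let ?k = "monodromy f"
 define g2 where "g2 = (\<lambda>z. act ?k (g' z))"
 have cg2: "cmap (cube 1) Y g2" unfolding g2_def
  by (rule cmap_continuous[OF _ act_cont[OF g(2)]]) (use g'(1) in \<open>simp add: is_lift_def\<close>)
 define c where "c = (\<lambda>z. if z 0 <= 1/2 then g (z(0 := 2 * z 0)) else g2 (z(0 := 2 * z 0 - 1)))"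
 let ?A = "cube 1 \<inter> {z. z 0 <= 1/2}" and ?B = "cube 1 \<inter> {z. 1/2 <= z 0}"
 have inA: "z(0 := 2 * z 0) \<in> cube 1" if "z \<in> ?A" for z using that by (auto simp: cube_iff)
 have inB: "z(0 := 2 * z 0 - 1) \<in> cube 1" if "z \<in> ?B" for z using that by (auto simp: cube_iff)
 have "cmap (?A \<union> ?B) Y c"
 proof (rule cmap_Un)
  show "closed ?A" "closed ?B"
   by (intro closed_Int closed_cube closed_Collect_le continuous_intros)+
  have "cmap ?A Y (\<lambda>z. g (z(0 := 2 * z 0)))"
  proof (rule cmap_compose[of "cube 1"])
   show "continuous_on ?A (\<lambda>z. z(0 := 2 * z 0))"
    by (intro continuous_on_fun_upd continuous_intros)
   show "cmap (cube 1) Y g" using g(1) by (simp add: is_lift_def)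
   show "(\<lambda>z. z(0 := 2 * z 0)) ` ?A \<subseteq> cube 1" using inA by blast
  qed
  thus "cmap ?A Y c" by (rule cmap_cong) (simp add: c_def)
  have "cmap ?B Y (\<lambda>z. g2 (z(0 := 2 * z 0 - 1)))"
  proof (rule cmap_compose[OF cg2])
   show "continuous_on ?B (\<lambda>z. z(0 := 2 * z 0 - 1))"
    by (intro continuous_on_fun_upd continuous_intros)
   show "(\<lambda>z. z(0 := 2 * z 0 - 1)) ` ?B \<subseteq> cube 1" using inB by blast
  qed
  thus "cmap ?B Y c"
  proof (rule cmap_cong)
   fix z assume z: "z \<in> ?B"
   show "g2 (z(0 := 2 * z 0 - 1)) = c z"
   proof (cases "z 0 = 1/2")
    case True
    have "z i = 0" if "i \<ge> 1" for i using z that by (simp add: cube_iff)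
    hence e: "z(0 := 2 * z 0 - 1) = vzero" "z(0 := 2 * z 0) = vone 1"
     using True by (auto simp: vone_def fun_eq_iff Suc_leI)
    have "c z = g (vone 1)" unfolding c_def e using True by simp
    moreover have "g2 (z(0 := 2 * z 0 - 1)) = act ?k y0" unfolding g2_def e using g'(1) by (simp add: is_lift_def)
    ultimately show ?thesis using g(3) by simp
   next
    case False
    thus ?thesis using z by (simp add: c_def)
   qed
  qed
 qed
 moreover have "?A \<union> ?B = cube 1" by auto
 ultimately have cc: "cmap (cube 1) Y c" by simp
 have pc: "p (c z) = loop_concat f f' z" if z: "z \<in> cube 1" for z
 proof (cases "z 0 <= 1/2")
  case True
  thus ?thesis using inA[of z] z g(1) by (simp add: c_def loop_concat_def is_lift_def)
 next
  case False
  hence zb: "z(0 := 2 * z 0 - 1) \<in> cube 1" using inB[of z] z by simp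
  hence "g' (z(0 := 2 * z 0 - 1)) \<in> topspace Y" using g'(1) cmap_in unfolding is_lift_def by blast
  hence "p (g2 (z(0 := 2 * z 0 - 1))) = f' (z(0 := 2 * z 0 - 1))"
   using p_act[OF g(2)] g'(1) zb by (simp add: g2_def is_lift_def)
  thus ?thesis using False by (simp add: c_def loop_concat_def)
 qed
 have "vzero(0 := 0) = vzero" "(vone 1)(0 := 1) = vone 1" by (auto simp: vone_def)
 hence "c vzero = y0" "c (vone 1) = g2 (vone 1)"
  using g(1) by (simp_all add: c_def is_lift_def vone_def)
 hence lift: "is_lift (loop_concat f f') c" and "c (vone 1) = act (monodromy f \<otimes> monodromy f') y0"
  using cc pc g'(3) act_mult[OF g(2) g'(2) y0] by (auto simp: is_lift_def g2_def)
 thus "loop_concat f f' \<in> cube_loops 1 X (p y0)"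
  "monodromy (loop_concat f f') = monodromy f \<otimes> monodromy f'"
  using is_lift_loop[OF lift] monodromy_eqI[OF lift] g(2) g'(2) by blast+
qed

lemma fundamental_group_iso: "homotopy_group 1 X (p y0) \<cong> G"
proof -
 let ?L = "cube_loops 1 X (p y0)" and ?R = "loop_homotopy 1 X (p y0)" and ?H = "homotopy_group 1 X (p y0)"
 have RL: "f \<in> ?L" "f' \<in> ?L" if "(f, f') \<in> ?R" for f f' using that by (auto simp: loop_homotopy_def)
 have cls: "?R `` {f} = {f' \<in> ?L. monodromy f' = monodromy f}" if "f \<in> ?L" for f
 proof -
  have "(f, f') \<in> ?R \<longleftrightarrow> f' \<in> ?L \<and> monodromy f' = monodromy f" for f'
   using RL(2)[of f f'] monodromy_iff[OF that, of f'] by metis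
  thus ?thesis by blast
 qed
 have car: "carrier ?H = (\<lambda>f. ?R `` {f}) ` ?L" by (auto simp: homotopy_group_def quotient_def)
 define \<phi> where "\<phi> = (\<lambda>A. monodromy (SOME f. f \<in> A))"
 have \<phi>: "\<phi> (?R `` {f}) = monodromy f" if "f \<in> ?L" for f
 proof -
  have "f \<in> ?R `` {f}" using cls that by simp
  hence "(SOME f'. f' \<in> ?R `` {f}) \<in> ?R `` {f}"
   using someI_ex[of "\<lambda>f'. f' \<in> ?R `` {f}"] by blast
  thus ?thesis unfolding \<phi>_def using cls[OF that] by blast
 qed
 have mult: "?R `` {f} \<otimes>\<^bsub>?H\<^esub> ?R `` {f'} = ?R `` {loop_concat f f'}" if "f \<in> ?L" "f' \<in> ?L" for f f'
 proof -
  have *: "?R `` {loop_concat u v} = ?R `` {loop_concat f f'}" if "u \<in> ?R `` {f}" "v \<in> ?R `` {f'}" for u v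
  proof -
   have u: "u \<in> ?L" "monodromy u = monodromy f" and v: "v \<in> ?L" "monodromy v = monodromy f'"
    using that cls[OF \<open>f \<in> ?L\<close>] cls[OF \<open>f' \<in> ?L\<close>] by auto
   show ?thesis
    using cls[OF monodromy_concat(1)[OF u(1) v(1)]] cls[OF monodromy_concat(1)[OF \<open>f \<in> ?L\<close> \<open>f' \<in> ?L\<close>]]
     monodromy_concat(2)[OF u(1) v(1)] monodromy_concat(2)[OF \<open>f \<in> ?L\<close> \<open>f' \<in> ?L\<close>] u(2) v(2) by simp
  qed
  have "f \<in> ?R `` {f}" "f' \<in> ?R `` {f'}" using cls that by auto
  hence "(\<Union>u\<in>?R `` {f}. \<Union>v\<in>?R `` {f'}. ?R `` {loop_concat u v}) = ?R `` {loop_concat f f'}"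
   using * by blast
  thus ?thesis by (simp add: homotopy_group_def)
 qed
 have "\<phi> \<in> hom ?H G"
 proof (rule homI)
  fix A assume "A \<in> carrier ?H"
  then obtain f where "f \<in> ?L" "A = ?R `` {f}" using car by auto
  thus "\<phi> A \<in> carrier G" using \<phi> monodromy_lift by metis
 next
  fix A B assume "A \<in> carrier ?H" "B \<in> carrier ?H"
  then obtain f f' where f: "f \<in> ?L" "A = ?R `` {f}" "f' \<in> ?L" "B = ?R `` {f'}" using car by auto
  thus "\<phi> (A \<otimes>\<^bsub>?H\<^esub> B) = \<phi> A \<otimes> \<phi> B"
   using mult \<phi> monodromy_concat[OF f(1,3)] by simp
 qed
 moreover have "bij_betw \<phi> (carrier ?H) (carrier G)"
  unfolding bij_betw_def
 proof
  show "inj_on \<phi> (carrier ?H)"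
  proof (rule inj_onI)
   fix A B assume "A \<in> carrier ?H" "B \<in> carrier ?H" and eq: "\<phi> A = \<phi> B"
   then obtain f f' where f: "f \<in> ?L" "A = ?R `` {f}" "f' \<in> ?L" "B = ?R `` {f'}" using car by auto
   thus "A = B" using \<phi> eq cls by simp
  qed
  show "\<phi> ` carrier ?H = carrier G"
  proof (intro equalityI subsetI)
   fix k assume "k \<in> \<phi> ` carrier ?H"
   then obtain f where "f \<in> ?L" "k = \<phi> (?R `` {f})" using car by auto
   thus "k \<in> carrier G" using \<phi> monodromy_lift by metis
  next
   fix k assume "k \<in> carrier G"
   then obtain f where "f \<in> ?L" "monodromy f = k" using monodromy_surj by blast
   thus "k \<in> \<phi> ` carrier ?H" using car \<phi> by (metis imageI)
  qed
 qed
 ultimately show ?thesis by (intro is_isoI[of \<phi>]) (simp add: iso_def)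
qed

theorem Eilenberg_MacLane_quotient: "Eilenberg_MacLane_1 X G"
proof -
 have "path_connected_space X"
  unfolding path_connected_space_def
 proof (intro ballI)
  fix x x' assume "x \<in> topspace X" "x' \<in> topspace X"
  then obtain y y' where y: "y \<in> topspace Y" "p y = x" "y' \<in> topspace Y" "p y' = x'" using p_surj by metis
  then obtain g where g: "pathin Y g" "g 0 = y" "g 1 = y'"
   using weakly_contractible_path_connected[OF wc] unfolding path_connected_space_def by blast
  thus "\<exists>g. pathin X g \<and> g 0 = x \<and> g 1 = x'"
   using pathin_compose[OF g(1) p_cont] y by (intro exI[of _ "p \<circ> g"]) simp
 qed
 thus ?thesis
  using p_in[OF y0] fundamental_group_iso homotopy_group_trivial
  unfolding Eilenberg_MacLane_1_def by (intro conjI bexI[of _ "p y0"]) auto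
qed

end

section \<open>CW structures on quotients\<close>

definition open_cube :: "nat => rvec set" where
 "open_cube n = {x. (\<forall>i<n. 0 < x i \<and> x i < 1) \<and> (\<forall>i\<ge>n. x i = 0)}"

lemma open_cube_eq: "open_cube n = cube n - cube_boundary n"
proof -
 have "x \<in> open_cube n \<longleftrightarrow> x \<in> cube n \<and> (\<forall>i<n. x i ~= 0 \<and> x i ~= 1)" for x
  unfolding open_cube_def cube_def topspace_Euclidean_space by force
 thus ?thesis by (auto simp: cube_boundary_def)
qed

lemma open_cube_subset: "open_cube n \<subseteq> cube n"
 by (auto simp: open_cube_eq)

lemma unit_disc_iff: "x \<in> unit_disc n \<longleftrightarrow> (\<forall>i\<ge>n. x i = 0) \<and> L2_set x {..<n} <= 1"
 by (auto simp: unit_disc_def topspace_Euclidean_space L2_set_def)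

lemma open_unit_disc_iff: "x \<in> open_unit_disc n \<longleftrightarrow> (\<forall>i\<ge>n. x i = 0) \<and> L2_set x {..<n} < 1"
 by (auto simp: open_unit_disc_def topspace_Euclidean_space L2_set_def)

lemma disc_boundary_iff: "x \<in> disc_boundary n \<longleftrightarrow> (\<forall>i\<ge>n. x i = 0) \<and> L2_set x {..<n} = 1"
 by (auto simp: disc_boundary_def topspace_Euclidean_space L2_set_def)

lemma unit_disc_subset: "open_unit_disc n \<subseteq> unit_disc n" "disc_boundary n \<subseteq> unit_disc n"
  "unit_disc n = open_unit_disc n \<union> disc_boundary n"
 by (auto simp: open_unit_disc_def unit_disc_def disc_boundary_def)

lemma subtopology_Euclidean_space:
 assumes "S \<subseteq> topspace (Euclidean_space n)"
 shows "subtopology (Euclidean_space n) S = top_of_set S"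
 using assms unfolding Euclidean_space_def subtopology_subtopology euclidean_product_topology
 by (simp add: inf.absorb2)

lemma unit_disc_topspace: "unit_disc n \<subseteq> topspace (Euclidean_space n)" "open_unit_disc n \<subseteq> topspace (Euclidean_space n)"
 by (auto simp: open_unit_disc_def unit_disc_def)

lemma continuous_on_L2_set: "continuous_on S (\<lambda>x::rvec. L2_set x {..<n})"
 unfolding L2_set_def by (intro continuous_intros)

lemma compact_unit_disc: "compact (unit_disc n)"
proof -
 have "unit_disc n \<subseteq> {(\<lambda>i. -1)..(\<lambda>i. 1)}"
 proof
  fix x assume x: "x \<in> unit_disc n"
  have "\<bar>x i\<bar> <= 1" for i
  proof (cases "i < n")
   case True
   have "\<bar>x i\<bar> <= L2_set x {..<n}"
    using member_le_L2_set[of "{..<n}" i "\<lambda>i. \<bar>x i\<bar>"] True by (simp add: L2_set_def)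
   thus ?thesis using x by (simp add: unit_disc_iff)
  next
   case False
   thus ?thesis using x by (simp add: unit_disc_iff)
  qed
  hence "-1 <= x i \<and> x i <= 1" for i by (simp add: abs_le_iff minus_le_iff)
  thus "x \<in> {(\<lambda>i. -1)..(\<lambda>i. 1)}" by (simp add: le_fun_def)
 qed
 moreover have "closed (unit_disc n)"
 proof -
  have "unit_disc n = (\<Inter>i\<in>{n..}. {x. x i = 0}) \<inter> {x. L2_set x {..<n} <= 1}"
   by (auto simp: unit_disc_iff)
  moreover have "closed {x::rvec. x i = 0}" for i
   by (intro closed_Collect_eq continuous_intros)
  moreover have "closed {x::rvec. L2_set x {..<n} <= 1}"
   by (intro closed_Collect_le continuous_on_L2_set continuous_on_const)
  ultimately show ?thesis by (auto intro!: closed_Int closed_INT)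
 qed
 ultimately show ?thesis
  using compact_Int_closed[OF compact_box] by (metis inf.absorb2)
qed

text \<open>The radial map that rescales the Euclidean norm to the supremum norm.\<close>

lemma disc_cube_homeomorphism:
 "\<exists>\<kappa>. continuous_on (unit_disc n) \<kappa> \<and> inj_on \<kappa> (unit_disc n) \<and>
   \<kappa> ` open_unit_disc n = open_cube n \<and> \<kappa> ` disc_boundary n = cube_boundary n"
proof (cases "n = 0")
 case True
 have e: "unit_disc 0 = {\<lambda>_. 0}" "open_unit_disc 0 = {\<lambda>_. 0}" "disc_boundary 0 = {}" "open_cube 0 = {\<lambda>_. 0}" "cube_boundary 0 = {}"
  by (auto simp: unit_disc_iff open_unit_disc_iff disc_boundary_iff open_cube_def cube_boundary_def fun_eq_iff)
 show ?thesis unfolding True e by (intro exI[of _ id]) auto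
next
 case False
 define N where "N = (\<lambda>x::rvec. Max ((\<lambda>i. \<bar>x i\<bar>) ` {..<n}))"
 define E where "E = (\<lambda>x::rvec. L2_set x {..<n})"
 define V where "V = {x::rvec. \<forall>i\<ge>n. x i = 0}"
 have D: "finite {..<n}" "{..<n} ~= {}" using False by auto
 have Nge: "\<bar>x i\<bar> <= N x" if "i < n" for x i unfolding N_def using that D by (auto intro: Max_ge)
 have Nex: "\<exists>i<n. N x = \<bar>x i\<bar>" for x
 proof -
  have "N x \<in> (\<lambda>i. \<bar>x i\<bar>) ` {..<n}" unfolding N_def using D by (intro Max_in) auto
  thus ?thesis by auto
 qed
 have N0: "N x \<ge> 0" for x using Nge[of 0 x] False by (metis abs_ge_zero gr0I order_trans)
 have Nsc: "N (\<lambda>i. c * x i) = c * N x" if "c \<ge> 0" for c x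
 proof (rule antisym)
  obtain j where "j < n" "N (\<lambda>i. c * x i) = \<bar>c * x j\<bar>" using Nex[of "\<lambda>i. c * x i"] by blast
  thus "N (\<lambda>i. c * x i) <= c * N x"
   using mult_left_mono[OF Nge[of j x] that] that by (simp add: abs_mult)
  obtain i where "i < n" "N x = \<bar>x i\<bar>" using Nex by blast
  thus "c * N x <= N (\<lambda>i. c * x i)" using Nge[of i "\<lambda>i. c * x i"] that by (simp add: abs_mult)
 qed
 have E0: "E x \<ge> 0" for x by (simp add: E_def)
 have Esc: "E (\<lambda>i. c * x i) = c * E x" if "c \<ge> 0" for c x
  using L2_set_right_distrib[OF that, of x "{..<n}"] by (simp add: E_def)
 have zero: "x = (\<lambda>_. 0)" if "x \<in> V" "\<forall>i<n. x i = 0" for x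
 proof
  fix i show "x i = 0" using that by (cases "i < n") (auto simp: V_def)
 qed
 have Npos: "N x > 0" if "x \<in> V" "x ~= (\<lambda>_. 0)" for x
 proof -
  from zero[OF that(1)] that(2) obtain i where "i < n" "x i ~= 0" by blast
  thus ?thesis using Nge[of i x] by (metis abs_le_zero_iff linorder_not_le order_trans)
 qed
 have Epos: "E x > 0" if "x \<in> V" "x ~= (\<lambda>_. 0)" for x
 proof -
  from zero[OF that(1)] that(2) obtain i where i: "i < n" "x i ~= 0" by blast
  have "E x ~= 0" unfolding E_def using i by (subst L2_set_eq_0_iff) auto
  thus ?thesis using E0[of x] by simp
 qed
 have scV: "(\<lambda>i. c * x i) \<in> V" if "x \<in> V" for c x using that by (simp add: V_def)
 define s where "s = (\<lambda>x. E x / N x)"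
 define K where "K = (\<lambda>x. (\<lambda>i. s x * x i))"
 have s0: "s x \<ge> 0" for x using E0 N0 by (simp add: s_def)
 have KV: "K x \<in> V" if "x \<in> V" for x using scV[OF that] by (simp add: K_def)
 have NK: "N (K x) = E x" if "x \<in> V" for x
 proof (cases "x = (\<lambda>_. 0)")
  case True
  thus ?thesis using D by (simp add: K_def N_def E_def L2_set_def)
 next
  case F: False
  show ?thesis using Nsc[OF s0[of x], of x] Npos[OF that F] by (simp add: K_def s_def)
 qed
 have injK: "x = x'" if x: "x \<in> V" "x' \<in> V" and eq: "K x = K x'" for x x'
 proof (cases "x = (\<lambda>_. 0) \<or> x' = (\<lambda>_. 0)")
  case True
  have "E x = E x'" using NK[OF x(1)] NK[OF x(2)] eq by simp
  moreover have "E (\<lambda>_. 0) = 0" by (simp add: E_def L2_set_def)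
  ultimately show ?thesis using True Epos[OF x(1)] Epos[OF x(2)] by (metis less_irrefl)
 next
  case F: False
  have Ee: "E x = E x'" using NK[OF x(1)] NK[OF x(2)] eq by simp
  have "s x * E x = s x' * E x'" using Esc[OF s0[of x], of x] Esc[OF s0[of x'], of x'] eq by (simp add: K_def)
  hence "s x = s x'" using Ee Epos[OF x(1)] F by auto
  moreover have "s x > 0" using Epos[OF x(1)] Npos[OF x(1)] F by (simp add: s_def)
  moreover have "s x * x i = s x' * x' i" for i using fun_cong[OF eq, of i] by (simp add: K_def)
  ultimately show ?thesis by (intro ext) auto
 qed
 have surjK: "\<exists>x\<in>V. K x = w \<and> E x = N w" if w: "w \<in> V" for w
 proof (cases "w = (\<lambda>_. 0)")
  case True
  thus ?thesis using w D by (intro bexI[of _ w]) (auto simp: K_def N_def E_def L2_set_def)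
 next
  case F: False
  define c where "c = N w / E w"
  have c: "c > 0" using Npos[OF w F] Epos[OF w F] by (simp add: c_def)
  define x where "x = (\<lambda>i. c * w i)"
  have xV: "x \<in> V" unfolding x_def by (rule scV[OF w])
  have Ex: "E x = N w" using Esc[of c w] c Epos[OF w F] by (simp add: x_def c_def)
  have "N x = c * N w" using Nsc[of c w] c by (simp add: x_def)
  hence "s x * c = 1" using Ex c Npos[OF w F] by (simp add: s_def)
  hence "s x * x i = w i" for i by (simp add: x_def flip: mult.assoc)
  thus ?thesis using xV Ex by (intro bexI[of _ x]) (auto simp: K_def)
 qed
 have cN: "continuous_on S N" for S
  unfolding N_def by (rule continuous_on_Max_finite[OF D]) (intro continuous_intros)
 have cE: "continuous_on S E" for S unfolding E_def by (rule continuous_on_L2_set)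
 have Kb: "\<bar>K x i\<bar> <= E x" if "x \<in> V" for x i
  using Nge[of i "K x"] NK[OF that] KV[OF that] E0[of x] by (cases "i < n") (auto simp: V_def)
 \<comment> \<open>Away from 0 the factor is a quotient of two continuous norms. At 0, where it
   reads 0/0, continuity comes from the bound \<open>Kb\<close> by the Euclidean norm.\<close>
 have cK: "continuous_on V (\<lambda>x. K x i)" for i
  unfolding continuous_on_eq_continuous_within
 proof
  fix x assume x: "x \<in> V"
  show "continuous (at x within V) (\<lambda>x. K x i)"
  proof (cases "x = (\<lambda>_. 0)")
   case True
   have "(E \<longlongrightarrow> E x) (at x within V)" using cE[of V] x unfolding continuous_on_def by blast
   hence "(E \<longlongrightarrow> 0) (at x within V)" using True by (simp add: E_def L2_set_def)
   hence "((\<lambda>x. K x i) \<longlongrightarrow> 0) (at x within V)"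
    by (rule Lim_null_comparison[rotated]) (auto simp: eventually_at_filter Kb intro!: always_eventually)
   thus ?thesis using True by (simp add: continuous_within K_def)
  next
   case F: False
   have "N x ~= 0" using Npos[OF x F] by simp
   moreover have "continuous (at x within V) N" "continuous (at x within V) E" "continuous (at x within V) (\<lambda>x. x i)"
    using cN[of V] cE[of V] continuous_on_proj[of V i] x unfolding continuous_on_eq_continuous_within by blast+
   ultimately show ?thesis unfolding K_def s_def by (intro continuous_intros) auto
  qed
 qed
 define \<kappa> where "\<kappa> = (\<lambda>x i. if i < n then (1 + K x i) / 2 else 0)"
 have VD: "x \<in> unit_disc n \<longleftrightarrow> x \<in> V \<and> E x <= 1" "x \<in> open_unit_disc n \<longleftrightarrow> x \<in> V \<and> E x < 1"
  "x \<in> disc_boundary n \<longleftrightarrow> x \<in> V \<and> E x = 1" for x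
  by (simp_all add: unit_disc_iff open_unit_disc_iff disc_boundary_iff V_def E_def)
 have c\<kappa>: "continuous_on (unit_disc n) \<kappa>"
 proof (rule continuous_on_coordinatewise_then_product)
  fix i
  have "continuous_on V (\<lambda>x. \<kappa> x i)"
   by (cases "i < n") (auto simp: \<kappa>_def intro!: continuous_intros cK)
  thus "continuous_on (unit_disc n) (\<lambda>x. \<kappa> x i)"
   by (rule continuous_on_subset) (auto simp: VD)
 qed
 have KK: "K x = K x'" if "x \<in> V" "x' \<in> V" "\<kappa> x = \<kappa> x'" for x x'
 proof
  fix i show "K x i = K x' i"
  proof (cases "i < n")
   case True
   thus ?thesis using fun_cong[OF that(3), of i] by (simp add: \<kappa>_def)
  next
   case F: False
   thus ?thesis using KV[OF that(1)] KV[OF that(2)] by (simp add: V_def)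
  qed
 qed
 have inj: "inj_on \<kappa> (unit_disc n)"
  by (rule inj_onI) (use injK KK VD in blast)
 have \<kappa>o: "\<kappa> x \<in> open_cube n" if "x \<in> V" "E x < 1" for x
 proof -
  have "\<bar>K x i\<bar> < 1" for i using Kb[OF that(1), of i] that(2) by linarith
  hence b: "- 1 < K x i" "K x i < 1" for i by (metis abs_less_iff minus_less_iff)+
  have "0 < (1 + K x i) / 2 \<and> (1 + K x i) / 2 < 1" for i
   using b[of i] by (simp add: field_simps)
  thus ?thesis by (simp add: open_cube_def \<kappa>_def)
 qed
 have \<kappa>b: "\<kappa> x \<in> cube_boundary n" if "x \<in> V" "E x = 1" for x
 proof -
  have "\<bar>K x i\<bar> <= 1" for i using Kb[OF that(1), of i] that(2) by linarith
  hence b: "- 1 <= K x i" "K x i <= 1" for i by (metis abs_le_D2 abs_le_D1 minus_le_iff)+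
  have "0 <= (1 + K x i) / 2 \<and> (1 + K x i) / 2 <= 1" for i
   using b[of i] by (simp add: field_simps)
  moreover obtain i where i: "i < n" "N (K x) = \<bar>K x i\<bar>" using Nex by blast
  hence "\<bar>K x i\<bar> = 1" using NK[OF that(1)] that(2) by simp
  hence "(1 + K x i) / 2 = 0 \<or> (1 + K x i) / 2 = 1" by (auto simp: abs_if split: if_splits)
  ultimately show ?thesis using i(1) by (auto simp: cube_boundary_def cube_iff \<kappa>_def)
 qed
 have pre: "\<exists>x\<in>V. \<kappa> x = c \<and> E x = N (\<lambda>i. if i < n then 2 * c i - 1 else 0)" if "c \<in> cube n" for c
 proof -
  let ?w = "\<lambda>i. if i < n then 2 * c i - 1 else 0"
  have "?w \<in> V" by (simp add: V_def)
  from surjK[OF this] obtain x where x: "x \<in> V" "K x = ?w" "E x = N ?w" by blast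
  have "\<kappa> x = c" using that by (auto simp: \<kappa>_def x(2) cube_iff fun_eq_iff)
  thus ?thesis using x by blast
 qed
 have "\<kappa> ` open_unit_disc n = open_cube n"
 proof (intro equalityI subsetI)
  fix c assume c: "c \<in> open_cube n"
  then obtain x where x: "x \<in> V" "\<kappa> x = c" "E x = N (\<lambda>i. if i < n then 2 * c i - 1 else 0)"
   using pre open_cube_subset by blast
  obtain i where "i < n" "N (\<lambda>i. if i < n then 2 * c i - 1 else 0) = \<bar>2 * c i - 1\<bar>"
   using Nex[of "\<lambda>i. if i < n then 2 * c i - 1 else 0"] by auto
  hence "E x < 1" using c x(3) by (auto simp: open_cube_def abs_less_iff)
  thus "c \<in> \<kappa> ` open_unit_disc n" using x VD by blast
 qed (use \<kappa>o VD in blast)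
 moreover have "\<kappa> ` disc_boundary n = cube_boundary n"
 proof (intro equalityI subsetI)
  fix c assume c: "c \<in> cube_boundary n"
  hence cc: "c \<in> cube n" using cube_boundary_subset by blast
  then obtain x where x: "x \<in> V" "\<kappa> x = c" "E x = N (\<lambda>i. if i < n then 2 * c i - 1 else 0)"
   using pre by blast
  let ?w = "\<lambda>i. if i < n then 2 * c i - 1 else 0"
  obtain j where "j < n" "N ?w = \<bar>2 * c j - 1\<bar>" using Nex[of ?w] by auto
  moreover have "0 <= c j" "c j <= 1" using cc by (auto simp: cube_iff)
  ultimately have "E x <= 1" using x(3) by (simp add: abs_le_iff)
  obtain i where i: "i < n" "c i = 0 \<or> c i = 1" using c by (auto simp: cube_boundary_def)
  hence "1 <= E x" using Nge[of i ?w] x(3) by auto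
  with \<open>E x <= 1\<close> show "c \<in> \<kappa> ` disc_boundary n" using x VD by force
 qed (use \<kappa>b VD in blast)
 ultimately show ?thesis using c\<kappa> inj by blast
qed

lemma quotient_topology_exists: "\<exists>X. quotient_map Y X p"
proof -
 let ?P = "\<lambda>U. U \<subseteq> p ` topspace Y \<and> openin Y {y \<in> topspace Y. p y \<in> U}"
 have "istopology ?P"
  unfolding istopology_def
 proof (intro conjI allI impI)
  fix S T assume "?P S" "?P T"
  moreover have "{y \<in> topspace Y. p y \<in> S \<inter> T} = {y \<in> topspace Y. p y \<in> S} \<inter> {y \<in> topspace Y. p y \<in> T}" by blast
  ultimately show "S \<inter> T \<subseteq> p ` topspace Y" "openin Y {y \<in> topspace Y. p y \<in> S \<inter> T}" by auto
 next
  fix \<K> assume K: "\<forall>K\<in>\<K>. ?P K"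
  thus "\<Union>\<K> \<subseteq> p ` topspace Y" by blast
  have "{y \<in> topspace Y. p y \<in> \<Union>\<K>} = (\<Union>K\<in>\<K>. {y \<in> topspace Y. p y \<in> K})" by blast
  thus "openin Y {y \<in> topspace Y. p y \<in> \<Union>\<K>}" using K by auto
 qed
 define T where "T = topology ?P"
 have op: "openin T U \<longleftrightarrow> ?P U" for U
  unfolding T_def using fun_cong[OF topology_inverse'[OF \<open>istopology ?P\<close>], of U] .
 have "?P (p ` topspace Y)"
 proof
  have "{y \<in> topspace Y. p y \<in> p ` topspace Y} = topspace Y" by blast
  thus "openin Y {y \<in> topspace Y. p y \<in> p ` topspace Y}" by simp
 qed simp
 hence "openin T (p ` topspace Y)" using op by blast
 hence "p ` topspace Y \<subseteq> topspace T" by (rule openin_subset)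
 moreover have "topspace T \<subseteq> p ` topspace Y" using op[of "topspace T"] by simp
 ultimately have "p ` topspace Y = topspace T" by (rule equalityI)
 hence "quotient_map Y T p"
  using op by (simp add: quotient_map_def)
 thus ?thesis by blast
qed

text \<open>An equivariant cell structure in coordinates: each point knows its open cell and its
  position in the open cube. Freeness is required on cells, so no element maps a cell to itself by a
  nontrivial symmetry and every cell embeds in the quotient. \<open>base\<close> merely supplies the
  list component of the points of the quotient.\<close>

locale cell_structure = group G
 for G :: "('g, 'e) monoid_scheme" (structure) +
 fixes Y :: "'y topology" and act :: "'g => 'y => 'y"
  and C :: "'c set" and dm :: "'c => nat" and \<Phi> :: "'c => rvec => 'y"
  and cellof :: "'y => 'c" and coord :: "'y => rvec" and actc :: "'g => 'c => 'c"
  and base :: "'z list"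
 assumes act_cont: "g \<in> carrier G ==> continuous_map Y Y (act g)"
  and act_one: "y \<in> topspace Y ==> act \<one> y = y"
  and act_mult: "g \<in> carrier G ==> h \<in> carrier G ==> y \<in> topspace Y ==> act (g \<otimes> h) y = act g (act h y)"
  and PD: "y \<in> topspace Y ==> y' \<in> topspace Y ==> \<exists>U U'. openin Y U \<and> openin Y U' \<and> y \<in> U \<and> y' \<in> U' \<and>
    (\<forall>g\<in>carrier G. \<forall>z\<in>U'. act g z \<in> U --> act g y' = y)"
  and \<Phi>_cont: "e \<in> C ==> cmap (cube (dm e)) Y (\<Phi> e)"
  and cellof: "y \<in> topspace Y ==> cellof y \<in> C \<and> coord y \<in> open_cube (dm (cellof y)) \<and> \<Phi> (cellof y) (coord y) = y"
  and cell_\<Phi>: "e \<in> C ==> c \<in> open_cube (dm e) ==> cellof (\<Phi> e c) = e \<and> coord (\<Phi> e c) = c"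
  and cell_finite: "e \<in> C ==> finite (cellof ` \<Phi> e ` cube (dm e))"
  and cell_boundary: "e \<in> C ==> c \<in> cube_boundary (dm e) ==> dm (cellof (\<Phi> e c)) < dm e"
  and actc: "g \<in> carrier G ==> e \<in> C ==> actc g e \<in> C \<and> dm (actc g e) = dm e"
  and actc_cellof: "g \<in> carrier G ==> y \<in> topspace Y ==> cellof (act g y) = actc g (cellof y)"
  and actc_mult: "g \<in> carrier G ==> h \<in> carrier G ==> e \<in> C ==> actc (g \<otimes> h) e = actc g (actc h e)"
  and actc_free: "g \<in> carrier G ==> e \<in> C ==> actc g e = e ==> g = \<one>"
  and closed_test: "A \<subseteq> topspace Y ==> (\<And>e. e \<in> C ==> closed {c \<in> cube (dm e). \<Phi> e c \<in> A}) ==> closedin Y A"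
  and countable_C: "countable C"
begin

lemma act_top: "g \<in> carrier G ==> y \<in> topspace Y ==> act g y \<in> topspace Y"
 using act_cont[of g] continuous_map_image_subset_topspace by fastforce

lemma act_inv': "g \<in> carrier G ==> y \<in> topspace Y ==> act (inv g) (act g y) = y"
 using act_mult[of "inv g" g y] act_one by simp

lemma actc_one: "e \<in> C ==> actc \<one> e = e"
proof -
 assume e: "e \<in> C"
 define c where "c = (\<lambda>i. if i < dm e then 1/2 else 0 :: real)"
 have c: "c \<in> open_cube (dm e)" by (simp add: open_cube_def c_def)
 hence y: "\<Phi> e c \<in> topspace Y" using cmap_in[OF \<Phi>_cont[OF e]] open_cube_subset by blast
 thus "actc \<one> e = e" using actc_cellof[of \<one>, OF _ y] act_one[OF y] cell_\<Phi>[OF e c] by simp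
qed

definition same_orbit where "same_orbit e e' \<longleftrightarrow> (\<exists>g\<in>carrier G. e' = actc g e)"

definition rep where "rep e = (SOME e'. same_orbit e e')"

lemma same_orbit_act: "e \<in> C ==> g \<in> carrier G ==> same_orbit (actc g e) e' = same_orbit e e'"
proof -
 assume e: "e \<in> C" "g \<in> carrier G"
 have "e' = actc (h \<otimes> inv g) (actc g e)" if "h \<in> carrier G" "e' = actc h e" for h
 proof -
  have "actc (h \<otimes> inv g) (actc g e) = actc (h \<otimes> inv g \<otimes> g) e"
   using e that(1) by (subst actc_mult) auto
  also have "h \<otimes> inv g \<otimes> g = h" using e that(1) by (simp add: m_assoc)
  finally show ?thesis using that by simp
 qed
 moreover have "e' = actc (h \<otimes> g) e" if "h \<in> carrier G" "e' = actc h (actc g e)" for h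
  using e that by (simp add: actc_mult)
 ultimately show ?thesis unfolding same_orbit_def using e(2) by (metis inv_closed m_closed)
qed

lemma rep_act:
 assumes "e \<in> C" "g \<in> carrier G"
 shows "rep (actc g e) = rep e"
proof -
 have "same_orbit (actc g e) = same_orbit e" using same_orbit_act[OF assms] by blast
 thus ?thesis by (simp add: rep_def)
qed

lemma rep_orbit: "e \<in> C ==> \<exists>g\<in>carrier G. rep e = actc g e"
proof -
 assume "e \<in> C"
 hence "same_orbit e e" unfolding same_orbit_def using actc_one by (metis one_closed)
 hence "same_orbit e (rep e)" unfolding rep_def by (rule someI)
 thus ?thesis by (simp add: same_orbit_def)
qed

lemma rep_C: "e \<in> C ==> rep e \<in> C \<and> dm (rep e) = dm e"
 using rep_orbit actc by metis

lemma rep_rep: "e \<in> C ==> rep (rep e) = rep e"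
proof -
 assume e: "e \<in> C"
 from rep_orbit[OF e] obtain g where g: "g \<in> carrier G" "rep e = actc g e" by blast
 have "rep (rep e) = rep (actc g e)" by (rule arg_cong[OF g(2)])
 thus ?thesis using rep_act[OF e g(1)] by (rule trans)
qed

text \<open>By freeness on cells only one group element moves the cell of \<open>y\<close> to its
  representative. Hence the choice is no choice, and \<open>nrm\<close> selects exactly one point of
  each orbit.\<close>

definition nrm where "nrm y = act (SOME g. g \<in> carrier G \<and> rep (cellof y) = actc g (cellof y)) y"

lemma nrm:
 assumes "y \<in> topspace Y" "g \<in> carrier G" "rep (cellof y) = actc g (cellof y)"
 shows "nrm y = act g y"
proof -
 have e: "cellof y \<in> C" using cellof assms(1) by blast
 have "(SOME g. g \<in> carrier G \<and> rep (cellof y) = actc g (cellof y)) = g"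
 proof (rule some_equality)
  show "g \<in> carrier G \<and> rep (cellof y) = actc g (cellof y)" using assms by simp
  fix h assume h: "h \<in> carrier G \<and> rep (cellof y) = actc h (cellof y)"
  have "actc (inv g \<otimes> h) (cellof y) = actc (inv g) (actc g (cellof y))"
   using h assms e by (simp add: actc_mult)
  also have "\<dots> = actc (inv g \<otimes> g) (cellof y)" using assms(2) e by (subst actc_mult) auto
  also have "\<dots> = cellof y" using assms(2) e actc_one by simp
  finally have "inv g \<otimes> h = \<one>" using actc_free[of "inv g \<otimes> h"] h assms(2) e by simp
  thus "h = g" using h assms(2) by (metis inv_closed inv_equality inv_inv)
 qed
 thus ?thesis by (simp add: nrm_def)
qed

lemma nrm_ex: "y \<in> topspace Y ==> \<exists>g\<in>carrier G. nrm y = act g y \<and> rep (cellof y) = actc g (cellof y)"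
 using rep_orbit[of "cellof y"] nrm cellof by blast

lemma nrm_cell: "y \<in> topspace Y ==> nrm y \<in> topspace Y \<and> cellof (nrm y) = rep (cellof y)"
 using nrm_ex act_top actc_cellof by metis

lemma nrm_act: "y \<in> topspace Y ==> g \<in> carrier G ==> nrm (act g y) = nrm y"
proof -
 assume y: "y \<in> topspace Y" and g: "g \<in> carrier G"
 obtain h where h: "h \<in> carrier G" "nrm y = act h y" "rep (cellof y) = actc h (cellof y)" using nrm_ex[OF y] by blast
 have e: "cellof y \<in> C" using cellof y by blast
 have "actc (h \<otimes> inv g) (actc g (cellof y)) = actc (h \<otimes> inv g \<otimes> g) (cellof y)"
  using e g h(1) by (subst actc_mult) auto
 also have hg: "h \<otimes> inv g \<otimes> g = h" using g h(1) by (simp add: m_assoc)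
 finally have "rep (cellof (act g y)) = actc (h \<otimes> inv g) (cellof (act g y))"
  using h(3) g e y by (simp add: actc_cellof rep_act)
 hence "nrm (act g y) = act (h \<otimes> inv g) (act g y)"
  using nrm[OF act_top[OF g y], of "h \<otimes> inv g"] g h(1) by simp
 also have "\<dots> = act (h \<otimes> inv g \<otimes> g) y" using act_mult[of "h \<otimes> inv g" g y] g h(1) y by simp
 finally show ?thesis using h(2) hg by simp
qed

text \<open>The points of a complex in \<open>type_F\<close> are pairs of a list and a real
  sequence. Coordinate 0 stores the number of the cell, which is faithful by countability, and the
  cube coordinates are shifted by one.\<close>

definition point where
 "point e c = (base, \<lambda>i. case i of 0 => real (to_nat_on C e) | Suc j => c j)"

lemma point_inj: "e \<in> C ==> e' \<in> C ==> point e c = point e' c' ==> e = e' \<and> c = c'"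
proof -
 assume e: "e \<in> C" "e' \<in> C" and eq: "point e c = point e' c'"
 hence f: "(case i of 0 => real (to_nat_on C e) | Suc j => c j) = (case i of 0 => real (to_nat_on C e') | Suc j => c' j)" for i
  unfolding point_def prod.inject by (metis (no_types))
 have "to_nat_on C e = to_nat_on C e'" using f[of 0] by simp
 hence "e = e'" using e countable_C by (meson inj_on_eq_iff inj_on_to_nat_on)
 moreover have "c j = c' j" for j using f[of "Suc j"] by simp
 ultimately show ?thesis by auto
qed

definition pr where
 "pr y = point (cellof (nrm y)) (coord (nrm y))"

lemma pr_fib:
 assumes y: "y \<in> topspace Y" "y' \<in> topspace Y"
 shows "pr y = pr y' \<longleftrightarrow> (\<exists>g\<in>carrier G. y' = act g y)"
proof
 assume eq: "pr y = pr y'"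
 have t: "nrm y \<in> topspace Y" "nrm y' \<in> topspace Y" using nrm_cell y by auto
 hence "cellof (nrm y) = cellof (nrm y') \<and> coord (nrm y) = coord (nrm y')"
  using point_inj[of "cellof (nrm y)" "cellof (nrm y')"] eq cellof unfolding pr_def by blast
 hence "nrm y = nrm y'" using cellof t by metis
 moreover obtain g where g: "g \<in> carrier G" "nrm y = act g y" using nrm_ex y by blast
 moreover obtain h where h: "h \<in> carrier G" "nrm y' = act h y'" using nrm_ex y by blast
 ultimately have "y' = act (inv h) (act g y)" using act_inv' y by metis
 hence "y' = act (inv h \<otimes> g) y" using act_mult g h y by simp
 thus "\<exists>g\<in>carrier G. y' = act g y" using g h by blast
next
 assume "\<exists>g\<in>carrier G. y' = act g y"
 thus "pr y = pr y'" using nrm_act y by (auto simp: pr_def)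
qed

lemma pr_\<Phi>: "e \<in> C ==> rep e = e ==> c \<in> open_cube (dm e) ==> pr (\<Phi> e c) = point e c"
proof -
 assume e: "e \<in> C" "rep e = e" and c: "c \<in> open_cube (dm e)"
 have y: "\<Phi> e c \<in> topspace Y" using cmap_in[OF \<Phi>_cont[OF e(1)]] open_cube_subset c by blast
 have "nrm (\<Phi> e c) = act \<one> (\<Phi> e c)"
  by (rule nrm[OF y]) (use cell_\<Phi>[OF e(1) c] e actc_one in auto)
 thus ?thesis using act_one[OF y] cell_\<Phi>[OF e(1) c] by (simp add: pr_def)
qed

theorem CW_quotient:
 assumes S: "finite S" "\<And>e. e \<in> C ==> dm e <= n ==> \<exists>g\<in>carrier G. actc g e \<in> S"
 shows "\<exists>X CC. CW_complex X CC \<and> finite_skeleton n CC \<and> free_action G Y X pr act"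
proof -
 obtain X where X: "quotient_map Y X pr" using quotient_topology_exists by blast
 interpret fa: free_action G Y X pr act
 proof unfold_locales
  show "g = \<one>" if "g \<in> carrier G" "y \<in> topspace Y" "act g y = y" for g y
   using actc_free[of g "cellof y"] actc_cellof[OF that(1,2)] that cellof by auto
 qed (fact act_cont act_one act_mult PD X pr_fib)+
 have "\<forall>k. \<exists>\<kappa>. continuous_on (unit_disc k) \<kappa> \<and> inj_on \<kappa> (unit_disc k) \<and>
   \<kappa> ` open_unit_disc k = open_cube k \<and> \<kappa> ` disc_boundary k = cube_boundary k"
  using disc_cube_homeomorphism by blast
 then obtain \<kappa> where \<kappa>: "\<And>k. continuous_on (unit_disc k) (\<kappa> k)" "\<And>k. inj_on (\<kappa> k) (unit_disc k)"
   "\<And>k. \<kappa> k ` open_unit_disc k = open_cube k" "\<And>k. \<kappa> k ` disc_boundary k = cube_boundary k"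
  by metis
 have \<kappa>d: "\<kappa> k ` unit_disc k = cube k" for k
  unfolding unit_disc_subset(3)[of k] image_Un \<kappa> using cube_boundary_subset[of k] by (auto simp: open_cube_eq)
 define R where "R = {e \<in> C. rep e = e}"
 define \<Psi> where "\<Psi> = (\<lambda>e x. pr (\<Phi> e (\<kappa> (dm e) x)))"
 define CC where "CC = (\<lambda>k. \<Psi> ` {e \<in> R. dm e = k})"
 have repR: "rep e \<in> R" if "e \<in> C" for e using rep_C[OF that] rep_rep[OF that] by (simp add: R_def)
 have cubeY: "\<Phi> e c \<in> topspace Y" if "e \<in> C" "c \<in> cube (dm e)" for e c
  using cmap_in[OF \<Phi>_cont[OF that(1)] that(2)] .
 have cp: "cmap (cube (dm e)) X (\<lambda>c. pr (\<Phi> e c))" if "e \<in> C" for e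
  by (rule cmap_continuous[OF \<Phi>_cont[OF that] fa.p_cont])
 have c\<Psi>: "cmap (unit_disc (dm e)) X (\<Psi> e)" if "e \<in> C" for e
  unfolding \<Psi>_def by (rule cmap_compose[OF cp[OF that] \<kappa>(1)]) (simp add: \<kappa>d)
 have \<Psi>pt: "\<Psi> e x = point e (\<kappa> (dm e) x)" if "e \<in> R" "x \<in> open_unit_disc (dm e)" for e x
  using pr_\<Phi>[of e "\<kappa> (dm e) x"] that \<kappa>(3)[of "dm e"] by (auto simp: \<Psi>_def R_def)
 have \<Psi>img: "\<Psi> e ` open_unit_disc (dm e) = point e ` open_cube (dm e)" if "e \<in> R" for e
  using \<Psi>pt[OF that] \<kappa>(3)[of "dm e"] by (metis (no_types, lifting) image_cong image_image)
 have prpt: "pr y = point (rep (cellof y)) (coord (nrm y)) \<and> coord (nrm y) \<in> open_cube (dm (rep (cellof y))) \<and> rep (cellof y) \<in> R"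
  if "y \<in> topspace Y" for y
  using nrm_cell[OF that] cellof[of "nrm y"] repR cellof[OF that] by (auto simp: pr_def)
 have clX: "closedin X (\<Psi> e ` unit_disc (dm e))" if "e \<in> C" for e
  using compactin_imp_closedin[OF fa.Hausdorff_X image_compactin[OF _ c\<Psi>[OF that]]] compact_unit_disc
  by (simp add: compactin_subtopology)
 have emb: "embedding_map (top_of_set (open_unit_disc (dm e))) X (\<Psi> e)" if e: "e \<in> R" for e
  unfolding embedding_map_def
 proof (rule bijective_open_imp_homeomorphic_map)
  let ?D = "open_unit_disc (dm e)"
  have eC: "e \<in> C" using e by (simp add: R_def)
  have sub: "?D \<subseteq> unit_disc (dm e)" by (rule unit_disc_subset)
  have cD: "cmap ?D X (\<Psi> e)" by (rule cmap_subset[OF c\<Psi>[OF eC] sub])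
  thus "cmap ?D (subtopology X (\<Psi> e ` topspace (top_of_set ?D))) (\<Psi> e)"
   by (simp add: continuous_map_in_subtopology)
  show "\<Psi> e ` topspace (top_of_set ?D) = topspace (subtopology X (\<Psi> e ` topspace (top_of_set ?D)))"
   using cmap_in[OF cD] by auto
  show inj: "inj_on (\<Psi> e) (topspace (top_of_set ?D))"
  proof (rule inj_onI)
   fix x x' assume x: "x \<in> topspace (top_of_set ?D)" "x' \<in> topspace (top_of_set ?D)" "\<Psi> e x = \<Psi> e x'"
   hence "\<kappa> (dm e) x = \<kappa> (dm e) x'" using \<Psi>pt[OF e] point_inj[OF eC eC] by auto
   thus "x = x'" using \<kappa>(2)[of "dm e"] x sub by (auto dest: inj_onD)
  qed
  show "open_map (top_of_set ?D) (subtopology X (\<Psi> e ` topspace (top_of_set ?D))) (\<Psi> e)"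
   unfolding open_map_def
  proof (intro allI impI)
   fix U assume U: "openin (top_of_set ?D) U"
   hence UD: "U \<subseteq> ?D" using openin_imp_subset by blast
   obtain W where W: "open W" "U = ?D \<inter> W" using U by (auto simp: openin_open)
   \<comment> \<open>The image of an open set is the open cell minus the image of the compact rest
     of the disc. No point of the boundary can spoil this: it lands in a cell of smaller dimension,
     and passing to representatives preserves dimensions.\<close>
   let ?K = "unit_disc (dm e) - (W \<inter> ?D)"
   have Dopen: "?D = unit_disc (dm e) - disc_boundary (dm e)"
    by (auto simp: open_unit_disc_def unit_disc_def disc_boundary_def)
   have clB: "closed (disc_boundary (dm e))"
   proof -
    have "disc_boundary (dm e) = unit_disc (dm e) \<inter> {x. L2_set x {..<dm e} = 1}"
     by (auto simp: disc_boundary_iff unit_disc_iff)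
    moreover have "closed {x::rvec. L2_set x {..<dm e} = 1}"
     by (intro closed_Collect_eq continuous_on_L2_set continuous_on_const)
    ultimately show ?thesis using compact_imp_closed[OF compact_unit_disc[of "dm e"]] by auto
   qed
   have "?K = (unit_disc (dm e) \<inter> - W) \<union> disc_boundary (dm e)"
    unfolding Dopen using unit_disc_subset(2) by blast
   hence "closed ?K" using W(1) clB compact_imp_closed[OF compact_unit_disc] by (simp add: closed_Compl closed_Int closed_Un)
   hence "compact ?K" using compact_Int_closed[OF compact_unit_disc[of "dm e"], of ?K]
    by (simp add: Int_absorb1)
   hence cl: "closedin X (\<Psi> e ` ?K)"
    using compactin_imp_closedin[OF fa.Hausdorff_X image_compactin[OF _ c\<Psi>[OF eC]]]
    by (simp add: compactin_subtopology)
   have "\<Psi> e ` U = \<Psi> e ` ?D \<inter> (topspace X - \<Psi> e ` ?K)"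
   proof (intro equalityI subsetI)
    fix v assume "v \<in> \<Psi> e ` U"
    then obtain x where x: "x \<in> U" "v = \<Psi> e x" by blast
    have "v \<notin> \<Psi> e ` ?K"
    proof
     assume "v \<in> \<Psi> e ` ?K"
     then obtain x' where x'0: "v = \<Psi> e x'" "x' \<in> ?K" by (rule imageE)
     have x': "x' \<in> ?K" "\<Psi> e x = \<Psi> e x'" using x'0 x(2) by simp_all
     show False
     proof (cases "x' \<in> ?D")
      case True
      hence "x = x'" using inj x'(2) x(1) UD by (auto dest: inj_onD)
      thus False using x'(1) x(1) W(2) by simp
     next
      case False
      hence "x' \<in> disc_boundary (dm e)" using x'(1) unit_disc_subset(3)[of "dm e"] by simp
      hence "\<kappa> (dm e) x' \<in> cube_boundary (dm e)" using \<kappa>(4) by blast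
      hence c: "dm (cellof (\<Phi> e (\<kappa> (dm e) x'))) < dm e" "\<kappa> (dm e) x' \<in> cube (dm e)"
       using cell_boundary[OF eC] cube_boundary_subset by blast+
      let ?y = "\<Phi> e (\<kappa> (dm e) x')"
      note q = prpt[OF cubeY[OF eC c(2)]]
      have "x \<in> ?D" using x(1) UD by blast
      hence "point e (\<kappa> (dm e) x) = pr ?y" using \<Psi>pt[OF e] x'(2) by (metis \<Psi>_def)
      hence "point e (\<kappa> (dm e) x) = point (rep (cellof ?y)) (coord (nrm ?y))" using q by metis
      moreover have "rep (cellof ?y) \<in> C" using q by (simp add: R_def)
      ultimately have "rep (cellof ?y) = e" using point_inj[OF eC, of "rep (cellof ?y)"] by metis
      thus False using rep_C[of "cellof ?y"] cellof[OF cubeY[OF eC c(2)]] c(1) by auto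
     qed
    qed
    thus "v \<in> \<Psi> e ` ?D \<inter> (topspace X - \<Psi> e ` ?K)" using x UD cmap_in[OF cD] by blast
   next
    fix v assume "v \<in> \<Psi> e ` ?D \<inter> (topspace X - \<Psi> e ` ?K)"
    then obtain x where x: "x \<in> ?D" "v = \<Psi> e x" "v \<notin> \<Psi> e ` ?K" by blast
    hence "x \<in> W" using sub by blast
    thus "v \<in> \<Psi> e ` U" using x W(2) by blast
   qed
   moreover have "openin X (topspace X - \<Psi> e ` ?K)" using cl by (simp add: closedin_def)
   ultimately show "openin (subtopology X (\<Psi> e ` topspace (top_of_set ?D))) (\<Psi> e ` U)"
    by (simp add: openin_subtopology_Int2)
  qed
 qed
 have "CW_complex X CC"
  unfolding CW_complex_def
 proof (intro conjI allI ballI impI)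
  show "Hausdorff_space X" by (rule fa.Hausdorff_X)
  show "continuous_map (subtopology (Euclidean_space k) (unit_disc k)) X f" if "f \<in> CC k" for k f
   using that c\<Psi> by (auto simp: CC_def R_def subtopology_Euclidean_space[OF unit_disc_topspace(1)])
  show "embedding_map (subtopology (Euclidean_space k) (open_unit_disc k)) X f" if "f \<in> CC k" for k f
   using that emb by (auto simp: CC_def subtopology_Euclidean_space[OF unit_disc_topspace(2)])
  show "disjoint_family_on (\<lambda>(k, f). f ` open_unit_disc k) (SIGMA k:UNIV. CC k)"
   unfolding disjoint_family_on_def
  proof (intro ballI impI)
   fix a b assume a: "a \<in> (SIGMA k:UNIV. CC k)" and b: "b \<in> (SIGMA k:UNIV. CC k)" and ne: "a ~= b"
   obtain e where e: "e \<in> R" "a = (dm e, \<Psi> e)" using a by (auto simp: CC_def)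
   obtain e' where e': "e' \<in> R" "b = (dm e', \<Psi> e')" using b by (auto simp: CC_def)
   have "e ~= e'" using ne e e' by auto
   hence "point e c ~= point e' c'" for c c'
    using point_inj[of e e' c c'] e e' unfolding R_def by blast
   hence "point e ` open_cube (dm e) \<inter> point e' ` open_cube (dm e') = {}" by blast
   thus "(case a of (k, f) => f ` open_unit_disc k) \<inter> (case b of (k, f) => f ` open_unit_disc k) = {}"
    using \<Psi>img e e' by simp
  qed
  show "(\<Union>(k, f)\<in>(SIGMA k:UNIV. CC k). f ` open_unit_disc k) = topspace X"
  proof (intro equalityI subsetI)
   fix x assume "x \<in> (\<Union>(k, f)\<in>(SIGMA k:UNIV. CC k). f ` open_unit_disc k)"
   then obtain e where e: "e \<in> R" "x \<in> \<Psi> e ` open_unit_disc (dm e)" by (auto simp: CC_def)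
   thus "x \<in> topspace X"
    using cmap_in[OF c\<Psi>[of e]] unit_disc_subset(1)[of "dm e"] by (auto simp: R_def)
  next
   fix x assume "x \<in> topspace X"
   then obtain y where y: "y \<in> topspace Y" "x = pr y" using fa.p_surj by blast
   hence "x \<in> \<Psi> (rep (cellof y)) ` open_unit_disc (dm (rep (cellof y)))"
    using prpt[OF y(1)] \<Psi>img by blast
   thus "x \<in> (\<Union>(k, f)\<in>(SIGMA k:UNIV. CC k). f ` open_unit_disc k)"
    using prpt[OF y(1)] by (auto simp: CC_def)
  qed
  fix k f assume f: "f \<in> CC k"
  then obtain e where e: "e \<in> R" "k = dm e" "f = \<Psi> e" by (auto simp: CC_def)
  have eC: "e \<in> C" using e by (simp add: R_def)
  let ?K = "cellof ` \<Phi> e ` cube_boundary (dm e)"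
  let ?F = "(\<lambda>e'. (dm e', \<Psi> e')) ` rep ` ?K"
  have KC: "e' \<in> C" "dm e' < dm e" if "e' \<in> ?K" for e'
  proof -
   from that obtain c where c: "c \<in> cube_boundary (dm e)" "e' = cellof (\<Phi> e c)" by blast
   hence "c \<in> cube (dm e)" using cube_boundary_subset by blast
   thus "e' \<in> C" using cellof[OF cubeY[OF eC]] c by simp
   show "dm e' < dm e" using cell_boundary[OF eC c(1)] c(2) by simp
  qed
  show "\<exists>F. finite F \<and> F \<subseteq> (SIGMA m:{..<k}. CC m) \<and> f ` disc_boundary k \<subseteq> (\<Union>(m, g)\<in>F. g ` open_unit_disc m)"
  proof (intro exI[of _ ?F] conjI)
   have "?K \<subseteq> cellof ` \<Phi> e ` cube (dm e)" using cube_boundary_subset by blast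
   thus "finite ?F" using finite_subset[OF _ cell_finite[OF eC]] by blast
   show "?F \<subseteq> (SIGMA m:{..<k}. CC m)"
   proof
    fix a assume "a \<in> ?F"
    then obtain e' where e': "e' \<in> ?K" "a = (dm (rep e'), \<Psi> (rep e'))" by blast
    thus "a \<in> (SIGMA m:{..<k}. CC m)"
     using KC[OF e'(1)] rep_C[of e'] repR[of e'] e(2) by (auto simp: CC_def)
   qed
   show "f ` disc_boundary k \<subseteq> (\<Union>(m, g)\<in>?F. g ` open_unit_disc m)"
   proof
    fix v assume "v \<in> f ` disc_boundary k"
    then obtain x where x: "x \<in> disc_boundary (dm e)" "v = \<Psi> e x" using e by blast
    define c where "c = \<kappa> (dm e) x"
    have c: "c \<in> cube_boundary (dm e)" "v = pr (\<Phi> e c)" using x \<kappa>(4) by (auto simp: c_def \<Psi>_def)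
    let ?y = "\<Phi> e c"
    have "c \<in> cube (dm e)" using c cube_boundary_subset by blast
    hence "v \<in> \<Psi> (rep (cellof ?y)) ` open_unit_disc (dm (rep (cellof ?y)))"
     using prpt[OF cubeY[OF eC]] \<Psi>img c(2) by blast
    moreover have "(dm (rep (cellof ?y)), \<Psi> (rep (cellof ?y))) \<in> ?F" using c(1) by blast
    ultimately show "v \<in> (\<Union>(m, g)\<in>?F. g ` open_unit_disc m)" by blast
   qed
  qed
 next
  fix A assume A: "A \<subseteq> topspace X"
  show "closedin X A \<longleftrightarrow> (\<forall>k. \<forall>f\<in>CC k. closedin X (A \<inter> f ` unit_disc k))"
  proof
   assume "closedin X A"
   thus "\<forall>k. \<forall>f\<in>CC k. closedin X (A \<inter> f ` unit_disc k)"
    using clX by (auto simp: CC_def R_def)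
  next
   assume "\<forall>k. \<forall>f\<in>CC k. closedin X (A \<inter> f ` unit_disc k)"
   hence cl: "closedin X (A \<inter> \<Psi> e ` unit_disc (dm e))" if "e \<in> R" for e using that by (auto simp: CC_def)
   have "closedin Y {y \<in> topspace Y. pr y \<in> A}"
   proof (rule closed_test)
    fix e assume eC: "e \<in> C"
    \<comment> \<open>One cube meets finitely many cells, so on this cube membership in
      \<open>A\<close> can be tested against finitely many closed pieces of the quotient.\<close>
    let ?K = "rep ` cellof ` \<Phi> e ` cube (dm e)"
    let ?B = "\<Union>e'\<in>?K. A \<inter> \<Psi> e' ` unit_disc (dm e')"
    have KR: "?K \<subseteq> R" using repR cellof cubeY[OF eC] by blast
    have "closedin X ?B"
    proof (rule closedin_Union)
     show "finite ((\<lambda>e'. A \<inter> \<Psi> e' ` unit_disc (dm e')) ` ?K)" using cell_finite[OF eC] by simp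
     show "closedin X K" if "K \<in> (\<lambda>e'. A \<inter> \<Psi> e' ` unit_disc (dm e')) ` ?K" for K
      using that cl KR by blast
    qed
    hence "closedin (top_of_set (cube (dm e))) {c \<in> cube (dm e). pr (\<Phi> e c) \<in> ?B}"
     using closedin_continuous_map_preimage[OF cp[OF eC]] by fastforce
    moreover have "{c \<in> cube (dm e). pr (\<Phi> e c) \<in> ?B} = {c \<in> cube (dm e). \<Phi> e c \<in> {y \<in> topspace Y. pr y \<in> A}}"
    proof (intro equalityI subsetI)
     fix c assume "c \<in> {c \<in> cube (dm e). \<Phi> e c \<in> {y \<in> topspace Y. pr y \<in> A}}"
     hence c: "c \<in> cube (dm e)" "pr (\<Phi> e c) \<in> A" by auto
     let ?e = "rep (cellof (\<Phi> e c))"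
     have "pr (\<Phi> e c) \<in> \<Psi> ?e ` open_unit_disc (dm ?e)"
      using prpt[OF cubeY[OF eC c(1)]] \<Psi>img by blast
     hence "pr (\<Phi> e c) \<in> A \<inter> \<Psi> ?e ` unit_disc (dm ?e)" using unit_disc_subset(1) c(2) by blast
     thus "c \<in> {c \<in> cube (dm e). pr (\<Phi> e c) \<in> ?B}" using c(1) by blast
    qed (use cubeY[OF eC] in blast)
    ultimately show "closed {c \<in> cube (dm e). \<Phi> e c \<in> {y \<in> topspace Y. pr y \<in> A}}"
     using closedin_closed_eq[OF closed_cube] by simp
   qed blast
   hence "openin Y (topspace Y - {y \<in> topspace Y. pr y \<in> A})" by (simp add: closedin_def)
   moreover have "topspace Y - {y \<in> topspace Y. pr y \<in> A} = {y \<in> topspace Y. pr y \<in> topspace X - A}"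
    using fa.p_in by blast
   ultimately have "openin Y {y \<in> topspace Y. pr y \<in> topspace X - A}" by (simp only:)
   moreover have "openin Y {y \<in> topspace Y. pr y \<in> U} = openin X U" if "U \<subseteq> topspace X" for U
    using X that unfolding quotient_map_def by blast
   ultimately have "openin X (topspace X - A)" using Diff_subset[of "topspace X" A] by blast
   thus "closedin X A" using A by (simp add: closedin_def)
  qed
 qed
 moreover have "finite_skeleton n CC"
 proof -
  have "e \<in> rep ` S" if "e \<in> R" "dm e <= n" for e
  proof -
   have "e \<in> C" "rep e = e" using that by (auto simp: R_def)
   with S(2)[of e] that(2) obtain g where "g \<in> carrier G" "actc g e \<in> S" by blast
   thus ?thesis using rep_act[OF \<open>e \<in> C\<close>] \<open>rep e = e\<close> by (metis imageI)
  qed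
  hence "(SIGMA m:{..n}. CC m) \<subseteq> (\<lambda>e. (dm e, \<Psi> e)) ` rep ` S" by (auto simp: CC_def)
  thus ?thesis unfolding finite_skeleton_def using S(1) finite_subset by blast
 qed
 ultimately show ?thesis using fa.free_action_axioms by blast
qed

end

section \<open>Final topologies generated by cubes\<close>

type_synonym 'y plot = "nat \<times> (rvec => 'y)"

definition plot_space :: "'y plot set => 'y set" where
 "plot_space P = (\<Union>(n, \<pi>)\<in>P. \<pi> ` cube n)"

text \<open>The final topology with respect to the plots. Plots may overlap and may parametrise
  redundantly, which makes it easy to supply them; cells, with their uniqueness requirements, enter
  only later and induce the same topology by \<open>plot_top_closed_test\<close>.\<close>

definition plot_top :: "'y plot set => 'y topology" where
 "plot_top P = topology (\<lambda>U. U \<subseteq> plot_space P \<and>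
   (\<forall>(n, \<pi>)\<in>P. openin (top_of_set (cube n)) {c \<in> cube n. \<pi> c \<in> U}))"

lemma openin_plot_top:
 "openin (plot_top P) U \<longleftrightarrow> U \<subseteq> plot_space P \<and>
   (\<forall>(n, \<pi>)\<in>P. openin (top_of_set (cube n)) {c \<in> cube n. \<pi> c \<in> U})"
proof -
 let ?P = "\<lambda>U. U \<subseteq> plot_space P \<and> (\<forall>(n, \<pi>)\<in>P. openin (top_of_set (cube n)) {c \<in> cube n. \<pi> c \<in> U})"
 have "istopology ?P"
  unfolding istopology_def
 proof (intro conjI allI impI)
  fix S T assume "?P S" "?P T"
  thus "S \<inter> T \<subseteq> plot_space P" by blast
  have "{c \<in> cube n. \<pi> c \<in> S \<inter> T} = {c \<in> cube n. \<pi> c \<in> S} \<inter> {c \<in> cube n. \<pi> c \<in> T}" for n and \<pi> :: "rvec => 'a"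
   by blast
  thus "\<forall>(n, \<pi>)\<in>P. openin (top_of_set (cube n)) {c \<in> cube n. \<pi> c \<in> S \<inter> T}"
   using \<open>?P S\<close> \<open>?P T\<close> by auto
 next
  fix \<K> assume K: "\<forall>K\<in>\<K>. ?P K"
  thus "\<Union>\<K> \<subseteq> plot_space P" by blast
  have "{c \<in> cube n. \<pi> c \<in> \<Union>\<K>} = (\<Union>K\<in>\<K>. {c \<in> cube n. \<pi> c \<in> K})" for n and \<pi> :: "rvec => 'a"
   by blast
  thus "\<forall>(n, \<pi>)\<in>P. openin (top_of_set (cube n)) {c \<in> cube n. \<pi> c \<in> \<Union>\<K>}"
   using K by (auto intro!: openin_Union)
 qed
 thus ?thesis unfolding plot_top_def using fun_cong[OF topology_inverse'[OF \<open>istopology ?P\<close>], of U] by simp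
qed

lemma topspace_plot_top: "topspace (plot_top P) = plot_space P"
proof -
 have "{c \<in> cube n. \<pi> c \<in> plot_space P} = cube n" if "(n, \<pi>) \<in> P" for n \<pi>
  using that by (auto simp: plot_space_def)
 hence "openin (plot_top P) (plot_space P)"
  unfolding openin_plot_top by auto
 thus ?thesis using openin_subset openin_plot_top[of P "topspace (plot_top P)"] by fastforce
qed

lemma plot_cont: "(n, \<pi>) \<in> P ==> cmap (cube n) (plot_top P) \<pi>"
proof -
 assume P: "(n, \<pi>) \<in> P"
 hence "\<pi> c \<in> plot_space P" if "c \<in> cube n" for c using that by (auto simp: plot_space_def)
 thus ?thesis using P by (auto simp: continuous_map_def topspace_plot_top openin_plot_top)
qed

lemma continuous_from_plot_top:
 assumes "\<And>n \<pi>. (n, \<pi>) \<in> P ==> cmap (cube n) Z (\<lambda>c. f (\<pi> c))"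
 shows "continuous_map (plot_top P) Z f"
 unfolding continuous_map_def
proof (intro conjI allI impI)
 show "f \<in> topspace (plot_top P) \<rightarrow> topspace Z"
  using cmap_in[OF assms] by (auto simp: topspace_plot_top plot_space_def)
 fix U assume U: "openin Z U"
 have "openin (top_of_set (cube n)) {c \<in> cube n. \<pi> c \<in> {y \<in> plot_space P. f y \<in> U}}" if "(n, \<pi>) \<in> P" for n \<pi>
 proof -
  have "{c \<in> cube n. \<pi> c \<in> {y \<in> plot_space P. f y \<in> U}} = {c \<in> cube n. f (\<pi> c) \<in> U}"
   using that by (auto simp: plot_space_def)
  thus ?thesis using openin_continuous_map_preimage[OF assms[OF that] U] by simp
 qed
 thus "openin (plot_top P) {x \<in> topspace (plot_top P). f x \<in> U}"
  by (auto simp: openin_plot_top topspace_plot_top)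
qed

lemma openin_plot_topI:
 assumes "U \<subseteq> plot_space P" "\<And>n \<pi>. (n, \<pi>) \<in> P ==> openin (top_of_set (cube n)) {c \<in> cube n. \<pi> c \<in> U}"
 shows "openin (plot_top P) U"
 using assms by (auto simp: openin_plot_top)

lemma openin_plot_topD:
 assumes "openin (plot_top P) U" "(n, \<pi>) \<in> P"
 shows "openin (top_of_set (cube n)) {c \<in> cube n. \<pi> c \<in> U}"
 using assms by (auto simp: openin_plot_top)

text \<open>The space is a quotient of a disjoint sum of cubes. The product of a quotient map with
  the interval is again a quotient map because the interval is locally compact and Hausdorff; so a
  homotopy, too, can be tested cube by cube. The version for an open subset serves homotopies that
  exist only on a star or on an open edge.\<close>

lemma homotopy_from_plot_top:
 assumes U: "openin (plot_top P) U"
  and K: "\<And>n \<pi>. (n, \<pi>) \<in> P ==> cmap ({0..1::real} \<times> {c \<in> cube n. \<pi> c \<in> U}) Z (\<lambda>tc. K (fst tc, \<pi> (snd tc)))"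
 shows "continuous_map (prod_topology (top_of_set {0..1::real}) (subtopology (plot_top P) U)) Z K"
proof -
 let ?I = "top_of_set {0..1::real}"
 let ?S = "sum_topology (\<lambda>i. top_of_set (cube (fst i))) P"
 define q where "q = (\<lambda>(i :: 'a plot, c). snd i c)"
 have tS: "topspace ?S = Sigma P (\<lambda>i. cube (fst i))" by (simp add: o_def)
 have opS: "openin ?S W \<longleftrightarrow> W \<subseteq> Sigma P (\<lambda>i. cube (fst i)) \<and> (\<forall>i\<in>P. openin (top_of_set (cube (fst i))) {c. (i, c) \<in> W})" for W
  by (simp add: openin_sum_topology o_def)
 have "quotient_map ?S (plot_top P) q"
  unfolding quotient_map_def
 proof (intro conjI allI impI)
  show "q ` topspace ?S = topspace (plot_top P)"
   unfolding tS topspace_plot_top plot_space_def q_def by force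
  fix W assume W: "W \<subseteq> topspace (plot_top P)"
  have e: "{c. (i, c) \<in> {x \<in> topspace ?S. q x \<in> W}} = {c \<in> cube (fst i). snd i c \<in> W}" if "i \<in> P" for i
   using that by (auto simp: q_def)
  have "openin ?S {x \<in> topspace ?S. q x \<in> W} \<longleftrightarrow> (\<forall>i\<in>P. openin (top_of_set (cube (fst i))) {c \<in> cube (fst i). snd i c \<in> W})"
   unfolding opS using e by auto
  thus "openin ?S {x \<in> topspace ?S. q x \<in> W} = openin (plot_top P) W"
   using W by (auto simp: openin_plot_top topspace_plot_top)
 qed
 hence "quotient_map (subtopology ?S {x \<in> topspace ?S. q x \<in> U}) (subtopology (plot_top P) U) q"
  using quotient_map_restriction U by blast
 moreover have "locally_compact_space ?I"
  by (simp add: compact_imp_locally_compact_space compact_space_subtopology)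
 moreover have "Hausdorff_space ?I"
  by (simp add: Hausdorff_space_subtopology)
 ultimately have Q: "quotient_map (prod_topology ?I (subtopology ?S {x \<in> topspace ?S. q x \<in> U}))
   (prod_topology ?I (subtopology (plot_top P) U)) (\<lambda>(t, x). (t, q x))"
  using quotient_map_prod_right by blast
 let ?V = "{x \<in> topspace ?S. q x \<in> U}"
 have "continuous_map (prod_topology ?I (subtopology ?S ?V)) Z (K \<circ> (\<lambda>(t, x). (t, q x)))"
  unfolding continuous_map_def
 proof (intro conjI allI impI)
  show "K \<circ> (\<lambda>(t, x). (t, q x)) \<in> topspace (prod_topology ?I (subtopology ?S ?V)) \<rightarrow> topspace Z"
  proof
   fix a assume "a \<in> topspace (prod_topology ?I (subtopology ?S ?V))"
   then obtain t n \<pi> c where a: "a = (t, ((n, \<pi>), c))" "t \<in> {0..1}" "(n, \<pi>) \<in> P" "c \<in> cube n" "\<pi> c \<in> U"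
    by (auto simp: q_def)
   thus "(K \<circ> (\<lambda>(t, x). (t, q x))) a \<in> topspace Z"
    using cmap_in[OF K[OF a(3)], of "(t, c)"] by (auto simp: q_def)
  qed
  fix O' assume O: "openin Z O'"
  let ?W = "{a \<in> topspace (prod_topology ?I (subtopology ?S ?V)). (K \<circ> (\<lambda>(t, x). (t, q x))) a \<in> O'}"
  show "openin (prod_topology ?I (subtopology ?S ?V)) ?W"
   unfolding openin_prod_topology_alt
  proof (intro allI impI)
   fix t x assume "(t, x) \<in> ?W"
   then obtain n \<pi> c where a: "x = ((n, \<pi>), c)" "t \<in> {0..1}" "(n, \<pi>) \<in> P" "c \<in> cube n" "\<pi> c \<in> U" "K (t, \<pi> c) \<in> O'"
    by (auto simp: q_def)
   let ?D = "{c \<in> cube n. \<pi> c \<in> U}"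
   have "openin (top_of_set ({0..1::real} \<times> ?D)) {tc \<in> {0..1} \<times> ?D. K (fst tc, \<pi> (snd tc)) \<in> O'}"
    using openin_continuous_map_preimage[OF K[OF a(3)] O] by simp
   hence "openin (prod_topology ?I (top_of_set ?D)) {tc \<in> {0..1} \<times> ?D. K (fst tc, \<pi> (snd tc)) \<in> O'}"
    by (simp only: top_of_set_Times)
   moreover have "(t, c) \<in> {tc \<in> {0..1} \<times> ?D. K (fst tc, \<pi> (snd tc)) \<in> O'}" using a by simp
   ultimately have "\<exists>A B. openin ?I A \<and> openin (top_of_set ?D) B \<and> t \<in> A \<and> c \<in> B \<and>
    A \<times> B \<subseteq> {tc \<in> {0..1} \<times> ?D. K (fst tc, \<pi> (snd tc)) \<in> O'}"
    by (rule openin_prod_topology_alt[THEN iffD1, rule_format])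
   then obtain A B where AB: "openin ?I A" "openin (top_of_set ?D) B" "t \<in> A" "c \<in> B"
    "A \<times> B \<subseteq> {tc \<in> {0..1} \<times> ?D. K (fst tc, \<pi> (snd tc)) \<in> O'}"
    by (elim exE conjE)
   have Dop: "openin (top_of_set (cube n)) ?D" using openin_plot_topD[OF U a(3)] .
   have BD: "B \<subseteq> ?D" using AB(2) openin_imp_subset by blast
   have "openin (top_of_set (cube n)) B" using AB(2) Dop openin_trans by blast
   hence "openin ?S ({(n, \<pi>)} \<times> B)"
   proof -
    have "{c. (i, c) \<in> {(n, \<pi>)} \<times> B} = (if i = (n, \<pi>) then B else {})" for i by auto
    thus ?thesis unfolding opS using a(3) BD \<open>openin (top_of_set (cube n)) B\<close> by auto
   qed
   hence "openin (subtopology ?S ?V) (?V \<inter> ({(n, \<pi>)} \<times> B))"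
    by (simp add: openin_subtopology_Int2)
   moreover have "A \<times> (?V \<inter> ({(n, \<pi>)} \<times> B)) \<subseteq> ?W"
    using AB(5) openin_subset[OF AB(1)] BD a(3) by (auto simp: q_def)
   moreover have "x \<in> ?V \<inter> ({(n, \<pi>)} \<times> B)" using a AB(4) by (auto simp: q_def)
   ultimately show "\<exists>U V. openin ?I U \<and> openin (subtopology ?S ?V) V \<and> t \<in> U \<and> x \<in> V \<and> U \<times> V \<subseteq> ?W"
    using AB(1,3) by blast
  qed
 qed
 thus ?thesis using continuous_compose_quotient_map[OF Q] by blast
qed

lemma homotopy_from_plot_top_UNIV:
 assumes "\<And>n \<pi>. (n, \<pi>) \<in> P ==> cmap ({0..1::real} \<times> cube n) Z (\<lambda>tc. K (fst tc, \<pi> (snd tc)))"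
 shows "continuous_map (prod_topology (top_of_set {0..1::real}) (plot_top P)) Z K"
proof -
 have "{c \<in> cube n. \<pi> c \<in> topspace (plot_top P)} = cube n" if "(n, \<pi>) \<in> P" for n \<pi>
  using that by (auto simp: topspace_plot_top plot_space_def)
 hence "continuous_map (prod_topology (top_of_set {0..1::real}) (subtopology (plot_top P) (topspace (plot_top P)))) Z K"
  using assms by (intro homotopy_from_plot_top) auto
 thus ?thesis by simp
qed

text \<open>Closed cells are compact in a Hausdorff space, hence closed, and every plot meets only
  finitely many of them. So a set that is closed in each cell is closed in each plot.\<close>

lemma plot_top_closed_test:
 assumes H: "Hausdorff_space (plot_top P)"
  and \<Phi>: "\<And>e. e \<in> C ==> cmap (cube (dm e)) (plot_top P) (\<Phi> e)"
  and cell: "\<And>y. y \<in> plot_space P ==> cellof y \<in> C \<and> y \<in> \<Phi> (cellof y) ` cube (dm (cellof y))"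
  and fin: "\<And>n \<pi>. (n, \<pi>) \<in> P ==> finite (cellof ` \<pi> ` cube n)"
  and A: "A \<subseteq> topspace (plot_top P)" "\<And>e. e \<in> C ==> closed {c \<in> cube (dm e). \<Phi> e c \<in> A}"
 shows "closedin (plot_top P) A"
proof -
 have cl: "closedin (plot_top P) (A \<inter> \<Phi> e ` cube (dm e))" if "e \<in> C" for e
 proof -
  let ?B = "{c \<in> cube (dm e). \<Phi> e c \<in> A}"
  have "compact ?B"
  proof -
   have "cube (dm e) \<inter> ?B = ?B" by blast
   thus ?thesis using compact_Int_closed[OF compact_cube[of "dm e"] A(2)[OF that]] by (simp only:)
  qed
  hence "compactin (plot_top P) (\<Phi> e ` ?B)"
   using image_compactin[OF _ \<Phi>[OF that], of ?B] by (simp add: compactin_subtopology)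
  moreover have "\<Phi> e ` ?B = A \<inter> \<Phi> e ` cube (dm e)" by auto
  ultimately show ?thesis using compactin_imp_closedin[OF H] by simp
 qed
 have "openin (plot_top P) (topspace (plot_top P) - A)"
 proof (rule openin_plot_topI)
  show "topspace (plot_top P) - A \<subseteq> plot_space P" by (auto simp: topspace_plot_top)
  fix n \<pi> assume P: "(n, \<pi>) \<in> P"
  let ?K = "cellof ` \<pi> ` cube n"
  let ?B = "\<Union>e\<in>?K. A \<inter> \<Phi> e ` cube (dm e)"
  have pY: "\<pi> c \<in> plot_space P" if "c \<in> cube n" for c using that P by (auto simp: plot_space_def)
  have "closedin (plot_top P) ?B"
  proof (rule closedin_Union)
   show "finite ((\<lambda>e. A \<inter> \<Phi> e ` cube (dm e)) ` ?K)" using fin[OF P] by simp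
   show "closedin (plot_top P) K" if "K \<in> (\<lambda>e. A \<inter> \<Phi> e ` cube (dm e)) ` ?K" for K
    using that cl cell pY by blast
  qed
  hence "openin (plot_top P) (topspace (plot_top P) - ?B)" by (simp add: closedin_def)
  hence "openin (top_of_set (cube n)) {c \<in> cube n. \<pi> c \<in> topspace (plot_top P) - ?B}"
   by (rule openin_plot_topD[OF _ P])
  moreover have "{c \<in> cube n. \<pi> c \<in> topspace (plot_top P) - ?B} = {c \<in> cube n. \<pi> c \<in> topspace (plot_top P) - A}"
  proof -
   have "\<pi> c \<in> ?B \<longleftrightarrow> \<pi> c \<in> A" if "c \<in> cube n" for c
   proof
    assume "\<pi> c \<in> A"
    moreover have "\<pi> c \<in> \<Phi> (cellof (\<pi> c)) ` cube (dm (cellof (\<pi> c)))" using cell[OF pY[OF that]] by blast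
    ultimately show "\<pi> c \<in> ?B" using that by blast
   qed blast
   hence "c \<in> cube n \<and> \<pi> c \<in> topspace (plot_top P) - ?B \<longleftrightarrow> c \<in> cube n \<and> \<pi> c \<in> topspace (plot_top P) - A" for c
    unfolding Diff_iff by (intro conj_cong refl) simp
   thus ?thesis by (rule Collect_cong)
  qed
  ultimately show "openin (top_of_set (cube n)) {c \<in> cube n. \<pi> c \<in> topspace (plot_top P) - A}" by simp
 qed
 thus ?thesis using A(1) by (simp add: closedin_def)
qed

section \<open>Spaces of step functions\<close>

definition clique :: "'v set => ('v => 'v => bool) => 'v set => bool" where
 "clique V cl T \<longleftrightarrow> T \<subseteq> V \<and> (\<forall>x\<in>T. \<forall>y\<in>T. cl x y)"

lemma clique_subset: "clique V cl T ==> S \<subseteq> T ==> clique V cl S"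
 unfolding clique_def by blast

definition cnt :: "nat => rvec => real => nat" where
 "cnt n b x = card {i. i < n \<and> b i <= x}"

lemma cnt_le: "cnt n b x <= n"
proof -
 have "cnt n b x <= card {..<n}" unfolding cnt_def by (rule card_mono) auto
 thus ?thesis by simp
qed

lemma cnt_Suc: "cnt (Suc n) b x = cnt n b x + (if b n <= x then 1 else 0)"
proof -
 have "{i. i < Suc n \<and> b i <= x} = {i. i < n \<and> b i <= x} \<union> (if b n <= x then {n} else {})"
  by (auto simp: less_Suc_eq)
 thus ?thesis unfolding cnt_def by (simp add: card_insert_if)
qed

lemma cnt_cong: "(\<And>i. i < n ==> b i <= x \<longleftrightarrow> b' i <= x') ==> cnt n b x = cnt n b' x'"
 unfolding cnt_def by (rule arg_cong[of _ _ card]) auto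

lemma cnt_sorted:
 assumes "\<And>i j. i <= j ==> j < n ==> b i <= b j" "k <= n"
  "\<And>i. i < k ==> b i <= x" "k < n ==> x < b k"
 shows "cnt n b x = k"
proof -
 have "{i. i < n \<and> b i <= x} = {..<k}"
 proof (intro equalityI subsetI)
  fix i assume i: "i \<in> {i. i < n \<and> b i <= x}"
  show "i \<in> {..<k}"
  proof (rule ccontr)
   assume "i \<notin> {..<k}"
   hence ki: "k <= i" "k < n" using i by auto
   hence "b k <= b i" using assms(1)[of k i] i by simp
   thus False using assms(4)[OF ki(2)] i by simp
  qed
 next
  fix i assume i: "i \<in> {..<k}"
  thus "i \<in> {i. i < n \<and> b i <= x}" using assms(2) assms(3)[of i] by simp
 qed
 thus ?thesis by (simp add: cnt_def)
qed

text \<open>The value at \<open>x\<close> is selected by the number of breakpoints up to \<open>x\<close>, so that the breakpoints need not be sorted.\<close>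

definition step :: "'v list => rvec => real => 'v" where
 "step v b = (\<lambda>x\<in>{0..<1}. v ! cnt (length v - 1) b x)"

definition lft :: "('v => 'w) => (real => 'v) => real => 'w" where
 "lft \<alpha> f = (\<lambda>x\<in>{0..<1}. \<alpha> (f x))"

text \<open>The half-open gaps force continuity from the right, so that a jump is visible only from
  the left, as in \<open>jumps\<close>. A step function is then determined by its value at 0 and its
  values at the jumps. The exceptional set \<open>B\<close> is allowed to be larger than the set of
  jumps.\<close>

definition stepfun :: "(real => 'v) => bool" where
 "stepfun f \<longleftrightarrow> f \<in> extensional {0..<1} \<and>
   (\<exists>B. finite B \<and> (\<forall>x y. 0 <= x --> x <= y --> y < 1 --> B \<inter> {x<..y} = {} --> f x = f y))"

definition jumps :: "(real => 'v) => real set" where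
 "jumps f = {x. 0 < x \<and> x < 1 \<and> (\<forall>\<epsilon>>0. \<exists>y. 0 <= y \<and> x - \<epsilon> < y \<and> y < x \<and> f y ~= f x)}"

lemma step_apply: "0 <= x ==> x < 1 ==> step v b x = v ! cnt (length v - 1) b x"
 by (simp add: step_def)

lemma cnt_less_length: "v ~= [] ==> cnt (length v - 1) b x < length v"
proof -
 assume "v ~= []"
 hence "length v - 1 < length v" by simp
 thus ?thesis by (rule le_less_trans[OF cnt_le])
qed

lemma step_in_set: "v ~= [] ==> 0 <= x ==> x < 1 ==> step v b x \<in> set v"
 using nth_mem[OF cnt_less_length[of v b x]] by (simp only: step_apply) simp

lemma lft_step: "v ~= [] ==> lft \<alpha> (step v b) = step (map \<alpha> v) b"
proof
 fix x assume v: "v ~= []"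
 show "lft \<alpha> (step v b) x = step (map \<alpha> v) b x"
 proof (cases "0 <= x \<and> x < 1")
  case True
  thus ?thesis using cnt_less_length[OF v, of b x] by (simp add: lft_def step_apply)
 next
  case False
  thus ?thesis by (auto simp: lft_def step_def)
 qed
qed

lemma lft_lft: "lft \<alpha> (lft \<beta> f) = lft (\<lambda>v. \<alpha> (\<beta> v)) f"
 by (auto simp: lft_def)

lemma lft_image: "lft \<alpha> f ` {0..<1} = \<alpha> ` f ` {0..<1}"
 by (auto simp: lft_def image_image)

lemma lft_id: "f \<in> extensional {0..<1} ==> (\<And>x. 0 <= x ==> x < 1 ==> \<alpha> (f x) = f x) ==> lft \<alpha> f = f"
 by (auto simp: lft_def extensional_def fun_eq_iff)

lemma lft_cong: "(\<And>x. 0 <= x ==> x < 1 ==> \<alpha> (f x) = \<beta> (f x)) ==> lft \<alpha> f = lft \<beta> f"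
 by (auto simp: lft_def fun_eq_iff)

lemma step_const:
 assumes "0 <= x" "x <= y" "y < 1" "b ` {..<length v - 1} \<inter> {x<..y} = {}"
 shows "step v b x = step v b y"
proof -
 have "cnt (length v - 1) b x = cnt (length v - 1) b y"
 proof (rule cnt_cong)
  fix i assume i: "i < length v - 1"
  hence "b i \<notin> {x<..y}" using assms(4) by blast
  thus "b i <= x \<longleftrightarrow> b i <= y" using assms(2) by auto
 qed
 thus ?thesis using assms by (simp add: step_apply)
qed

lemma stepfun_step: "stepfun (step v b)"
 unfolding stepfun_def
proof (intro conjI exI[of _ "b ` {..<length v - 1}"] allI impI)
 show "step v b \<in> extensional {0..<1}" by (simp add: step_def)
 show "step v b x = step v b y" if "0 <= x" "x <= y" "y < 1" "b ` {..<length v - 1} \<inter> {x<..y} = {}" for x y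
  using that by (rule step_const)
qed simp

lemma stepfun_ext: "stepfun f ==> f \<in> extensional {0..<1}"
 by (simp add: stepfun_def)

lemma stepfun_lft:
 assumes "stepfun f"
 shows "stepfun (lft \<alpha> f)"
proof -
 obtain B where B: "finite B" "\<forall>x y. 0 <= x --> x <= y --> y < 1 --> B \<inter> {x<..y} = {} --> f x = f y"
  using assms by (auto simp: stepfun_def)
 have "lft \<alpha> f x = lft \<alpha> f y" if "0 <= x" "x <= y" "y < 1" "B \<inter> {x<..y} = {}" for x y
 proof -
  have "f x = f y" using B(2) that by blast
  thus ?thesis using that by (simp add: lft_def)
 qed
 moreover have "lft \<alpha> f \<in> extensional {0..<1}" by (simp add: lft_def)
 ultimately show ?thesis unfolding stepfun_def using B(1) by blast
qed

lemma finite_gap_left: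
 fixes B :: "real set"
 assumes "finite B"
 shows "\<exists>\<epsilon>>0. \<forall>s\<in>B. s < x --> s <= x - \<epsilon>"
 using assms
proof (induction B rule: finite_induct)
 case empty
 thus ?case by (intro exI[of _ 1]) auto
next
 case (insert a B)
 then obtain \<epsilon> where e: "\<epsilon> > 0" "\<forall>s\<in>B. s < x --> s <= x - \<epsilon>" by blast
 show ?case
  by (rule exI[of _ "if a < x then min \<epsilon> (x - a) else \<epsilon>"]) (use e in \<open>auto simp: min_def\<close>)
qed

lemma jumps_subset:
 assumes "finite B" "\<forall>x y. 0 <= x --> x <= y --> y < 1 --> B \<inter> {x<..y} = {} --> f x = f y"
 shows "jumps f \<subseteq> B"
proof
 fix x assume x: "x \<in> jumps f"
 show "x \<in> B"
 proof (rule ccontr)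
  assume "x \<notin> B"
  obtain \<epsilon> where e: "\<epsilon> > 0" "\<forall>s\<in>B. s < x --> s <= x - \<epsilon>" using finite_gap_left[OF assms(1)] by blast
  obtain y where y: "0 <= y" "x - \<epsilon> < y" "y < x" "f y ~= f x" using x e(1) unfolding jumps_def by blast
  have "B \<inter> {y<..x} = {}" using e(2) \<open>x \<notin> B\<close> y(2) by force
  thus False using assms(2) y x by (auto simp: jumps_def)
 qed
qed

lemma jumps_finite: "stepfun f ==> finite (jumps f)"
 unfolding stepfun_def using jumps_subset finite_subset by metis

lemma jumps_step: "jumps (step v b) \<subseteq> b ` {..<length v - 1} \<inter> {0<..<1}"
proof
 fix x assume x: "x \<in> jumps (step v b)"
 moreover have "jumps (step v b) \<subseteq> b ` {..<length v - 1}"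
  using step_const[of _ _ b v] by (intro jumps_subset) (simp_all del: One_nat_def)
 ultimately show "x \<in> b ` {..<length v - 1} \<inter> {0<..<1}" by (auto simp: jumps_def)
qed

lemma jumps_lft: "jumps (lft \<alpha> f) \<subseteq> jumps f"
proof
 fix x assume x: "x \<in> jumps (lft \<alpha> f)"
 have "\<exists>y. 0 <= y \<and> x - \<epsilon> < y \<and> y < x \<and> f y ~= f x" if "\<epsilon> > 0" for \<epsilon>
 proof -
  obtain y where "0 <= y" "x - \<epsilon> < y" "y < x" "lft \<alpha> f y ~= lft \<alpha> f x" using x \<open>\<epsilon> > 0\<close> unfolding jumps_def by blast
  moreover hence "f y ~= f x" using x by (auto simp: lft_def jumps_def)
  ultimately show ?thesis by blast
 qed
 thus "x \<in> jumps f" using x by (auto simp: jumps_def)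
qed

text \<open>Only \<open>B\<close> is known to be finite, and it may contain spurious points. Among
  its points after \<open>q\<close> where the value differs from \<open>f q\<close>, the least one
  is a genuine jump: just to the left of it the value is still \<open>f q\<close>.\<close>

lemma no_jump:
 assumes f: "stepfun f" and x: "0 <= q" "q <= x" "x < 1" "jumps f \<inter> {q<..x} = {}"
 shows "f x = f q"
proof (rule ccontr)
 assume ne: "f x ~= f q"
 obtain B where B: "finite B" "\<And>x y. 0 <= x ==> x <= y ==> y < 1 ==> B \<inter> {x<..y} = {} ==> f x = f y"
  using f by (auto simp: stepfun_def)
 have last: "f y = f q \<or> (\<exists>s\<in>B. q < s \<and> s <= y \<and> f y = f s)" if "q <= y" "y < 1" for y
 proof (cases "B \<inter> {q<..y} = {}")
  case True
  thus ?thesis using B(2)[of q y] x(1) that by metis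
 next
  case False
  define s where "s = Max (B \<inter> {q<..y})"
  have s: "s \<in> B \<inter> {q<..y}" unfolding s_def using B(1) False by (intro Max_in) auto
  have "B \<inter> {s<..y} = {}"
  proof (rule ccontr)
   assume "B \<inter> {s<..y} ~= {}"
   then obtain r where "r \<in> B" "s < r" "r <= y" by auto
   hence "r \<in> B \<inter> {q<..y}" using s by auto
   hence "r <= s" unfolding s_def using B(1) by (intro Max_ge) auto
   thus False using \<open>s < r\<close> by simp
  qed
  hence "f s = f y" using B(2)[of s y] s x(1) that by auto
  thus ?thesis using s by (metis IntE greaterThanAtMost_iff)
 qed
 let ?S = "{s \<in> B. q < s \<and> s <= x \<and> f s ~= f q}"
 have ne': "?S ~= {}" using last[OF x(2,3)] ne by force
 have fin: "finite ?S" using B(1) by simp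
 have m: "Min ?S \<in> ?S" using Min_in[OF fin ne'] .
 have m2: "Min ?S <= s" if "s \<in> ?S" for s using Min_le[OF fin that] .
 define s where "s = Min ?S"
 have s: "s \<in> B" "q < s" "s <= x" "f s ~= f q" using m by (auto simp: s_def)
 have left: "f y = f q" if yq: "q <= y" "y < s" for y
 proof (rule ccontr)
  assume "f y ~= f q"
  moreover have "y < 1" using yq s(3) x(3) by linarith
  ultimately obtain r where "r \<in> B" "q < r" "r <= y" "f y = f r" using last[OF yq(1)] by blast
  hence "r \<in> ?S" using \<open>f y ~= f q\<close> yq s(3) by auto
  thus False using m2[of r] \<open>r <= y\<close> yq(2) by (simp add: s_def)
 qed
 have "s \<in> jumps f"
  unfolding jumps_def
 proof (intro CollectI conjI allI impI)
  show "0 < s" "s < 1" using s x by auto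
  fix \<epsilon> :: real assume "\<epsilon> > 0"
  define y where "y = max q (s - \<epsilon> / 2)"
  have "q <= y" "y < s" "s - \<epsilon> < y" using s(2) \<open>\<epsilon> > 0\<close> by (auto simp: y_def)
  thus "\<exists>y. 0 <= y \<and> s - \<epsilon> < y \<and> y < s \<and> f y ~= f s"
   using left[of y] s(4) x(1) by (intro exI[of _ y]) auto
 qed
 thus False using x(4) s by auto
qed

section \<open>Normal form and topology of step functions\<close>

definition js :: "(real => 'v) => real list" where "js f = sorted_list_of_set (jumps f)"
definition vals :: "(real => 'v) => 'v list" where "vals f = f 0 # map f (js f)"
definition brk :: "(real => 'v) => rvec" where "brk f = (\<lambda>i. if i < length (js f) then js f ! i else 0)"

lemma js_props:
 assumes "stepfun f"
 shows "set (js f) = jumps f" "sorted (js f)" "distinct (js f)" "length (js f) = card (jumps f)"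
 using jumps_finite[OF assms] by (simp_all add: js_def)

lemma length_vals: "length (vals f) - 1 = length (js f)"
 by (simp add: vals_def)

lemma brk_mono:
 assumes "stepfun f" "i < j" "j < length (js f)"
 shows "brk f i < brk f j"
 using js_props[OF assms(1)] assms(2,3) sorted_wrt_nth_less[of "(<)" "js f" i j]
 by (simp add: brk_def strict_sorted_iff)

lemma brk_in: "stepfun f ==> i < length (js f) ==> brk f i \<in> jumps f"
 using js_props(1)[of f] nth_mem[of i "js f"] by (simp add: brk_def)

lemma brk_01: "stepfun f ==> i < length (js f) ==> 0 < brk f i \<and> brk f i < 1"
 using brk_in[of f i] by (auto simp: jumps_def)

lemma vals_nth:
 assumes f: "stepfun f" and x: "0 <= x" "x < 1"
 shows "f x = vals f ! cnt (length (js f)) (brk f) x"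
proof -
 let ?n = "length (js f)" and ?k = "cnt (length (js f)) (brk f) x"
 have mono: "brk f i <= brk f j" if "i <= j" "j < ?n" for i j
  using brk_mono[OF f, of i j] that by (cases "i = j") auto
 have set: "{i. i < ?n \<and> brk f i <= x} = {..<?k}"
 proof -
  let ?A = "{i. i < ?n \<and> brk f i <= x}"
  have down: "i \<in> ?A" if "j \<in> ?A" "i <= j" for i j using that mono[of i j] by auto
  have "finite ?A" by simp
  have "?A = {..<card ?A}"
  proof (rule card_subset_eq[symmetric])
   show "finite ?A" by simp
   show "{..<card ?A} \<subseteq> ?A"
   proof
    fix i assume i: "i \<in> {..<card ?A}"
    show "i \<in> ?A"
    proof (rule ccontr)
     assume "i \<notin> ?A"
     hence "?A \<subseteq> {..<i}" using down[of _ i] by (meson lessThan_iff linorder_not_le subsetI)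
     hence "card ?A <= i" using card_mono[of "{..<i}" ?A] by simp
     thus False using i by simp
    qed
   qed
  qed simp
  thus ?thesis by (simp add: cnt_def)
 qed
 have nj: "jumps f \<inter> {q<..x} = {}" if q: "\<And>i. i < ?k ==> brk f i <= q" for q
 proof (rule ccontr)
  assume "jumps f \<inter> {q<..x} ~= {}"
  then obtain r where r: "r \<in> jumps f" "q < r" "r <= x" by auto
  then obtain i where i: "i < ?n" "r = brk f i" using js_props(1)[OF f] by (metis brk_def in_set_conv_nth)
  hence "i < ?k" using set r(3) by auto
  thus False using q i r(2) by force
 qed
 show ?thesis
 proof (cases ?k)
  case 0
  thus ?thesis using no_jump[OF f, of 0 x] nj[of 0] x by (simp add: vals_def)
 next
  case (Suc k)
  have k: "k < ?n" "brk f k <= x" using set Suc by auto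
  have "f x = f (brk f k)"
  proof (rule no_jump[OF f _ k(2) x(2)])
   show "0 <= brk f k" using brk_01[OF f k(1)] by simp
   show "jumps f \<inter> {brk f k<..x} = {}"
    by (rule nj) (use mono k(1) Suc in auto)
  qed
  thus ?thesis using Suc k(1) by (simp add: vals_def brk_def)
 qed
qed

lemma step_normal: "stepfun f ==> step (vals f) (brk f) = f"
proof
 fix x assume f: "stepfun f"
 show "step (vals f) (brk f) x = f x"
 proof (cases "0 <= x \<and> x < 1")
  case True
  thus ?thesis using vals_nth[OF f, of x] unfolding length_vals[symmetric] by (simp add: step_apply)
 next
  case False
  thus ?thesis using stepfun_ext[OF f] by (auto simp: step_def extensional_def)
 qed
qed

lemma brk_cube: "stepfun f ==> brk f \<in> cube (length (js f))"
proof -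
 assume f: "stepfun f"
 have "0 <= brk f i \<and> brk f i <= 1" for i
  using brk_01[OF f, of i] by (cases "i < length (js f)") (simp_all add: brk_def)
 thus ?thesis by (simp add: cube_iff brk_def)
qed

lemma set_vals: "stepfun f ==> set (vals f) \<subseteq> f ` {0..<1}"
proof
 fix w assume f: "stepfun f" and w: "w \<in> set (vals f)"
 hence "w = f 0 \<or> (\<exists>x\<in>jumps f. w = f x)" using js_props(1)[OF f] by (auto simp: vals_def)
 thus "w \<in> f ` {0..<1}" by (auto simp: jumps_def)
qed

text \<open>The resulting space is the geometric realisation of the simplicial set whose n-simplices
  are the (n + 1)-tuples with entries in a clique. Breakpoints are the simplex coordinates; faces
  arise when breakpoints reach 0 or 1 or merge, and degenerate simplices disappear because equal
  neighbouring values make no jump.\<close>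

definition SEplots :: "'v set => ('v => 'v => bool) => (real => 'v) plot set" where
 "SEplots V cl = {(length v - 1, step v) | v. v ~= [] \<and> clique V cl (set v)}"

abbreviation "SE V cl \<equiv> plot_top (SEplots V cl)"

lemma SE_space: "plot_space (SEplots V cl) = {f. stepfun f \<and> clique V cl (f ` {0..<1})}"
proof (intro equalityI subsetI)
 fix f assume "f \<in> plot_space (SEplots V cl)"
 then obtain v b where v: "v ~= []" "clique V cl (set v)" "f = step v b" by (auto simp: plot_space_def SEplots_def)
 hence "f ` {0..<1} \<subseteq> set v" using step_in_set by fastforce
 thus "f \<in> {f. stepfun f \<and> clique V cl (f ` {0..<1})}" using v stepfun_step clique_subset by blast
next
 fix f assume f: "f \<in> {f. stepfun f \<and> clique V cl (f ` {0..<1})}"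
 hence "clique V cl (set (vals f))" using set_vals clique_subset by blast
 hence "(length (js f), step (vals f)) \<in> SEplots V cl"
  unfolding SEplots_def using length_vals[of f] by (intro CollectI exI[of _ "vals f"]) (auto simp: vals_def)
 thus "f \<in> plot_space (SEplots V cl)"
 proof -
  have "f \<in> step (vals f) ` cube (length (js f))"
   using step_normal[of f] brk_cube[of f] f by (intro image_eqI[of _ _ "brk f"]) auto
  thus ?thesis unfolding plot_space_def
   using \<open>(length (js f), step (vals f)) \<in> SEplots V cl\<close> by blast
 qed
qed

lemma SE_plotI: "v ~= [] ==> clique V cl (set v) ==> length v = Suc n ==> (n, step v) \<in> SEplots V cl"
 unfolding SEplots_def by (intro CollectI exI[of _ v]) auto

lemma step_cmap:
 "v ~= [] ==> clique V cl (set v) ==> length v = Suc n ==> cmap (cube n) (SE V cl) (step v)"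
 by (rule plot_cont[OF SE_plotI])

lemma lft_cont:
 assumes "\<And>T. clique V cl T ==> clique W cl' (\<alpha> ` T)"
 shows "continuous_map (SE V cl) (SE W cl') (lft \<alpha>)"
proof (rule continuous_from_plot_top)
 fix n \<pi> assume "(n, \<pi>) \<in> SEplots V cl"
 then obtain v where v: "v ~= []" "clique V cl (set v)" "n = length v - 1" "\<pi> = step v" by (auto simp: SEplots_def)
 have "cmap (cube n) (SE W cl') (step (map \<alpha> v))"
  by (rule step_cmap) (use v assms[OF v(2)] in auto)
 thus "cmap (cube n) (SE W cl') (\<lambda>c. lft \<alpha> (\<pi> c))"
  using v by (simp add: lft_step)
qed

text \<open>
 As \<open>t\<close> decreases from 1 to 0, \<open>Mix\<close> replaces \<open>\<beta> k\<close> by \<open>\<beta> (Suc k)\<close> along a jump that travels through the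
 interval, so that at any time only two consecutive maps are in use.
\<close>

definition Mix :: "(nat => 'v => 'w) => ('v => 'w) => real \<times> (real => 'v) => real => 'w" where
 "Mix \<beta> \<beta>' = (\<lambda>(t, f). \<lambda>x\<in>{0..<1}. if t <= 0 then \<beta>' (f x) else \<beta> (nat \<lceil>1 / t - 1 - x\<rceil>) (f x))"

lemma Mix_0: "t <= 0 ==> Mix \<beta> \<beta>' (t, f) = lft \<beta>' f"
 by (auto simp: Mix_def lft_def)

lemma Mix_1: "Mix \<beta> \<beta>' (1, f) = lft (\<beta> 0) f"
proof
 fix x :: real
 have "nat \<lceil>- x\<rceil> = 0" if "0 <= x" using that by simp
 thus "Mix \<beta> \<beta>' (1, f) x = lft (\<beta> 0) f x" by (auto simp: Mix_def lft_def)
qed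

lemma Mix_index:
 assumes "0 <= x" "x < 1" "0 <= \<theta>" "\<theta> <= 1" "1 / t - 1 = real k + \<theta>"
 shows "nat \<lceil>1 / t - 1 - x\<rceil> = (if x < \<theta> then Suc k else k)"
proof (cases "x < \<theta>")
 case True
 hence "\<lceil>1 / t - 1 - x\<rceil> = int k + 1" using assms by (intro ceiling_unique) auto
 thus ?thesis using True by simp
next
 case False
 hence "\<lceil>1 / t - 1 - x\<rceil> = int k" using assms by (intro ceiling_unique) auto
 thus ?thesis using False by simp
qed

lemma Mix_level:
 assumes "0 < t" "t <= (1::real)"
 shows "\<exists>k \<theta>. 0 <= \<theta> \<and> \<theta> <= 1 \<and> 1 / t - 1 = real k + \<theta> \<and> real k + 1 <= 1 / t \<and> 1 / t <= real k + 2"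
proof -
 have "1 <= 1 / t" using assms by simp
 hence q: "1 <= \<lfloor>1 / t\<rfloor>" by simp
 define k where "k = nat (\<lfloor>1 / t\<rfloor> - 1)"
 have "real k = real_of_int \<lfloor>1 / t\<rfloor> - 1" using q by (simp add: k_def)
 moreover have "real_of_int \<lfloor>1 / t\<rfloor> <= 1 / t" "1 / t < real_of_int \<lfloor>1 / t\<rfloor> + 1" by linarith+
 ultimately show ?thesis by (intro exI[of _ k] exI[of _ "1 / t - 1 - real k"]) linarith
qed

lemma Mix_cut:
 assumes "0 <= \<theta>" "\<theta> <= 1" "1 / t - 1 = real k + \<theta>" "0 < t" "0 <= x" "x < 1"
 shows "Mix \<beta> \<beta>' (t, f) x = (if x < \<theta> then \<beta> (Suc k) (f x) else \<beta> k (f x))"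
 using Mix_index[OF assms(5,6,1,2,3)] assms by (simp add: Mix_def)

text \<open>Besides the old jumps only the travelling cut can occur. This count is what bounds the
  dimension of the cells met by \<open>phi\<close> on an edge.\<close>

lemma jumps_Mix:
 assumes "0 < t" "t <= 1"
 shows "\<exists>\<theta>. jumps (Mix \<beta> \<beta>' (t, f)) \<subseteq> insert \<theta> (jumps f)"
proof -
 obtain k \<theta> where k: "0 <= \<theta>" "\<theta> <= 1" "1 / t - 1 = real k + \<theta>" using Mix_level[OF assms] by blast
 have "x \<in> jumps f" if x: "x \<in> jumps (Mix \<beta> \<beta>' (t, f))" "x ~= \<theta>" for x
  unfolding jumps_def
 proof (intro CollectI conjI allI impI)
  show x01: "0 < x" "x < 1" using x by (auto simp: jumps_def)
  fix \<epsilon> :: real assume e: "\<epsilon> > 0"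
  define \<epsilon>' where "\<epsilon>' = (if \<theta> < x then min \<epsilon> (x - \<theta>) else \<epsilon>)"
  have e': "\<epsilon>' > 0" "\<epsilon>' <= \<epsilon>" "\<theta> < x ==> \<epsilon>' <= x - \<theta>" using e by (auto simp: \<epsilon>'_def)
  obtain y where y: "0 <= y" "x - \<epsilon>' < y" "y < x" "Mix \<beta> \<beta>' (t, f) y ~= Mix \<beta> \<beta>' (t, f) x"
   using x(1) e'(1) unfolding jumps_def by blast
  have "y < \<theta> \<longleftrightarrow> x < \<theta>" using y e'(3) x(2) by linarith
  moreover have "Mix \<beta> \<beta>' (t, f) x = (if x < \<theta> then \<beta> (Suc k) (f x) else \<beta> k (f x))"
   by (rule Mix_cut[OF k assms(1) less_imp_le[OF x01(1)] x01(2)])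
  moreover have "Mix \<beta> \<beta>' (t, f) y = (if y < \<theta> then \<beta> (Suc k) (f y) else \<beta> k (f y))"
   by (rule Mix_cut[OF k assms(1) y(1) less_trans[OF y(3) x01(2)]])
  ultimately have "f y ~= f x" using y(4) by (auto split: if_splits)
  thus "\<exists>y. 0 <= y \<and> x - \<epsilon> < y \<and> y < x \<and> f y ~= f x" using y e' by (intro exI[of _ y]) auto
 qed
 thus ?thesis by blast
qed

text \<open>At each positive time two consecutive maps are in use at once, so the clique condition
  is imposed on the union of their images. Eventual constancy at each value gives continuity at time
  0, since a plot involves only finitely many values.\<close>

theorem Mix_cont:
 assumes \<beta>: "\<And>T k. clique V cl T ==> clique W cl' (\<beta> (Suc k) ` T \<union> \<beta> k ` T)"
  and lim: "\<And>v. v \<in> V ==> \<exists>N. \<forall>k\<ge>N. \<beta> k v = \<beta>' v"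
 shows "continuous_map (prod_topology (top_of_set {0..1::real}) (SE V cl)) (SE W cl') (Mix \<beta> \<beta>')"
proof (rule homotopy_from_plot_top_UNIV)
 fix m \<pi> assume "(m, \<pi>) \<in> SEplots V cl"
 then obtain v where v: "v ~= []" "clique V cl (set v)" "m = length v - 1" "\<pi> = step v" by (auto simp: SEplots_def)
 have lv: "length v = Suc m" using v by (cases v) auto
 have vV: "set v \<subseteq> V" using v(2) by (simp add: clique_def)
 have "\<exists>N. \<forall>w\<in>S. \<forall>k\<ge>N. \<beta> k w = \<beta>' w" if "finite S" "S \<subseteq> V" for S
  using that
 proof (induction S rule: finite_induct)
  case empty
  thus ?case by simp
 next
  case (insert w S)
  then obtain N where N: "\<forall>w\<in>S. \<forall>k\<ge>N. \<beta> k w = \<beta>' w" by blast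
  obtain N' where "\<forall>k\<ge>N'. \<beta> k w = \<beta>' w" using lim insert.prems by blast
  thus ?case using N by (intro exI[of _ "max N N'"]) auto
 qed
 then obtain N where N: "\<And>w k. w \<in> set v ==> N <= k ==> \<beta> k w = \<beta>' w" using vV by (meson finite_set)
 let ?S = "{0..1::real} \<times> cube m"
 let ?F = "\<lambda>tc. Mix \<beta> \<beta>' (fst tc, \<pi> (snd tc))"
 \<comment> \<open>The piece \<open>None\<close> covers the times so small that only indices from
   \<open>N\<close> on occur, where all maps equal the limit. The piece \<open>Some (k, T)\<close>
   covers the times at which the indices \<open>k\<close> and \<open>Suc k\<close> are in use and
   \<open>T\<close> is the set of breakpoints to the left of the cut. Its inequalities compare a
   breakpoint with the cut \<open>1 / t - 1 - k\<close>, cleared of denominators so that they are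
   closed conditions everywhere.\<close>
 define I where "I = insert None (Some ` ({..N} \<times> Pow {..<m}))"
 define piece where "piece = (\<lambda>i. case i of None => ?S \<inter> {tc. fst tc <= 1 / real (Suc N)}
   | Some (k, T) => ?S \<inter> {tc. 1 / (real k + 2) <= fst tc} \<inter> {tc. fst tc <= 1 / (real k + 1)} \<inter>
     (\<Inter>i\<in>T. {tc. (snd tc i + 1 + real k) * fst tc <= 1}) \<inter>
     (\<Inter>i\<in>{..<m} - T. {tc. 1 <= (snd tc i + 1 + real k) * fst tc}))"
 have cs: "continuous_on UNIV (\<lambda>tc::real \<times> rvec. snd tc i)" for i
  by (rule continuous_on_coord) (intro continuous_intros)
 have ct: "continuous_on UNIV (\<lambda>tc::real \<times> rvec. (snd tc i + 1 + real k) * fst tc)" for i k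
  by (intro continuous_intros cs)
 have clS: "closed ?S" by (intro closed_Times closed_cube) simp
 show "cmap ?S (SE W cl') ?F"
 proof (rule cmap_paste[of I])
  show "finite I" by (simp add: I_def)
  have "closed (piece i)" for i
  proof (cases i)
   case None
   have "closed {tc::real \<times> rvec. fst tc <= 1 / real (Suc N)}"
    by (intro closed_Collect_le continuous_intros)
   thus ?thesis unfolding piece_def None using clS by (simp add: closed_Int)
  next
   case (Some kT)
   obtain k T where kT: "kT = (k, T)" by force
   have 1: "closed {tc::real \<times> rvec. 1 / (real k + 2) <= fst tc}" "closed {tc::real \<times> rvec. fst tc <= 1 / (real k + 1)}"
    by (intro closed_Collect_le continuous_intros)+
   have 2: "closed {tc::real \<times> rvec. (snd tc i + 1 + real k) * fst tc <= 1}" "closed {tc::real \<times> rvec. 1 <= (snd tc i + 1 + real k) * fst tc}" for i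
    by (intro closed_Collect_le ct continuous_on_const)+
   show ?thesis unfolding piece_def Some kT option.case prod.case
    by (intro closed_Int closed_INT clS 1 2 ballI)
  qed
  moreover have "piece i \<subseteq> ?S" for i unfolding piece_def by (auto split: option.splits prod.splits)
  ultimately show "closedin (top_of_set ?S) (piece i)" for i by (intro closed_subset)
  show "?S \<subseteq> (\<Union>i\<in>I. piece i)"
  proof
   fix tc assume tc: "tc \<in> ?S"
   obtain t c where [simp]: "tc = (t, c)" by force
   have t: "0 <= t" "t <= 1" "c \<in> cube m" using tc by auto
   show "tc \<in> (\<Union>i\<in>I. piece i)"
   proof (cases "t <= 1 / real (Suc N)")
    case True
    hence "tc \<in> piece None" using tc by (simp add: piece_def)
    thus ?thesis by (auto simp: I_def)
   next
    case False
    hence t0: "0 < t" by (smt (verit) divide_nonneg_nonneg of_nat_0_le_iff)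
    obtain k \<theta> where k: "0 <= \<theta>" "\<theta> <= 1" "1 / t - 1 = real k + \<theta>" "real k + 1 <= 1 / t" "1 / t <= real k + 2"
     using Mix_level[OF t0 t(2)] by blast
    have "1 / t < real (Suc N)" using False t0 by (simp add: field_simps)
    hence kN: "k <= N" using k(4) by simp
    define T where "T = {i. i < m \<and> c i < \<theta>}"
    have th: "\<theta> * t = 1 - t - real k * t"
    proof -
     have "(1 / t - 1) * t = (real k + \<theta>) * t" using k(3) by simp
     thus ?thesis using t0 by (simp add: algebra_simps)
    qed
    have "(c i + 1 + real k) * t <= 1" if "i \<in> T" for i
    proof -
     have "c i * t <= \<theta> * t" using that t0 by (simp add: T_def)
     thus ?thesis using th by (simp add: algebra_simps)
    qed
    moreover have "1 <= (c i + 1 + real k) * t" if "i \<in> {..<m} - T" for i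
    proof -
     have "\<theta> * t <= c i * t" using that t0 by (auto simp: T_def)
     thus ?thesis using th by (simp add: algebra_simps)
    qed
    moreover have "1 / (real k + 2) <= t" "t <= 1 / (real k + 1)" using k(4,5) t0 by (auto simp: field_simps)
    ultimately have "tc \<in> piece (Some (k, T))" using tc by (simp add: piece_def)
    moreover have "Some (k, T) \<in> I" using kN by (auto simp: I_def T_def)
    ultimately show ?thesis by blast
   qed
  qed
  fix i assume i: "i \<in> I"
  show "cmap (piece i) (SE W cl') ?F"
  proof (cases i)
   case None
   have sW: "clique W cl' (set (map \<beta>' v))"
   proof (rule clique_subset[OF \<beta>[OF v(2), of N]])
    show "set (map \<beta>' v) \<subseteq> \<beta> (Suc N) ` set v \<union> \<beta> N ` set v" using N[of _ N] by force
   qed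
   have "cmap (piece i) (SE W cl') (\<lambda>tc. step (map \<beta>' v) (snd tc))"
   proof (rule cmap_compose[OF step_cmap[OF _ sW, of m]])
    show "continuous_on (piece i) snd" by (intro continuous_intros)
    show "snd ` piece i \<subseteq> cube m" by (auto simp: piece_def None)
   qed (use lv in auto)
   thus ?thesis
   proof (rule cmap_cong)
    fix tc assume tc: "tc \<in> piece i"
    hence t: "0 <= fst tc" "fst tc <= 1 / real (Suc N)" by (auto simp: piece_def None)
    have "?F tc = lft \<beta>' (step v (snd tc))"
    proof
     fix x
     show "?F tc x = lft \<beta>' (step v (snd tc)) x"
     proof (cases "0 <= x \<and> x < 1 \<and> fst tc > 0")
      case True
      hence "real (Suc N) <= 1 / fst tc" using t by (simp add: field_simps)
      hence "real N - 1 < 1 / fst tc - 1 - x" using True by simp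
      hence "int N <= \<lceil>1 / fst tc - 1 - x\<rceil>" by linarith
      hence "N <= nat \<lceil>1 / fst tc - 1 - x\<rceil>" by linarith
      thus ?thesis using True N[OF step_in_set[OF v(1)], of x] v(4) by (simp add: Mix_def lft_def)
     next
      case False
      thus ?thesis using v(4) by (auto simp: Mix_def lft_def)
     qed
    qed
    thus "step (map \<beta>' v) (snd tc) = ?F tc" using lft_step[OF v(1)] by metis
   qed
  next
   case (Some kT)
   then obtain k T where kT: "i = Some (k, T)" "k <= N" "T \<subseteq> {..<m}" using i by (auto simp: I_def)
   define j where "j = card T"
   have jm: "j <= m" using card_mono[of "{..<m}" T] kT(3) by (simp add: j_def)
   \<comment> \<open>The cut falls into the interval carrying entry \<open>j\<close>, so this entry
     occurs twice, once under each map. The position of the cut becomes the additional breakpoint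
     with index \<open>m\<close>.\<close>
   define v' where "v' = map (\<beta> (Suc k)) (take (Suc j) v) @ map (\<beta> k) (drop j v)"
   have lv': "length v' = Suc (Suc m)" using jm lv by (simp add: v'_def)
   have sW: "clique W cl' (set v')"
    by (rule clique_subset[OF \<beta>[OF v(2), of k]]) (auto simp: v'_def dest: in_set_takeD in_set_dropD)
   define th where "th = (\<lambda>tc::real \<times> rvec. 1 / fst tc - 1 - real k)"
   have pt: "0 < fst tc" "0 <= th tc" "th tc <= 1" "snd tc \<in> cube m"
    "\<And>i. i \<in> T ==> snd tc i <= th tc" "\<And>i. i < m ==> i \<notin> T ==> th tc <= snd tc i" if tc: "tc \<in> piece i" for tc
   proof -
    have b: "1 / (real k + 2) <= fst tc" "fst tc <= 1 / (real k + 1)" using tc by (auto simp: piece_def kT(1))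
    have "0 < 1 / (real k + 2)" by simp
    thus t0: "0 < fst tc" using b(1) by linarith
    show "0 <= th tc" "th tc <= 1" using b t0 by (auto simp: th_def field_simps)
    show "snd tc \<in> cube m" using tc by (auto simp: piece_def kT(1))
    show "snd tc i <= th tc" if "i \<in> T" for i
    proof -
     have "(snd tc i + 1 + real k) * fst tc <= 1" using tc that by (auto simp: piece_def kT(1))
     thus ?thesis using t0 by (simp add: th_def field_simps)
    qed
    show "th tc <= snd tc i" if "i < m" "i \<notin> T" for i
    proof -
     have "1 <= (snd tc i + 1 + real k) * fst tc" using tc that by (auto simp: piece_def kT(1))
     thus ?thesis using t0 by (simp add: th_def field_simps)
    qed
   qed
   have "cmap (piece i) (SE W cl') (\<lambda>tc. step v' ((snd tc)(m := th tc)))"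
   proof (rule cmap_compose[OF step_cmap[OF _ sW lv']])
    show "v' ~= []" using lv' by auto
    have "continuous_on (piece i) th"
     unfolding th_def by (intro continuous_intros) (use pt(1) in force)
    thus "continuous_on (piece i) (\<lambda>tc. (snd tc)(m := th tc))"
     by (intro continuous_on_fun_upd continuous_intros)
    show "(\<lambda>tc. (snd tc)(m := th tc)) ` piece i \<subseteq> cube (Suc m)"
     using cube_upd_Suc pt by blast
   qed
   thus ?thesis
   proof (rule cmap_cong)
    fix tc assume tc: "tc \<in> piece i"
    note p = pt[OF tc]
    let ?c = "snd tc" and ?\<theta> = "th tc"
    show "step v' (?c(m := ?\<theta>)) = ?F tc"
    proof
     fix x
     show "step v' (?c(m := ?\<theta>)) x = ?F tc x"
     proof (cases "0 <= x \<and> x < 1")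
      case False
      thus ?thesis by (auto simp: step_def Mix_def)
     next
      case True
      let ?q = "cnt m ?c x"
      have q: "?q <= m" by (rule cnt_le)
      have cc: "cnt m (?c(m := ?\<theta>)) x = ?q" by (rule cnt_cong) simp
      have F: "?F tc x = (if x < ?\<theta> then \<beta> (Suc k) (v ! ?q) else \<beta> k (v ! ?q))"
      proof -
       have e: "1 / fst tc - 1 = real k + ?\<theta>" by (simp add: th_def)
       have "Mix \<beta> \<beta>' (fst tc, step v ?c) x =
         (if x < ?\<theta> then \<beta> (Suc k) (step v ?c x) else \<beta> k (step v ?c x))"
        using True by (intro Mix_cut[OF p(2,3) e p(1)]) auto
       moreover have "step v ?c x = v ! ?q" using True lv by (simp add: step_apply)
       ultimately show ?thesis using v(4) by (simp only:)
      qed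
      show ?thesis
      proof (cases "x < ?\<theta>")
       case xt: True
       have "{i. i < m \<and> ?c i <= x} \<subseteq> T" using p(6) xt by force
       moreover have "finite T" using kT(3) finite_subset by blast
       ultimately have "?q <= j" unfolding cnt_def j_def by (intro card_mono)
       hence "?q < length (take (Suc j) v)" using jm lv by simp
       hence "v' ! ?q = \<beta> (Suc k) (v ! ?q)" by (simp add: v'_def nth_append)
       moreover have "step v' (?c(m := ?\<theta>)) x = v' ! ?q"
        using True xt lv' cc by (simp add: step_apply cnt_Suc)
       ultimately show ?thesis using F xt by simp
      next
       case xt: False
       have "T \<subseteq> {i. i < m \<and> ?c i <= x}" using p(5) xt kT(3) by force
       hence "j <= ?q" unfolding cnt_def j_def by (intro card_mono) simp_all
       hence "v' ! Suc ?q = \<beta> k (v ! ?q)" using q lv jm by (simp add: v'_def nth_append)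
       moreover have "step v' (?c(m := ?\<theta>)) x = v' ! Suc ?q"
        using True xt lv' cc by (simp add: step_apply cnt_Suc)
       ultimately show ?thesis using F xt by simp
      qed
     qed
    qed
   qed
  qed
 qed
qed

text \<open>Iterated products map the cube onto the simplex of sorted breakpoints. A coordinate 0
  makes breakpoints vanish, and a coordinate 1 merges a breakpoint with the next one or with the
  right end; so faces of the cube lose a jump. On the open cube the map is injective, and
  \<open>Ecoord\<close> recovers the coordinates as ratios of consecutive breakpoints.\<close>

definition bb :: "nat => rvec => rvec" where
 "bb n c = (\<lambda>i. if i < n then \<Prod>j\<in>{i..<n}. c j else 0)"

lemma bb_Suc: "i < n ==> bb n c i = c i * (if Suc i < n then bb n c (Suc i) else 1)"
proof -
 assume i: "i < n"
 have "(\<Prod>j\<in>{i..<n}. c j) = c i * (\<Prod>j\<in>{Suc i..<n}. c j)"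
  using i by (rule prod.atLeast_Suc_lessThan)
 moreover have "(\<Prod>j\<in>{Suc i..<n}. c j) = 1" if "\<not> Suc i < n"
  using that by simp
 ultimately show ?thesis using i by (simp add: bb_def)
qed

lemma bb_cont: "continuous_on S (bb n)"
proof (rule continuous_on_coordinatewise_then_product)
 fix i
 have "continuous_on S (\<lambda>c::rvec. \<Prod>j\<in>{i..<n}. c j)"
  by (intro continuous_on_prod continuous_on_proj)
 thus "continuous_on S (\<lambda>c. bb n c i)" by (cases "i < n") (simp_all add: bb_def)
qed

lemma bb_cube: "c \<in> cube n ==> bb n c \<in> cube n"
 by (auto simp: cube_iff bb_def intro: prod_nonneg prod_le_1)

lemma bb_open_pos: "c \<in> open_cube n ==> i < n ==> 0 < bb n c i"
 by (auto simp: bb_def open_cube_def intro: prod_pos)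

lemma bb_open_less1:
 assumes "c \<in> open_cube n" "i < n"
 shows "bb n c i < 1"
proof -
 have "bb n c \<in> cube n" using assms(1) open_cube_subset bb_cube by blast
 hence "(if Suc i < n then bb n c (Suc i) else 1) <= 1" by (auto simp: cube_iff)
 moreover have "0 < c i" "c i < 1" using assms by (auto simp: open_cube_def)
 ultimately have "c i * (if Suc i < n then bb n c (Suc i) else 1) <= c i * 1"
  by (intro mult_left_mono) auto
 thus ?thesis using bb_Suc[OF assms(2), of c] \<open>c i < 1\<close> by linarith
qed

lemma bb_open_less:
 assumes "c \<in> open_cube n" "i < j" "j < n"
 shows "bb n c i < bb n c j"
 using assms(2,3)
proof (induction j)
 case (Suc j)
 have "0 < bb n c (Suc j)" by (rule bb_open_pos[OF assms(1) Suc.prems(2)])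
 moreover have "c j < 1" using assms(1) Suc.prems by (auto simp: open_cube_def)
 ultimately have "bb n c j < bb n c (Suc j)"
  using bb_Suc[of j n c] Suc.prems(2) by simp
 thus ?case using Suc by (cases "i = j") auto
qed simp

lemma bb_open_le: "c \<in> open_cube n ==> i <= j ==> j < n ==> bb n c i <= bb n c j"
 using bb_open_less[of c n i j] by (cases "i = j") auto

definition Ecell :: "'v set => ('v => 'v => bool) => 'v list => bool" where
 "Ecell V cl e \<longleftrightarrow> e ~= [] \<and> clique V cl (set e) \<and> distinct_adj e"

definition Echar :: "'v list => rvec => real => 'v" where
 "Echar e c = step e (bb (length e - 1) c)"

definition Ecoord :: "(real => 'v) => rvec" where
 "Ecoord f = (\<lambda>i. if i < length (js f) then brk f i / (if Suc i < length (js f) then brk f (Suc i) else 1) else 0)"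

lemma vals_distinct_adj:
 assumes f: "stepfun f"
 shows "distinct_adj (vals f)"
 unfolding distinct_adj_conv_nth
proof (intro allI impI)
 fix i assume "Suc i < length (vals f)"
 hence i: "i < length (js f)" by (simp add: vals_def)
 define q where "q = (if i = 0 then 0 else brk f (i - 1))"
 have q: "0 <= q" "q < brk f i"
  using brk_01[OF f i] brk_01[OF f, of "i - 1"] brk_mono[OF f, of "i - 1" i] i by (auto simp: q_def intro: less_imp_le)
 have left: "f y = f q" if y: "q <= y" "y < brk f i" for y
 proof (rule no_jump[OF f q(1) y(1)])
  show "y < 1" using y(2) brk_01[OF f i] by simp
  show "jumps f \<inter> {q<..y} = {}"
  proof (rule ccontr)
   assume "jumps f \<inter> {q<..y} ~= {}"
   then obtain r where r: "r \<in> jumps f" "q < r" "r <= y" by auto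
   then obtain l where l: "l < length (js f)" "r = brk f l"
    using js_props(1)[OF f] by (metis brk_def in_set_conv_nth)
   show False
   proof (cases "l < i")
    case True
    hence "l <= i - 1" "i - 1 < length (js f)" "i ~= 0" using i by auto
    hence "brk f l <= brk f (i - 1)" using brk_mono[OF f, of l "i - 1"] by (cases "l = i - 1") auto
    thus False using r(2) l(2) \<open>i ~= 0\<close> by (simp add: q_def)
   next
    case False
    hence "brk f i <= brk f l" using brk_mono[OF f, of i l] l(1) by (cases "l = i") auto
    thus False using r(3) l(2) y(2) by simp
   qed
  qed
 qed
 have "\<forall>\<epsilon>>0. \<exists>y. 0 <= y \<and> brk f i - \<epsilon> < y \<and> y < brk f i \<and> f y ~= f (brk f i)"
  using brk_in[OF f i] by (simp add: jumps_def)
 then obtain y where "brk f i - (brk f i - q) < y" "y < brk f i" "f y ~= f (brk f i)"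
  using q(2) by (metis diff_gt_0_iff_gt)
 hence "f q ~= f (brk f i)" using left[of y] by simp
 moreover have "vals f ! i = f q" using i by (cases i) (auto simp: vals_def q_def brk_def)
 moreover have "vals f ! Suc i = f (brk f i)" using i by (simp add: vals_def brk_def)
 ultimately show "vals f ! i ~= vals f ! Suc i" by simp
qed

lemma Ecoord_open:
 assumes f: "stepfun f"
 shows "Ecoord f \<in> open_cube (length (js f))"
proof -
 have "0 < Ecoord f i \<and> Ecoord f i < 1" if i: "i < length (js f)" for i
 proof (cases "Suc i < length (js f)")
  case True
  thus ?thesis using brk_01[OF f i] brk_mono[OF f, of i "Suc i"] brk_01[OF f True] i
   by (simp add: Ecoord_def)
 next
  case False
  thus ?thesis using brk_01[OF f i] i by (simp add: Ecoord_def)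
 qed
 thus ?thesis by (simp add: open_cube_def Ecoord_def)
qed

lemma bb_Ecoord:
 assumes f: "stepfun f"
 shows "bb (length (js f)) (Ecoord f) = brk f"
proof
 fix i
 let ?n = "length (js f)"
 show "bb ?n (Ecoord f) i = brk f i"
 proof (cases "i < ?n")
  case True
  thus ?thesis
  proof (induction "?n - i" arbitrary: i rule: less_induct)
   case less
   show ?case
   proof (cases "Suc i < ?n")
    case True
    hence "bb ?n (Ecoord f) (Suc i) = brk f (Suc i)" using less by simp
    thus ?thesis using bb_Suc[OF less.prems, of "Ecoord f"] True less.prems brk_01[OF f True]
     by (simp add: Ecoord_def)
   next
    case False
    thus ?thesis using bb_Suc[OF less.prems, of "Ecoord f"] less.prems by (simp add: Ecoord_def)
   qed
  qed
 next
  case False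
  thus ?thesis by (simp add: bb_def brk_def)
 qed
qed

lemma Echar_normal: "stepfun f ==> Echar (vals f) (Ecoord f) = f"
 unfolding Echar_def length_vals by (simp add: bb_Ecoord step_normal)

lemma Ecell_vals: "stepfun f ==> clique V cl (f ` {0..<1}) ==> Ecell V cl (vals f)"
 unfolding Ecell_def using vals_distinct_adj[of f] clique_subset[OF _ set_vals[of f], of V cl] by (simp add: vals_def)

text \<open>In the open cube the breakpoints are strictly increasing, and distinct neighbouring
  values turn each of them into a genuine jump. Hence the normal form returns the same list and the
  ratios return the same coordinates.\<close>

lemma Echar_cell:
 assumes e: "Ecell V cl e" and c: "c \<in> open_cube (length e - 1)"
 shows "vals (Echar e c) = e" "Ecoord (Echar e c) = c"
proof -
 define n where "n = length e - 1"
 define \<beta> where "\<beta> = bb n c"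
 define f where "f = step e \<beta>"
 have fE: "Echar e c = f" by (simp add: Echar_def f_def \<beta>_def n_def)
 have le: "length e = Suc n" using e by (cases e) (auto simp: n_def Ecell_def)
 have c': "c \<in> open_cube n" using c by (simp add: n_def)
 note pos = bb_open_pos[OF c', folded \<beta>_def] and less1 = bb_open_less1[OF c', folded \<beta>_def]
  and mono = bb_open_less[OF c', folded \<beta>_def] and mono' = bb_open_le[OF c', folded \<beta>_def]
 have sf: "stepfun f" unfolding f_def by (rule stepfun_step)
 have f0: "f 0 = e ! 0"
 proof -
  have "cnt n \<beta> 0 = 0" by (rule cnt_sorted[OF mono']) (use pos in auto)
  thus ?thesis by (simp add: f_def step_apply n_def)
 qed
 have f\<beta>: "f (\<beta> i) = e ! Suc i" if i: "i < n" for i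
 proof -
  have "cnt n \<beta> (\<beta> i) = Suc i"
  proof (rule cnt_sorted[OF mono'])
   show "\<beta> l <= \<beta> i" if "l < Suc i" for l using mono'[of l i] that i by simp
   show "\<beta> i < \<beta> (Suc i)" if "Suc i < n" using mono[of i "Suc i"] that by simp
  qed (use i in auto)
  thus ?thesis using pos[OF i] less1[OF i] by (simp add: f_def step_apply n_def)
 qed
 have fl: "f x = e ! i" if i: "i < n" and x: "0 <= x" "i ~= 0 ==> \<beta> (i - 1) <= x" "x < \<beta> i" for i x
 proof -
  have "cnt n \<beta> x = i"
  proof (rule cnt_sorted[OF mono'])
   show "\<beta> l <= x" if "l < i" for l
   proof -
    have "\<beta> l <= \<beta> (i - 1)" using mono'[of l "i - 1"] that i by simp
    thus ?thesis using x(2) that by simp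
   qed
  qed (use i x in auto)
  thus ?thesis using x(1,3) less1[OF i] by (simp add: f_def step_apply n_def)
 qed
 have jumps: "jumps f = \<beta> ` {..<n}"
 proof
  show "jumps f \<subseteq> \<beta> ` {..<n}" using jumps_step[of e \<beta>] by (auto simp: f_def n_def)
  show "\<beta> ` {..<n} \<subseteq> jumps f"
  proof
   fix x assume "x \<in> \<beta> ` {..<n}"
   then obtain i where i: "i < n" "x = \<beta> i" by auto
   show "x \<in> jumps f"
    unfolding jumps_def i(2)
   proof (intro CollectI conjI allI impI)
    show "0 < \<beta> i" "\<beta> i < 1" using pos[OF i(1)] less1[OF i(1)] by auto
    fix \<epsilon> :: real assume "\<epsilon> > 0"
    define q where "q = (if i = 0 then 0 else \<beta> (i - 1))"
    have q: "0 <= q" "q < \<beta> i" using pos[OF i(1)] pos[of "i - 1"] mono[of "i - 1" i] i(1) by (auto simp: q_def intro: less_imp_le)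
    define y where "y = max q (\<beta> i - \<epsilon> / 2)"
    have y: "q <= y" "y < \<beta> i" "\<beta> i - \<epsilon> < y" using q \<open>\<epsilon> > 0\<close> by (auto simp: y_def)
    have "f y = e ! i" by (rule fl[OF i(1)]) (use y q in \<open>auto simp: q_def\<close>)
    moreover have "e ! i ~= e ! Suc i"
     using e i(1) le by (simp add: Ecell_def distinct_adj_conv_nth)
    ultimately show "\<exists>y. 0 <= y \<and> \<beta> i - \<epsilon> < y \<and> y < \<beta> i \<and> f y ~= f (\<beta> i)"
     using y q f\<beta>[OF i(1)] by (intro exI[of _ y]) auto
   qed
  qed
 qed
 have srt: "sorted (map \<beta> [0..<n])" "distinct (map \<beta> [0..<n])"
 proof -
  show "sorted (map \<beta> [0..<n])" by (rule sorted_iff_nth_mono[THEN iffD2]) (use mono' in auto)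
  have "inj_on \<beta> {0..<n}"
  proof (rule inj_onI)
   fix i j assume "i \<in> {0..<n}" "j \<in> {0..<n}" "\<beta> i = \<beta> j"
   thus "i = j" using mono[of i j] mono[of j i] by (cases i j rule: linorder_cases) auto
  qed
  thus "distinct (map \<beta> [0..<n])" by (simp add: distinct_map)
 qed
 have js: "js f = map \<beta> [0..<n]"
 proof (rule sorted_distinct_set_unique)
  show "sorted (js f)" "distinct (js f)" using js_props[OF sf] by auto
  show "set (js f) = set (map \<beta> [0..<n])" using js_props(1)[OF sf] jumps by auto
 qed (use srt in auto)
 have "vals f = e"
 proof (rule nth_equalityI)
  show "length (vals f) = length e" using le js by (simp add: vals_def)
  fix i assume "i < length (vals f)"
  hence "i < Suc n" using js by (simp add: vals_def)
  thus "vals f ! i = e ! i" using f0 f\<beta> js by (cases i) (auto simp: vals_def)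
 qed
 thus "vals (Echar e c) = e" using fE by simp
 have ljs: "length (js f) = n" using js by simp
 have brk: "brk f i = \<beta> i" if "i < n" for i using that js by (simp add: brk_def)
 have "Ecoord f i = c i" for i
 proof (cases "i < n")
  case True
  have "\<beta> i = c i * (if Suc i < n then \<beta> (Suc i) else 1)" unfolding \<beta>_def by (rule bb_Suc[OF True])
  thus ?thesis using True brk pos[of "Suc i"] by (cases "Suc i < n") (simp_all add: Ecoord_def ljs)
 next
  case False
  thus ?thesis using c' by (simp add: Ecoord_def ljs open_cube_def)
 qed
 thus "Ecoord (Echar e c) = c" using fE by auto
qed

lemma Echar_cmap:
 assumes "Ecell V cl e"
 shows "cmap (cube (length e - 1)) (SE V cl) (Echar e)"
 unfolding Echar_def
proof (rule cmap_compose[OF step_cmap bb_cont])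
 show "e ~= []" "clique V cl (set e)" using assms by (auto simp: Ecell_def)
 thus "length e = Suc (length e - 1)" by (cases e) auto
 show "bb (length e - 1) ` cube (length e - 1) \<subseteq> cube (length e - 1)" using bb_cube by blast
qed

lemma Echar_boundary:
 assumes "c \<in> cube_boundary (length e - 1)"
 shows "card (jumps (Echar e c)) < length e - 1"
proof -
 define n where "n = length e - 1"
 have c: "c \<in> cube_boundary n" using assms by (simp add: n_def)
 then obtain i where i: "i < n" "c i = 0 \<or> c i = 1" by (auto simp: cube_boundary_def)
 have jb: "jumps (Echar e c) \<subseteq> bb n c ` {..<n} \<inter> {0<..<1}"
  using jumps_step[of e "bb n c"] by (simp add: Echar_def n_def)
 have "jumps (Echar e c) \<subseteq> bb n c ` ({..<n} - {i})"
 proof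
  fix x assume "x \<in> jumps (Echar e c)"
  hence "x \<in> bb n c ` {..<n}" "x \<in> {0<..<1}" using jb by blast+
  then obtain l where l: "l < n" "x = bb n c l" "0 < x" "x < 1" by auto
  show "x \<in> bb n c ` ({..<n} - {i})"
  proof (cases "l = i")
   case True
   have b: "x = c i * (if Suc i < n then bb n c (Suc i) else 1)" using bb_Suc[OF i(1), of c] True l(2) by simp
   hence "c i = 1" using i(2) l(3) by auto
   hence "Suc i < n \<and> x = bb n c (Suc i)" using b l(4) by (auto split: if_splits)
   thus ?thesis by auto
  next
   case False
   thus ?thesis using l by auto
  qed
 qed
 hence "card (jumps (Echar e c)) <= card (bb n c ` ({..<n} - {i}))" by (intro card_mono) auto
 also have "\<dots> <= card ({..<n} - {i})" by (rule card_image_le) simp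
 also have "\<dots> < n" using i(1) by simp
 finally show ?thesis by (simp add: n_def)
qed

lemma vals_bound:
 assumes "stepfun f" "f ` {0..<1} \<subseteq> W" "card (jumps f) <= d"
 shows "vals f \<in> {l. set l \<subseteq> W \<and> length l <= Suc d}"
proof -
 have "set (vals f) \<subseteq> W" using set_vals[OF assms(1)] assms(2) by (rule order_trans)
 moreover have "length (vals f) = Suc (card (jumps f))" using js_props(4)[OF assms(1)] by (simp add: vals_def)
 ultimately show ?thesis using assms(3) by simp
qed

lemma step_image: "v ~= [] ==> step v b ` {0..<1} \<subseteq> set v"
 using step_in_set[of v _ b] by auto

lemma card_jumps_step: "card (jumps (step v b)) <= length v - 1"
proof -
 have "jumps (step v b) \<subseteq> b ` {..<length v - 1}" using jumps_step[of v b] by (rule order_trans) simp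
 hence "card (jumps (step v b)) <= card (b ` {..<length v - 1})" by (intro card_mono) auto
 also have "\<dots> <= card {..<length v - 1}" by (rule card_image_le) simp
 finally show ?thesis by simp
qed

text \<open>An injective change of values creates and destroys no jump. For a group acting on the
  values this means that it permutes the cells and preserves the coordinates in them.\<close>

lemma lft_inj:
 assumes "inj_on \<alpha> (f ` {0..<1})"
 shows "jumps (lft \<alpha> f) = jumps f" "stepfun f ==> vals (lft \<alpha> f) = map \<alpha> (vals f)"
  "Ecoord (lft \<alpha> f) = Ecoord f"
proof -
 show j: "jumps (lft \<alpha> f) = jumps f"
 proof (rule antisym[OF jumps_lft])
  show "jumps f \<subseteq> jumps (lft \<alpha> f)"
  proof
   fix x assume x: "x \<in> jumps f"
   have "\<exists>y. 0 <= y \<and> x - \<epsilon> < y \<and> y < x \<and> lft \<alpha> f y ~= lft \<alpha> f x" if "\<epsilon> > 0" for \<epsilon>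
   proof -
    from x \<open>\<epsilon> > 0\<close> obtain y where y: "0 <= y" "x - \<epsilon> < y" "y < x" "f y ~= f x" unfolding jumps_def by blast
    have x1: "0 <= x" "x < 1" using x by (auto simp: jumps_def)
    hence "\<alpha> (f y) ~= \<alpha> (f x)" using inj_onD[OF assms, of "f y" "f x"] y by auto
    hence "lft \<alpha> f y ~= lft \<alpha> f x" using x1 y by (simp add: lft_def)
    thus ?thesis using y by blast
   qed
   thus "x \<in> jumps (lft \<alpha> f)" using x by (simp add: jumps_def)
  qed
 qed
 hence js: "js (lft \<alpha> f) = js f" by (simp add: js_def)
 show "vals (lft \<alpha> f) = map \<alpha> (vals f)" if "stepfun f"
 proof -
  have "lft \<alpha> f x = \<alpha> (f x)" if "x \<in> set (js f)" for x
  proof -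
   have "x \<in> jumps f" using js_props(1)[OF \<open>stepfun f\<close>] that by simp
   thus ?thesis by (simp add: jumps_def lft_def)
  qed
  thus ?thesis using js by (simp add: vals_def lft_def)
 qed
 show "Ecoord (lft \<alpha> f) = Ecoord f" unfolding Ecoord_def brk_def js ..
qed

text \<open>The orbits of a group acting on the values are separated by the measure of the set where two step functions differ.\<close>

definition Dset :: "(real => 'v) => (real => 'v) => real set" where
 "Dset f g = {x \<in> {0..<1}. f x ~= g x}"

lemma Dset_measurable:
 assumes "stepfun f" "stepfun g"
 shows "Dset f g \<in> sets lborel"
proof -
 obtain B where B: "finite B" "\<forall>x y. 0 <= x --> x <= y --> y < 1 --> B \<inter> {x<..y} = {} --> f x = f y"
  using assms(1) by (auto simp: stepfun_def)
 obtain B' where B': "finite B'" "\<forall>x y. 0 <= x --> x <= y --> y < 1 --> B' \<inter> {x<..y} = {} --> g x = g y"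
  using assms(2) by (auto simp: stepfun_def)
 define P where "P = insert 0 (B \<union> B')"
 have "open (Dset f g - P)"
  unfolding open_dist
 proof (intro ballI)
  fix x assume x: "x \<in> Dset f g - P"
  hence x01: "0 < x" "x < 1" "f x ~= g x" "x \<notin> B" "x \<notin> B'" by (auto simp: Dset_def P_def)
  have "open ({0<..<1} - (B \<union> B'))" using B(1) B'(1) by (intro open_Diff finite_imp_closed) auto
  then obtain \<epsilon> where \<epsilon>: "\<epsilon> > 0" "\<And>y. \<bar>y - x\<bar> < \<epsilon> ==> y \<in> {0<..<1} - (B \<union> B')"
   using x01 unfolding open_dist dist_real_def by (metis DiffI UnE greaterThanLessThan_iff)
  have "y \<in> Dset f g - P" if y: "\<bar>y - x\<bar> < \<epsilon>" for y
  proof -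
   have y01: "0 < y" "y < 1" "y \<notin> B" "y \<notin> B'" using \<epsilon>(2)[OF y] by auto
   have btw: "z \<notin> B \<and> z \<notin> B'" if "min x y < z" "z <= max x y" for z
   proof -
    have "\<bar>z - x\<bar> < \<epsilon>" using that y by linarith
    thus ?thesis using \<epsilon>(2) by blast
   qed
   have "f y = f x \<and> g y = g x"
   proof (cases "x <= y")
    case True
    have "B \<inter> {x<..y} = {}" "B' \<inter> {x<..y} = {}" using btw True by auto
    hence "f x = f y" "g x = g y" using B(2) B'(2) x01 y01 True by auto
    thus ?thesis by simp
   next
    case False
    have "B \<inter> {y<..x} = {}" "B' \<inter> {y<..x} = {}" using btw False by auto
    hence "f y = f x" "g y = g x" using B(2) B'(2) x01 y01 False by auto
    thus ?thesis by simp
   qed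
   thus ?thesis using x01 y01 by (simp add: Dset_def P_def)
  qed
  thus "\<exists>e>0. \<forall>x'. dist x' x < e --> x' \<in> Dset f g - P" unfolding dist_real_def using \<epsilon>(1) by blast
 qed
 hence "Dset f g - P \<in> sets lborel" by simp
 moreover have "finite (Dset f g \<inter> P)" using B(1) B'(1) by (simp add: P_def)
 hence "Dset f g \<inter> P \<in> sets lborel" by (simp add: finite_imp_closed borel_closed)
 moreover have "Dset f g = (Dset f g - P) \<union> (Dset f g \<inter> P)" by blast
 ultimately show ?thesis by (metis sets.Un)
qed

lemma emeasure_Dset_finite: "emeasure lborel (Dset f g) < \<infinity>"
proof -
 have "emeasure lborel (Dset f g) <= emeasure lborel {0..<1::real}"
  by (rule emeasure_mono) (auto simp: Dset_def)
 also have "\<dots> < \<infinity>" by simp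
 finally show ?thesis .
qed

lemma Dset_triangle:
 assumes "stepfun f" "stepfun g" "stepfun h"
 shows "measure lborel (Dset f h) <= measure lborel (Dset f g) + measure lborel (Dset g h)"
proof -
 have fm: "Dset f g \<in> fmeasurable lborel" "Dset g h \<in> fmeasurable lborel"
  using Dset_measurable assms emeasure_Dset_finite by (auto intro!: fmeasurableI)
 have "measure lborel (Dset f h) <= measure lborel (Dset f g \<union> Dset g h)"
  by (rule measure_mono_fmeasurable) (use fm Dset_measurable assms in \<open>auto simp: Dset_def intro: fmeasurable.Un\<close>)
 also have "\<dots> <= measure lborel (Dset f g) + measure lborel (Dset g h)"
  by (rule measure_Un_le) (use fm in auto)
 finally show ?thesis .
qed

text \<open>Where the two functions differ, some breakpoint lies to the left for one parameter and
  to the right for the other; such points form the intervals between \<open>b i\<close> and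
  \<open>b' i\<close>.\<close>

lemma Dset_step:
 "measure lborel (Dset (step v b) (step v b')) <= (\<Sum>i<length v - 1. \<bar>b i - b' i\<bar>)"
proof -
 let ?I = "\<lambda>i. {min (b i) (b' i)..<max (b i) (b' i)}"
 have sub: "Dset (step v b) (step v b') \<subseteq> (\<Union>i<length v - 1. ?I i)"
 proof
  fix x assume x: "x \<in> Dset (step v b) (step v b')"
  hence "cnt (length v - 1) b x ~= cnt (length v - 1) b' x" by (auto simp: Dset_def step_apply)
  then obtain i where "i < length v - 1" "(b i <= x) ~= (b' i <= x)" using cnt_cong by metis
  thus "x \<in> (\<Union>i<length v - 1. ?I i)" by (intro UN_I[of i]) auto
 qed
 have "measure lborel (Dset (step v b) (step v b')) <= measure lborel (\<Union>i<length v - 1. ?I i)"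
  by (rule measure_mono_fmeasurable[OF sub Dset_measurable[OF stepfun_step stepfun_step]],
   rule fmeasurable.finite_UN) (simp, rule fmeasurableI, simp_all)
 also have "\<dots> <= (\<Sum>i<length v - 1. measure lborel (?I i))"
  by (rule measure_UNION_le) auto
 also have "\<dots> = (\<Sum>i<length v - 1. \<bar>b i - b' i\<bar>)"
  by (rule sum.cong) (auto simp: max_def min_def abs_if)
 finally show ?thesis .
qed

lemma Dset_open:
 assumes f: "stepfun f"
 shows "openin (SE V cl) {g \<in> plot_space (SEplots V cl). measure lborel (Dset g f) < \<eta>}"
proof (rule openin_plot_topI)
 fix n \<pi> assume "(n, \<pi>) \<in> SEplots V cl"
 then obtain v where v: "v ~= []" "clique V cl (set v)" "n = length v - 1" "\<pi> = step v" by (auto simp: SEplots_def)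
 have sp: "step v c \<in> plot_space (SEplots V cl)" if "c \<in> cube n" for c
 proof -
  have "length v = Suc n" using v(1,3) by (cases v) auto
  from cmap_in[OF step_cmap[OF v(1,2) this] that] show ?thesis by (simp add: topspace_plot_top)
 qed
 show "openin (top_of_set (cube n)) {c \<in> cube n. \<pi> c \<in> {g \<in> plot_space (SEplots V cl). measure lborel (Dset g f) < \<eta>}}"
  (is "openin _ ?S")
 proof (subst openin_subopen, intro ballI)
  fix c0 assume c0: "c0 \<in> ?S"
  define r where "r = \<eta> - measure lborel (Dset (step v c0) f)"
  have r: "r > 0" "c0 \<in> cube n" using c0 v(4) by (auto simp: r_def)
  let ?N = "cube n \<inter> {c. (\<Sum>i<n. \<bar>c i - c0 i\<bar>) < r}"
  have "open {c::rvec. (\<Sum>i<n. \<bar>c i - c0 i\<bar>) < r}"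
   by (intro open_Collect_less continuous_intros)
  hence "openin (top_of_set (cube n)) ?N" by (auto simp: openin_open)
  moreover have "c0 \<in> ?N" using r by simp
  moreover have "?N \<subseteq> ?S"
  proof
   fix c assume c: "c \<in> ?N"
   have "measure lborel (Dset (step v c) f) <= measure lborel (Dset (step v c) (step v c0)) + measure lborel (Dset (step v c0) f)"
    by (rule Dset_triangle[OF stepfun_step stepfun_step f])
   also have "measure lborel (Dset (step v c) (step v c0)) <= (\<Sum>i<n. \<bar>c i - c0 i\<bar>)" using Dset_step[of v c c0] v(3) by simp
   finally have "measure lborel (Dset (step v c) f) < \<eta>" using c by (simp add: r_def)
   thus "c \<in> ?S" using c sp v(4) by simp
  qed
  ultimately show "\<exists>T. openin (top_of_set (cube n)) T \<and> c0 \<in> T \<and> T \<subseteq> ?S" by blast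
 qed
qed blast

lemma finite_gap:
 fixes P :: "real set"
 assumes "finite P"
 shows "\<exists>\<delta>>0. \<forall>p\<in>P. \<forall>q\<in>P. p < q --> \<delta> <= q - p"
proof -
 let ?S = "insert 1 ((\<lambda>(p, q). q - p) ` {(p, q) \<in> P \<times> P. p < q})"
 have fin: "finite ?S" using assms by (auto intro: finite_subset[of _ "P \<times> P"])
 have "Min ?S > 0" using fin by (subst Min_gr_iff) auto
 moreover have "Min ?S <= q - p" if "p \<in> P" "q \<in> P" "p < q" for p q
  by (rule Min_le[OF fin]) (use that in auto)
 ultimately show ?thesis by blast
qed

text \<open>If \<open>g\<close> is close to \<open>f'\<close> and \<open>lft \<alpha> g\<close> is
  close to \<open>f\<close>, then \<open>lft \<alpha> f'\<close> differs from \<open>f\<close> on a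
  set of measure less than \<delta>, because changing values by \<alpha> cannot enlarge the set of
  differences. But that set is a union of intervals between neighbouring points of \<open>P\<close>,
  each of length at least \<delta>. So it is empty, whatever \<alpha> is.\<close>

theorem SE_separated:
 assumes f: "f \<in> topspace (SE V cl)" "f' \<in> topspace (SE V cl)"
 shows "\<exists>U U'. openin (SE V cl) U \<and> openin (SE V cl) U' \<and> f \<in> U \<and> f' \<in> U' \<and>
  (\<forall>\<alpha>. \<forall>g\<in>U'. lft \<alpha> g \<in> U --> lft \<alpha> f' = f)"
proof -
 have sf: "stepfun f" "stepfun f'" using f by (auto simp: topspace_plot_top SE_space)
 obtain B where B: "finite B" "\<forall>x y. 0 <= x --> x <= y --> y < 1 --> B \<inter> {x<..y} = {} --> f x = f y"
  using sf(1) by (auto simp: stepfun_def)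
 obtain B' where B': "finite B'" "\<forall>x y. 0 <= x --> x <= y --> y < 1 --> B' \<inter> {x<..y} = {} --> f' x = f' y"
  using sf(2) by (auto simp: stepfun_def)
 define P where "P = {0, 1} \<union> B \<union> B'"
 have finP: "finite P" using B(1) B'(1) by (simp add: P_def)
 obtain \<delta> where \<delta>: "\<delta> > 0" "\<forall>p\<in>P. \<forall>q\<in>P. p < q --> \<delta> <= q - p" using finite_gap[OF finP] by blast
 define U where "U = {g \<in> plot_space (SEplots V cl). measure lborel (Dset g f) < \<delta> / 2}"
 define U' where "U' = {g \<in> plot_space (SEplots V cl). measure lborel (Dset g f') < \<delta> / 2}"
 have D0: "Dset h h = {}" for h :: "real => 'a" by (simp add: Dset_def)
 have "f \<in> U" "f' \<in> U'" using f \<delta>(1) by (auto simp: U_def U'_def topspace_plot_top D0)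
 moreover have "openin (SE V cl) U" "openin (SE V cl) U'"
  unfolding U_def U'_def using Dset_open sf by blast+
 moreover have "lft \<alpha> f' = f" if g: "g \<in> U'" "lft \<alpha> g \<in> U" for \<alpha> g
 proof (rule ccontr)
  assume ne: "lft \<alpha> f' ~= f"
  have sg: "stepfun g" using g(1) by (simp add: U'_def SE_space)
  obtain x where x: "0 <= x" "x < 1" "lft \<alpha> f' x ~= f x"
  proof -
   from ne obtain x where "lft \<alpha> f' x ~= f x" by blast
   moreover hence "0 <= x \<and> x < 1" using stepfun_ext[OF sf(1)] by (auto simp: lft_def extensional_def split: if_splits)
   ultimately show ?thesis using that by blast
  qed
  define q where "q = Max {p \<in> P. p <= x}"
  define r where "r = Min {p \<in> P. x < p}"
  have Q: "q \<in> {p \<in> P. p <= x}" unfolding q_def using finP x by (intro Max_in) (auto simp: P_def)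
  have R: "r \<in> {p \<in> P. x < p}" unfolding r_def using finP x by (intro Min_in) (auto simp: P_def)
  have q0: "0 <= q" unfolding q_def using finP x by (intro Max_ge) (auto simp: P_def)
  have r1: "r <= 1" unfolding r_def using finP x by (intro Min_le) (auto simp: P_def)
  have noP: "p \<notin> P" if "q < p" "p < r" for p
  proof
   assume p: "p \<in> P"
   show False
   proof (cases "p <= x")
    case True
    hence "p <= q" unfolding q_def using finP p by (intro Max_ge) auto
    thus False using that by simp
   next
    case False
    hence "r <= p" unfolding r_def using finP p by (intro Min_le) auto
    thus False using that by simp
   qed
  qed
  have sub: "{q..<r} \<subseteq> Dset (lft \<alpha> f') f"
  proof
   fix y assume y: "y \<in> {q..<r}"
   have y01: "0 <= y" "y < 1" using y q0 r1 by auto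
   have e: "f q = f z \<and> f' q = f' z" if z: "q <= z" "z < r" for z
   proof -
    have "B \<inter> {q<..z} = {}" "B' \<inter> {q<..z} = {}" using noP z by (auto simp: P_def)
    thus ?thesis using B(2) B'(2) q0 z r1 by auto
   qed
   have "f y = f x \<and> f' y = f' x" using e[of y] e[of x] y Q R by auto
   hence "lft \<alpha> f' y ~= f y" using x y01 by (simp add: lft_def)
   thus "y \<in> Dset (lft \<alpha> f') f" using y01 by (simp add: Dset_def)
  qed
  have "\<delta> <= r - q" using \<delta>(2) Q R by auto
  also have "r - q = measure lborel {q..<r}" using Q R by simp
  also have "\<dots> <= measure lborel (Dset (lft \<alpha> f') f)"
   by (rule measure_mono_fmeasurable[OF sub])
    (auto intro!: fmeasurableI Dset_measurable stepfun_lft sf emeasure_Dset_finite)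
  also have "\<dots> <= measure lborel (Dset (lft \<alpha> f') (lft \<alpha> g)) + measure lborel (Dset (lft \<alpha> g) f)"
   by (intro Dset_triangle stepfun_lft sf sg)
  also have "measure lborel (Dset (lft \<alpha> f') (lft \<alpha> g)) <= measure lborel (Dset g f')"
  proof (rule measure_mono_fmeasurable)
   show "Dset (lft \<alpha> f') (lft \<alpha> g) \<subseteq> Dset g f'" by (auto simp: Dset_def lft_def)
   show "Dset (lft \<alpha> f') (lft \<alpha> g) \<in> sets lborel" by (intro Dset_measurable stepfun_lft sf sg)
   show "Dset g f' \<in> fmeasurable lborel"
    by (rule fmeasurableI[OF Dset_measurable[OF sg sf(2)] emeasure_Dset_finite])
  qed
  finally have "\<delta> <= measure lborel (Dset g f') + measure lborel (Dset (lft \<alpha> g) f)" by simp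
  thus False using g by (simp add: U_def U'_def)
 qed
 ultimately show ?thesis by blast
qed

section \<open>Free groups\<close>

lemma inv_letter_inv [simp]: "inv_letter (inv_letter a) = a"
 by (simp add: inv_letter_def)

lemma inv_letter_neq [simp]: "inv_letter a ~= a" "a ~= inv_letter a"
 by (cases a; simp add: inv_letter_def)+

lemma reduced_Nil [simp]: "reduced_word []"
 by (simp add: reduced_word_def)

lemma reduced_Cons: "reduced_word (a # w) \<longleftrightarrow> reduced_word w \<and> (w ~= [] --> hd w ~= inv_letter a)"
 by (cases w) (auto simp: reduced_word_def)

lemma reduced_append:
 "reduced_word (u @ v) \<longleftrightarrow> reduced_word u \<and> reduced_word v \<and> (u ~= [] --> v ~= [] --> hd v ~= inv_letter (last u))"
 by (auto simp: reduced_word_def successively_append_iff)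

lemma reduced_cons_reduced: "reduced_word w ==> reduced_word (reduced_cons a w)"
 by (cases w) (auto simp: reduced_Cons)

lemma reduced_cons_inv: "reduced_word w ==> reduced_cons (inv_letter a) (reduced_cons a w) = w"
 by (cases w rule: list.exhaust, simp, rename_tac b w', case_tac w') (auto simp: reduced_Cons)

lemma reduced_cons_Cons: "reduced_word (a # w) ==> reduced_cons a w = a # w"
 by (cases w) (auto simp: reduced_Cons)

abbreviation "wmul \<equiv> foldr reduced_cons"

lemma wmul_reduced: "reduced_word v ==> reduced_word (wmul u v)"
 by (induction u) (auto simp: reduced_cons_reduced)

lemma wmul_reduced_cons: "reduced_word v ==> wmul (reduced_cons a u) v = reduced_cons a (wmul u v)"
proof (cases u)
 case (Cons b u')
 assume v: "reduced_word v"
 show ?thesis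
 proof (cases "b = inv_letter a")
  case True
  hence "reduced_cons a (wmul u v) = wmul u' v"
   using reduced_cons_inv[OF wmul_reduced[OF v, of u'], of b] Cons by simp
  thus ?thesis using True Cons by simp
 qed (use Cons in simp)
qed simp

lemma wmul_assoc: "reduced_word w ==> wmul (wmul u v) w = wmul u (wmul v w)"
 by (induction u) (auto simp: wmul_reduced_cons)

lemma wmul_append: "reduced_word (u @ v) ==> wmul u v = u @ v"
proof (induction u)
 case (Cons a u)
 hence "wmul u v = u @ v" by (simp add: reduced_Cons)
 thus ?case using reduced_cons_Cons[of a "u @ v"] Cons.prems by simp
qed simp

lemma wmul_Nil: "reduced_word u ==> wmul u [] = u"
 using wmul_append[of u "[]"] by simp

definition winv :: "letter list => letter list" where "winv u = rev (map inv_letter u)"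

lemma wmul_winv: "wmul (winv u) u = []"
 by (induction u) (auto simp: winv_def)

lemma reduced_winv: "reduced_word u ==> reduced_word (winv u)"
proof (induction u)
 case (Cons a u)
 have "last (winv u) = inv_letter (hd u)" if "u ~= []" using that by (cases u) (auto simp: winv_def)
 thus ?case using Cons by (cases "u = []") (auto simp: winv_def reduced_append reduced_Cons)
qed (simp add: winv_def)

lemma set_reduced_cons: "set (reduced_cons a w) \<subseteq> insert a (set w)"
 by (cases w) auto

lemma set_wmul: "set (wmul u v) \<subseteq> set u \<union> set v"
proof (induction u)
 case (Cons a u)
 thus ?case using set_reduced_cons[of a "wmul u v"] by auto
qed simp

lemma length_wmul: "length (wmul u v) <= length u + length v"
proof (induction u)
 case (Cons a u)
 have "length (reduced_cons a w) <= Suc (length w)" for w by (cases w) auto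
 from this[of "wmul u v"] show ?case using Cons by simp
qed simp

lemma set_winv: "set u \<subseteq> UNIV \<times> K ==> set (winv u) \<subseteq> UNIV \<times> K"
 by (auto simp: winv_def inv_letter_def)

theorem group_free_group: "group (free_group k)"
proof (rule groupI)
 fix x y z assume x: "x \<in> carrier (free_group k)" and y: "y \<in> carrier (free_group k)" and z: "z \<in> carrier (free_group k)"
 show "x \<otimes>\<^bsub>free_group k\<^esub> y \<in> carrier (free_group k)"
  using x y wmul_reduced[of y x] set_wmul[of x y] by (auto simp: free_group_def)
 show "x \<otimes>\<^bsub>free_group k\<^esub> y \<otimes>\<^bsub>free_group k\<^esub> z = x \<otimes>\<^bsub>free_group k\<^esub> (y \<otimes>\<^bsub>free_group k\<^esub> z)"
  using z wmul_assoc[of z x y] by (simp add: free_group_def)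
next
 fix x assume x: "x \<in> carrier (free_group k)"
 have "winv x \<in> carrier (free_group k)" using x reduced_winv[of x] set_winv[of x] by (simp add: free_group_def)
 moreover have "winv x \<otimes>\<^bsub>free_group k\<^esub> x = \<one>\<^bsub>free_group k\<^esub>" using wmul_winv[of x] by (simp add: free_group_def)
 ultimately show "\<exists>y\<in>carrier (free_group k). y \<otimes>\<^bsub>free_group k\<^esub> x = \<one>\<^bsub>free_group k\<^esub>" by blast
qed (auto simp: free_group_def)

section \<open>The free group of rank 2, written additively, with its swap\<close>

typedef fg = "{w. set w \<subseteq> UNIV \<times> {..<2::nat} \<and> reduced_word w}"
 by (rule exI[of _ "[]"]) simp

setup_lifting type_definition_fg

instantiation fg :: group_add
begin
lift_definition zero_fg :: fg is "[]" by simp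
lift_definition plus_fg :: "fg => fg => fg" is wmul
 using set_wmul wmul_reduced by blast
lift_definition uminus_fg :: "fg => fg" is winv
 using set_winv reduced_winv by blast
definition minus_fg :: "fg => fg => fg" where "minus_fg a b = a + - b"
instance
proof
 fix a b c :: fg
 show "a + b + c = a + (b + c)" by transfer (simp add: wmul_assoc)
 show "0 + a = a" by transfer simp
 show "a + 0 = a" by transfer (simp add: wmul_Nil)
 show "- a + a = 0" by transfer (rule wmul_winv)
 show "a + - b = a - b" by (simp add: minus_fg_def)
qed
end

instance fg :: countable
proof (rule countable_classI[of "\<lambda>g. to_nat (Rep_fg g)"])
 fix x y assume "to_nat (Rep_fg x) = to_nat (Rep_fg y)"
 thus "x = y" by (simp add: Rep_fg_inject)
qed

lift_definition flen :: "fg => nat" is length .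

definition lsum :: "letter list => int" where "lsum w = (\<Sum>a\<leftarrow>w. if fst a then 1 else -1)"

lemma lsum_simps [simp]: "lsum [] = 0" "lsum (a # w) = (if fst a then 1 else -1) + lsum w" "lsum (u @ v) = lsum u + lsum v"
 by (simp_all add: lsum_def)

lemma lsum_wmul: "lsum (wmul u v) = lsum u + lsum v"
proof (induction u)
 case (Cons a u)
 have "lsum (reduced_cons a w) = (if fst a then 1 else -1) + lsum w" for w
  by (cases w) (auto simp: inv_letter_def)
 thus ?case using Cons by simp
qed simp

lift_definition fh :: "fg => int" is lsum .

lemma fh_add [simp]: "fh (a + b) = fh a + fh b"
 by transfer (rule lsum_wmul)

lemma fh_0 [simp]: "fh 0 = 0" by transfer simp

lemma fh_minus [simp]: "fh (- a) = - fh a"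
proof -
 have "fh (- a + a) = 0" by (simp only: left_minus fh_0)
 thus ?thesis unfolding fh_add by simp
qed

lemma fh_flen: "\<bar>fh a\<bar> <= int (flen a)"
proof (transfer, elim conjE)
 fix a show "\<bar>lsum a\<bar> <= int (length a)" by (induction a) auto
qed

lemma flen_0 [simp]: "flen 0 = 0" by transfer simp

lemma flen_0_iff: "flen a = 0 \<longleftrightarrow> a = 0" by transfer simp

lemma flen_minus [simp]: "flen (- a) = flen a" by transfer (simp add: winv_def)

lemma flen_add: "flen (a + b) <= flen a + flen b" by transfer (rule length_wmul)

lemma neg_add_cancel: "- (p + a) + (p + b) = - a + (b :: fg)"
 by (simp only: minus_add add.assoc minus_add_cancel)

lemma flen_sym: "flen (- a + b) = flen (- b + a)"
 using flen_minus[of "- a + b"] by (simp add: minus_add)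

lemma finite_flen: "finite {g. flen g <= n}"
proof -
 have "finite {w :: letter list. set w \<subseteq> UNIV \<times> {..<2} \<and> length w <= n}"
  by (rule finite_lists_length_le) simp
 moreover have "Rep_fg ` {g. flen g <= n} \<subseteq> {w. set w \<subseteq> UNIV \<times> {..<2} \<and> length w <= n}"
  using Rep_fg by (auto simp: flen.rep_eq)
 ultimately have "finite (Rep_fg ` {g. flen g <= n})" by (rule rev_finite_subset)
 thus ?thesis by (rule finite_imageD) (simp add: inj_on_def Rep_fg_inject)
qed

definition swl :: "letter => letter" where "swl a = (fst a, 1 - snd a)"

lemma swl_inv: "snd a < 2 ==> snd b < 2 ==> swl b = inv_letter (swl a) \<longleftrightarrow> b = inv_letter a"
 by (auto simp: swl_def inv_letter_def prod_eq_iff)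

lemma reduced_swl: "set w \<subseteq> UNIV \<times> {..<2} ==> reduced_word w ==> reduced_word (map swl w)"
proof (induction w)
 case (Cons a w)
 thus ?case using swl_inv[of a "hd w"] by (cases w) (auto simp: reduced_Cons)
qed simp

lemma wmul_swl:
 assumes "set u \<subseteq> UNIV \<times> {..<2}" "set v \<subseteq> UNIV \<times> {..<2}"
 shows "map swl (wmul u v) = wmul (map swl u) (map swl v)"
 using assms(1)
proof (induction u)
 case (Cons a u)
 have "map swl (reduced_cons a w) = reduced_cons (swl a) (map swl w)" if "set w \<subseteq> UNIV \<times> {..<2}" for w
 proof (cases w)
  case (Cons b w')
  hence "snd a < 2" "snd b < 2" using that \<open>set (a # u) \<subseteq> UNIV \<times> {..<2}\<close> by auto
  thus ?thesis using swl_inv[of a b] Cons by auto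
 qed simp
 moreover have "set (wmul u v) \<subseteq> UNIV \<times> {..<2}" using set_wmul[of u v] Cons.prems assms(2) by auto
 ultimately show ?case using Cons by simp
qed simp

lift_definition swp :: "fg => fg" is "map swl"
 by (auto simp: reduced_swl swl_def)

lemma swp_add [simp]: "swp (a + b) = swp a + swp b"
 by transfer (simp add: wmul_swl)

lemma swp_0 [simp]: "swp 0 = 0" by transfer simp

lemma swp_minus [simp]: "swp (- a) = - swp a"
proof -
 have "swp (- a) + swp a = 0" unfolding swp_add[symmetric] by simp
 thus ?thesis by (simp add: eq_neg_iff_add_eq_0)
qed

lemma swp_swp [simp]: "swp (swp a) = a"
proof (transfer, elim conjE)
 fix a :: "letter list" assume "set a \<subseteq> UNIV \<times> {..<2}"
 hence "map (swl \<circ> swl) a = a" by (intro map_idI) (auto simp: swl_def)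
 thus "map swl (map swl a) = a" by simp
qed

lemma swp_eq [simp]: "swp a = swp b \<longleftrightarrow> a = b"
 by (metis swp_swp)

text \<open>The swap acts letter by letter without any cancellation and changes the generator of
  every letter, so already the first letter of a nonempty word moves.\<close>

lemma swp_fixed: "swp a = a ==> a = 0"
proof (transfer, elim conjE)
 fix a :: "letter list" assume "set a \<subseteq> UNIV \<times> {..<2}" "map swl a = a"
 thus "a = []" by (cases a) (auto simp: swl_def prod_eq_iff, arith)
qed

lemma fh_swp [simp]: "fh (swp a) = fh a"
 by transfer (simp add: lsum_def swl_def o_def)

lemma flen_swp [simp]: "flen (swp a) = flen a"
 by transfer simp

definition sg :: "bool => fg => fg" where "sg e a = (if e then swp a else a)"

lemma sg_simps [simp]: "sg e (a + b) = sg e a + sg e b" "sg e 0 = 0" "sg e (- a) = - sg e a" "fh (sg e a) = fh a"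
  "flen (sg e a) = flen a" "sg e (sg e' a) = sg (e ~= e') a" "sg False a = a" "sg e a = sg e b \<longleftrightarrow> a = b"
 by (auto simp: sg_def)

lift_definition pow :: "bool => int => fg" is "\<lambda>i n. replicate (nat \<bar>n\<bar>) (0 < n, of_bool i)"
proof -
 have "reduced_word (replicate k a)" for k a
  by (induction k) (auto simp: reduced_Cons hd_replicate)
 thus "set (replicate (nat \<bar>n\<bar>) (0 < n, of_bool i)) \<subseteq> UNIV \<times> {..<2::nat} \<and> reduced_word (replicate (nat \<bar>n\<bar>) (0 < n, of_bool i))" for i n
  by (auto simp: set_replicate_conv_if)
qed

lemma pow_0 [simp]: "pow i 0 = 0" by transfer simp

lemma pow_Suc: "pow i (n + 1) = pow i 1 + pow i n"
proof (transfer)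
 fix i n
 show "replicate (nat \<bar>n + 1\<bar>) (0 < n + 1, of_bool i) = wmul (replicate (nat \<bar>1\<bar>) (0 < (1::int), of_bool i)) (replicate (nat \<bar>n\<bar>) (0 < n, of_bool i))"
 proof (cases "0 <= n")
  case True
  hence "nat \<bar>n + 1\<bar> = Suc (nat n)" by simp
  thus ?thesis using True by (cases "nat n") (auto simp: inv_letter_def)
 next
  case False
  hence "nat \<bar>n\<bar> = Suc (nat \<bar>n + 1\<bar>)" by simp
  thus ?thesis using False by (cases "n = -1") (auto simp: inv_letter_def)
 qed
qed

lemma pow_add: "pow i (n + m) = pow i n + pow i m"
proof (induction n rule: int_induct[where k = 0])
 case (step1 n)
 have "pow i (n + 1 + m) = pow i 1 + pow i (n + m)" using pow_Suc[of i "n + m"] by (simp add: algebra_simps)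
 also have "\<dots> = pow i (n + 1) + pow i m" unfolding step1 pow_Suc by (simp add: add.assoc)
 finally show ?case .
next
 case (step2 n)
 have "pow i 1 + pow i (n - 1 + m) = pow i (n + m)" using pow_Suc[of i "n - 1 + m"] by (simp add: algebra_simps)
 also have "\<dots> = pow i 1 + (pow i (n - 1) + pow i m)" using pow_Suc[of i "n - 1"] step2 by (simp add: add.assoc)
 finally show ?case by simp
qed simp

lemma pow_minus: "pow i (- n) = - pow i n"
 using pow_add[of i "- n" n] by (simp add: eq_neg_iff_add_eq_0)

lemma fh_pow [simp]: "fh (pow i n) = n"
proof (transfer)
 have "lsum (replicate k a) = (if fst a then int k else - int k)" for k a by (induction k) auto
 thus "lsum (replicate (nat \<bar>n\<bar>) (0 < n, of_bool i)) = n" for i n by simp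
qed

lemma flen_pow [simp]: "flen (pow i n) = nat \<bar>n\<bar>"
 by transfer simp

lemma sg_pow [simp]: "sg e (pow i n) = pow (i ~= e) n"
proof -
 have "swp (pow i n) = pow (\<not> i) n" by transfer (simp add: swl_def)
 thus ?thesis by (cases e) (simp_all add: sg_def)
qed

text \<open>The parent of an edge in the tree: a word and its parent lie in a common coset of the
  last generator.\<close>

lift_definition par :: "fg => fg" is butlast
proof -
 fix w :: "letter list" assume w: "set w \<subseteq> UNIV \<times> {..<2} \<and> reduced_word w"
 show "set (butlast w) \<subseteq> UNIV \<times> {..<2} \<and> reduced_word (butlast w)"
 proof (cases "w = []")
  case False
  hence "w = butlast w @ [last w]" by simp
  thus ?thesis using w reduced_append[of "butlast w" "[last w]"] in_set_butlastD by (metis subset_iff)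
 qed simp
qed

lemma flen_par: "g ~= 0 ==> flen (par g) < flen g"
 by transfer simp

lemma Rep_fg_add:
 assumes "reduced_word (Rep_fg a @ Rep_fg b)"
 shows "Rep_fg (a + b) = Rep_fg a @ Rep_fg b"
 using wmul_append[OF assms] by (simp add: plus_fg.rep_eq)

lemma hd_last_pow:
 assumes "k ~= 0"
 shows "Rep_fg (pow i k) ~= []" "hd (Rep_fg (pow i k)) = (0 < k, of_bool i)" "last (Rep_fg (pow i k)) = (0 < k, of_bool i)"
 using assms by (auto simp: pow.rep_eq hd_replicate last_replicate)

text \<open>A power of the other generator cannot cancel against the end of \<open>g\<close>, and a
  following power of \<open>j\<close> cannot cancel against that power. So whatever lies beyond the
  far end of the edge \<open>g\<close> is longer than \<open>g\<close>; this makes that end a leaf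
  when \<open>g\<close> has maximal length.\<close>

lemma last_generator:
 assumes "g ~= 0"
 shows "\<exists>j s. g = par g + pow j s \<and> (\<forall>k n. k ~= 0 --> flen g < flen (g + pow (\<not> j) k + pow j n))"
proof -
 define w where "w = Rep_fg g"
 have w: "w ~= []" "set w \<subseteq> UNIV \<times> {..<2}" "reduced_word w"
  using assms Rep_fg[of g] by (auto simp: w_def Rep_fg_inject[symmetric] zero_fg.rep_eq)
 have "last w \<in> UNIV \<times> {..<2}" using w last_in_set by blast
 hence "snd (last w) = 0 \<or> snd (last w) = 1" by (cases "last w") auto
 moreover define b where "b \<longleftrightarrow> snd (last w) = 1"
 ultimately have b: "snd (last w) = of_bool b" by auto
 define s where "s = (if fst (last w) then 1 else -1 :: int)"
 have ps: "Rep_fg (pow b s) = [last w]" using b by (simp add: pow.rep_eq s_def prod_eq_iff)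
 have red: "reduced_word (Rep_fg (par g) @ [last w])" using w by (simp add: par.rep_eq w_def)
 have "Rep_fg (par g + pow b s) = Rep_fg (par g) @ [last w]" using Rep_fg_add[of "par g" "pow b s"] red ps by simp
 also have "\<dots> = Rep_fg g" using w(1) by (simp add: par.rep_eq w_def)
 finally have "g = par g + pow b s" by (simp add: Rep_fg_inject)
 moreover have "flen g < flen (g + pow (\<not> b) k + pow b n)" if k: "k ~= 0" for k n
 proof -
  have R: "reduced_word (Rep_fg (pow i n))" for i n using Rep_fg[of "pow i n"] by simp
  have alt: "hd (Rep_fg (pow i l)) ~= inv_letter a" if "l ~= 0" "snd a = of_bool (\<not> i)" for i l a
  proof
   assume "hd (Rep_fg (pow i l)) = inv_letter a"
   hence "snd (hd (Rep_fg (pow i l))) = snd a" by (simp add: inv_letter_def)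
   thus False using that hd_last_pow(2)[OF that(1), of i] by (cases i) auto
  qed
  have "reduced_word (Rep_fg g @ Rep_fg (pow (\<not> b) k))"
   unfolding reduced_append using w(3) R alt[OF k, of "last w" "\<not> b"] b by (simp add: w_def)
  hence 1: "Rep_fg (g + pow (\<not> b) k) = w @ Rep_fg (pow (\<not> b) k)"
   unfolding w_def by (rule Rep_fg_add)
  have 2: "Rep_fg (g + pow (\<not> b) k + pow b n) = (w @ Rep_fg (pow (\<not> b) k)) @ Rep_fg (pow b n)"
  proof (cases "n = 0")
   case False
   have "reduced_word (w @ Rep_fg (pow (\<not> b) k))" using Rep_fg[of "g + pow (\<not> b) k"] 1 by simp
   hence "reduced_word (Rep_fg (g + pow (\<not> b) k) @ Rep_fg (pow b n))"
    unfolding 1 reduced_append[of "w @ Rep_fg (pow (\<not> b) k)"]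
    using R hd_last_pow[OF k, of "\<not> b"] alt[OF False, of "last (Rep_fg (pow (\<not> b) k))" b] by simp
   thus ?thesis using Rep_fg_add 1 by simp
  qed (use 1 in \<open>simp add: zero_fg.rep_eq\<close>)
  thus ?thesis using hd_last_pow(1)[OF k, of "\<not> b"] by (simp add: flen.rep_eq w_def)
 qed
 ultimately show ?thesis by blast
qed

lift_definition trunc :: "nat => fg => fg" is take
proof -
 fix n and w :: "letter list" assume w: "set w \<subseteq> UNIV \<times> {..<2} \<and> reduced_word w"
 thus "set (take n w) \<subseteq> UNIV \<times> {..<2} \<and> reduced_word (take n w)"
  using reduced_append[of "take n w" "drop n w"] set_take_subset[of n w] by auto
qed

lemma trunc_0 [simp]: "trunc 0 v = 0" by transfer simp

lemma trunc_ge: "flen v <= k ==> trunc k v = v" by transfer simp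

lemma common_prefix: "\<exists>p v' w'. v = p @ v' \<and> w = p @ w' \<and> (v' = [] \<or> w' = [] \<or> hd v' ~= hd w')"
proof (induction v arbitrary: w)
 case (Cons a v)
 show ?case
 proof (cases "w ~= [] \<and> hd w = a")
  case True
  obtain p v' w' where "v = p @ v'" "tl w = p @ w'" "v' = [] \<or> w' = [] \<or> hd v' ~= hd w'" using Cons[of "tl w"] by blast
  thus ?thesis using True by (intro exI[of _ "a # p"] exI[of _ v'] exI[of _ w']) (cases w, auto)
 next
  case False
  thus ?thesis by (intro exI[of _ "[]"] exI[of _ "a # v"] exI[of _ w]) auto
 qed
qed simp

lemma flen_common_prefix:
 assumes "Rep_fg v = p @ a" "Rep_fg w = p @ b"
 shows "flen (- v + w) <= length a + length b"
proof -
 have v: "p @ a \<in> {w. set w \<subseteq> UNIV \<times> {..<2} \<and> reduced_word w}" "p @ b \<in> {w. set w \<subseteq> UNIV \<times> {..<2} \<and> reduced_word w}"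
  using Rep_fg[of v] Rep_fg[of w] assms by auto
 hence R: "Rep_fg (Abs_fg p) = p" "Rep_fg (Abs_fg a) = a" "Rep_fg (Abs_fg b) = b"
  by (auto simp: Abs_fg_inverse reduced_append)
 have "v = Abs_fg p + Abs_fg a" "w = Abs_fg p + Abs_fg b"
  using Rep_fg_add[of "Abs_fg p" "Abs_fg a"] Rep_fg_add[of "Abs_fg p" "Abs_fg b"] R v assms
  by (auto simp: Rep_fg_inject[symmetric])
 hence "- v + w = - Abs_fg a + Abs_fg b" by (simp only: neg_add_cancel)
 thus ?thesis using flen_add[of "- Abs_fg a" "Abs_fg b"] R(2,3) by (simp add: flen.rep_eq[symmetric]) (simp add: flen.rep_eq R)
qed

text \<open>The distance of two words is the total length of what remains after their common prefix.
  If the prefix is cut, both truncations lie on the same path and differ by at most one letter;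
  otherwise cutting can only shorten the two remainders.\<close>

lemma flen_trunc:
 assumes "k' = k \<or> k' = Suc k"
 shows "flen (- trunc k' v + trunc k w) <= max 1 (flen (- v + w))"
proof -
 obtain p a b where pab: "Rep_fg v = p @ a" "Rep_fg w = p @ b" "a = [] \<or> b = [] \<or> hd a ~= hd b"
  using common_prefix by blast
 have v: "reduced_word (p @ a)" "reduced_word (p @ b)" "set a \<subseteq> UNIV \<times> {..<2}" "set b \<subseteq> UNIV \<times> {..<2}" "set p \<subseteq> UNIV \<times> {..<2}"
  using Rep_fg[of v] Rep_fg[of w] pab by auto
 hence R: "Rep_fg (Abs_fg p) = p" "Rep_fg (Abs_fg a) = a" "Rep_fg (Abs_fg b) = b"
  by (auto simp: Abs_fg_inverse reduced_append)
 have "v = Abs_fg p + Abs_fg a" "w = Abs_fg p + Abs_fg b"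
  using Rep_fg_add[of "Abs_fg p" "Abs_fg a"] Rep_fg_add[of "Abs_fg p" "Abs_fg b"] R v pab
  by (auto simp: Rep_fg_inject[symmetric])
 hence "- v + w = - Abs_fg a + Abs_fg b" by (simp only: neg_add_cancel)
 moreover have "reduced_word (winv a @ b)"
 proof -
  have "last (winv a) = inv_letter (hd a)" if "a ~= []" using that by (cases a) (auto simp: winv_def)
  moreover have "winv a = [] \<longleftrightarrow> a = []" by (simp add: winv_def)
  ultimately show ?thesis using v(1,2) pab(3) reduced_winv[of a] unfolding reduced_append by auto
 qed
 hence "Rep_fg (- Abs_fg a + Abs_fg b) = winv a @ b" using Rep_fg_add[of "- Abs_fg a" "Abs_fg b"] R
  by (simp add: uminus_fg.rep_eq)
 ultimately have len: "flen (- v + w) = length a + length b" by (simp add: flen.rep_eq winv_def)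
 show ?thesis
 proof (cases "length p <= k")
  case True
  hence "Rep_fg (trunc k' v) = p @ take (k' - length p) a" "Rep_fg (trunc k w) = p @ take (k - length p) b"
   using pab assms by (auto simp: trunc.rep_eq)
  from flen_common_prefix[OF this] show ?thesis using len by auto
 next
  case False
  define q where "q = take k p"
  have "k < length p" using False by simp
  have "take k' p = q @ take (k' - k) (drop k p)" unfolding q_def using assms take_add[of k "k' - k" p] by auto
  hence "Rep_fg (trunc k' v) = q @ take (k' - k) (drop k p)" "Rep_fg (trunc k w) = q @ []"
   using pab \<open>k < length p\<close> assms by (auto simp: trunc.rep_eq q_def)
  from flen_common_prefix[OF this] show ?thesis using assms by auto
 qed
qed

text \<open>These are the vertices of the Bass-Serre tree of the free product of two infinite cyclic
  groups. The tag records which generator the coset belongs to.\<close>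

definition line :: "bool => fg => bool \<times> fg set" where
 "line i g = (i, range (\<lambda>n. g + pow i n))"

definition is_line :: "bool \<times> fg set => bool" where "is_line l \<longleftrightarrow> (\<exists>i g. l = line i g)"

text \<open>Both generators have exponent sum 1, so a coset contains exactly one word of each
  exponent sum: the exponent sum is a coordinate on every line.\<close>

definition lpos :: "bool \<times> fg set => int => fg" where "lpos l t = (THE w. w \<in> snd l \<and> fh w = t)"

definition lact :: "fg => bool => bool \<times> fg set => bool \<times> fg set" where
 "lact w e l = (fst l ~= e, (\<lambda>v. w + sg e v) ` snd l)"

lemma is_line_line [simp]: "is_line (line i g)" by (auto simp: is_line_def)

lemma fst_line [simp]: "fst (line i g) = i" by (simp add: line_def)

lemma line_shift [simp]: "line i (g + pow i k) = line i g"
proof -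
 have "range (\<lambda>n. g + pow i k + pow i n) = range (\<lambda>n. g + pow i n)" (is "?A = ?B")
 proof
  show "?A \<subseteq> ?B" by (auto simp: add.assoc pow_add[symmetric])
  have "g + pow i n = g + pow i k + pow i (n - k)" for n by (simp add: add.assoc pow_add[symmetric])
  thus "?B \<subseteq> ?A" by blast
 qed
 thus ?thesis by (simp add: line_def)
qed

lemma mem_line: "g \<in> snd (line i g)"
 unfolding line_def by (auto intro: image_eqI[of _ _ 0])

lemma line_eq: "g' \<in> snd (line i g) ==> line i g' = line i g"
proof -
 assume "g' \<in> snd (line i g)"
 then obtain n where "g' = g + pow i n" by (auto simp: line_def)
 thus ?thesis by simp
qed

lemma line_eq_iff: "line i g = line i' g' \<longleftrightarrow> i = i' \<and> g \<in> snd (line i' g')"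
proof
 assume e: "line i g = line i' g'"
 hence "i = i'" by (metis fst_line)
 thus "i = i' \<and> g \<in> snd (line i' g')" using mem_line[of g i] e by simp
next
 assume "i = i' \<and> g \<in> snd (line i' g')"
 thus "line i g = line i' g'" using line_eq[of g i' g'] by simp
qed

lemma lpos_line: "lpos (line i g) t = g + pow i (t - fh g)"
 unfolding lpos_def by (rule the_equality) (auto simp: line_def)

lemma fh_lpos [simp]: "is_line l ==> fh (lpos l t) = t"
 by (auto simp: is_line_def lpos_line)

lemma line_lpos: "is_line l ==> line (fst l) (lpos l t) = l"
 by (auto simp: is_line_def lpos_line)

lemma flen_lpos: "is_line l ==> flen (- lpos l t + lpos l t') = nat \<bar>t' - t\<bar>"
proof -
 assume "is_line l"
 then obtain i g where l: "l = line i g" by (auto simp: is_line_def)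
 have "- lpos l t + lpos l t' = pow i (t' - t)"
  unfolding l lpos_line neg_add_cancel by (simp only: pow_minus[symmetric] pow_add[symmetric]) simp
 thus ?thesis by simp
qed

lemma lact_line: "lact w e (line i g) = line (i ~= e) (w + sg e g)"
 by (simp add: lact_def line_def image_image add.assoc)

lemma is_line_lact [simp]: "is_line l ==> is_line (lact w e l)"
proof -
 assume "is_line l"
 then obtain i g where "l = line i g" by (auto simp: is_line_def)
 thus ?thesis by (simp only: lact_line is_line_line)
qed

lemma lpos_lact: "is_line l ==> lpos (lact w e l) (fh w + t) = w + sg e (lpos l t)"
 by (auto simp: is_line_def lact_line lpos_line add.assoc)

lemma lact_lact: "lact w e (lact w' e' l) = lact (w + sg e w') (e ~= e') l"
 by (auto simp: lact_def image_image add.assoc)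

lemma lact_0: "lact 0 False l = l"
 by (simp add: lact_def)

section \<open>The semidirect product, its exponent sum and its closeness relation\<close>

type_synonym gp = "fg list \<times> bool"

definition gmul :: "gp => gp => gp" where
 "gmul a b = (map2 (\<lambda>w v. w + sg (snd a) v) (fst a) (fst b), snd a ~= snd b)"

definition gone :: "nat => gp" where "gone m = (replicate m 0, False)"

definition VV :: "nat => gp set" where "VV m = {p. length (fst p) = m}"

definition GG :: "nat => gp monoid" where
 "GG m = \<lparr>carrier = VV m, mult = gmul, one = gone m\<rparr>"

lemma gmul_VV [simp]: "a \<in> VV m ==> b \<in> VV m ==> gmul a b \<in> VV m"
 by (simp add: gmul_def VV_def)

lemma gmul_assoc: "gmul (gmul a b) c = gmul a (gmul b c)"
proof -
 have m: "map2 (\<lambda>w v. w + sg e (sg d v)) (map2 (\<lambda>w v. w + sg e v) as bs) cs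
  = map2 (\<lambda>w v. w + sg e v) as (map2 (\<lambda>w v. w + sg d v) bs cs)" for e d as bs cs
 proof (induction as arbitrary: bs cs)
  case (Cons a as)
  show ?case by (cases bs; cases cs) (auto simp: Cons add.assoc simp del: sg_simps(6))
 qed simp
 show ?thesis unfolding gmul_def fst_conv snd_conv sg_simps(6)[symmetric] m by auto
qed

lemma gone_VV [simp]: "gone m \<in> VV m" by (simp add: gone_def VV_def)

lemma gmul_gone: "a \<in> VV m ==> gmul (gone m) a = a"
proof -
 have "map2 (\<lambda>w v. w + v) (replicate (length as) 0) as = as" for as :: "fg list"
  by (induction as) auto
 thus "a \<in> VV m ==> gmul (gone m) a = a" by (auto simp: gmul_def gone_def VV_def)
qed

definition ginv :: "gp => gp" where "ginv a = (map (\<lambda>w. - sg (snd a) w) (fst a), snd a)"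

lemma ginv_VV [simp]: "a \<in> VV m ==> ginv a \<in> VV m"
 by (simp add: ginv_def VV_def)

lemma gmul_ginv: "a \<in> VV m ==> gmul (ginv a) a = gone m"
proof -
 have "map2 (\<lambda>w v. w + sg e v) (map (\<lambda>w. - sg e w) as) as = replicate (length as) 0" for e as
  by (induction as) auto
 thus "a \<in> VV m ==> gmul (ginv a) a = gone m" by (auto simp: gmul_def gone_def VV_def ginv_def)
qed

lemma group_GG: "group (GG m)"
proof (rule groupI)
 fix x assume "x \<in> carrier (GG m)"
 thus "\<exists>y\<in>carrier (GG m). y \<otimes>\<^bsub>GG m\<^esub> x = \<one>\<^bsub>GG m\<^esub>"
  by (intro bexI[of _ "ginv x"]) (auto simp: GG_def gmul_ginv)
qed (auto simp: GG_def gmul_assoc gmul_gone)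

lemma gmul_free:
 assumes "a \<in> VV m" "b \<in> VV m" "gmul a b = b"
 shows "a = gone m"
proof -
 interpret group "GG m" by (rule group_GG)
 show ?thesis using r_cancel_one[of b a] assms by (simp add: GG_def)
qed

definition hs :: "gp => int" where "hs p = (\<Sum>w\<leftarrow>fst p. fh w)"

lemma hs_gmul: "a \<in> VV m ==> b \<in> VV m ==> hs (gmul a b) = hs a + hs b"
proof -
 have "length as = length bs ==> (\<Sum>w\<leftarrow>map2 (\<lambda>w v. w + sg e v) as bs. fh w) = (\<Sum>w\<leftarrow>as. fh w) + (\<Sum>w\<leftarrow>bs. fh w)" for as bs e
  by (induction as bs rule: list_induct2) auto
 thus "a \<in> VV m ==> b \<in> VV m ==> ?thesis" by (simp add: hs_def gmul_def VV_def)
qed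

lemma hs_Cons [simp]: "hs (w # ws, e) = fh w + hs (ws, e)" by (simp add: hs_def)

text \<open>An entry followed by n others may move by 2^n. The later entries together then change
  the exponent sum by at most 1 + 2 + ... + 2^(n - 1) = 2^n - 1, and this is exactly how far a newly
  prepended entry has to move in \<open>vmap\<close> to compensate. Doubling the tolerance with each
  new entry therefore lets the recursion preserve cliques.\<close>

fun cll :: "fg list => fg list => bool" where
 "cll [] [] = True"
| "cll (v # vs) (w # ws) = (flen (- v + w) <= 2 ^ length vs \<and> cll vs ws)"
| "cll _ _ = False"

definition cl :: "gp => gp => bool" where "cl p q \<longleftrightarrow> cll (fst p) (fst q)"

lemma cll_hs: "cll vs ws ==> \<bar>hs (vs, e) - hs (ws, d)\<bar> <= 2 ^ length vs - 1"
proof (induction vs ws rule: cll.induct)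
 case (2 v vs w ws)
 have f: "fh (- v + w) = fh w - fh v" by simp
 have "flen (- v + w) <= 2 ^ length vs" using 2(2) by simp
 hence "int (flen (- v + w)) <= int (2 ^ length vs)" by (rule of_nat_mono)
 hence "\<bar>fh w - fh v\<bar> <= 2 ^ length vs" using fh_flen[of "- v + w"] unfolding f of_nat_power of_nat_numeral by linarith
 moreover have "\<bar>hs (vs, e) - hs (ws, d)\<bar> <= 2 ^ length vs - 1" using 2 by simp
 ultimately show ?case by simp
qed (auto simp: hs_def)

lemma cl_hs: "cl p q ==> p \<in> VV m ==> \<bar>hs p - hs q\<bar> <= 2 ^ m - 1"
 using cll_hs[of "fst p" "fst q" "snd p" "snd q"] by (simp add: cl_def VV_def)

lemma cl_gmul: "length (fst a) = length (fst p) ==> cl p q ==> cl (gmul a p) (gmul a q)"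
proof -
 have "cll vs ws ==> length as = length vs ==>
  cll (map2 (\<lambda>w v. w + sg e v) as vs) (map2 (\<lambda>w v. w + sg e v) as ws) \<and> length vs = length ws" for as vs ws e
 proof (induction vs ws arbitrary: as rule: cll.induct)
  case (2 v vs w ws)
  then obtain a as' where as: "as = a # as'" by (cases as) auto
  have "- (a + sg e v) + (a + sg e w) = sg e (- v + w)" unfolding neg_add_cancel by (simp only: sg_simps)
  hence "flen (- (a + sg e v) + (a + sg e w)) = flen (- v + w)" by (metis sg_simps(5))
  thus ?case using 2 as by simp
 qed auto
 thus "length (fst a) = length (fst p) ==> cl p q ==> ?thesis" by (simp add: cl_def gmul_def)
qed

lemma clique_gmul: "a \<in> VV m ==> clique (VV m) cl T ==> clique (VV m) cl (gmul a ` T)"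
 unfolding clique_def
proof (intro conjI ballI)
 assume a: "a \<in> VV m" and T: "T \<subseteq> VV m \<and> (\<forall>x\<in>T. \<forall>y\<in>T. cl x y)"
 show "gmul a ` T \<subseteq> VV m" using a T by auto
 fix x y assume "x \<in> gmul a ` T" "y \<in> gmul a ` T"
 then obtain x' y' where xy: "x = gmul a x'" "y = gmul a y'" "x' \<in> T" "y' \<in> T" by auto
 hence "length (fst a) = length (fst x')" "cl x' y'" using a T by (auto simp: VV_def)
 thus "cl x y" using cl_gmul xy by simp
qed

lemma finite_cl: "finite {p. cl q p}"
proof -
 have "finite {ws. cll vs ws}" for vs
 proof (induction vs)
  case Nil
  have "{ws. cll [] ws} \<subseteq> {[]}" by (auto elim: cll.elims)
  thus ?case by (rule finite_subset) simp
 next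
  case (Cons v vs)
  have "{ws. cll (v # vs) ws} \<subseteq> (\<lambda>(x, ws). (v + x) # ws) ` ({x. flen x <= 2 ^ length vs} \<times> {ws. cll vs ws})"
  proof
   fix ws assume "ws \<in> {ws. cll (v # vs) ws}"
   then obtain w ws' where w: "ws = w # ws'" "flen (- v + w) <= 2 ^ length vs" "cll vs ws'" by (cases ws) auto
   thus "ws \<in> (\<lambda>(x, ws). (v + x) # ws) ` ({x. flen x <= 2 ^ length vs} \<times> {ws. cll vs ws})"
    by (intro image_eqI[of _ _ "(- v + w, ws')"]) (auto simp: add.assoc[symmetric])
  qed
  thus ?case by (rule finite_subset) (intro finite_imageI finite_cartesian_product finite_flen Cons)
 qed
 hence "finite ({ws. cll (fst q) ws} \<times> (UNIV :: bool set))" by (intro finite_cartesian_product) auto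
 moreover have "{p. cl q p} \<subseteq> {ws. cll (fst q) ws} \<times> UNIV" by (auto simp: cl_def)
 ultimately show ?thesis by (rule rev_finite_subset)
qed

text \<open>Closeness does not look at the swap bit, so the bit may be erased in the last stage
  without leaving the cliques.\<close>

definition vtrunc :: "nat => gp => gp" where
 "vtrunc k p = (map (trunc k) (fst p), if k = 0 then False else snd p)"

lemma cll_length: "cll vs ws ==> length vs = length ws"
 by (induction vs ws rule: cll.induct) auto

lemma cll_sym: "cll vs ws ==> cll ws vs"
proof (induction vs ws rule: cll.induct)
 case (2 v vs w ws)
 thus ?case using cll_length[of vs ws] flen_sym[of v w] by simp
qed auto

lemma cll_trunc: "k' = k \<or> k' = Suc k ==> cll vs ws ==> cll (map (trunc k') vs) (map (trunc k) ws)"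
proof (induction vs ws rule: cll.induct)
 case (2 v vs w ws)
 have "flen (- trunc k' v + trunc k w) <= max 1 (flen (- v + w))" by (rule flen_trunc[OF 2(2)])
 also have "\<dots> <= 2 ^ length vs" using 2(3) by simp
 finally show ?case using 2 by simp
qed auto

lemma cl_vtrunc: "k' = k \<or> k' = Suc k ==> cl p q ==> cl (vtrunc k' p) (vtrunc k q) \<and> cl (vtrunc k q) (vtrunc k' p)"
 using cll_trunc[of k' k "fst p" "fst q"] cll_sym by (simp add: cl_def vtrunc_def)

lemma clique_vtrunc:
 assumes "clique (VV m) cl T"
 shows "clique (VV m) cl (vtrunc (Suc k) ` T \<union> vtrunc k ` T)"
 unfolding clique_def
proof (intro conjI ballI)
 have T: "T \<subseteq> VV m" "\<forall>x\<in>T. \<forall>y\<in>T. cl x y" using assms by (auto simp: clique_def)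
 thus "vtrunc (Suc k) ` T \<union> vtrunc k ` T \<subseteq> VV m" by (auto simp: VV_def vtrunc_def)
 fix x y assume "x \<in> vtrunc (Suc k) ` T \<union> vtrunc k ` T" "y \<in> vtrunc (Suc k) ` T \<union> vtrunc k ` T"
 then obtain a b i j where ab: "x = vtrunc i a" "y = vtrunc j b" "a \<in> T" "b \<in> T" "i = k \<or> i = Suc k" "j = k \<or> j = Suc k"
  by blast
 have "cl a b" "cl b a" using T(2) ab by auto
 thus "cl x y" using cl_vtrunc[of i j a b] cl_vtrunc[of j i b a] ab by (cases "i = j") auto
qed

lemma vtrunc_0: "p \<in> VV m ==> vtrunc 0 p = gone m"
proof -
 have "map (trunc 0) ws = replicate (length ws) 0" for ws by (induction ws) auto
 thus "p \<in> VV m ==> vtrunc 0 p = gone m" by (auto simp: vtrunc_def gone_def VV_def)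
qed

lemma vtrunc_limit: "\<exists>N. \<forall>k\<ge>N. vtrunc k p = p"
proof -
 have "\<exists>N. \<forall>k\<ge>N. map (trunc k) ws = ws" for ws
 proof (induction ws)
  case (Cons w ws)
  then obtain N where N: "\<forall>k\<ge>N. map (trunc k) ws = ws" by blast
  thus ?case by (intro exI[of _ "max N (flen w)"]) (auto simp: trunc_ge)
 qed simp
 then obtain N where "\<forall>k\<ge>N. map (trunc k) (fst p) = fst p" by blast
 thus ?thesis by (intro exI[of _ "Suc N"]) (auto simp: vtrunc_def prod_eq_iff)
qed

lemma cl_refl: "cl p p"
proof -
 have "cll ws ws" for ws by (induction ws) auto
 thus ?thesis by (simp add: cl_def)
qed

text \<open>Truncation contracts each tree towards the trivial word without breaking closeness.
  \<open>Mix\<close> runs through the truncations in order of decreasing length, from the identity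
  at time 0 to the constant function at time 1.\<close>

lemma weakly_contractible_SE: "weakly_contractible (SE (VV m) cl)"
proof (rule weakly_contractible_contractible)
 define f0 :: "real => gp" where "f0 = step [gone m] (\<lambda>_. 0)"
 have f0: "f0 = (\<lambda>x\<in>{0..<1}. gone m)" by (auto simp: f0_def step_def cnt_def)
 have "clique (VV m) cl {gone m}" by (simp add: clique_def cl_refl)
 from cmap_in[OF step_cmap[of "[gone m]", OF _ _ , of "VV m" cl 0]] this show "f0 \<in> topspace (SE (VV m) cl)"
  by (simp add: f0_def cube_iff)
 show "continuous_map (prod_topology (top_of_set {0..1::real}) (SE (VV m) cl)) (SE (VV m) cl) (Mix vtrunc (\<lambda>p. p))"
  by (rule Mix_cont[OF clique_vtrunc vtrunc_limit])
 fix y assume "y \<in> topspace (SE (VV m) cl)"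
 hence y: "stepfun y" "y ` {0..<1} \<subseteq> VV m" by (auto simp: topspace_plot_top SE_space clique_def)
 thus "Mix vtrunc (\<lambda>p. p) (0, y) = y" unfolding Mix_0[OF order_refl] by (intro lft_id stepfun_ext) auto
 show "Mix vtrunc (\<lambda>p. p) (1, y) = f0"
  unfolding Mix_1 f0 lft_def using y(2) by (auto intro!: restrict_ext vtrunc_0)
qed

section \<open>Trees of spaces\<close>

text \<open>
 A point \<open>Vert l s f\<close> of the \<open>m + 1\<close>-st space lies over the vertex \<open>l\<close> at level \<open>s\<close>; \<open>Edge y g u\<close> is the
 point at parameter \<open>0 < u < 1\<close> over the edge \<open>g\<close>, which joins \<open>line False g\<close> to \<open>line True g\<close>.
\<close>

datatype pt = Base int "real => gp" | Vert "bool \<times> fg set" int "real => gp" | Edge pt fg real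

abbreviation "EE m \<equiv> SE (VV m) cl"

lemma EE_val: "f \<in> topspace (EE m) ==> 0 <= x ==> x < 1 ==> f x \<in> VV m"
 by (auto simp: topspace_plot_top SE_space clique_def)

lemma EE_stepfun: "f \<in> topspace (EE m) ==> stepfun f"
 by (auto simp: topspace_plot_top SE_space)

lemma cmap_pair:
 assumes "continuous_on S h" "h ` S \<subseteq> T" "cmap S Y k"
 shows "cmap S (prod_topology (top_of_set T) Y) (\<lambda>x. (h x, k x))"
 using assms by (auto simp: continuous_map_pairwise o_def continuous_map_in_subtopology)

text \<open>The first entry is the only word in the coset \<open>l\<close> that makes the total
  exponent sum equal to \<open>s\<close>. This mirrors the vertex stabiliser in \<open>H\<close>, in
  which the first entry is a function of the others.\<close>

definition vmap :: "bool \<times> fg set => int => gp => gp" where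
 "vmap l s p = (lpos l (s - hs p) # fst p, snd p)"

definition clampi :: "int => nat => int" where "clampi d k = max (- int k) (min (int k) d)"

text \<open>From the common word \<open>g\<close> of both end vertices the first entry walks along
  one coset towards the position demanded by \<open>vmap\<close>, at most \<open>k\<close> steps
  far. Each increase of \<open>k\<close> moves it by at most one letter.\<close>

definition ebm :: "bool => fg => int => nat => gp => gp" where
 "ebm i g L k p = ((g + pow i (clampi (L - hs p) k)) # fst p, snd p)"

definition Psi :: "bool => fg => int => real \<times> (real => gp) => real => gp" where
 "Psi i g L = Mix (ebm i g L) (vmap (line i g) (L + fh g))"

primrec lev :: "pt => int" where
 "lev (Base j f) = j"
| "lev (Vert l s f) = s"
| "lev (Edge y g u) = lev y + fh g"

text \<open>The gluing at the next stage needs a map into the contractible space, defined on the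
  whole current space and equivariant. Along an edge it passes from one vertex map to the other
  through the function whose first entry is constantly \<open>g\<close>; there both halves agree by
  \<open>Psi_1\<close>.\<close>

primrec phi :: "pt => real => gp" where
 "phi (Base j f) = f"
| "phi (Vert l s f) = lft (vmap l s) f"
| "phi (Edge y g u) = (if u <= 1/2 then Psi False g (lev y) (2 * u, phi y) else Psi True g (lev y) (2 * (1 - u), phi y))"

definition edge :: "pt => fg => real => pt" where
 "edge y g u = (if u <= 0 then Vert (line False g) (lev y + fh g) (phi y)
   else if u \<ge> 1 then Vert (line True g) (lev y + fh g) (phi y) else Edge y g u)"

text \<open>An edge plot takes the full interval as its last coordinate, with \<open>edge\<close>
  turning both ends into vertex points. So the double mapping cylinder formed with
  \<open>phi\<close> is built into the topology.\<close>

primrec plots :: "nat => pt plot set" where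
 "plots 0 = {(n, \<lambda>c. Base j (\<pi> c)) | n \<pi> j. (n, \<pi>) \<in> SEplots (VV 0) cl}"
| "plots (Suc m) = {(n, \<lambda>c. Vert l s (\<pi> c)) | n \<pi> l s. is_line l \<and> (n, \<pi>) \<in> SEplots (VV m) cl} \<union>
   {(Suc n, \<lambda>c. edge (\<pi> (c(n := 0))) g (c n)) | n \<pi> g. (n, \<pi>) \<in> plots m}"

abbreviation "YY m \<equiv> plot_top (plots m)"

primrec pts :: "nat => pt set" where
 "pts 0 = {Base j f | j f. f \<in> topspace (EE 0)}"
| "pts (Suc m) = {Vert l s f | l s f. is_line l \<and> f \<in> topspace (EE m)} \<union> {Edge y g u | y g u. y \<in> pts m \<and> 0 < u \<and> u < 1}"

lemma plots_SucE:
 assumes "(n, \<pi>) \<in> plots (Suc m)"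
 obtains (v) l s \<pi>0 where "is_line l" "(n, \<pi>0) \<in> SEplots (VV m) cl" "\<pi> = (\<lambda>c. Vert l s (\<pi>0 c))"
 | (e) n0 \<pi>0 g where "n = Suc n0" "(n0, \<pi>0) \<in> plots m" "\<pi> = (\<lambda>c. edge (\<pi>0 (c(n0 := 0))) g (c n0))"
 using assms by auto

lemma plots_VertI: "is_line l ==> (n, \<pi>) \<in> SEplots (VV m) cl ==> (n, \<lambda>c. Vert l s (\<pi> c)) \<in> plots (Suc m)"
 unfolding plots.simps
 by (rule UnI1, rule CollectI, rule exI[of _ n], rule exI[of _ \<pi>], rule exI[of _ l], rule exI[of _ s]) blast

lemma plots_edgeI: "(n, \<pi>) \<in> plots m ==> (Suc n, \<lambda>c. edge (\<pi> (c(n := 0))) g (c n)) \<in> plots (Suc m)"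
 unfolding plots.simps
 by (rule UnI2, rule CollectI, rule exI[of _ n], rule exI[of _ \<pi>], rule exI[of _ g]) blast

lemma pts_Vert_iff [simp]: "Vert l s f \<in> pts (Suc m) \<longleftrightarrow> is_line l \<and> f \<in> topspace (EE m)"
 by (auto simp del: split_paired_Ex)

lemma pts_Edge_iff [simp]: "Edge y g u \<in> pts (Suc m) \<longleftrightarrow> y \<in> pts m \<and> 0 < u \<and> u < 1"
 by (auto simp del: split_paired_Ex)

lemma pts_SucE:
 assumes "y \<in> pts (Suc m)"
 obtains (v) l s f where "y = Vert l s f" "is_line l" "f \<in> topspace (EE m)"
 | (e) z g u where "y = Edge z g u" "z \<in> pts m" "0 < u" "u < 1"
 using assms by (cases y) auto

declare plots.simps(2) [simp del] pts.simps(2) [simp del]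

lemma vmap_line: "vmap (line i g) (L + fh g) p = ((g + pow i (L - hs p)) # fst p, snd p)"
 by (simp add: vmap_def lpos_line)

lemma flen_gpow: "flen (- (g + pow i a) + (g + pow i b)) = nat \<bar>b - a\<bar>"
proof -
 have "- (g + pow i a) + (g + pow i b) = pow i (b - a)"
  unfolding neg_add_cancel by (simp only: pow_minus[symmetric] pow_add[symmetric]) simp
 thus ?thesis by (simp only: flen_pow)
qed

lemma cl_Cons: "cl (v # fst p, e) (w # fst q, d) \<longleftrightarrow> flen (- v + w) <= 2 ^ length (fst p) \<and> cl p q"
 by (simp add: cl_def)

text \<open>The new first entry compensates the exponent sum of the others, which within a clique
  varies by at most 2^m - 1, less than the 2^m granted to an entry in front of \<open>m\<close>
  others.\<close>

lemma clique_vmap: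
 assumes l: "is_line l" and T: "clique (VV m) cl T"
 shows "clique (VV (Suc m)) cl (vmap l s ` T)"
 unfolding clique_def
proof (intro conjI ballI)
 have T': "T \<subseteq> VV m" "\<forall>x\<in>T. \<forall>y\<in>T. cl x y" using T by (auto simp: clique_def)
 thus "vmap l s ` T \<subseteq> VV (Suc m)" by (auto simp: VV_def vmap_def)
 fix x y assume "x \<in> vmap l s ` T" "y \<in> vmap l s ` T"
 then obtain p q where pq: "p \<in> T" "q \<in> T" "x = vmap l s p" "y = vmap l s q" by blast
 have c: "cl p q" "p \<in> VV m" using T' pq by auto
 have "\<bar>hs p - hs q\<bar> <= 2 ^ m - 1" by (rule cl_hs[OF c])
 hence "nat \<bar>s - hs q - (s - hs p)\<bar> <= 2 ^ m" by (simp add: nat_le_iff)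
 hence "flen (- lpos l (s - hs p) + lpos l (s - hs q)) <= 2 ^ m" by (simp only: flen_lpos[OF l])
 thus "cl x y" unfolding pq(3,4) vmap_def cl_Cons using c by (simp add: VV_def)
qed

lemma clampi_diff: "k' = k \<or> k' = Suc k \<or> k = Suc k' ==> \<bar>clampi d k - clampi d' k'\<bar> <= max 1 \<bar>d - d'\<bar>"
 unfolding clampi_def by (auto simp: max_def min_def)

text \<open>Clamped positions differ by no more than the unclamped ones or, if these nearly
  coincide, by the one step between consecutive bounds \<open>k\<close>. Both fit into the tolerance
  2^m, which is at least 1.\<close>

lemma clique_ebm:
 assumes T: "clique (VV m) cl T"
 shows "clique (VV (Suc m)) cl (ebm i g L (Suc k) ` T \<union> ebm i g L k ` T)"
 unfolding clique_def
proof (intro conjI ballI)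
 have T': "T \<subseteq> VV m" "\<forall>x\<in>T. \<forall>y\<in>T. cl x y" using T by (auto simp: clique_def)
 thus "ebm i g L (Suc k) ` T \<union> ebm i g L k ` T \<subseteq> VV (Suc m)" by (auto simp: VV_def ebm_def)
 fix x y assume "x \<in> ebm i g L (Suc k) ` T \<union> ebm i g L k ` T" "y \<in> ebm i g L (Suc k) ` T \<union> ebm i g L k ` T"
 then obtain p q a b where pq: "p \<in> T" "q \<in> T" "x = ebm i g L a p" "y = ebm i g L b q" "a = k \<or> a = Suc k" "b = k \<or> b = Suc k"
  by blast
 have c: "cl p q" "p \<in> VV m" using T' pq by auto
 have "\<bar>hs p - hs q\<bar> <= 2 ^ m - 1" by (rule cl_hs[OF c])
 moreover have "\<bar>clampi (L - hs q) b - clampi (L - hs p) a\<bar> <= max 1 \<bar>(L - hs q) - (L - hs p)\<bar>"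
  by (rule clampi_diff) (use pq(5,6) in auto)
 moreover have "(1::int) <= 2 ^ m" by simp
 ultimately have "\<bar>clampi (L - hs q) b - clampi (L - hs p) a\<bar> <= 2 ^ m" by linarith
 hence "nat \<bar>clampi (L - hs q) b - clampi (L - hs p) a\<bar> <= 2 ^ m" by (simp add: nat_le_iff)
 hence "flen (- (g + pow i (clampi (L - hs p) a)) + (g + pow i (clampi (L - hs q) b))) <= 2 ^ m" by (simp only: flen_gpow)
 thus "cl x y" unfolding pq(3,4) ebm_def cl_Cons using c by (simp only: VV_def) simp
qed

lemma ebm_limit: "\<exists>N. \<forall>k\<ge>N. ebm i g L k p = vmap (line i g) (L + fh g) p"
proof -
 have "clampi (L - hs p) k = L - hs p" if "nat \<bar>L - hs p\<bar> <= k" for k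
  using that by (auto simp: clampi_def max_def min_def)
 thus ?thesis unfolding vmap_line ebm_def by (intro exI[of _ "nat \<bar>L - hs p\<bar>"]) simp
qed

lemma Psi_cont: "continuous_map (prod_topology (top_of_set {0..1::real}) (EE m)) (EE (Suc m)) (Psi i g L)"
 unfolding Psi_def by (rule Mix_cont[OF clique_ebm ebm_limit])

lemma Psi_0: "t <= 0 ==> Psi i g L (t, f) = lft (vmap (line i g) (L + fh g)) f"
 unfolding Psi_def by (rule Mix_0)

lemma Psi_1: "Psi i g L (1, f) = lft (\<lambda>p. (g # fst p, snd p)) f"
 unfolding Psi_def Mix_1 by (rule lft_cong) (simp add: ebm_def clampi_def)

lemma lev_edge [simp]: "lev (edge y g u) = lev y + fh g"
 by (simp add: edge_def)

lemma phi_edge: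
 assumes "0 <= u" "u <= 1"
 shows "phi (edge y g u) = (if u <= 1/2 then Psi False g (lev y) (2 * u, phi y) else Psi True g (lev y) (2 * (1 - u), phi y))"
proof -
 consider "u = 0" | "u = 1" | "0 < u" "u < 1" using assms by linarith
 thus ?thesis by cases (simp_all add: edge_def Psi_0)
qed

lemma vmap_cont: "is_line l ==> continuous_map (EE m) (EE (Suc m)) (lft (vmap l s))"
 by (rule lft_cont[OF clique_vmap])

lemma plots_cont:
 "(n, \<pi>) \<in> plots m ==> cmap (cube n) (EE m) (\<lambda>c. phi (\<pi> c)) \<and> (\<exists>t. \<forall>c\<in>cube n. lev (\<pi> c) = t)"
proof (induction m arbitrary: n \<pi>)
 case 0
 then obtain \<pi>0 j where p: "(n, \<pi>0) \<in> SEplots (VV 0) cl" "\<pi> = (\<lambda>c. Base j (\<pi>0 c))" by auto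
 show ?case unfolding p(2) using plot_cont[OF p(1)] by simp
next
 case (Suc m)
 from Suc.prems show ?case
 proof (cases rule: plots_SucE)
  case (v l s \<pi>0)
  have "cmap (cube n) (EE (Suc m)) (\<lambda>c. lft (vmap l s) (\<pi>0 c))"
   using continuous_map_compose[OF plot_cont[OF v(2)] vmap_cont[OF v(1)]] by (simp add: o_def)
  thus ?thesis unfolding v(3) by simp
 next
  case (e n0 \<pi>0 g)
  obtain t where ih: "cmap (cube n0) (EE m) (\<lambda>c. phi (\<pi>0 c))" "\<forall>c\<in>cube n0. lev (\<pi>0 c) = t" using Suc.IH[OF e(2)] by blast
  define F where "F c = phi (\<pi>0 (c(n0 := 0)))" for c
  have upd: "(\<lambda>c. c(n0 := 0)) ` cube n \<subseteq> cube n0" using cube_Suc_upd e(1) by blast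
  have F: "cmap (cube n) (EE m) F" unfolding F_def by (rule cmap_compose[OF ih(1) continuous_on_upd_const upd])
  have c01: "0 <= c n0 \<and> c n0 <= 1" if "c \<in> cube n" for c using that by (auto simp: cube_iff)
  have ph: "phi (\<pi> c) = (if c n0 <= 1/2 then Psi False g t (2 * c n0, F c) else Psi True g t (2 * (1 - c n0), F c))" if c: "c \<in> cube n" for c
  proof -
   have "lev (\<pi>0 (c(n0 := 0))) = t" using ih(2) upd c by blast
   thus ?thesis unfolding e(3) F_def using phi_edge[of "c n0"] c01[OF c] by simp
  qed
  let ?A = "cube n \<inter> {c. c n0 <= 1/2}" and ?B = "cube n \<inter> {c. 1/2 <= c n0}"
  have "cmap ?A (prod_topology (top_of_set {0..1}) (EE m)) (\<lambda>c. (2 * c n0, F c))"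
   by (rule cmap_pair) (use c01 cmap_subset[OF F] in \<open>auto intro!: continuous_intros\<close>)
  from continuous_map_compose[OF this Psi_cont[of m False g t]]
  have "cmap ?A (EE (Suc m)) (\<lambda>c. Psi False g t (2 * c n0, F c))" by (simp add: o_def)
  hence A: "cmap ?A (EE (Suc m)) (\<lambda>c. phi (\<pi> c))" by (rule cmap_cong) (use ph in auto)
  have "cmap ?B (prod_topology (top_of_set {0..1}) (EE m)) (\<lambda>c. (2 * (1 - c n0), F c))"
   by (rule cmap_pair) (use c01 cmap_subset[OF F] in \<open>auto intro!: continuous_intros\<close>)
  from continuous_map_compose[OF this Psi_cont[of m True g t]]
  have "cmap ?B (EE (Suc m)) (\<lambda>c. Psi True g t (2 * (1 - c n0), F c))" by (simp add: o_def)
  hence B: "cmap ?B (EE (Suc m)) (\<lambda>c. phi (\<pi> c))"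
  proof (rule cmap_cong)
   fix c assume c: "c \<in> ?B"
   show "Psi True g t (2 * (1 - c n0), F c) = phi (\<pi> c)"
   proof (cases "c n0 = 1/2")
    case True
    hence e1: "2 * (1 - c n0) = 1" by auto
    show ?thesis unfolding e1 using ph[of c] c True by (simp add: Psi_1)
   qed (use ph c in auto)
  qed
  have "cmap (?A \<union> ?B) (EE (Suc m)) (\<lambda>c. phi (\<pi> c))"
   by (rule cmap_Un[OF _ _ A B]) (intro closed_Int closed_cube closed_Collect_le continuous_intros)+
  moreover have "?A \<union> ?B = cube n" by auto
  moreover have "\<forall>c\<in>cube n. lev (\<pi> c) = t + fh g" unfolding e(3) using ih(2) upd by auto
  ultimately show ?thesis by auto
 qed
qed

lemma phi_cont: "continuous_map (YY m) (EE m) phi"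
 by (rule continuous_from_plot_top) (use plots_cont in blast)

lemma plot_space_pts: "plot_space (plots m) = pts m"
proof (induction m)
 case 0
 have "plot_space (plots 0) = {Base j f | j f. f \<in> plot_space (SEplots (VV 0) cl)}" (is "?A = ?B")
 proof
  show "?A \<subseteq> ?B"
  proof
   fix y assume "y \<in> ?A"
   then obtain n \<pi> c where "(n, \<pi>) \<in> plots 0" "c \<in> cube n" "y = \<pi> c" unfolding plot_space_def by blast
   then obtain \<pi>0 j where "(n, \<pi>0) \<in> SEplots (VV 0) cl" "y = Base j (\<pi>0 c)" by auto
   thus "y \<in> ?B" using \<open>c \<in> cube n\<close> unfolding plot_space_def by blast
  qed
  show "?B \<subseteq> ?A"
  proof
   fix y assume "y \<in> ?B"
   then obtain j n \<pi> c where p: "(n, \<pi>) \<in> SEplots (VV 0) cl" "c \<in> cube n" "y = Base j (\<pi> c)" unfolding plot_space_def by blast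
   have "(n, \<lambda>c. Base j (\<pi> c)) \<in> plots 0" using p(1) by auto
   thus "y \<in> ?A" using p(2,3) unfolding plot_space_def by blast
  qed
 qed
 thus ?case by (simp add: topspace_plot_top)
next
 case (Suc m)
 have phi: "phi y \<in> topspace (EE m)" if "y \<in> pts m" for y
  using phi_cont[of m] that Suc by (auto simp: continuous_map_def topspace_plot_top)
 show ?case
 proof
  show "plot_space (plots (Suc m)) \<subseteq> pts (Suc m)"
  proof
   fix y assume "y \<in> plot_space (plots (Suc m))"
   then obtain n \<pi> c where c: "(n, \<pi>) \<in> plots (Suc m)" "c \<in> cube n" "y = \<pi> c" unfolding plot_space_def by blast
   from c(1) show "y \<in> pts (Suc m)"
   proof (cases rule: plots_SucE)
    case (v l s \<pi>0)
    thus ?thesis using c(2,3) cmap_in[OF plot_cont[OF v(2)] c(2)] by simp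
   next
    case (e n0 \<pi>0 g)
    have "c(n0 := 0) \<in> cube n0" using c(2) e(1) cube_Suc_upd by blast
    hence "\<pi>0 (c(n0 := 0)) \<in> plot_space (plots m)" using e(2) unfolding plot_space_def by blast
    hence "\<pi>0 (c(n0 := 0)) \<in> pts m" using Suc by simp
    thus ?thesis using phi c(3) e(3) by (auto simp: edge_def)
   qed
  qed
  show "pts (Suc m) \<subseteq> plot_space (plots (Suc m))"
  proof
   fix y assume "y \<in> pts (Suc m)"
   thus "y \<in> plot_space (plots (Suc m))"
   proof (cases rule: pts_SucE)
    case (v l s f)
    have "f \<in> plot_space (SEplots (VV m) cl)" using v(3) by (simp add: topspace_plot_top)
    then obtain n \<pi> c where c: "(n, \<pi>) \<in> SEplots (VV m) cl" "c \<in> cube n" "f = \<pi> c"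
     unfolding plot_space_def by blast
    have "(n, \<lambda>c. Vert l s (\<pi> c)) \<in> plots (Suc m)" by (rule plots_VertI[OF v(2) c(1)])
    thus ?thesis unfolding plot_space_def using c(2,3) v(1) by blast
   next
    case (e z g u)
    have "z \<in> plot_space (plots m)" using e(2) Suc by simp
    then obtain n \<pi> c where c: "(n, \<pi>) \<in> plots m" "c \<in> cube n" "z = \<pi> c"
     unfolding plot_space_def by blast
    have p: "(Suc n, \<lambda>c. edge (\<pi> (c(n := 0))) g (c n)) \<in> plots (Suc m)" by (rule plots_edgeI[OF c(1)])
    have "c(n := u) \<in> cube (Suc n)" using cube_upd_Suc[OF c(2)] e by simp
    moreover have "y = edge (\<pi> ((c(n := u))(n := 0))) g ((c(n := u)) n)"
     using cube_upd0[OF c(2)] c(3) e by (simp add: edge_def)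
    ultimately show ?thesis unfolding plot_space_def using p by blast
   qed
  qed
 qed
qed

lemma topspace_YY: "topspace (YY m) = pts m"
 by (simp add: topspace_plot_top plot_space_pts)

lemma phi_EE: "y \<in> pts m ==> phi y \<in> topspace (EE m)"
 using phi_cont[of m] by (auto simp: continuous_map_def topspace_YY)

lemma edge_pts: "y \<in> pts m ==> edge y g u \<in> pts (Suc m)"
 using phi_EE by (auto simp: edge_def)

lemma edge_cont: "continuous_map (prod_topology (top_of_set {0..1::real}) (YY m)) (YY (Suc m)) (\<lambda>z. edge (snd z) g (fst z))"
proof (rule homotopy_from_plot_top_UNIV)
 fix n \<pi> assume p: "(n, \<pi>) \<in> plots m"
 have "(Suc n, \<lambda>c. edge (\<pi> (c(n := 0))) g (c n)) \<in> plots (Suc m)" by (rule plots_edgeI[OF p])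
 note pl = plot_cont[OF this]
 have co: "continuous_on ({0..1::real} \<times> cube n) (\<lambda>tc. (snd tc)(n := fst tc))"
  by (intro continuous_on_fun_upd continuous_intros)
 have im: "(\<lambda>tc. (snd tc)(n := fst tc)) ` ({0..1::real} \<times> cube n) \<subseteq> cube (Suc n)"
  using cube_upd_Suc by auto
 have "cmap ({0..1::real} \<times> cube n) (YY (Suc m)) (\<lambda>tc. edge (\<pi> (((snd tc)(n := fst tc))(n := 0))) g (((snd tc)(n := fst tc)) n))"
  by (rule cmap_compose[OF pl co im])
 thus "cmap ({0..1::real} \<times> cube n) (YY (Suc m)) (\<lambda>tc. edge (snd (fst tc, \<pi> (snd tc))) g (fst (fst tc, \<pi> (snd tc))))"
  by (rule cmap_cong) (use cube_upd0 in auto)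
qed

lemma Vert_cont: "is_line l ==> continuous_map (EE m) (YY (Suc m)) (Vert l s)"
proof (rule continuous_from_plot_top)
 fix n \<pi> assume "is_line l" "(n, \<pi>) \<in> SEplots (VV m) cl"
 hence "(n, \<lambda>c. Vert l s (\<pi> c)) \<in> plots (Suc m)" by (rule plots_VertI)
 thus "cmap (cube n) (YY (Suc m)) (\<lambda>c. Vert l s (\<pi> c))" by (rule plot_cont)
qed

lemma Base_cont: "continuous_map (EE 0) (YY 0) (Base j)"
proof (rule continuous_from_plot_top)
 fix n \<pi> assume "(n, \<pi>) \<in> SEplots (VV 0) cl"
 hence "(n, \<lambda>c. Base j (\<pi> c)) \<in> plots 0" by auto
 thus "cmap (cube n) (YY 0) (\<lambda>c. Base j (\<pi> c))" by (rule plot_cont)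
qed

text \<open>The height is locally constant: an edge and its two ends carry the same level. So the
  space is the disjoint union of its level sets, each built directly and not cut out of something
  larger, and the full group permutes them.\<close>

lemma lev_open: "openin (YY m) {y \<in> pts m. lev y = t}"
proof (rule openin_plot_topI)
 fix n \<pi> assume p: "(n, \<pi>) \<in> plots m"
 obtain t' where t': "\<forall>c\<in>cube n. lev (\<pi> c) = t'" using plots_cont[OF p] by blast
 have "\<pi> c \<in> pts m" if "c \<in> cube n" for c using cmap_in[OF plot_cont[OF p] that] by (simp add: topspace_YY)
 hence "{c \<in> cube n. \<pi> c \<in> {y \<in> pts m. lev y = t}} = (if t' = t then cube n else {})" using t' by auto
 thus "openin (top_of_set (cube n)) {c \<in> cube n. \<pi> c \<in> {y \<in> pts m. lev y = t}}"
  by simp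
qed (auto simp: plot_space_pts)

section \<open>The group action on the trees of spaces\<close>

definition ghd :: "gp => fg" where "ghd a = hd (fst a)"
definition gtl :: "gp => gp" where "gtl a = (tl (fst a), snd a)"

lemma VV_SucE: "a \<in> VV (Suc m) ==> \<exists>w ws e. a = (w # ws, e) \<and> (ws, e) \<in> VV m"
 by (cases a; cases "fst a") (auto simp: VV_def)

lemma gtl_VV [simp]: "a \<in> VV (Suc m) ==> gtl a \<in> VV m" by (auto simp: gtl_def VV_def)

lemma snd_gtl [simp]: "snd (gtl a) = snd a" by (simp add: gtl_def)

lemma hs_gtl: "a \<in> VV (Suc m) ==> hs a = fh (ghd a) + hs (gtl a)"
 using VV_SucE[of a m] by (auto simp: ghd_def gtl_def)

lemma gmul_gtl:
 assumes "a \<in> VV (Suc m)" "b \<in> VV (Suc m)"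
 shows "gtl (gmul a b) = gmul (gtl a) (gtl b)" "ghd (gmul a b) = ghd a + sg (snd a) (ghd b)"
proof -
 obtain w ws e where "a = (w # ws, e)" using VV_SucE[OF assms(1)] by blast
 moreover obtain v vs d where "b = (v # vs, d)" using VV_SucE[OF assms(2)] by blast
 ultimately show "gtl (gmul a b) = gmul (gtl a) (gtl b)" "ghd (gmul a b) = ghd a + sg (snd a) (ghd b)"
  by (simp_all add: gmul_def gtl_def ghd_def)
qed

lemma gone_gtl: "gtl (gone (Suc m)) = gone m" "ghd (gone (Suc m)) = 0" "snd (gone m) = False"
 by (simp_all add: gone_def gtl_def ghd_def)

lemma gmul_push: "a \<in> VV (Suc m) ==>
 gmul a (v # fst p, snd p) = ((ghd a + sg (snd a) v) # fst (gmul (gtl a) p), snd (gmul (gtl a) p))"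
 using VV_SucE[of a m] by (auto simp: gmul_def ghd_def gtl_def)

lemma gmul_vmap:
 assumes "a \<in> VV (Suc m)" "p \<in> VV m" "is_line l"
 shows "gmul a (vmap l s p) = vmap (lact (ghd a) (snd a) l) (s + hs a) (gmul (gtl a) p)"
proof -
 have e: "s + hs a - hs (gmul (gtl a) p) = fh (ghd a) + (s - hs p)"
  using hs_gtl[OF assms(1)] hs_gmul[OF gtl_VV[OF assms(1)] assms(2)] by simp
 show ?thesis unfolding vmap_def gmul_push[OF assms(1)] e lpos_lact[OF assms(3)] ..
qed

lemma gmul_ebm:
 assumes "a \<in> VV (Suc m)" "p \<in> VV m"
 shows "gmul a (ebm i g L k p) = ebm (i ~= snd a) (ghd a + sg (snd a) g) (L + hs (gtl a)) k (gmul (gtl a) p)"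
proof -
 have "L + hs (gtl a) - hs (gmul (gtl a) p) = L - hs p"
  using hs_gmul[OF gtl_VV[OF assms(1)] assms(2)] by simp
 thus ?thesis unfolding ebm_def gmul_push[OF assms(1)] by (simp only: sg_simps sg_pow add.assoc)
qed

lemma Mix_lft: "Mix \<beta> \<beta>' (t, lft \<alpha> f) = Mix (\<lambda>k v. \<beta> k (\<alpha> v)) (\<lambda>v. \<beta>' (\<alpha> v)) (t, f)"
 unfolding Mix_def lft_def prod.case by (rule restrict_ext) simp

lemma lft_Mix: "lft \<gamma> (Mix \<beta> \<beta>' (t, f)) = Mix (\<lambda>k v. \<gamma> (\<beta> k v)) (\<lambda>v. \<gamma> (\<beta>' v)) (t, f)"
 unfolding Mix_def lft_def prod.case by (rule restrict_ext) simp

lemma Mix_cong: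
 assumes "\<And>x k. 0 <= x ==> x < 1 ==> \<beta> k (f x) = \<gamma> k (f x)" "\<And>x. 0 <= x ==> x < 1 ==> \<beta>' (f x) = \<gamma>' (f x)"
 shows "Mix \<beta> \<beta>' (t, f) = Mix \<gamma> \<gamma>' (t, f)"
 unfolding Mix_def prod.case by (rule restrict_ext) (use assms in simp)

lemma Psi_act:
 assumes a: "a \<in> VV (Suc m)" and f: "f \<in> topspace (EE m)"
 shows "lft (gmul a) (Psi i g L (t, f)) =
  Psi (i ~= snd a) (ghd a + sg (snd a) g) (L + hs (gtl a)) (t, lft (gmul (gtl a)) f)"
 unfolding Psi_def Mix_lft lft_Mix
proof (rule Mix_cong)
 fix x :: real assume x: "0 <= x" "x < 1"
 have v: "f x \<in> VV m" by (rule EE_val[OF f x])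
 show "gmul a (ebm i g L k (f x)) = ebm (i ~= snd a) (ghd a + sg (snd a) g) (L + hs (gtl a)) k (gmul (gtl a) (f x))" for k
  by (rule gmul_ebm[OF a v])
 have "L + fh g + hs a = L + hs (gtl a) + fh (ghd a + sg (snd a) g)" using hs_gtl[OF a] by simp
 thus "gmul a (vmap (line i g) (L + fh g) (f x)) =
  vmap (line (i ~= snd a) (ghd a + sg (snd a) g)) (L + hs (gtl a) + fh (ghd a + sg (snd a) g)) (gmul (gtl a) (f x))"
  unfolding gmul_vmap[OF a v is_line_line] lact_line by (simp only:)
qed

text \<open>Levels rise by the exponent sum of the acting element, so its kernel preserves each
  level. The swap exchanges the two types of vertices, hence it reverses the direction of
  edges.\<close>

primrec act :: "pt => gp => pt" where
 "act (Base j f) a = Base (j + hs a) (lft (gmul a) f)"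
| "act (Vert l s f) a = Vert (lact (ghd a) (snd a) l) (s + hs a) (lft (gmul (gtl a)) f)"
| "act (Edge y g u) a = Edge (act y (gtl a)) (ghd a + sg (snd a) g) (if snd a then 1 - u else u)"

lemma gmul_cont: "a \<in> VV m ==> continuous_map (EE m) (EE m) (lft (gmul a))"
 by (rule lft_cont[OF clique_gmul])

lemma gmul_EE: "a \<in> VV m ==> f \<in> topspace (EE m) ==> lft (gmul a) f \<in> topspace (EE m)"
 using gmul_cont[of a m] by (auto simp: continuous_map_def)

lemma act_props:
 "y \<in> pts m ==> a \<in> VV m ==> phi (act y a) = lft (gmul a) (phi y) \<and> lev (act y a) = lev y + hs a \<and> act y a \<in> pts m"
proof (induction m arbitrary: y a)
 case 0
 thus ?case using gmul_EE[OF 0(2)] by auto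
next
 case (Suc m)
 note a = Suc.prems(2)
 from Suc.prems(1) show ?case
 proof (cases rule: pts_SucE)
  case (v l s f)
  have "lft (gmul a) (lft (vmap l s) f) = lft (vmap (lact (ghd a) (snd a) l) (s + hs a)) (lft (gmul (gtl a)) f)"
   unfolding lft_lft by (rule lft_cong) (rule gmul_vmap[OF a EE_val[OF v(3)] v(2)])
  thus ?thesis using v gmul_EE[OF gtl_VV[OF a]] by simp
 next
  case (e z g u)
  note ih = Suc.IH[OF e(2) gtl_VV[OF a]]
  have p: "phi z \<in> topspace (EE m)" by (rule phi_EE[OF e(2)])
  have P: "Psi True g L (1, f) = Psi False g L (1, f)" for g L f unfolding Psi_1 ..
  have "phi (act y a) = lft (gmul a) (phi y)"
  proof (cases "snd a")
   case True
   consider "u < 1/2" | "u = 1/2" | "u > 1/2" by linarith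
   thus ?thesis
   proof cases
    \<comment> \<open>Reflection exchanges the two branches of \<open>phi\<close> but fixes the
      midpoint, which \<open>phi\<close> always evaluates by its first branch. The branches agree
      there by \<open>P\<close>.\<close>
    case 2
    hence h: "1 - u = 1/2" "2 * u = 1" by auto
    show ?thesis using e(1) ih True 2 h Psi_act[OF a p, of False g "lev z" 1] P by simp
   qed (use e(1) ih True Psi_act[OF a p, of False g "lev z" "2 * u"] Psi_act[OF a p, of True g "lev z" "2 * (1 - u)"] in simp_all)
  qed (use e(1) ih Psi_act[OF a p, of False g "lev z" "2 * u"] Psi_act[OF a p, of True g "lev z" "2 * (1 - u)"] in simp)
  thus ?thesis using e ih hs_gtl[OF a] by simp
 qed
qed

lemma act_edge:
 assumes "y \<in> pts m" "a \<in> VV (Suc m)" "0 <= u" "u <= 1"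
 shows "act (edge y g u) a = edge (act y (gtl a)) (ghd a + sg (snd a) g) (if snd a then 1 - u else u)"
proof -
 note ih = act_props[OF assms(1) gtl_VV[OF assms(2)]]
 consider "u = 0" | "u = 1" | "0 < u" "u < 1" using assms by linarith
 thus ?thesis by cases (use ih hs_gtl[OF assms(2)] in \<open>simp_all add: edge_def lact_line\<close>)
qed

lemma lft_gmul: "lft (gmul a) (lft (gmul b) f) = lft (gmul (gmul a b)) f"
 unfolding lft_lft gmul_assoc[symmetric] ..

lemma act_mult: "y \<in> pts m ==> a \<in> VV m ==> b \<in> VV m ==> act y (gmul a b) = act (act y b) a"
proof (induction m arbitrary: y a b)
 case 0
 thus ?case by (auto simp: lft_gmul hs_gmul[of a 0 b])
next
 case (Suc m)
 have g: "gtl (gmul a b) = gmul (gtl a) (gtl b)" "ghd (gmul a b) = ghd a + sg (snd a) (ghd b)"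
  using gmul_gtl[OF Suc.prems(2,3)] by auto
 have s: "snd (gmul a b) = (snd a ~= snd b)" by (simp add: gmul_def)
 have h: "hs (gmul a b) = hs b + hs a" using hs_gmul[OF Suc.prems(2,3)] by simp
 from Suc.prems(1) show ?case
 proof (cases rule: pts_SucE)
  case (v l s f)
  thus ?thesis by (simp add: g s h lact_lact lft_gmul)
 next
  case (e z g u)
  show ?thesis using Suc.IH[OF e(2) gtl_VV[OF Suc.prems(2)] gtl_VV[OF Suc.prems(3)]] e(1)
   by (simp add: g s add.assoc)
 qed
qed

lemma lft_gone: "f \<in> topspace (EE m) ==> lft (gmul (gone m)) f = f"
 by (rule lft_id[OF stepfun_ext[OF EE_stepfun]]) (auto intro: gmul_gone EE_val)

lemma act_one: "y \<in> pts m ==> act y (gone m) = y"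
proof (induction m arbitrary: y)
 case 0
 thus ?case using lft_gone[of _ 0] by (auto simp: gone_def hs_def)
next
 case (Suc m)
 have "hs (gone (Suc m)) = 0" by (simp add: gone_def hs_def sum_list_replicate)
 from Suc.prems this Suc.IH lft_gone[of _ m] show ?case by (cases rule: pts_SucE) (simp_all add: gone_gtl lact_0)
qed

lemma act_cont: "a \<in> VV m ==> continuous_map (YY m) (YY m) (\<lambda>y. act y a)"
proof (induction m arbitrary: a)
 case 0
 show ?case
 proof (rule continuous_from_plot_top)
  fix n \<pi> assume "(n, \<pi>) \<in> plots 0"
  then obtain \<pi>0 j where p: "(n, \<pi>0) \<in> SEplots (VV 0) cl" "\<pi> = (\<lambda>c. Base j (\<pi>0 c))" by auto
  show "cmap (cube n) (YY 0) (\<lambda>c. act (\<pi> c) a)"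
   using continuous_map_compose[OF continuous_map_compose[OF plot_cont[OF p(1)] gmul_cont[OF 0]] Base_cont[of "j + hs a"]]
   by (simp add: p(2) o_def)
 qed
next
 case (Suc m)
 show ?case
 proof (rule continuous_from_plot_top)
  fix n \<pi> assume "(n, \<pi>) \<in> plots (Suc m)"
  thus "cmap (cube n) (YY (Suc m)) (\<lambda>c. act (\<pi> c) a)"
  proof (cases rule: plots_SucE)
   case (v l s \<pi>0)
   show ?thesis
    using continuous_map_compose[OF continuous_map_compose[OF plot_cont[OF v(2)] gmul_cont[OF gtl_VV[OF Suc.prems]]]
      Vert_cont[OF is_line_lact[OF v(1)], of m "ghd a" "snd a" "s + hs a"]]
    by (simp add: v(3) o_def)
  next
   case (e n0 \<pi>0 g)
   have upd: "(\<lambda>c. c(n0 := 0)) ` cube n \<subseteq> cube n0" using cube_Suc_upd e(1) by blast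
   have 1: "cmap (cube n) (YY m) (\<lambda>c. \<pi>0 (c(n0 := 0)))" by (rule cmap_compose[OF plot_cont[OF e(2)] continuous_on_upd_const upd])
   have 2: "cmap (cube n) (YY m) (\<lambda>c. act (\<pi>0 (c(n0 := 0))) (gtl a))"
    using continuous_map_compose[OF 1 Suc.IH[OF gtl_VV[OF Suc.prems]]] by (simp add: o_def)
   have c01: "0 <= c n0 \<and> c n0 <= 1" if "c \<in> cube n" for c using that by (auto simp: cube_iff)
   have "continuous_on (cube n) (\<lambda>c. if snd a then 1 - c n0 else c n0)"
    by (cases "snd a") (auto intro!: continuous_intros)
   hence "cmap (cube n) (prod_topology (top_of_set {0..1}) (YY m)) (\<lambda>c. (if snd a then 1 - c n0 else c n0, act (\<pi>0 (c(n0 := 0))) (gtl a)))"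
    by (rule cmap_pair[OF _ _ 2]) (use c01 in auto)
   from continuous_map_compose[OF this edge_cont[of m "ghd a + sg (snd a) g"]]
   have "cmap (cube n) (YY (Suc m)) (\<lambda>c. edge (act (\<pi>0 (c(n0 := 0))) (gtl a)) (ghd a + sg (snd a) g) (if snd a then 1 - c n0 else c n0))"
    by (simp add: o_def)
   thus ?thesis
   proof (rule cmap_cong)
    fix c assume c: "c \<in> cube n"
    have "\<pi>0 (c(n0 := 0)) \<in> pts m" using cmap_in[OF 1 c] by (simp add: topspace_YY)
    thus "edge (act (\<pi>0 (c(n0 := 0))) (gtl a)) (ghd a + sg (snd a) g) (if snd a then 1 - c n0 else c n0) = act (\<pi> c) a"
     unfolding e(3) using act_edge[OF _ Suc.prems, of "\<pi>0 (c(n0 := 0))" "c n0" g] c01[OF c] by simp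
   qed
  qed
 qed
qed

section \<open>Separation of orbits\<close>

definition side :: "bool \<times> fg set => real => real => bool" where
 "side l \<kappa> u = (if fst l then \<kappa> < u else \<kappa> < 1 - u)"

text \<open>An edge contributes its points at distance less than 1 - \<kappa> from the vertex
  \<open>l\<close>. With \<kappa> = 0 this is the open star; with \<kappa> = 1/2 the stars of the
  two ends of an edge do not overlap. \<open>W\<close> restricts the step functions at the vertex
  and, through \<open>phi\<close>, on the edges.\<close>

definition star :: "nat => bool \<times> fg set => int => real => (real => gp) set => pt set" where
 "star m l s \<kappa> W = {y \<in> pts (Suc m). lev y = s \<and>
   (case y of Base j f => False | Vert l' s' f => l' = l \<and> f \<in> W | Edge z g u => g \<in> snd l \<and> phi z \<in> W \<and> side l \<kappa> u)}"

lemma line_mem: "is_line l ==> line (fst l) g = l \<longleftrightarrow> g \<in> snd l"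
proof -
 assume "is_line l"
 then obtain i h where l: "l = line i h" by (auto simp: is_line_def)
 show ?thesis unfolding l fst_line by (simp add: line_eq_iff)
qed

lemma edge_star:
 assumes "z \<in> pts m" "0 <= u" "u <= 1" "is_line l" "0 <= \<kappa>" "\<kappa> < 1"
 shows "edge z g u \<in> star m l s \<kappa> W \<longleftrightarrow> lev z + fh g = s \<and> g \<in> snd l \<and> phi z \<in> W \<and> side l \<kappa> u"
proof -
 have pe: "edge z g u \<in> pts (Suc m)" by (rule edge_pts[OF assms(1)])
 have ln: "line i g = l \<longleftrightarrow> i = fst l \<and> g \<in> snd l" for i
 proof -
  have "fst l = i" if "line i g = l" using that by auto
  thus ?thesis using line_mem[OF assms(4), of g] by auto
 qed
 consider "u = 0" | "u = 1" | "0 < u" "u < 1" using assms by linarith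
 thus ?thesis using pe assms(5,6) by cases (auto simp: star_def edge_def side_def ln)
qed

lemma openin_cube_Collect: "open S ==> openin (top_of_set (cube n)) {c \<in> cube n. c \<in> S}"
 by (auto simp: openin_open)

lemma star_open:
 assumes l: "is_line l" and W: "openin (EE m) W" and \<kappa>: "0 <= \<kappa>" "\<kappa> < 1"
 shows "openin (YY (Suc m)) (star m l s \<kappa> W)"
proof (rule openin_plot_topI)
 show "star m l s \<kappa> W \<subseteq> plot_space (plots (Suc m))" by (auto simp: star_def plot_space_pts)
 fix n \<pi> assume p: "(n, \<pi>) \<in> plots (Suc m)"
 have inp: "\<pi> c \<in> pts (Suc m)" if "c \<in> cube n" for c using cmap_in[OF plot_cont[OF p] that] by (simp add: topspace_YY)
 from p show "openin (top_of_set (cube n)) {c \<in> cube n. \<pi> c \<in> star m l s \<kappa> W}"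
 proof (cases rule: plots_SucE)
  case (v l' s' \<pi>0)
  have "{c \<in> cube n. \<pi> c \<in> star m l s \<kappa> W} = (if l' = l \<and> s' = s then {c \<in> cube n. \<pi>0 c \<in> W} else {})"
   using inp by (auto simp: v(3) star_def)
  moreover have "openin (top_of_set (cube n)) {c \<in> cube n. \<pi>0 c \<in> W}"
   using openin_continuous_map_preimage[OF plot_cont[OF v(2)] W] by simp
  ultimately show ?thesis by simp
 next
  case (e n0 \<pi>0 g)
  obtain t where t: "\<forall>c\<in>cube n0. lev (\<pi>0 c) = t" using plots_cont[OF e(2)] by blast
  have upd: "c(n0 := 0) \<in> cube n0" if "c \<in> cube n" for c using cube_Suc_upd e(1) that by blast
  have in0: "\<pi>0 c \<in> pts m" if "c \<in> cube n0" for c using cmap_in[OF plot_cont[OF e(2)] that] by (simp add: topspace_YY)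
  have ph: "cmap (cube n) (EE m) (\<lambda>c. phi (\<pi>0 (c(n0 := 0))))"
   by (rule cmap_compose[OF _ continuous_on_upd_const, of "cube n0" "EE m" "\<lambda>c. phi (\<pi>0 c)"]) (use upd plots_cont[OF e(2)] in auto)
  have "\<pi> c \<in> star m l s \<kappa> W \<longleftrightarrow> (t + fh g = s \<and> g \<in> snd l) \<and> phi (\<pi>0 (c(n0 := 0))) \<in> W \<and> side l \<kappa> (c n0)" if c: "c \<in> cube n" for c
  proof -
   have "0 <= c n0" "c n0 <= 1" using c by (auto simp: cube_iff)
   from edge_star[OF in0[OF upd[OF c]] this l \<kappa>] show ?thesis using t upd[OF c] by (auto simp: e(3))
  qed
  hence E: "{c \<in> cube n. \<pi> c \<in> star m l s \<kappa> W} = (if t + fh g = s \<and> g \<in> snd l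
   then {c \<in> cube n. phi (\<pi>0 (c(n0 := 0))) \<in> W} \<inter> {c \<in> cube n. c \<in> {c. side l \<kappa> (c n0)}} else {})" by auto
  have A: "openin (top_of_set (cube n)) {c \<in> cube n. phi (\<pi>0 (c(n0 := 0))) \<in> W}"
   using openin_continuous_map_preimage[OF ph W] by simp
  have "open {c::rvec. side l \<kappa> (c n0)}"
   unfolding side_def by (cases "fst l") (auto intro!: open_Collect_less continuous_intros)
  hence B: "openin (top_of_set (cube n)) {c \<in> cube n. c \<in> {c. side l \<kappa> (c n0)}}" by (rule openin_cube_Collect)
  show ?thesis unfolding E using openin_Int[OF A B] by (cases "t + fh g = s \<and> g \<in> snd l") (simp_all only: simp_thms if_True if_False openin_empty)
 qed
qed

lemma cmap_plot_pair:
 assumes "(n, \<pi>) \<in> plots m"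
 shows "cmap (cube (Suc n)) (prod_topology (top_of_set {0..1}) (YY m)) (\<lambda>c. (c n, \<pi> (c(n := 0))))"
proof (rule cmap_pair)
 show "cmap (cube (Suc n)) (YY m) (\<lambda>c. \<pi> (c(n := 0)))"
  by (rule cmap_compose[OF plot_cont[OF assms] continuous_on_upd_const]) (use cube_Suc_upd in auto)
 show "(\<lambda>c. c n) ` cube (Suc n) \<subseteq> {0..1}" by (auto simp: cube_iff)
qed (intro continuous_intros)

lemma open_edges:
 assumes Q: "openin (prod_topology (top_of_set {0..1}) (YY m)) Q" "Q \<subseteq> {0<..<1} \<times> UNIV"
 shows "openin (YY (Suc m)) {Edge z g u | z u. (u, z) \<in> Q}" (is "openin _ ?E")
proof (rule openin_plot_topI)
 have zp: "z \<in> pts m" if "(u, z) \<in> Q" for u z using openin_subset[OF Q(1)] that by (auto simp: topspace_YY)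
 show "?E \<subseteq> plot_space (plots (Suc m))" using zp Q(2) by (auto simp: plot_space_pts)
 fix n \<pi> assume "(n, \<pi>) \<in> plots (Suc m)"
 thus "openin (top_of_set (cube n)) {c \<in> cube n. \<pi> c \<in> ?E}"
 proof (cases rule: plots_SucE)
  case (v l s \<pi>0)
  hence E: "{c \<in> cube n. \<pi> c \<in> ?E} = {}" by auto
  show ?thesis unfolding E by simp
 next
  case (e n0 \<pi>0 g0)
  have "\<pi> c \<in> ?E \<longleftrightarrow> g0 = g \<and> (c n0, \<pi>0 (c(n0 := 0))) \<in> Q" for c
   using Q(2) by (auto simp: e(3) edge_def split: if_splits)
  hence E: "{c \<in> cube n. \<pi> c \<in> ?E} = (if g0 = g then {c \<in> cube n. (c n0, \<pi>0 (c(n0 := 0))) \<in> Q} else {})" by auto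
  have "openin (top_of_set (cube n)) {c \<in> cube n. (c n0, \<pi>0 (c(n0 := 0))) \<in> Q}"
   using openin_continuous_map_preimage[OF cmap_plot_pair[OF e(2)] Q(1)] e(1) by simp
  thus ?thesis unfolding E by simp
 qed
qed

text \<open>The distance to the nearer end is invariant under reversal of edges and vanishes exactly
  at the vertices, so it separates vertex points from edge points for the whole group at
  once.\<close>

primrec depth :: "pt => real" where
 "depth (Base j f) = 0"
| "depth (Vert l s f) = 0"
| "depth (Edge z g u) = min u (1 - u)"

lemma depth_act: "depth (act y a) = depth y"
 by (cases y) auto

lemma depth_open:
 assumes "open T"
 shows "openin (YY (Suc m)) {y \<in> pts (Suc m). depth y \<in> T}"
proof (rule openin_plot_topI)
 fix n \<pi> assume p: "(n, \<pi>) \<in> plots (Suc m)"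
 have inp: "\<pi> c \<in> pts (Suc m)" if "c \<in> cube n" for c using cmap_in[OF plot_cont[OF p] that] by (simp add: topspace_YY)
 from p have "\<exists>d. continuous_on UNIV d \<and> (\<forall>c. depth (\<pi> c) = d c)"
 proof (cases rule: plots_SucE)
  case (v l s \<pi>0)
  thus ?thesis by (intro exI[of _ "\<lambda>_. 0"]) auto
 next
  case (e n0 \<pi>0 g)
  have "continuous_on UNIV (\<lambda>c::rvec. max 0 (min (c n0) (1 - c n0)))" by (intro continuous_intros)
  moreover have "\<forall>c. depth (\<pi> c) = max 0 (min (c n0) (1 - c n0))" by (auto simp: e(3) edge_def max_def min_def)
  ultimately show ?thesis by blast
 qed
 then obtain d where d: "continuous_on UNIV d" "\<forall>c. depth (\<pi> c) = d c" by blast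
 have op: "open {c. d c \<in> T}" using open_vimage[OF assms d(1)] by (simp add: vimage_def)
 have E: "{c \<in> cube n. \<pi> c \<in> {y \<in> pts (Suc m). depth y \<in> T}} = {c \<in> cube n. c \<in> {c. d c \<in> T}}"
  using inp d(2) by auto
 show "openin (top_of_set (cube n)) {c \<in> cube n. \<pi> c \<in> {y \<in> pts (Suc m). depth y \<in> T}}"
  unfolding E by (rule openin_cube_Collect[OF op])
qed (auto simp: plot_space_pts)

lemma Base_open:
 assumes "openin (EE 0) W"
 shows "openin (YY 0) (Base j ` W)"
proof (rule openin_plot_topI)
 show "Base j ` W \<subseteq> plot_space (plots 0)" using openin_subset[OF assms] unfolding plot_space_pts by auto
 fix n \<pi> assume "(n, \<pi>) \<in> plots 0"
 then obtain \<pi>0 j0 where p: "(n, \<pi>0) \<in> SEplots (VV 0) cl" "\<pi> = (\<lambda>c. Base j0 (\<pi>0 c))" by auto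
 have "{c \<in> cube n. \<pi> c \<in> Base j ` W} = (if j0 = j then {c \<in> cube n. \<pi>0 c \<in> W} else {})" by (auto simp: p(2))
 moreover have "openin (top_of_set (cube n)) {c \<in> cube n. \<pi>0 c \<in> W}"
  using openin_continuous_map_preimage[OF plot_cont[OF p(1)] assms] by simp
 ultimately show "openin (top_of_set (cube n)) {c \<in> cube n. \<pi> c \<in> Base j ` W}" by simp
qed

definition separated :: "nat => pt => pt => bool" where
 "separated m y y' \<longleftrightarrow> (\<exists>U U'. openin (YY m) U \<and> openin (YY m) U' \<and> y \<in> U \<and> y' \<in> U' \<and>
   (\<forall>a\<in>VV m. \<forall>z\<in>U'. act z a \<in> U --> act y' a = y))"

lemma separatedI:
 assumes "openin (YY m) U" "openin (YY m) U'" "y \<in> U" "y' \<in> U'"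
  "\<And>a z. a \<in> VV m ==> z \<in> U' ==> act z a \<in> U ==> act y' a = y"
 shows "separated m y y'"
 unfolding separated_def by (rule exI[of _ U], rule exI[of _ U']) (use assms in blast)

lemma separated_Base:
 assumes "f \<in> topspace (EE 0)" "f' \<in> topspace (EE 0)"
 shows "separated 0 (Base j f) (Base j' f')"
proof -
 obtain U U' where U: "openin (EE 0) U" "openin (EE 0) U'" "f \<in> U" "f' \<in> U'"
  "\<forall>\<alpha>. \<forall>g\<in>U'. lft \<alpha> g \<in> U --> lft \<alpha> f' = f" using SE_separated[OF assms] by (elim exE conjE)
 show ?thesis
 proof (rule separatedI[OF Base_open[OF U(1)] Base_open[OF U(2)]])
  fix a z assume "z \<in> Base j' ` U'" "act z a \<in> Base j ` U"
  then obtain g where g: "g \<in> U'" "j' + hs a = j" "lft (gmul a) g \<in> U" by auto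
  hence "lft (gmul a) f' = f" using U(5) by blast
  thus "act (Base j' f') a = Base j f" using g by simp
 qed (use U in auto)
qed

text \<open>A point of a half star knows to which end of its edge it belongs, even after a reversal.
  So an element that carries a point of one half star into another carries the vertices to each
  other; the step functions are compared by \<open>SE_separated\<close>, via \<open>phi\<close> for
  points on edges.\<close>

lemma separated_Vert:
 assumes l: "is_line l" "is_line l'" and f: "f \<in> topspace (EE m)" "f' \<in> topspace (EE m)"
 shows "separated (Suc m) (Vert l s f) (Vert l' s' f')"
proof -
 obtain U U' where U: "openin (EE m) U" "openin (EE m) U'" "f \<in> U" "f' \<in> U'"
  "\<forall>\<alpha>. \<forall>g\<in>U'. lft \<alpha> g \<in> U --> lft \<alpha> f' = f" using SE_separated[OF f] by (elim exE conjE)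
 show ?thesis
 proof (rule separatedI[OF star_open[OF l(1) U(1), of "1/2" s] star_open[OF l(2) U(2), of "1/2" s']])
  fix a z assume a: "a \<in> VV (Suc m)" and z: "z \<in> star m l' s' (1/2) U'" "act z a \<in> star m l s (1/2) U"
  have zp: "z \<in> pts (Suc m)" "lev z = s'" using z(1) by (auto simp: star_def)
  have "lev (act z a) = s" using z(2) by (simp add: star_def)
  hence s: "s' + hs a = s" using act_props[OF zp(1) a] zp(2) by simp
  from zp(1) have "lact (ghd a) (snd a) l' = l \<and> lft (gmul (gtl a)) f' = f"
  proof (cases rule: pts_SucE)
   case (v k t h)
   hence "k = l'" "h \<in> U'" "lact (ghd a) (snd a) k = l" "lft (gmul (gtl a)) h \<in> U" using z by (auto simp: star_def)
   thus ?thesis using U(5) by blast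
  next
   case (e w g u)
   have 1: "g \<in> snd l'" "phi w \<in> U'" "side l' (1/2) u" using z(1) by (auto simp: star_def e(1))
   have 2: "ghd a + sg (snd a) g \<in> snd l" "phi (act w (gtl a)) \<in> U" "side l (1/2) (if snd a then 1 - u else u)"
    using z(2) by (auto simp: star_def e(1))
   have "fst l = (fst l' ~= snd a)" using 1(3) 2(3) by (auto simp: side_def split: if_splits)
   moreover have "l' = line (fst l') g" by (rule line_mem[OF l(2), THEN iffD2, OF 1(1), symmetric])
   hence "lact (ghd a) (snd a) l' = line (fst l' ~= snd a) (ghd a + sg (snd a) g)" by (metis lact_line)
   moreover have "line (fst l) (ghd a + sg (snd a) g) = l" using line_mem[OF l(1)] 2(1) by simp
   ultimately have "lact (ghd a) (snd a) l' = l" by simp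
   moreover have "lft (gmul (gtl a)) (phi w) \<in> U" using act_props[OF e(2) gtl_VV[OF a]] 2(2) by simp
   hence "lft (gmul (gtl a)) f' = f" using U(5) 1(2) by blast
   ultimately show ?thesis by simp
  qed
  thus "act (Vert l' s' f') a = Vert l s f" using s by simp
 qed (use U l f in \<open>auto simp: star_def\<close>)
qed

text \<open>A group element may reverse an edge, so both \<open>u'\<close> and its mirror image have
  to be kept away from \<open>u\<close> unless they equal it. The factor 2 leaves room for a window
  of radius \<delta> around each of the two points.\<close>

lemma flip_gap: "\<exists>\<delta>>0. \<forall>v\<in>{u', 1 - u'}. v ~= u --> 2 * \<delta> <= \<bar>v - (u::real)\<bar>"
proof -
 define d where "d v = (if v = u then 1 else \<bar>v - u\<bar> / 2)" for v
 have d: "0 < d v" for v by (simp add: d_def)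
 have "2 * min (d u') (d (1 - u')) <= \<bar>v - u\<bar>" if "v \<in> {u', 1 - u'}" "v ~= u" for v
 proof -
  have "min (d u') (d (1 - u')) <= d v" using that(1) by auto
  moreover have "d v = \<bar>v - u\<bar> / 2" using that(2) by (simp add: d_def)
  ultimately show ?thesis by simp
 qed
 thus ?thesis using d[of u'] d[of "1 - u'"] by (intro exI[of _ "min (d u') (d (1 - u'))"]) auto
qed

lemma separated_Edge:
 assumes w: "w \<in> pts m" "w' \<in> pts m" "separated m w w'" and u: "0 < u" "u < 1" "0 < u'" "u' < 1"
 shows "separated (Suc m) (Edge w g u) (Edge w' g' u')"
proof -
 obtain U U' where U: "openin (YY m) U" "openin (YY m) U'" "w \<in> U" "w' \<in> U'"
  "\<forall>a\<in>VV m. \<forall>z\<in>U'. act z a \<in> U --> act w' a = w" using w(3) unfolding separated_def by (elim exE conjE)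
 obtain \<delta> where \<delta>: "\<delta> > 0" "\<forall>v\<in>{u', 1 - u'}. v ~= u --> 2 * \<delta> <= \<bar>v - u\<bar>" using flip_gap by blast
 define I where "I x = {0<..<1} \<inter> {x - \<delta><..<x + \<delta>}" for x :: real
 have I: "openin (top_of_set {0..1}) (I x)" for x
  unfolding I_def by (rule open_subset) auto
 have O: "openin (YY (Suc m)) {Edge z g r | z r. (r, z) \<in> I x \<times> V}" if "openin (YY m) V" for V x g
  by (rule open_edges) (use I that in \<open>auto simp: openin_prod_Times_iff I_def\<close>)
 show ?thesis
 proof (rule separatedI[OF O[OF U(1), of g u] O[OF U(2), of g' u']])
  show "Edge w g u \<in> {Edge z g r | z r. (r, z) \<in> I u \<times> U}" "Edge w' g' u' \<in> {Edge z g' r | z r. (r, z) \<in> I u' \<times> U'}"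
   using U u \<delta>(1) by (auto simp: I_def)
  fix a z assume a: "a \<in> VV (Suc m)" and z: "z \<in> {Edge z g' r | z r. (r, z) \<in> I u' \<times> U'}"
   "act z a \<in> {Edge z g r | z r. (r, z) \<in> I u \<times> U}"
  then obtain y r where y: "z = Edge y g' r" "r \<in> I u'" "y \<in> U'" by auto
  have 2: "act y (gtl a) \<in> U" "ghd a + sg (snd a) g' = g" "(if snd a then 1 - r else r) \<in> I u" using z(2) y(1) by auto
  have "act w' (gtl a) = w" using U(5) gtl_VV[OF a] y(3) 2(1) by blast
  moreover have "(if snd a then 1 - u' else u') = u"
  proof (rule ccontr)
   assume "(if snd a then 1 - u' else u') ~= u"
   hence "2 * \<delta> <= \<bar>(if snd a then 1 - u' else u') - u\<bar>" using \<delta>(2) by auto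
   moreover have "\<bar>r - u'\<bar> < \<delta>" using y(2) by (auto simp: I_def)
   moreover have "\<bar>(if snd a then 1 - r else r) - u\<bar> < \<delta>" using 2(3) by (auto simp: I_def)
   ultimately show False by (auto split: if_splits)
  qed
  ultimately show "act (Edge w' g' u') a = Edge w g u" using 2(2) by simp
 qed
qed

lemma separated_depth:
 assumes "y \<in> pts (Suc m)" "y' \<in> pts (Suc m)" "depth y ~= depth y'"
 shows "separated (Suc m) y y'"
proof -
 obtain T T' where T: "open T" "open T'" "depth y \<in> T" "depth y' \<in> T'" "T \<inter> T' = {}"
  using hausdorff[OF assms(3)] by blast
 show ?thesis
 proof (rule separatedI[OF depth_open[OF T(1)] depth_open[OF T(2)]])
  fix a z assume "z \<in> {y \<in> pts (Suc m). depth y \<in> T'}" "act z a \<in> {y \<in> pts (Suc m). depth y \<in> T}"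
  thus "act y' a = y" using T(5) by (auto simp: depth_act)
 qed (use T assms in auto)
qed

theorem separated_pts: "y \<in> pts m ==> y' \<in> pts m ==> separated m y y'"
proof (induction m arbitrary: y y')
 case 0
 thus ?case using separated_Base by auto
next
 case (Suc m)
 from Suc.prems(1) show ?case
 proof (cases rule: pts_SucE)
  case v: (v l s f)
  from Suc.prems(2) show ?thesis
  proof (cases rule: pts_SucE)
   case v': (v l' s' f')
   show ?thesis unfolding v(1) v'(1) by (rule separated_Vert[OF v(2) v'(2) v(3) v'(3)])
  next
   case e': (e z' g' u')
   thus ?thesis by (intro separated_depth Suc.prems) (auto simp: v(1))
  qed
 next
  case e: (e z g u)
  from Suc.prems(2) show ?thesis
  proof (cases rule: pts_SucE)
   case v': (v l' s' f')
   thus ?thesis using e by (intro separated_depth Suc.prems) auto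
  next
   case e': (e z' g' u')
   show ?thesis unfolding e(1) e'(1)
    by (rule separated_Edge[OF e(2) e'(2) Suc.IH[OF e(2) e'(2)] e(3,4) e'(3,4)])
  qed
 qed
qed

section \<open>Weak contractibility of the levels\<close>

text \<open>Reduced to the version for homotopies by letting time do nothing, which saves a second
  argument about quotients restricted to open sets.\<close>

lemma continuous_from_plot_top_open:
 assumes U: "openin (plot_top P) U"
  and f: "\<And>n \<pi>. (n, \<pi>) \<in> P ==> cmap {c \<in> cube n. \<pi> c \<in> U} Z (\<lambda>c. f (\<pi> c))"
 shows "continuous_map (subtopology (plot_top P) U) Z f"
proof -
 have "continuous_map (prod_topology (top_of_set {0..1::real}) (subtopology (plot_top P) U)) Z (\<lambda>z. f (snd z))"
 proof (rule homotopy_from_plot_top[OF U])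
  fix n \<pi> assume "(n, \<pi>) \<in> P"
  have im: "snd ` ({0..1::real} \<times> {c \<in> cube n. \<pi> c \<in> U}) \<subseteq> {c \<in> cube n. \<pi> c \<in> U}" by auto
  have "cmap ({0..1::real} \<times> {c \<in> cube n. \<pi> c \<in> U}) Z (\<lambda>tc. f (\<pi> (snd tc)))"
   by (rule cmap_compose[OF f[OF \<open>(n, \<pi>) \<in> P\<close>] _ im]) (intro continuous_intros)
  thus "cmap ({0..1::real} \<times> {c \<in> cube n. \<pi> c \<in> U}) Z (\<lambda>tc. f (snd (fst tc, \<pi> (snd tc))))" by simp
 qed
 moreover have "continuous_map (subtopology (plot_top P) U) (prod_topology (top_of_set {0..1::real}) (subtopology (plot_top P) U)) (\<lambda>y. (0, y))"
  by (simp add: continuous_map_pairwise o_def continuous_map_in_subtopology)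
 ultimately have "continuous_map (subtopology (plot_top P) U) Z ((\<lambda>z. f (snd z)) \<circ> (\<lambda>y. (0::real, y)))"
  by (rule continuous_map_compose[rotated])
 thus ?thesis by (simp add: o_def)
qed

lemma weakly_contractible_Un_sub:
 assumes "openin Y A" "openin Y B" "weakly_contractible (subtopology Y A)" "weakly_contractible (subtopology Y B)"
  "weakly_contractible (subtopology Y (A \<inter> B))"
 shows "weakly_contractible (subtopology Y (A \<union> B))"
proof (rule weakly_contractible_Un)
 have o: "openin Y (A \<union> B)" using assms by blast
 show "openin (subtopology Y (A \<union> B)) A" "openin (subtopology Y (A \<union> B)) B"
  using assms by (auto simp: openin_open_subtopology[OF o])
 show "A \<union> B = topspace (subtopology Y (A \<union> B))" using openin_subset[OF o] by auto
 have "(A \<union> B) \<inter> A = A" "(A \<union> B) \<inter> B = B" "(A \<union> B) \<inter> (A \<inter> B) = A \<inter> B" by auto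
 thus "weakly_contractible (subtopology (subtopology Y (A \<union> B)) A)" "weakly_contractible (subtopology (subtopology Y (A \<union> B)) B)"
  "weakly_contractible (subtopology (subtopology Y (A \<union> B)) (A \<inter> B))"
  using assms by (simp_all add: subtopology_subtopology)
qed

primrec slide :: "pt => (real => real) => pt" where
 "slide (Base j f) \<sigma> = Base j f"
| "slide (Vert l s f) \<sigma> = Vert l s f"
| "slide (Edge z g u) \<sigma> = edge z g (\<sigma> u)"

lemma slide_edge: "(u <= 0 ==> \<sigma> u <= 0) ==> (u \<ge> 1 ==> \<sigma> u \<ge> 1) ==> slide (edge z g u) \<sigma> = edge z g (\<sigma> u)"
 by (auto simp: edge_def)

text \<open>A reparametrisation of edges respects the gluing only at ends that it fixes. Ends whose
  vertex points lie outside \<open>U\<close> are exempt, and this allows an open edge or star to be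
  shrunk away from them.\<close>

lemma slide_cont:
 assumes U: "openin (YY (Suc m)) U" and \<sigma>: "continuous_on UNIV (\<lambda>p. \<sigma> (fst p) (snd p))"
  and \<sigma>01: "\<And>\<tau> u. 0 <= \<tau> ==> \<tau> <= 1 ==> 0 <= u ==> u <= 1 ==> 0 <= \<sigma> \<tau> u \<and> \<sigma> \<tau> u <= 1"
  and e0: "\<And>z g \<tau>. z \<in> pts m ==> edge z g 0 \<in> U ==> \<sigma> \<tau> 0 = 0"
  and e1: "\<And>z g \<tau>. z \<in> pts m ==> edge z g 1 \<in> U ==> \<sigma> \<tau> 1 = 1"
  and inU: "\<And>y \<tau>. y \<in> U ==> 0 <= \<tau> ==> \<tau> <= 1 ==> slide y (\<sigma> \<tau>) \<in> U"
 shows "continuous_map (prod_topology (top_of_set {0..1::real}) (subtopology (YY (Suc m)) U)) (subtopology (YY (Suc m)) U)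
  (\<lambda>z. slide (snd z) (\<sigma> (fst z)))"
proof (rule continuous_map_into_subtopology)
 show "(\<lambda>z. slide (snd z) (\<sigma> (fst z))) \<in> topspace (prod_topology (top_of_set {0..1::real}) (subtopology (YY (Suc m)) U)) \<rightarrow> U"
  using inU by auto
 show "continuous_map (prod_topology (top_of_set {0..1::real}) (subtopology (YY (Suc m)) U)) (YY (Suc m)) (\<lambda>z. slide (snd z) (\<sigma> (fst z)))"
 proof (rule homotopy_from_plot_top[OF U])
  fix n \<pi> assume p: "(n, \<pi>) \<in> plots (Suc m)"
  let ?S = "{0..1::real} \<times> {c \<in> cube n. \<pi> c \<in> U}"
  from p have "cmap ?S (YY (Suc m)) (\<lambda>tc. slide (\<pi> (snd tc)) (\<sigma> (fst tc)))"
  proof (cases rule: plots_SucE)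
   case (v l s \<pi>0)
   have im: "snd ` ?S \<subseteq> cube n" by auto
   have "cmap ?S (YY (Suc m)) (\<lambda>tc. \<pi> (snd tc))"
    by (rule cmap_compose[OF plot_cont[OF p] _ im]) (intro continuous_intros)
   thus ?thesis unfolding v(3) by simp
  next
   case (e n0 \<pi>0 g)
   let ?h = "\<lambda>tc::real \<times> rvec. (snd tc)(n0 := \<sigma> (fst tc) (snd tc n0))"
   have "continuous_on ?S (\<lambda>tc. \<sigma> (fst tc) (snd tc n0))"
    using continuous_on_compose2[OF \<sigma>, of ?S "\<lambda>tc. (fst tc, snd tc n0)"]
    by (simp add: continuous_on_Pair continuous_on_fst continuous_on_coord continuous_on_snd)
   hence co: "continuous_on ?S ?h" by (intro continuous_on_fun_upd continuous_intros)
   have im: "?h ` ?S \<subseteq> cube n"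
   proof
    fix x assume "x \<in> ?h ` ?S"
    then obtain t c where tc: "0 <= t" "t <= 1" "c \<in> cube n" "x = c(n0 := \<sigma> t (c n0))" by auto
    have "0 <= c n0" "c n0 <= 1" using tc(3) by (auto simp: cube_iff)
    hence "(c(n0 := 0))(n0 := \<sigma> t (c n0)) \<in> cube (Suc n0)"
     using cube_upd_Suc[OF cube_Suc_upd] tc(3) e(1) \<sigma>01[OF tc(1,2)] by blast
    thus "x \<in> cube n" using tc(4) e(1) by simp
   qed
   have "cmap ?S (YY (Suc m)) (\<lambda>tc. \<pi> (?h tc))" by (rule cmap_compose[OF plot_cont[OF p] co im])
   thus ?thesis
   proof (rule cmap_cong)
    fix tc assume "tc \<in> ?S"
    then obtain t c where tc: "tc = (t, c)" "0 <= t" "t <= 1" "c \<in> cube n" "\<pi> c \<in> U" by auto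
    have c01: "0 <= c n0" "c n0 <= 1" using tc(4) by (auto simp: cube_iff)
    have "c(n0 := 0) \<in> cube n0" using tc(4) e(1) cube_Suc_upd by blast
    hence zp: "\<pi>0 (c(n0 := 0)) \<in> pts m" using cmap_in[OF plot_cont[OF e(2)]] by (simp add: topspace_YY)
    have eU: "edge (\<pi>0 (c(n0 := 0))) g (c n0) \<in> U" using tc(5) e(3) by simp
    have "slide (edge (\<pi>0 (c(n0 := 0))) g (c n0)) (\<sigma> t) = edge (\<pi>0 (c(n0 := 0))) g (\<sigma> t (c n0))"
    proof (rule slide_edge)
     assume "c n0 <= 0"
     hence "c n0 = 0" using c01 by simp
     thus "\<sigma> t (c n0) <= 0" using e0[OF zp, of g t] eU by simp
    next
     assume "1 <= c n0"
     hence "c n0 = 1" using c01 by simp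
     thus "1 <= \<sigma> t (c n0)" using e1[OF zp, of g t] eU by simp
    qed
    thus "\<pi> (?h tc) = slide (\<pi> (snd tc)) (\<sigma> (fst tc))" using tc(1) e(3) by simp
   qed
  qed
  thus "cmap ?S (YY (Suc m)) (\<lambda>tc. slide (snd (fst tc, \<pi> (snd tc))) (\<sigma> (fst (fst tc, \<pi> (snd tc)))))" by simp
 qed
qed

primrec proj :: "pt => real => gp" where
 "proj (Base j f) = f"
| "proj (Vert l s f) = f"
| "proj (Edge z g u) = phi z"

lemma proj_edge [simp]: "proj (edge z g u) = phi z" by (simp add: edge_def)

lemma proj_cont: "continuous_map (YY (Suc m)) (EE m) proj"
proof (rule continuous_from_plot_top)
 fix n \<pi> assume "(n, \<pi>) \<in> plots (Suc m)"
 thus "cmap (cube n) (EE m) (\<lambda>c. proj (\<pi> c))"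
 proof (cases rule: plots_SucE)
  case (v l s \<pi>0)
  thus ?thesis using plot_cont[OF v(2)] by simp
 next
  case (e n0 \<pi>0 g)
  have im: "(\<lambda>c. c(n0 := 0)) ` cube n \<subseteq> cube n0" using cube_Suc_upd e(1) by blast
  have "cmap (cube n) (EE m) (\<lambda>c. phi (\<pi>0 (c(n0 := 0))))"
   by (rule cmap_compose[OF plots_cont[OF e(2), THEN conjunct1] continuous_on_upd_const im])
  thus ?thesis by (simp add: e(3))
 qed
qed

abbreviation "fstar m l s \<equiv> star m l s 0 (topspace (EE m))"

lemma fstar_open: "is_line l ==> openin (YY (Suc m)) (fstar m l s)"
 by (rule star_open) auto

lemma fstar_mem:
 "Vert l' s' f \<in> fstar m l s \<longleftrightarrow> l' = l \<and> s' = s \<and> is_line l \<and> f \<in> topspace (EE m)"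
 "Edge z g u \<in> fstar m l s \<longleftrightarrow> z \<in> pts m \<and> 0 < u \<and> u < 1 \<and> lev z + fh g = s \<and> g \<in> snd l"
 using phi_EE[of z m] by (auto simp: star_def side_def)

lemma fstar_cases:
 assumes "y \<in> fstar m l s"
 obtains (v) f where "y = Vert l s f" "is_line l" "f \<in> topspace (EE m)"
 | (e) z g u where "y = Edge z g u" "z \<in> pts m" "0 < u" "u < 1" "lev z + fh g = s" "g \<in> snd l"
proof -
 have "y \<in> pts (Suc m)" using assms by (simp add: star_def)
 thus ?thesis
 proof (cases rule: pts_SucE)
  case (v l' s' f)
  thus ?thesis using that(1) assms fstar_mem(1) by simp
 next
  case (e z g u)
  thus ?thesis using that(2)[of z g u] assms fstar_mem(2)[of z g u] by simp
 qed
qed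

text \<open>All edges of the star are pushed linearly into their end at \<open>l\<close>. There a
  point of an edge becomes its image under \<open>phi\<close>, so the star is dominated by the
  contractible vertex space.\<close>

lemma weakly_contractible_fstar:
 assumes l: "is_line l"
 shows "weakly_contractible (subtopology (YY (Suc m)) (fstar m l s))" (is "weakly_contractible ?Y")
proof (rule weakly_contractible_dominated[OF weakly_contractible_SE[of m]])
 let ?U = "fstar m l s"
 define \<sigma> :: "real => real => real" where "\<sigma> \<tau> u = (if fst l then 1 - (1 - u) * (1 - \<tau>) else u * (1 - \<tau>))" for \<tau> u
 have \<sigma>01: "0 <= \<sigma> \<tau> u \<and> \<sigma> \<tau> u <= 1" if "0 <= \<tau>" "\<tau> <= 1" "0 <= u" "u <= 1" for \<tau> u
  using that mult_le_one[of "1 - u" "1 - \<tau>"] mult_le_one[of u "1 - \<tau>"] by (auto simp: \<sigma>_def)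
 have "\<sigma> = (\<lambda>\<tau> u. if fst l then 1 - (1 - u) * (1 - \<tau>) else u * (1 - \<tau>))" by (simp add: \<sigma>_def fun_eq_iff)
 hence \<sigma>c: "continuous_on UNIV (\<lambda>p. \<sigma> (fst p) (snd p))" by (cases "fst l") (auto intro!: continuous_intros)
 show "continuous_map ?Y (EE m) proj" by (rule continuous_map_from_subtopology[OF proj_cont])
 show "continuous_map (EE m) ?Y (Vert l s)"
  by (rule continuous_map_into_subtopology[OF Vert_cont[OF l]]) (use l fstar_mem(1) in auto)
 show "continuous_map (prod_topology (top_of_set {0..1::real}) ?Y) ?Y (\<lambda>z. slide (snd z) (\<sigma> (fst z)))"
 proof (rule slide_cont[OF fstar_open[OF l] \<sigma>c])
  fix z g \<tau> assume z: "z \<in> pts m"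
  show "\<sigma> \<tau> 0 = 0" if "edge z g 0 \<in> ?U"
  proof -
   have "side l 0 0" using edge_star[OF z _ _ l, of 0 0 g s "topspace (EE m)"] that by simp
   thus ?thesis by (cases "fst l") (simp_all add: side_def \<sigma>_def)
  qed
  show "\<sigma> \<tau> 1 = 1" if "edge z g 1 \<in> ?U"
  proof -
   have "side l 0 1" using edge_star[OF z _ _ l, of 1 0 g s "topspace (EE m)"] that by simp
   thus ?thesis by (cases "fst l") (simp_all add: side_def \<sigma>_def)
  qed
 next
  fix y \<tau> assume y: "y \<in> ?U" "0 <= \<tau>" "\<tau> <= (1::real)"
  from y(1) show "slide y (\<sigma> \<tau>) \<in> ?U"
  proof (cases rule: fstar_cases)
   case (v f)
   thus ?thesis using y by simp
  next
   case (e z g u)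
   have "(1 - u) * (1 - \<tau>) < 1" "u * (1 - \<tau>) < 1"
    using mult_left_le[of "1 - \<tau>" "1 - u"] mult_left_le[of "1 - \<tau>" u] e y by linarith+
   hence "side l 0 (\<sigma> \<tau> u)" by (simp add: side_def \<sigma>_def)
   hence "edge z g (\<sigma> \<tau> u) \<in> ?U" using edge_star[OF e(2) _ _ l, of "\<sigma> \<tau> u" 0 g s] \<sigma>01[OF y(2,3), of u] e phi_EE by auto
   thus ?thesis by (simp add: e(1))
  qed
 qed (use \<sigma>01 in auto)
 fix y assume "y \<in> topspace ?Y"
 hence "y \<in> ?U" by simp
 thus "slide (snd (0, y)) (\<sigma> (fst (0::real, y))) = y"
  by (cases rule: fstar_cases) (auto simp: \<sigma>_def edge_def)
 show "slide (snd (1, y)) (\<sigma> (fst (1::real, y))) = Vert l s (proj y)"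
  using \<open>y \<in> ?U\<close>
 proof (cases rule: fstar_cases)
  case (e z g u)
  thus ?thesis using line_mem[OF l, of g] by (cases "fst l") (auto simp: \<sigma>_def edge_def)
 qed simp
qed

definition eedges :: "nat => fg => int => pt set" where
 "eedges m g t = {Edge z g u | z u. z \<in> pts m \<and> lev z + fh g = t \<and> 0 < u \<and> u < 1}"

primrec foot :: "pt => pt" where
 "foot (Edge z g u) = z" | "foot (Base j f) = Base j f" | "foot (Vert l s f) = Vert l s f"

lemma eedges_mem: "Edge z h u \<in> eedges m g t \<longleftrightarrow> h = g \<and> z \<in> pts m \<and> lev z + fh g = t \<and> 0 < u \<and> u < 1"
 by (auto simp: eedges_def)

lemma eedges_open: "openin (YY (Suc m)) (eedges m g t)"
proof -
 have "openin (YY (Suc m)) {Edge z g u | z u. (u, z) \<in> {0<..<1} \<times> {y \<in> pts m. lev y = t - fh g}}"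
  by (rule open_edges) (use lev_open in \<open>auto simp: openin_prod_Times_iff intro!: open_subset\<close>)
 moreover have "{Edge z g u | z u. (u, z) \<in> {0<..<1} \<times> {y \<in> pts m. lev y = t - fh g}} = eedges m g t"
  unfolding eedges_def by (auto simp: algebra_simps)
 ultimately show ?thesis by simp
qed

text \<open>Without its ends, the edge is pushed to its midpoint. What remains is a copy of the
  previous space at the level lowered by the exponent sum of the edge.\<close>

lemma weakly_contractible_eedges:
 assumes wc: "weakly_contractible (subtopology (YY m) {y \<in> pts m. lev y = t - fh g})" (is "weakly_contractible ?Z")
 shows "weakly_contractible (subtopology (YY (Suc m)) (eedges m g t))" (is "weakly_contractible ?Y")
proof (rule weakly_contractible_dominated[OF wc])
 let ?U = "eedges m g t"
 define \<sigma> :: "real => real => real" where "\<sigma> \<tau> u = (1 - \<tau>) * u + \<tau> / 2" for \<tau> u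
 have \<sigma>01: "0 < \<sigma> \<tau> u \<and> \<sigma> \<tau> u < 1" if "0 <= \<tau>" "\<tau> <= 1" "0 < u" "u < 1" for \<tau> u
 proof (cases "\<tau> = 1")
  case False
  have "0 < (1 - \<tau>) * u" "(1 - \<tau>) * u < (1 - \<tau>) * 1" using that False by auto
  thus ?thesis using that by (auto simp: \<sigma>_def)
 qed (simp add: \<sigma>_def)
 have nov: "edge z h 0 \<notin> ?U" "edge z h 1 \<notin> ?U" for z h by (auto simp: edge_def eedges_def)
 have "continuous_map ?Y (YY m) foot"
 proof (rule continuous_from_plot_top_open[OF eedges_open])
  fix n \<pi> assume "(n, \<pi>) \<in> plots (Suc m)"
  thus "cmap {c \<in> cube n. \<pi> c \<in> ?U} (YY m) (\<lambda>c. foot (\<pi> c))"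
  proof (cases rule: plots_SucE)
   case (v l s \<pi>0)
   hence E: "{c \<in> cube n. \<pi> c \<in> ?U} = {}" by (auto simp: eedges_def)
   show ?thesis unfolding E by (simp add: continuous_map_def)
  next
   case (e n0 \<pi>0 h)
   have im: "(\<lambda>c. c(n0 := 0)) ` {c \<in> cube n. \<pi> c \<in> ?U} \<subseteq> cube n0" using cube_Suc_upd e(1) by blast
   have "cmap {c \<in> cube n. \<pi> c \<in> ?U} (YY m) (\<lambda>c. \<pi>0 (c(n0 := 0)))"
    by (rule cmap_compose[OF plot_cont[OF e(2)] continuous_on_upd_const im])
   thus ?thesis
    by (rule cmap_cong) (auto simp: e(3) edge_def eedges_def split: if_splits)
  qed
 qed
 thus "continuous_map ?Y ?Z foot"
  by (rule continuous_map_into_subtopology) (auto simp: eedges_def)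
 have "continuous_map ?Z (prod_topology (top_of_set {0..1::real}) (YY m)) (\<lambda>z. (1/2, z))"
  by (auto simp: continuous_map_pairwise o_def continuous_map_in_subtopology intro: continuous_map_from_subtopology)
 from continuous_map_compose[OF this edge_cont[of m g]]
 have "continuous_map ?Z (YY (Suc m)) (\<lambda>z. edge z g (1/2))" by (simp add: o_def)
 thus "continuous_map ?Z ?Y (\<lambda>z. edge z g (1/2))"
  by (rule continuous_map_into_subtopology) (auto simp: eedges_mem edge_def)
 show "continuous_map (prod_topology (top_of_set {0..1::real}) ?Y) ?Y (\<lambda>z. slide (snd z) (\<sigma> (fst z)))"
 proof (rule slide_cont[OF eedges_open])
  show "continuous_on UNIV (\<lambda>p. \<sigma> (fst p) (snd p))" unfolding \<sigma>_def by (intro continuous_intros) auto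
  show "0 <= \<sigma> \<tau> u \<and> \<sigma> \<tau> u <= 1" if "0 <= \<tau>" "\<tau> <= 1" "0 <= u" "u <= 1" for \<tau> u
  proof -
   have "0 <= (1 - \<tau>) * u" "(1 - \<tau>) * u <= 1 - \<tau>" using that mult_left_le[of u "1 - \<tau>"] by auto
   thus ?thesis using that(1,2) unfolding \<sigma>_def by linarith
  qed
  show "slide y (\<sigma> \<tau>) \<in> ?U" if y: "y \<in> ?U" "0 <= \<tau>" "\<tau> <= 1" for y \<tau>
  proof -
   obtain z u where z: "y = Edge z g u" "z \<in> pts m" "lev z + fh g = t" "0 < u" "u < 1" using y(1) by (auto simp: eedges_def)
   show ?thesis using \<sigma>01[OF y(2,3) z(4,5)] z by (simp add: edge_def eedges_def)
  qed
 qed (use nov in auto)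
 fix y assume "y \<in> topspace ?Y"
 then obtain z u where z: "y = Edge z g u" "0 < u" "u < 1" by (auto simp: eedges_def)
 show "slide (snd (0, y)) (\<sigma> (fst (0::real, y))) = y" using z by (simp add: \<sigma>_def edge_def)
 show "slide (snd (1, y)) (\<sigma> (fst (1::real, y))) = edge (foot y) g (1/2)" using z by (simp add: \<sigma>_def)
qed

text \<open>A nontrivial power of one generator is never a power of the other. In the tree this says
  that two vertices are joined by at most one edge.\<close>

lemma lines_meet: "h \<in> snd (line False g) ==> h \<in> snd (line True g) ==> h = g"
proof -
 assume "h \<in> snd (line False g)" "h \<in> snd (line True g)"
 hence "\<exists>n. h = g + pow False n" "\<exists>k. h = g + pow True k" by (auto simp: line_def)
 then obtain n k where h: "h = g + pow False n" "h = g + pow True k" by blast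
 hence e: "pow False n = pow True k" by simp
 have "n = 0"
 proof (rule ccontr)
  assume n: "n ~= 0"
  hence "k ~= 0" using hd_last_pow(1)[OF n, of False] e by (auto simp: zero_fg.rep_eq)
  thus False using hd_last_pow(2)[OF n, of False] hd_last_pow(2)[of k True] e by simp
 qed
 thus "h = g" using h by simp
qed

text \<open>Finite prefix-closed sets of words. Read as edges they span a finite subtree, since a
  word shares a coset with its parent.\<close>

definition good :: "fg set => bool" where
 "good S \<longleftrightarrow> finite S \<and> 0 \<in> S \<and> (\<forall>g\<in>S. g ~= 0 --> par g \<in> S)"

lemma good_exists: "\<exists>S. good S \<and> g \<in> S"
proof (induction "flen g" arbitrary: g rule: less_induct)
 case less
 show ?case
 proof (cases "g = 0")
  case True
  thus ?thesis by (intro exI[of _ "{0}"]) (simp add: good_def)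
 next
  case False
  then obtain S where "good S" "par g \<in> S" using less[OF flen_par[OF False]] by blast
  thus ?thesis by (intro exI[of _ "insert g S"]) (auto simp: good_def)
 qed
qed

definition WS :: "nat => int => fg set => pt set" where
 "WS m t S = (\<Union>g\<in>S. fstar m (line False g) t \<union> fstar m (line True g) t)"

lemma WS_mem: "y \<in> WS m t S \<longleftrightarrow> (\<exists>g\<in>S. \<exists>i. y \<in> fstar m (line i g) t)"
 unfolding WS_def by (auto intro: exI[of _ True] exI[of _ False]) (metis (full_types))

lemma WS_open: "openin (YY (Suc m)) (WS m t S)"
 unfolding WS_def by (intro openin_Union) (auto intro!: openin_Un fstar_open)

text \<open>A longest word \<open>g\<close> is removed. One of its cosets also contains its parent,
  so the star of that coset is still present; the other coset is a leaf of the subtree. The star of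
  the leaf meets the rest exactly in the open edge \<open>g\<close>, and vertex stars and open edges
  are the two kinds of pieces already known to be weakly contractible.\<close>

lemma weakly_contractible_WS:
 assumes wc: "\<And>t. weakly_contractible (subtopology (YY m) {y \<in> pts m. lev y = t})" and "good S"
 shows "weakly_contractible (subtopology (YY (Suc m)) (WS m t S))"
 using assms(2)
proof (induction "card S" arbitrary: S rule: less_induct)
 case less
 have fin: "finite S" "0 \<in> S" using less.prems by (auto simp: good_def)
 have "Max (flen ` S) \<in> flen ` S" using fin by (intro Max_in) auto
 then obtain g where g: "g \<in> S" "flen g = Max (flen ` S)" by auto
 have mx: "flen h <= flen g" if "h \<in> S" for h using that fin g by simp
 show ?case
 proof (cases "g = 0")
  case True
  hence "S = {0}" using fin(2) mx by (auto simp: flen_0_iff)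
  hence W: "WS m t S = fstar m (line False 0) t \<union> fstar m (line True 0) t" by (simp add: WS_def)
  have I: "fstar m (line False 0) t \<inter> fstar m (line True 0) t = eedges m 0 t"
  proof
   show "fstar m (line False 0) t \<inter> fstar m (line True 0) t \<subseteq> eedges m 0 t"
   proof
    fix y assume y: "y \<in> fstar m (line False 0) t \<inter> fstar m (line True 0) t"
    hence "y \<in> fstar m (line False 0) t" by simp
    thus "y \<in> eedges m 0 t"
    proof (cases rule: fstar_cases)
     case (v f)
     hence "line False 0 = line True 0" using y fstar_mem(1) by simp
     thus ?thesis by (metis fst_line)
    next
     case (e z h u)
     hence "h \<in> snd (line True 0)" using y fstar_mem(2) by simp
     hence "h = 0" using lines_meet e(6) by blast
     thus ?thesis using e by (auto simp: eedges_def)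
    qed
   qed
   show "eedges m 0 t \<subseteq> fstar m (line False 0) t \<inter> fstar m (line True 0) t"
    using mem_line[of 0] by (auto simp: eedges_def fstar_mem)
  qed
  have "weakly_contractible (subtopology (YY (Suc m)) (fstar m (line False 0) t \<inter> fstar m (line True 0) t))"
   unfolding I by (rule weakly_contractible_eedges[OF wc])
  thus ?thesis
   unfolding W by (intro weakly_contractible_Un_sub fstar_open weakly_contractible_fstar) auto
 next
  case False
  define S' where "S' = S - {g}"
  have p: "flen (par h) < flen h" if "h ~= 0" for h by (rule flen_par[OF that])
  have good': "good S'"
   using less.prems False p mx unfolding good_def S'_def by (auto dest!: mx) (metis leD)
  have "card S' < card S" unfolding S'_def by (rule card_Diff1_less[OF fin(1) g(1)])
  hence ih: "weakly_contractible (subtopology (YY (Suc m)) (WS m t S'))" using less.hyps good' by blast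
  obtain j s where js: "g = par g + pow j s" "\<forall>k n. k ~= 0 --> flen g < flen (g + pow (\<not> j) k + pow j n)"
   using last_generator[OF False] by blast
  \<comment> \<open>Words of this shape lie in the leaf coset or are one coset beyond it. By
    maximality of \<open>g\<close> none of them belongs to \<open>S\<close> unless it comes from
    \<open>g\<close> itself.\<close>
  have far: "k = 0" if "g + pow (\<not> j) k + pow j n \<in> S" for k n using js(2) mx[OF that] by (metis leD)
  have lj: "line j g = line j (par g)" using line_shift[of j "par g" s] js(1) by simp
  have pg: "par g \<in> S'" using less.prems False g(1) p[OF False] by (auto simp: good_def S'_def)
  let ?B = "fstar m (line (\<not> j) g) t"
  have W: "WS m t S = WS m t S' \<union> ?B"
  proof
   show "WS m t S \<subseteq> WS m t S' \<union> ?B"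
   proof
    fix y assume "y \<in> WS m t S"
    then obtain h i where h: "h \<in> S" "y \<in> fstar m (line i h) t" by (auto simp: WS_mem)
    show "y \<in> WS m t S' \<union> ?B"
    proof (cases "h = g")
     case True
     thus ?thesis using h lj pg by (cases "i = j") (auto simp: WS_mem)
    next
     case False
     thus ?thesis using h by (auto simp: WS_mem S'_def)
    qed
   qed
   have "?B \<subseteq> WS m t S" unfolding subset_iff WS_mem using g(1) by blast
   moreover have "WS m t S' \<subseteq> WS m t S" unfolding WS_def S'_def by blast
   ultimately show "WS m t S' \<union> ?B \<subseteq> WS m t S" by blast
  qed
  have I: "WS m t S' \<inter> ?B = eedges m g t"
  proof
   show "WS m t S' \<inter> ?B \<subseteq> eedges m g t"
   proof
    fix y assume y: "y \<in> WS m t S' \<inter> ?B"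
    then obtain h i where h: "h \<in> S" "h ~= g" "y \<in> fstar m (line i h) t" by (auto simp: WS_mem S'_def)
    from y have "y \<in> ?B" by simp
    thus "y \<in> eedges m g t"
    proof (cases rule: fstar_cases)
     case (v f)
     hence e: "line (\<not> j) g = line i h" using h(3) fstar_mem(1) by simp
     hence "i = (\<not> j)" by (metis fst_line)
     hence "h \<in> snd (line (\<not> j) g)" using e mem_line by metis
     then obtain k where "h = g + pow (\<not> j) k" by (auto simp: line_def)
     thus ?thesis using far[of k 0] h(1,2) by simp
    next
     case (e z h' u)
     have h': "h' \<in> snd (line i h)" using h(3) e(1) fstar_mem(2) by simp
     obtain k where k: "h' = g + pow (\<not> j) k" using e(6) by (auto simp: line_def)
     have "h \<in> snd (line i h')" using line_eq[OF h'] mem_line by metis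
     then obtain n where n: "h = h' + pow i n" by (auto simp: line_def)
     have "k = 0"
     proof (cases "i = j")
      case True
      thus ?thesis using far[of k n] h(1) n k by simp
     next
      case False
      hence "h = g + pow (\<not> j) (k + n)" using n k by (auto simp: pow_add add.assoc)
      thus ?thesis using far[of "k + n" 0] h(1,2) by simp
     qed
     thus ?thesis using e k by (auto simp: eedges_def)
    qed
   qed
   show "eedges m g t \<subseteq> WS m t S' \<inter> ?B"
   proof
    fix y assume "y \<in> eedges m g t"
    then obtain z u where z: "y = Edge z g u" "z \<in> pts m" "lev z + fh g = t" "0 < u" "u < 1" by (auto simp: eedges_def)
    have "y \<in> fstar m (line j (par g)) t" using z mem_line[of g j] lj by (simp add: fstar_mem)
    moreover have "y \<in> ?B" using z mem_line[of g] by (simp add: fstar_mem)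
    ultimately show "y \<in> WS m t S' \<inter> ?B" using pg by (auto simp: WS_mem)
   qed
  qed
  have "weakly_contractible (subtopology (YY (Suc m)) (WS m t S' \<inter> ?B))"
   unfolding I by (rule weakly_contractible_eedges[OF wc])
  thus ?thesis
   unfolding W by (intro weakly_contractible_Un_sub WS_open fstar_open weakly_contractible_fstar ih) auto
 qed
qed

lemma subtopology_level: "W \<subseteq> L ==> subtopology (subtopology Y L) W = subtopology Y W"
 by (simp add: subtopology_subtopology Int_absorb1)

text \<open>The induction hypothesis is needed for all levels at once, because the edge
  \<open>g\<close> uses the previous space at level \<open>t - fh g\<close>.\<close>

theorem weakly_contractible_level: "weakly_contractible (subtopology (YY m) {y \<in> pts m. lev y = t})"
proof (induction m arbitrary: t)
 case 0
 let ?Y = "subtopology (YY 0) {y \<in> pts 0. lev y = t}"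
 show ?case
 proof (rule weakly_contractible_dominated[OF weakly_contractible_SE[of 0], of ?Y phi "Base t" snd])
  show "continuous_map ?Y (EE 0) phi" by (rule continuous_map_from_subtopology[OF phi_cont])
  show "continuous_map (EE 0) ?Y (Base t)"
   by (rule continuous_map_into_subtopology[OF Base_cont]) auto
  show "continuous_map (prod_topology (top_of_set {0..1::real}) ?Y) ?Y snd" by (rule continuous_map_snd)
 qed auto
next
 case (Suc m)
 let ?L = "{y \<in> pts (Suc m). lev y = t}"
 have sub: "WS m t S \<subseteq> ?L" for S by (auto simp: WS_def star_def)
 show ?case
 proof (rule weakly_contractible_Union[where \<U> = "WS m t ` {S. good S}"])
  show "openin (subtopology (YY (Suc m)) ?L) U" if "U \<in> WS m t ` {S. good S}" for U
   using that sub WS_open[of m t] by (auto simp: openin_open_subtopology[OF lev_open])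
  show "weakly_contractible (subtopology (subtopology (YY (Suc m)) ?L) U)" if "U \<in> WS m t ` {S. good S}" for U
  proof -
   obtain S where S: "U = WS m t S" "good S" using \<open>U \<in> WS m t ` {S. good S}\<close> by auto
   show ?thesis unfolding S(1) subtopology_level[OF sub] by (rule weakly_contractible_WS[OF Suc.IH S(2)])
  qed
  show "topspace (subtopology (YY (Suc m)) ?L) \<subseteq> \<Union> (WS m t ` {S. good S})"
  proof
   fix y assume "y \<in> topspace (subtopology (YY (Suc m)) ?L)"
   hence y: "y \<in> pts (Suc m)" "lev y = t" by auto
   have "\<exists>g i. y \<in> fstar m (line i g) t"
    using y(1)
   proof (cases rule: pts_SucE)
    case (v l s f)
    then obtain i g where "l = line i g" by (auto simp: is_line_def)
    thus ?thesis using v y(2) by (auto simp: fstar_mem)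
   next
    case (e z g u)
    thus ?thesis using y(2) mem_line[of g True] by (auto simp: fstar_mem)
   qed
   then obtain g i where gi: "y \<in> fstar m (line i g) t" by blast
   obtain S where "good S" "g \<in> S" using good_exists by blast
   thus "y \<in> \<Union> (WS m t ` {S. good S})" using gi WS_mem[of y m t S] by blast
  qed
  show "WS m t ` {S. good S} ~= {}" using good_exists by blast
  show "\<exists>W\<in>WS m t ` {S. good S}. U \<union> V \<subseteq> W" if uv: "U \<in> WS m t ` {S. good S}" "V \<in> WS m t ` {S. good S}" for U V
  proof -
   obtain S T where ST: "U = WS m t S" "V = WS m t T" "good S" "good T" using uv by auto
   have "good (S \<union> T)" using ST(3,4) by (auto simp: good_def)
   moreover have "U \<union> V \<subseteq> WS m t (S \<union> T)" using ST(1,2) by (auto simp: WS_def)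
   ultimately show ?thesis by blast
  qed
 qed
qed

section \<open>Cells\<close>

datatype cell = CBase int "gp list" | CVert "bool \<times> fg set" int "gp list" | CEdge cell fg

primrec cdim :: "cell => nat" where
 "cdim (CBase j e) = length e - 1"
| "cdim (CVert l s e) = length e - 1"
| "cdim (CEdge c g) = Suc (cdim c)"

primrec clev :: "cell => int" where
 "clev (CBase j e) = j"
| "clev (CVert l s e) = s"
| "clev (CEdge c g) = clev c + fh g"

primrec cells :: "nat => cell set" where
 "cells 0 = {CBase j e | j e. Ecell (VV 0) cl e}"
| "cells (Suc m) = {CVert l s e | l s e. is_line l \<and> Ecell (VV m) cl e} \<union> {CEdge c g | c g. c \<in> cells m}"

primrec cmp :: "cell => rvec => pt" where
 "cmp (CBase j e) = (\<lambda>c. Base j (Echar e c))"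
| "cmp (CVert l s e) = (\<lambda>c. Vert l s (Echar e c))"
| "cmp (CEdge d g) = (\<lambda>c. edge (cmp d (c(cdim d := 0))) g (c (cdim d)))"

primrec cellof :: "pt => cell" where
 "cellof (Base j f) = CBase j (vals f)"
| "cellof (Vert l s f) = CVert l s (vals f)"
| "cellof (Edge y g u) = CEdge (cellof y) g"

primrec coords :: "pt => rvec" where
 "coords (Base j f) = Ecoord f"
| "coords (Vert l s f) = Ecoord f"
| "coords (Edge y g u) = (coords y)(cdim (cellof y) := u)"

primrec cact :: "cell => gp => cell" where
 "cact (CBase j e) a = CBase (j + hs a) (map (gmul a) e)"
| "cact (CVert l s e) a = CVert (lact (ghd a) (snd a) l) (s + hs a) (map (gmul (gtl a)) e)"
| "cact (CEdge c g) a = CEdge (cact c (gtl a)) (ghd a + sg (snd a) g)"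

lemma cells_simps [simp]: "CVert l s e \<in> cells (Suc m) \<longleftrightarrow> is_line l \<and> Ecell (VV m) cl e"
  "CEdge c g \<in> cells (Suc m) \<longleftrightarrow> c \<in> cells m"
 by (auto simp del: split_paired_Ex)

lemma cells_SucE:
 assumes "e \<in> cells (Suc m)"
 obtains (v) l s v where "e = CVert l s v" "is_line l" "Ecell (VV m) cl v"
 | (e) d g where "e = CEdge d g" "d \<in> cells m"
 using assms by (cases e) auto

declare cells.simps(2) [simp del]

lemma lev_cmp: "lev (cmp e c) = clev e"
 by (induction e arbitrary: c) auto

lemma cmp_cont: "e \<in> cells m ==> cmap (cube (cdim e)) (YY m) (cmp e)"
proof (induction m arbitrary: e)
 case 0
 then obtain j v where e: "e = CBase j v" "Ecell (VV 0) cl v" by auto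
 show ?case using continuous_map_compose[OF Echar_cmap[OF e(2)] Base_cont[of j]] by (simp add: e(1) o_def)
next
 case (Suc m)
 from Suc.prems show ?case
 proof (cases rule: cells_SucE)
  case (v l s v)
  show ?thesis using continuous_map_compose[OF Echar_cmap[OF v(3)] Vert_cont[OF v(2), of m s]] by (simp add: v(1) o_def)
 next
  case (e d g)
  let ?n = "cdim d"
  have im: "(\<lambda>c. c(?n := 0)) ` cube (Suc ?n) \<subseteq> cube ?n" using cube_Suc_upd by blast
  have "cmap (cube (Suc ?n)) (YY m) (\<lambda>c. cmp d (c(?n := 0)))"
   by (rule cmap_compose[OF Suc.IH[OF e(2)] continuous_on_upd_const im])
  hence "cmap (cube (Suc ?n)) (prod_topology (top_of_set {0..1}) (YY m)) (\<lambda>c. (c ?n, cmp d (c(?n := 0))))"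
   by (rule cmap_pair[rotated 2]) (auto simp: cube_iff intro!: continuous_intros)
  from continuous_map_compose[OF this edge_cont[of m g]] show ?thesis by (simp add: e(1) o_def)
 qed
qed

lemma cmp_pts: "e \<in> cells m ==> c \<in> cube (cdim e) ==> cmp e c \<in> pts m"
 using cmap_in[OF cmp_cont] by (simp add: topspace_YY)

lemma cdim_vals: "stepfun f ==> length (vals f) - 1 = card (jumps f)"
 by (simp only: length_vals js_props(4))

lemma cell_normal:
 assumes "f \<in> topspace (EE m)"
 shows "Ecell (VV m) cl (vals f)" "Ecoord f \<in> open_cube (length (vals f) - 1)" "Echar (vals f) (Ecoord f) = f"
proof -
 have f: "stepfun f" "clique (VV m) cl (f ` {0..<1})" using assms by (auto simp: topspace_plot_top SE_space)
 show "Ecell (VV m) cl (vals f)" by (rule Ecell_vals[OF f])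
 show "Ecoord f \<in> open_cube (length (vals f) - 1)" unfolding length_vals by (rule Ecoord_open[OF f(1)])
 show "Echar (vals f) (Ecoord f) = f" by (rule Echar_normal[OF f(1)])
qed

lemma cellof_cells: "y \<in> pts m ==> cellof y \<in> cells m \<and> coords y \<in> open_cube (cdim (cellof y)) \<and> cmp (cellof y) (coords y) = y"
proof (induction m arbitrary: y)
 case 0
 thus ?case using cell_normal by auto
next
 case (Suc m)
 from Suc.prems show ?case
 proof (cases rule: pts_SucE)
  case (v l s f)
  thus ?thesis using cell_normal[OF v(3)] by simp
 next
  case (e z g u)
  let ?n = "cdim (cellof z)"
  note ih = Suc.IH[OF e(2)]
  have "(coords z)(?n := 0) = coords z" using ih by (auto simp: open_cube_def)
  moreover have "(coords z)(?n := u) \<in> open_cube (Suc ?n)" using ih e(3,4) by (auto simp: open_cube_def less_Suc_eq)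
  ultimately show ?thesis using ih e by (simp add: edge_def fun_upd_same del: fun_upd_apply)
 qed
qed

lemma cellof_cmp: "e \<in> cells m ==> c \<in> open_cube (cdim e) ==> cellof (cmp e c) = e \<and> coords (cmp e c) = c"
proof (induction m arbitrary: e c)
 case 0
 thus ?case using Echar_cell by auto
next
 case (Suc m)
 from Suc.prems(1) show ?case
 proof (cases rule: cells_SucE)
  case (v l s v)
  thus ?thesis using Echar_cell[OF v(3)] Suc.prems(2) by simp
 next
  case (e d g)
  let ?n = "cdim d"
  have c: "0 < c ?n" "c ?n < 1" "c(?n := 0) \<in> open_cube ?n" using Suc.prems(2) by (auto simp: e(1) open_cube_def)
  show ?thesis using Suc.IH[OF e(2) c(3)] c(1,2) by (simp add: e(1) edge_def del: fun_upd_apply)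
 qed
qed

lemma cube_open_or_boundary: "x \<in> cube n ==> x \<in> open_cube n \<or> x \<in> cube_boundary n"
 by (auto simp: cube_boundary_def open_cube_def cube_iff order_less_le)

lemma jumps_Psi:
 assumes "stepfun f" "0 < t" "t <= 1"
 shows "card (jumps (Psi i g L (t, f))) <= Suc (card (jumps f))"
proof -
 obtain \<theta> where "jumps (Psi i g L (t, f)) \<subseteq> insert \<theta> (jumps f)" unfolding Psi_def using jumps_Mix[OF assms(2,3)] by blast
 hence "card (jumps (Psi i g L (t, f))) <= card (insert \<theta> (jumps f))"
  using jumps_finite[OF assms(1)] by (intro card_mono) auto
 also have "\<dots> <= Suc (card (jumps f))" by (rule card_insert_le_m1) (simp_all)
 finally show ?thesis .
qed

text \<open>Hence \<open>phi\<close> is cellular.\<close>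

lemma jumps_phi: "y \<in> pts m ==> card (jumps (phi y)) <= cdim (cellof y)"
proof (induction m arbitrary: y)
 case 0
 thus ?case using cdim_vals[OF EE_stepfun] by auto
next
 case (Suc m)
 from Suc.prems show ?case
 proof (cases rule: pts_SucE)
  case (v l s f)
  have f: "stepfun f" by (rule EE_stepfun[OF v(3)])
  have "card (jumps (lft (vmap l s) f)) <= card (jumps f)" by (rule card_mono[OF jumps_finite[OF f] jumps_lft])
  thus ?thesis using cdim_vals[OF f] by (simp add: v(1))
 next
  case (e z g u)
  have f: "stepfun (phi z)" by (rule EE_stepfun[OF phi_EE[OF e(2)]])
  have "card (jumps (phi y)) <= Suc (card (jumps (phi z)))"
   using jumps_Psi[OF f, of "2 * u"] jumps_Psi[OF f, of "2 * (1 - u)"] e by simp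
  thus ?thesis using Suc.IH[OF e(2)] by (simp add: e(1))
 qed
qed

text \<open>At the two ends of an edge cell the extra interval is lost, while \<open>phi\<close>
  does not raise the dimension by \<open>jumps_phi\<close>. Elsewhere on the boundary the edge
  parameter is interior and the cell below drops in dimension.\<close>

lemma cdim_boundary: "e \<in> cells m ==> c \<in> cube_boundary (cdim e) ==> cdim (cellof (cmp e c)) < cdim e"
proof (induction m arbitrary: e c)
 case 0
 then obtain j v where e: "e = CBase j v" by auto
 have "stepfun (Echar v c)" unfolding Echar_def by (rule stepfun_step)
 from cdim_vals[OF this] show ?case using Echar_boundary[of c v] 0(2) by (simp add: e)
next
 case (Suc m)
 from Suc.prems(1) show ?case
 proof (cases rule: cells_SucE)
  case (v l s v)
  have "stepfun (Echar v c)" unfolding Echar_def by (rule stepfun_step)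
  from cdim_vals[OF this] show ?thesis using Echar_boundary[of c v] Suc.prems(2) by (simp add: v(1))
 next
  case (e d g)
  let ?n = "cdim d" and ?w = "cmp d (c(cdim d := 0))"
  have c: "c \<in> cube (Suc ?n)" "c ?n = 0 \<or> c ?n = 1 \<or> c(?n := 0) \<in> cube_boundary ?n"
   using cube_boundary_SucD[of c ?n] Suc.prems(2) by (simp_all add: e(1))
  have c0: "c(?n := 0) \<in> cube ?n" using c(1) cube_Suc_upd by blast
  have w: "?w \<in> pts m" by (rule cmp_pts[OF e(2) c0])
  have le: "cdim (cellof ?w) <= ?n"
   using cube_open_or_boundary[OF c0] cellof_cmp[OF e(2), of "c(?n := 0)"] Suc.IH[OF e(2), of "c(?n := 0)"]
   by (auto simp del: fun_upd_apply)
  have "0 <= c ?n" "c ?n <= 1" using c(1) by (auto simp: cube_iff)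
  then consider "c ?n = 0 \<or> c ?n = 1" | "0 < c ?n" "c ?n < 1" by linarith
  thus ?thesis
  proof cases
   case 1
   have "length (vals (phi ?w)) - 1 <= ?n"
    using cdim_vals[OF EE_stepfun[OF phi_EE[OF w]]] jumps_phi[OF w] le by simp
   thus ?thesis using 1 by (auto simp: e(1) edge_def simp del: fun_upd_apply)
  next
   case 2
   hence "c(?n := 0) \<in> cube_boundary ?n" using c(2) by auto
   from Suc.IH[OF e(2) this] show ?thesis using 2 by (simp add: e(1) edge_def del: fun_upd_apply)
  qed
 qed
qed

text \<open>A finite set that contains every value occurring while a first entry walks along the
  coset: the clamped exponent never exceeds the final exponent \<open>L - hs p\<close> in absolute
  value, whatever the bound \<open>k\<close> is.\<close>

definition PW :: "bool => fg => int => gp set => gp set" where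
 "PW i g L W = (\<lambda>(p, a). ((g + pow i a) # fst p, snd p)) ` (SIGMA p:W. {- \<bar>L - hs p\<bar>..\<bar>L - hs p\<bar>})"

lemma finite_PW: "finite W ==> finite (PW i g L W)"
 unfolding PW_def by (intro finite_imageI finite_SigmaI) auto

lemma PW_mem: "p \<in> W ==> - \<bar>L - hs p\<bar> <= a ==> a <= \<bar>L - hs p\<bar> ==> ((g + pow i a) # fst p, snd p) \<in> PW i g L W"
 unfolding PW_def by (rule image_eqI[of _ _ "(p, a)"]) auto

lemma Psi_values:
 assumes "f ` {0..<1} \<subseteq> W"
 shows "Psi i g L (t, f) ` {0..<1} \<subseteq> PW i g L W"
proof
 fix y assume "y \<in> Psi i g L (t, f) ` {0..<1}"
 then obtain x where x: "0 <= x" "x < 1" "y = Psi i g L (t, f) x" by auto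
 have fx: "f x \<in> W" using assms x by auto
 have "vmap (line i g) (L + fh g) (f x) \<in> PW i g L W" unfolding vmap_line by (rule PW_mem[OF fx]) auto
 moreover have "ebm i g L k (f x) \<in> PW i g L W" for k
  unfolding ebm_def by (rule PW_mem[OF fx]) (auto simp: clampi_def)
 ultimately show "y \<in> PW i g L W" using x by (auto simp: Psi_def Mix_def)
qed

lemma plots_values: "(n, \<pi>) \<in> plots m ==> \<exists>W. finite W \<and> (\<forall>c\<in>cube n. phi (\<pi> c) ` {0..<1} \<subseteq> W)"
proof (induction m arbitrary: n \<pi>)
 case 0
 then obtain \<pi>0 j where p: "(n, \<pi>0) \<in> SEplots (VV 0) cl" "\<pi> = (\<lambda>c. Base j (\<pi>0 c))" by auto
 then obtain v where v: "v ~= []" "\<pi>0 = step v" by (auto simp: SEplots_def)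
 show ?case using step_image[OF v(1)] by (intro exI[of _ "set v"]) (simp add: p(2) v(2))
next
 case (Suc m)
 from Suc.prems show ?case
 proof (cases rule: plots_SucE)
  case (v l s \<pi>0)
  then obtain w where w: "w ~= []" "\<pi>0 = step w" by (auto simp: SEplots_def)
  have "phi (\<pi> c) ` {0..<1} \<subseteq> vmap l s ` set w" for c
   using step_image[OF w(1), of c] by (simp only: v(3) w(2) phi.simps lft_image) blast
  thus ?thesis by (intro exI[of _ "vmap l s ` set w"]) auto
 next
  case (e n0 \<pi>0 g)
  obtain W where W: "finite W" "\<forall>c\<in>cube n0. phi (\<pi>0 c) ` {0..<1} \<subseteq> W" using Suc.IH[OF e(2)] by blast
  obtain t where t: "\<forall>c\<in>cube n0. lev (\<pi>0 c) = t" using plots_cont[OF e(2)] by blast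
  have "phi (\<pi> c) ` {0..<1} \<subseteq> PW False g t W \<union> PW True g t W" if c: "c \<in> cube n" for c
  proof -
   have c0: "c(n0 := 0) \<in> cube n0" using c e(1) cube_Suc_upd by blast
   have "0 <= c n0" "c n0 <= 1" using c by (auto simp: cube_iff)
   note ph = phi_edge[OF this, of "\<pi>0 (c(n0 := 0))" g]
   have lv: "lev (\<pi>0 (c(n0 := 0))) = t" and im: "phi (\<pi>0 (c(n0 := 0))) ` {0..<1} \<subseteq> W" using t W(2) c0 by auto
   show ?thesis unfolding e(3) ph lv
    using Psi_values[OF im, of False g t "2 * c n0"] Psi_values[OF im, of True g t "2 * (1 - c n0)"]
    by (cases "c n0 <= 1/2") auto
  qed
  thus ?thesis using finite_PW[OF W(1)] by (intro exI[of _ "PW False g t W \<union> PW True g t W"]) auto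
 qed
qed

text \<open>New cells arise only at the ends of an edge, where \<open>phi\<close> has boundedly many
  jumps and takes its values in a fixed finite set. This leaves finitely many lists.\<close>

lemma finite_cells_plot: "(n, \<pi>) \<in> plots m ==> finite (cellof ` \<pi> ` cube n)"
proof (induction m arbitrary: n \<pi>)
 case 0
 then obtain \<pi>0 j where p: "(n, \<pi>0) \<in> SEplots (VV 0) cl" "\<pi> = (\<lambda>c. Base j (\<pi>0 c))" by auto
 then obtain v where v: "v ~= []" "\<pi>0 = step v" by (auto simp: SEplots_def)
 have "cellof ` \<pi> ` cube n \<subseteq> CBase j ` {l. set l \<subseteq> set v \<and> length l <= Suc (length v - 1)}"
  using vals_bound[OF stepfun_step step_image[OF v(1)] card_jumps_step] by (auto simp: p(2) v(2))
 thus ?case by (rule finite_subset) (intro finite_imageI finite_lists_length_le finite_set)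
next
 case (Suc m)
 from Suc.prems show ?case
 proof (cases rule: plots_SucE)
  case (v l s \<pi>0)
  then obtain w where w: "w ~= []" "\<pi>0 = step w" by (auto simp: SEplots_def)
  have "cellof ` \<pi> ` cube n \<subseteq> CVert l s ` {l. set l \<subseteq> set w \<and> length l <= Suc (length w - 1)}"
   using vals_bound[OF stepfun_step step_image[OF w(1)] card_jumps_step] by (auto simp: v(3) w(2))
  thus ?thesis by (rule finite_subset) (intro finite_imageI finite_lists_length_le finite_set)
 next
  case (e n0 \<pi>0 g)
  let ?F = "cellof ` \<pi>0 ` cube n0"
  have fin: "finite ?F" by (rule Suc.IH[OF e(2)])
  obtain W where W: "finite W" "\<forall>c\<in>cube n0. phi (\<pi>0 c) ` {0..<1} \<subseteq> W" using plots_values[OF e(2)] by blast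
  obtain t where t: "\<forall>c\<in>cube n0. lev (\<pi>0 c) = t" using plots_cont[OF e(2)] by blast
  define N where "N = Max (cdim ` ?F)"
  let ?V = "{l. set l \<subseteq> W \<and> length l <= Suc N}"
  have "cellof ` \<pi> ` cube n \<subseteq> (\<lambda>c. CEdge c g) ` ?F \<union> CVert (line False g) (t + fh g) ` ?V \<union> CVert (line True g) (t + fh g) ` ?V"
  proof
   fix x assume "x \<in> cellof ` \<pi> ` cube n"
   then obtain c where c: "c \<in> cube n" "x = cellof (\<pi> c)" by auto
   have c0: "c(n0 := 0) \<in> cube n0" using c e(1) cube_Suc_upd by blast
   let ?w = "\<pi>0 (c(n0 := 0))"
   have w: "?w \<in> pts m" using cmap_in[OF plot_cont[OF e(2)] c0] by (simp add: topspace_YY)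
   have inF: "cellof ?w \<in> ?F" using c0 by blast
   hence "cdim (cellof ?w) <= N" unfolding N_def using fin by (intro Max_ge) auto
   hence "card (jumps (phi ?w)) <= N" using jumps_phi[OF w] by linarith
   moreover have "phi ?w ` {0..<1} \<subseteq> W" using W(2) c0 by blast
   ultimately have vV: "vals (phi ?w) \<in> ?V" using vals_bound[OF EE_stepfun[OF phi_EE[OF w]]] by blast
   have lv: "lev ?w = t" using t c0 by blast
   have "cellof (\<pi> c) = CEdge (cellof ?w) g \<or> cellof (\<pi> c) = CVert (line False g) (t + fh g) (vals (phi ?w))
    \<or> cellof (\<pi> c) = CVert (line True g) (t + fh g) (vals (phi ?w))"
    by (cases "c n0 <= 0"; cases "1 <= c n0") (simp_all add: e(3) edge_def lv del: fun_upd_apply)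
   thus "x \<in> (\<lambda>c. CEdge c g) ` ?F \<union> CVert (line False g) (t + fh g) ` ?V \<union> CVert (line True g) (t + fh g) ` ?V"
    by (elim disjE) (use c(2) inF vV in blast)+
  qed
  moreover have "finite ?V" by (rule finite_lists_length_le[OF W(1)])
  hence "finite ((\<lambda>c. CEdge c g) ` ?F \<union> CVert (line False g) (t + fh g) ` ?V \<union> CVert (line True g) (t + fh g) ` ?V)"
   by (intro finite_UnI finite_imageI fin)
  ultimately show ?thesis by (rule finite_subset)
 qed
qed

text \<open>Characteristic maps differ from plots only by the reparametrisation \<open>bb\<close>,
  so finiteness for plots carries over to cells.\<close>

lemma cmp_plot: "e \<in> cells m ==> \<exists>\<pi>. (cdim e, \<pi>) \<in> plots m \<and> cmp e ` cube (cdim e) \<subseteq> \<pi> ` cube (cdim e)"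
proof (induction m arbitrary: e)
 case 0
 then obtain j v where e: "e = CBase j v" "Ecell (VV 0) cl v" by auto
 have p: "(length v - 1, step v) \<in> SEplots (VV 0) cl" using e(2) by (auto simp: SEplots_def Ecell_def)
 have "(length v - 1, \<lambda>c. Base j (step v c)) \<in> plots 0" using p by auto
 thus ?case using bb_cube[of _ "length v - 1"] by (intro exI[of _ "\<lambda>c. Base j (step v c)"]) (auto simp: e(1) Echar_def)
next
 case (Suc m)
 from Suc.prems show ?case
 proof (cases rule: cells_SucE)
  case (v l s v)
  have p: "(length v - 1, step v) \<in> SEplots (VV m) cl" using v(3) by (auto simp: SEplots_def Ecell_def)
  have "(length v - 1, \<lambda>c. Vert l s (step v c)) \<in> plots (Suc m)" by (rule plots_VertI[OF v(2) p])
  thus ?thesis using bb_cube[of _ "length v - 1"] by (intro exI[of _ "\<lambda>c. Vert l s (step v c)"]) (auto simp: v(1) Echar_def)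
 next
  case (e d g)
  let ?n = "cdim d"
  obtain \<pi> where p: "(?n, \<pi>) \<in> plots m" "cmp d ` cube ?n \<subseteq> \<pi> ` cube ?n" using Suc.IH[OF e(2)] by blast
  let ?p = "\<lambda>c. edge (\<pi> (c(?n := 0))) g (c ?n)"
  have "cmp e ` cube (cdim e) \<subseteq> ?p ` cube (cdim e)"
  proof
   fix y assume "y \<in> cmp e ` cube (cdim e)"
   then obtain c where c: "c \<in> cube (Suc ?n)" "y = edge (cmp d (c(?n := 0))) g (c ?n)" by (auto simp: e(1))
   have "cmp d (c(?n := 0)) \<in> \<pi> ` cube ?n" using p(2) cube_Suc_upd[OF c(1)] by blast
   then obtain b where b: "b \<in> cube ?n" "cmp d (c(?n := 0)) = \<pi> b" by blast
   have "0 <= c ?n" "c ?n <= 1" using c(1) by (auto simp: cube_iff)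
   hence "b(?n := c ?n) \<in> cube (Suc ?n)" by (rule cube_upd_Suc[OF b(1)])
   moreover have "y = ?p (b(?n := c ?n))" using c(2) b(2) cube_upd0[OF b(1)] by simp
   ultimately show "y \<in> ?p ` cube (cdim e)" unfolding e(1) cdim.simps by blast
  qed
  thus ?thesis using plots_edgeI[OF p(1), of g] e(1) by auto
 qed
qed

lemma finite_cells_cmp: "e \<in> cells m ==> finite (cellof ` cmp e ` cube (cdim e))"
proof -
 assume "e \<in> cells m"
 then obtain \<pi> where p: "(cdim e, \<pi>) \<in> plots m" "cmp e ` cube (cdim e) \<subseteq> \<pi> ` cube (cdim e)" using cmp_plot by blast
 show ?thesis by (rule finite_subset[OF image_mono[OF p(2)] finite_cells_plot[OF p(1)]])
qed

lemma inj_gmul: "a \<in> VV m ==> inj_on (gmul a) (VV m)"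
proof (rule inj_onI)
 fix x y assume a: "a \<in> VV m" "x \<in> VV m" "y \<in> VV m" "gmul a x = gmul a y"
 have "gmul (ginv a) (gmul a z) = z" if "z \<in> VV m" for z
  using gmul_gone[OF that] by (simp only: gmul_assoc[symmetric] gmul_ginv[OF a(1)])
 thus "x = y" using a by metis
qed

lemma Ecell_gmul: "a \<in> VV m ==> Ecell (VV m) cl e ==> Ecell (VV m) cl (map (gmul a) e)"
 unfolding Ecell_def
 by (auto intro!: clique_gmul distinct_adj_mapI inj_on_subset[OF inj_gmul] simp: clique_def[of "VV m" cl "set e"])

lemma cact_cells: "e \<in> cells m ==> a \<in> VV m ==> cact e a \<in> cells m \<and> cdim (cact e a) = cdim e \<and> clev (cact e a) = clev e + hs a"
proof (induction m arbitrary: e a)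
 case 0
 thus ?case using Ecell_gmul[OF 0(2)] by auto
next
 case (Suc m)
 from Suc.prems(1) show ?case
 proof (cases rule: cells_SucE)
  case (v l s v)
  thus ?thesis using Ecell_gmul[OF gtl_VV[OF Suc.prems(2)] v(3)] by simp
 next
  case (e d g)
  thus ?thesis using Suc.IH[OF e(2) gtl_VV[OF Suc.prems(2)]] hs_gtl[OF Suc.prems(2)] by simp
 qed
qed

lemma vals_gmul: "a \<in> VV m ==> f \<in> topspace (EE m) ==> vals (lft (gmul a) f) = map (gmul a) (vals f)"
proof -
 assume a: "a \<in> VV m" and f: "f \<in> topspace (EE m)"
 have "f ` {0..<1} \<subseteq> VV m" using EE_val[OF f] by auto
 hence "inj_on (gmul a) (f ` {0..<1})" by (rule inj_on_subset[OF inj_gmul[OF a]])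
 thus ?thesis by (rule lft_inj(2)[OF _ EE_stepfun[OF f]])
qed

lemma cellof_act: "y \<in> pts m ==> a \<in> VV m ==> cellof (act y a) = cact (cellof y) a"
proof (induction m arbitrary: y a)
 case 0
 thus ?case using vals_gmul[OF 0(2)] by auto
next
 case (Suc m)
 from Suc.prems(1) show ?case
 proof (cases rule: pts_SucE)
  case (v l s f)
  thus ?thesis using vals_gmul[OF gtl_VV[OF Suc.prems(2)] v(3)] by simp
 next
  case (e z g u)
  thus ?thesis using Suc.IH[OF e(2) gtl_VV[OF Suc.prems(2)]] by simp
 qed
qed

lemma cact_mult: "e \<in> cells m ==> a \<in> VV m ==> b \<in> VV m ==> cact e (gmul a b) = cact (cact e b) a"
proof (induction m arbitrary: e a b)
 case 0
 thus ?case by (auto simp: gmul_assoc hs_gmul[of a 0 b])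
next
 case (Suc m)
 have g: "gtl (gmul a b) = gmul (gtl a) (gtl b)" "ghd (gmul a b) = ghd a + sg (snd a) (ghd b)"
  using gmul_gtl[OF Suc.prems(2,3)] by auto
 have s: "snd (gmul a b) = (snd a ~= snd b)" by (simp add: gmul_def)
 have h: "hs (gmul a b) = hs b + hs a" using hs_gmul[OF Suc.prems(2,3)] by simp
 from Suc.prems(1) show ?case
 proof (cases rule: cells_SucE)
  case (v l t v)
  thus ?thesis by (simp add: g s h lact_lact gmul_assoc)
 next
  case (e d k)
  thus ?thesis using Suc.IH[OF e(2) gtl_VV[OF Suc.prems(2)] gtl_VV[OF Suc.prems(3)]]
   by (simp add: g s add.assoc)
 qed
qed

lemma gone_SucI: "a \<in> VV (Suc m) ==> ghd a = 0 ==> gtl a = gone m ==> a = gone (Suc m)"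
 using VV_SucE[of a m] by (auto simp: ghd_def gtl_def gone_def)

lemma map_gmul_free:
 assumes "a \<in> VV m" "Ecell (VV m) cl v" "map (gmul a) v = v"
 shows "a = gone m"
proof -
 have v: "v ~= []" "hd v \<in> VV m" using assms(2) by (auto simp: Ecell_def clique_def)
 hence "gmul a (hd v) = hd v" using assms(3) by (cases v) auto
 thus ?thesis by (rule gmul_free[OF assms(1) v(2)])
qed

text \<open>A cell over a vertex is an ordered tuple, so fixing it fixes its first value, and left
  multiplication by a nontrivial element has no fixed point. This settles all entries but the first,
  and the swap bit. The fixed level then gives the first entry exponent sum 0, so it fixes the word
  of exponent sum 0 in the coset and must be trivial. On an edge the first entry fixes the word
  \<open>g\<close> once the swap bit is gone.\<close>

lemma cact_free: "e \<in> cells m ==> a \<in> VV m ==> cact e a = e ==> a = gone m"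
proof (induction m arbitrary: e a)
 case 0
 thus ?case using map_gmul_free[OF 0(2)] by auto
next
 case (Suc m)
 note a = Suc.prems(2)
 from Suc.prems(1) show ?case
 proof (cases rule: cells_SucE)
  case (v l s v)
  have 1: "lact (ghd a) (snd a) l = l" "hs a = 0" "map (gmul (gtl a)) v = v" using Suc.prems(3) by (simp_all add: v(1))
  have g: "gtl a = gone m" by (rule map_gmul_free[OF gtl_VV[OF a] v(3) 1(3)])
  hence s: "\<not> snd a" using snd_gtl[of a] gone_gtl(3)[of m] by simp
  have "hs (gone m) = 0" by (simp add: gone_def hs_def sum_list_replicate)
  hence "fh (ghd a) = 0" using hs_gtl[OF a] 1(2) g by simp
  hence "lpos l 0 = ghd a + lpos l 0" using lpos_lact[OF v(2), of "ghd a" "snd a" 0] 1(1) s by simp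
  hence "ghd a = 0" by (metis add_right_cancel add_0)
  thus ?thesis by (rule gone_SucI[OF a _ g])
 next
  case (e d g)
  have 1: "cact d (gtl a) = d" "ghd a + sg (snd a) g = g" using Suc.prems(3) by (simp_all add: e(1))
  have t: "gtl a = gone m" by (rule Suc.IH[OF e(2) gtl_VV[OF a] 1(1)])
  hence "\<not> snd a" using snd_gtl[of a] gone_gtl(3)[of m] by simp
  hence "ghd a + g = 0 + g" using 1(2) by simp
  hence "ghd a = 0" by (simp only: add_right_cancel)
  thus ?thesis by (rule gone_SucI[OF a _ t])
 qed
qed

text \<open>Vertex cells have finitely many orbits in every dimension, since the other values are
  close to the first one, which can be translated to the neutral element. Only edge cells limit the
  range: an edge cell has one dimension more than the cell below, so the strict bound moves from
  \<open>m\<close> to \<open>Suc m\<close>, starting from nothing at 0.\<close>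

lemma finite_orbits: "\<exists>S. finite S \<and> (\<forall>e\<in>cells m. cdim e < m --> (\<exists>a\<in>VV m. cact e a \<in> S))"
proof (induction m)
 case 0
 show ?case by (intro exI[of _ "{}"]) simp
next
 case (Suc m)
 obtain S where S: "finite S" "\<forall>e\<in>cells m. cdim e < m --> (\<exists>a\<in>VV m. cact e a \<in> S)" using Suc by blast
 let ?V = "{v. set v \<subseteq> {p. cl (gone m) p} \<and> length v <= Suc m}"
 let ?T = "(\<lambda>(i, v). CVert (line i 0) 0 v) ` (UNIV \<times> ?V) \<union> (\<lambda>c. CEdge c 0) ` S"
 have "finite ?V" by (rule finite_lists_length_le[OF finite_cl])
 hence fin: "finite ?T" using S(1) by (intro finite_UnI finite_imageI finite_cartesian_product) auto
 have cons: "(w # fst b, snd b) \<in> VV (Suc m)" "gtl (w # fst b, snd b) = b" "ghd (w # fst b, snd b) = w" if "b \<in> VV m" for w b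
  using that by (auto simp: VV_def gtl_def ghd_def)
 have "\<exists>a\<in>VV (Suc m). cact e a \<in> ?T" if e: "e \<in> cells (Suc m)" "cdim e < Suc m" for e
  using e(1)
 proof (cases rule: cells_SucE)
  case (v l s v)
  have v': "v ~= []" "clique (VV m) cl (set v)" using v(3) by (auto simp: Ecell_def)
  \<comment> \<open>\<open>b\<close> moves the first value to the neutral element. Then
    \<open>w\<close> is chosen with the right exponent sum to bring the level to 0 and the coset to
    one through the trivial word.\<close>
  define b where "b = ginv (hd v)"
  have hv: "hd v \<in> set v" using v'(1) by simp
  hence hV: "hd v \<in> VV m" using v'(2) unfolding clique_def by blast
  have b: "b \<in> VV m" "gmul b (hd v) = gone m" using gmul_ginv[OF hV] hV by (auto simp: b_def)
  define t where "t = s + hs b"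
  define w where "w = - sg (snd b) (lpos l t)"
  define a where "a = (w # fst b, snd b)"
  note ca = cons[OF b(1), of w, folded a_def]
  have sa: "snd a = snd b" by (simp add: a_def)
  have "lact w (snd b) l = line (fst l ~= snd b) (w + sg (snd b) (lpos l t))"
   using lact_line[of w "snd b" "fst l" "lpos l t"] line_lpos[OF v(2), of t] by simp
  hence l: "lact w (snd b) l = line (fst l ~= snd b) 0" by (simp add: w_def)
  have s0: "s + hs a = 0" using hs_gtl[OF ca(1)] ca(2,3) v(2) by (simp add: w_def t_def)
  have "clique (VV m) cl (gmul b ` set v)" by (rule clique_gmul[OF b(1) v'(2)])
  hence "\<forall>p\<in>gmul b ` set v. cl (gone m) p" using b(2) hv unfolding clique_def by (metis imageI)
  hence mV: "map (gmul b) v \<in> ?V" using e(2) by (auto simp: v(1))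
  have ce: "cact e a = CVert (line (fst l ~= snd b) 0) 0 (map (gmul b) v)" using s0 l by (simp add: v(1) ca sa)
  have "cact e a \<in> ?T"
   unfolding ce by (rule UnI1, rule image_eqI[of _ _ "(fst l ~= snd b, map (gmul b) v)"]) (use mV in auto)
  thus ?thesis using ca(1) by blast
 next
  case e': (e d g)
  have "cdim d < m" using e(2) e'(1) by simp
  then obtain b where b: "b \<in> VV m" "cact d b \<in> S" using S(2) e'(2) by blast
  define a where "a = (- sg (snd b) g # fst b, snd b)"
  note ca = cons[OF b(1), of "- sg (snd b) g", folded a_def]
  have "cact e a = CEdge (cact d b) 0" using ca by (simp add: e'(1)) (simp add: a_def)
  thus ?thesis using ca(1) b(2) by blast
 qed
 thus ?case using fin by (intro exI[of _ ?T]) blast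
qed

lemma countable_cells: "countable (cells m)"
proof (induction m)
 case 0
 have "cells 0 \<subseteq> (\<lambda>(j, e). CBase j e) ` UNIV" by auto
 thus ?case by (rule countable_subset) (rule countable_image, rule countableI_type)
next
 case (Suc m)
 have "cells (Suc m) \<subseteq> (\<lambda>(i, g, s, e). CVert (line i g) s e) ` UNIV \<union> (\<lambda>(c, g). CEdge c g) ` (cells m \<times> UNIV)"
 proof
  fix e assume "e \<in> cells (Suc m)"
  thus "e \<in> (\<lambda>(i, g, s, e). CVert (line i g) s e) ` UNIV \<union> (\<lambda>(c, g). CEdge c g) ` (cells m \<times> UNIV)"
  proof (cases rule: cells_SucE)
   case (v l s v)
   then obtain i g where "l = line i g" by (auto simp: is_line_def)
   thus ?thesis using v by (intro UnI1 image_eqI[of _ _ "(i, g, s, v)"]) auto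
  qed auto
 qed
 thus ?case
  by (rule countable_subset) (intro countable_Un countable_image countable_SIGMA Suc countableI_type)
qed

lemma Hausdorff_YY: "Hausdorff_space (YY m)"
 unfolding Hausdorff_space_def topspace_YY
proof (intro allI impI)
 fix y y' assume y: "y \<in> pts m \<and> y' \<in> pts m \<and> y ~= y'"
 then obtain U U' where U: "openin (YY m) U" "openin (YY m) U'" "y \<in> U" "y' \<in> U'"
  "\<forall>a\<in>VV m. \<forall>z\<in>U'. act z a \<in> U --> act y' a = y" using separated_pts[of y m y'] unfolding separated_def by (elim exE conjE) auto
 have "disjnt U U'"
  unfolding disjnt_iff
 proof (intro allI notI)
  fix z assume z: "z \<in> U \<and> z \<in> U'"
  hence "z \<in> pts m" using openin_subset[OF U(1)] by (auto simp: topspace_YY)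
  hence "act y' (gone m) = y" using U(5) z act_one[of z m] gone_VV by metis
  thus False using act_one[of y' m] y by simp
 qed
 thus "\<exists>U V. openin (YY m) U \<and> openin (YY m) V \<and> y \<in> U \<and> y' \<in> V \<and> disjnt U V" using U by blast
qed

section \<open>The kernel of the exponent sum and its classifying space\<close>

definition HH :: "nat => gp monoid" where
 "HH m = \<lparr>carrier = {a \<in> VV m. hs a = 0}, mult = gmul, one = gone m\<rparr>"

lemma hs_gone [simp]: "hs (gone m) = 0"
 by (simp add: gone_def hs_def sum_list_replicate)

lemma hs_ginv: "a \<in> VV m ==> hs (ginv a) = - hs a"
 using hs_gmul[of "ginv a" m a] gmul_ginv[of a m] by simp

lemma group_HH: "group (HH m)"
proof (rule groupI)
 fix x assume "x \<in> carrier (HH m)"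
 thus "\<exists>y\<in>carrier (HH m). y \<otimes>\<^bsub>HH m\<^esub> x = \<one>\<^bsub>HH m\<^esub>"
  by (intro bexI[of _ "ginv x"]) (auto simp: HH_def gmul_ginv hs_ginv)
qed (auto simp: HH_def gmul_assoc gmul_gone hs_gmul)

lemma level_shift:
 assumes "0 < m"
 shows "\<exists>b\<in>VV m. hs b = t"
proof -
 obtain k where "m = Suc k" using assms by (cases m) auto
 thus ?thesis by (intro bexI[of _ "(pow False t # replicate k 0, False)"]) (auto simp: VV_def hs_def sum_list_replicate)
qed

abbreviation "LY m \<equiv> subtopology (YY m) {y \<in> pts m. lev y = 0}"

lemma cell_structure_LY:
 "cell_structure (HH m) (LY m) (\<lambda>a y. act y a) {e \<in> cells m. clev e = 0} cdim cmp cellof coords (\<lambda>a e. cact e a)"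
proof -
 let ?L = "{y \<in> pts m. lev y = 0}"
 have top: "topspace (LY m) = ?L" by (auto simp: topspace_YY)
 have lc: "clev (cellof y) = lev y" if "y \<in> pts m" for y using cellof_cells[OF that] lev_cmp[of "cellof y" "coords y"] by simp
 interpret group "HH m" by (rule group_HH)
 show ?thesis
 proof (unfold_locales, unfold top)
  fix g assume g: "g \<in> carrier (HH m)"
  hence g': "g \<in> VV m" "hs g = 0" by (auto simp: HH_def)
  show "continuous_map (LY m) (LY m) (\<lambda>y. act y g)"
   by (rule continuous_map_into_subtopology[OF continuous_map_from_subtopology[OF act_cont[OF g'(1)]]])
    (use act_props[OF _ g'(1)] g'(2) in auto)
  fix e assume e: "e \<in> {e \<in> cells m. clev e = 0}"
  show "cact e g \<in> {e \<in> cells m. clev e = 0} \<and> cdim (cact e g) = cdim e"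
   using cact_cells[of e m g] e g' by auto
  show "g = \<one>\<^bsub>HH m\<^esub>" if "cact e g = e" using cact_free[of e m g] that e g' by (simp add: HH_def)
  show "cact e (g \<otimes>\<^bsub>HH m\<^esub> h) = cact (cact e h) g" if "h \<in> carrier (HH m)" for h
   using cact_mult[of e m g h] that e g' by (simp add: HH_def)
 next
  fix y assume y: "y \<in> ?L"
  show "act y \<one>\<^bsub>HH m\<^esub> = y" using act_one[of y m] y by (simp add: HH_def)
  show "act y (g \<otimes>\<^bsub>HH m\<^esub> h) = act (act y h) g" if "g \<in> carrier (HH m)" "h \<in> carrier (HH m)" for g h
   using act_mult[of y m g h] that y by (simp add: HH_def)
  show "cellof (act y g) = cact (cellof y) g" if "g \<in> carrier (HH m)" for g
   using cellof_act[of y m g] that y by (simp add: HH_def)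
  show "cellof y \<in> {e \<in> cells m. clev e = 0} \<and> coords y \<in> open_cube (cdim (cellof y)) \<and> cmp (cellof y) (coords y) = y"
   using cellof_cells[of y m] lc[of y] y by simp
  fix y' assume y': "y' \<in> ?L"
  obtain U U' where U: "openin (YY m) U" "openin (YY m) U'" "y \<in> U" "y' \<in> U'"
   "\<forall>a\<in>VV m. \<forall>z\<in>U'. act z a \<in> U --> act y' a = y"
  proof -
   have "separated m y y'" using separated_pts y y' by simp
   thus ?thesis using that unfolding separated_def by (elim exE conjE)
  qed
  have o: "openin (LY m) (U \<inter> ?L)" "openin (LY m) (U' \<inter> ?L)" using U(1,2) by (auto intro: openin_subtopology_Int)
  have "\<forall>g\<in>carrier (HH m). \<forall>z\<in>U' \<inter> ?L. act z g \<in> U \<inter> ?L --> act y' g = y"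
  proof (intro ballI impI)
   fix g z assume h: "g \<in> carrier (HH m)" "z \<in> U' \<inter> ?L" "act z g \<in> U \<inter> ?L"
   have "g \<in> VV m" using h(1) by (simp add: HH_def)
   thus "act y' g = y" using U(5) h(2,3) by blast
  qed
  thus "\<exists>U U'. openin (LY m) U \<and> openin (LY m) U' \<and> y \<in> U \<and> y' \<in> U' \<and>
    (\<forall>g\<in>carrier (HH m). \<forall>z\<in>U'. act z g \<in> U --> act y' g = y)"
   using o U(3,4) y y' by (intro exI[of _ "U \<inter> ?L"] exI[of _ "U' \<inter> ?L"]) auto
 next
  fix e assume e: "e \<in> {e \<in> cells m. clev e = 0}"
  show "cmap (cube (cdim e)) (LY m) (cmp e)"
   by (rule continuous_map_into_subtopology) (use e cmp_cont cmp_pts lev_cmp in auto)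
  show "finite (cellof ` cmp e ` cube (cdim e))" using finite_cells_cmp[of e m] e by simp
  fix c
  show "cellof (cmp e c) = e \<and> coords (cmp e c) = c" if "c \<in> open_cube (cdim e)" using cellof_cmp[of e m] e that by simp
  show "cdim (cellof (cmp e c)) < cdim e" if "c \<in> cube_boundary (cdim e)" using cdim_boundary[of e m] e that by simp
 next
  show "countable {e \<in> cells m. clev e = 0}" by (rule countable_subset[OF _ countable_cells]) auto
  fix A assume A: "A \<subseteq> ?L" "\<And>e. e \<in> {e \<in> cells m. clev e = 0} ==> closed {c \<in> cube (cdim e). cmp e c \<in> A}"
  have "closedin (YY m) A"
  proof (rule plot_top_closed_test[OF Hausdorff_YY cmp_cont])
   show "cellof y \<in> cells m \<and> y \<in> cmp (cellof y) ` cube (cdim (cellof y))" if "y \<in> plot_space (plots m)" for y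
    using cellof_cells[of y m] that open_cube_subset by (metis image_eqI plot_space_pts subsetD)
   show "finite (cellof ` \<pi> ` cube n)" if "(n, \<pi>) \<in> plots m" for n \<pi> by (rule finite_cells_plot[OF that])
   show "A \<subseteq> topspace (YY m)" using A(1) by (auto simp: topspace_YY)
   show "closed {c \<in> cube (cdim e). cmp e c \<in> A}" if "e \<in> cells m" for e
   proof (cases "clev e = 0")
    case True
    thus ?thesis using A(2) that by simp
   next
    case False
    hence E: "{c \<in> cube (cdim e). cmp e c \<in> A} = {}" using A(1) lev_cmp[of e] by auto
    show ?thesis unfolding E by simp
   qed
  qed
  thus "closedin (LY m) A" using A(1) by (auto simp: closedin_subtopology)
 qed
qed

theorem HH_complex:
 assumes m: "0 < m"
 shows "\<exists>(X :: ('z list \<times> rvec) topology) C. CW_complex X C \<and> Eilenberg_MacLane_1 X (HH m) \<and> finite_skeleton (m - 1) C"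
proof -
 interpret cell_structure "HH m" "LY m" "\<lambda>a y. act y a" "{e \<in> cells m. clev e = 0}" cdim cmp cellof coords "\<lambda>a e. cact e a" "[] :: 'z list"
  by (rule cell_structure_LY)
 obtain S where S: "finite S" "\<forall>e\<in>cells m. cdim e < m --> (\<exists>a\<in>VV m. cact e a \<in> S)" using finite_orbits by blast
 \<comment> \<open>\<open>S\<close> represents the orbits of the whole group on cells of all levels.
   If \<open>a\<close> moves a cell of level 0 into \<open>S\<close>, the result has level
   \<open>hs a\<close>; a further translation by \<open>b (- hs a)\<close> returns it to level 0,
   and the product has exponent sum 0. So the shifted set meets the required orbits of the
   kernel.\<close>
 obtain b where b: "\<forall>t. b t \<in> VV m \<and> hs (b t) = t" using level_shift[OF m] by metis
 let ?S = "(\<lambda>e. cact e (b (- clev e))) ` S"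
 have "\<exists>g\<in>carrier (HH m). cact e g \<in> ?S" if e: "e \<in> {e \<in> cells m. clev e = 0}" "cdim e <= m - 1" for e
 proof -
  have "cdim e < m" using e(2) m by linarith
  then obtain a where a: "a \<in> VV m" "cact e a \<in> S" using S(2) e(1) by blast
  have l: "clev (cact e a) = hs a" using cact_cells[OF _ a(1), of e] e(1) by simp
  let ?g = "gmul (b (- hs a)) a"
  have "?g \<in> carrier (HH m)" using a(1) b by (simp add: HH_def hs_gmul[of _ m])
  moreover have "cact e ?g = cact (cact e a) (b (- clev (cact e a)))" using cact_mult[of e m "b (- hs a)" a] e(1) a(1) b l by simp
  ultimately show ?thesis using a(2) by blast
 qed
 then obtain X :: "('z list \<times> rvec) topology" and CC where X: "CW_complex X CC" "finite_skeleton (m - 1) CC"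
   "free_action (HH m) (LY m) X pr (\<lambda>a y. act y a)"
  using CW_quotient[of ?S "m - 1"] S(1) by blast
 obtain y0 where y0: "y0 \<in> topspace (LY m)"
  using weakly_contractible_nonempty[OF weakly_contractible_level[of m 0]] by blast
 interpret fa: wc_free_action "HH m" "LY m" X pr "\<lambda>a y. act y a" y0
  by (intro wc_free_action.intro wc_free_action_axioms.intro X(3) weakly_contractible_level y0)
 show ?thesis by (intro exI[of _ X] exI[of _ CC] conjI X(1,2) fa.Eilenberg_MacLane_quotient)
qed

section \<open>Automorphisms of free groups\<close>

text \<open>Words in infinitely many generators, so that one type serves every rank; the free group
  of rank \<open>k\<close> is recovered inside it as \<open>supp k\<close>.\<close>

typedef fn = "{w. reduced_word w}"
 by (rule exI[of _ "[]"]) simp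

setup_lifting type_definition_fn

instantiation fn :: group_add
begin
lift_definition zero_fn :: fn is "[]" by simp
lift_definition plus_fn :: "fn => fn => fn" is wmul by (rule wmul_reduced)
lift_definition uminus_fn :: "fn => fn" is winv by (rule reduced_winv)
definition minus_fn :: "fn => fn => fn" where "minus_fn a b = a + - b"
instance
proof
 fix a b c :: fn
 show "a + b + c = a + (b + c)" by transfer (simp add: wmul_assoc)
 show "0 + a = a" by transfer simp
 show "a + 0 = a" by transfer (simp add: wmul_Nil)
 show "- a + a = 0" by transfer (rule wmul_winv)
 show "a + - b = a - b" by (simp add: minus_fn_def)
qed
end

text \<open>The universal property of the free group: evaluation of a word after sending the i-th
  generator to \<open>f i\<close>.\<close>

primrec hx :: "(nat => 'a::group_add) => letter list => 'a" where
 "hx f [] = 0"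
| "hx f (l # w) = (if fst l then f (snd l) else - f (snd l)) + hx f w"

lemma hx_reduced_cons: "hx f (reduced_cons l w) = hx f (l # w)"
 by (cases w) (auto simp: inv_letter_def add.assoc[symmetric])

lemma hx_wmul: "hx f (wmul u v) = hx f u + hx f v"
 by (induction u) (auto simp: hx_reduced_cons add.assoc)

lemma hx_cong: "(\<And>l. l \<in> set w ==> f (snd l) = f' (snd l)) ==> hx f w = hx f' w"
 by (induction w) auto

lemma hx_conj: "hx (\<lambda>j. u + f j - u) w = u + hx f w - u"
proof (induction w)
 case (Cons l w)
 have "- (u + f (snd l) - u) = u + - f (snd l) - u"
  by (simp only: diff_conv_add_uminus minus_add minus_minus add.assoc)
 hence "(if fst l then u + f (snd l) - u else - (u + f (snd l) - u)) = u + (if fst l then f (snd l) else - f (snd l)) - u"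
  by simp
 thus ?case unfolding hx.simps Cons
  by (simp only: diff_conv_add_uminus add.assoc minus_add_cancel)
qed simp

lemma hx_map: "(\<And>l. fst (t l) = fst l) ==> (\<And>l. l \<in> set w ==> snd (t l) = p (snd l)) ==> hx f (map t w) = hx (\<lambda>j. f (p j)) w"
 by (induction w) auto

lemma hx_additive:
 fixes \<phi> :: "'a::group_add => 'b::group_add"
 assumes add: "\<And>x y. \<phi> (x + y) = \<phi> x + \<phi> y"
 shows "\<phi> (hx f w) = hx (\<lambda>j. \<phi> (f j)) w"
proof -
 have "\<phi> 0 + \<phi> 0 = \<phi> 0 + 0" using add[of 0 0] by (simp only: add_0_right)
 hence z: "\<phi> 0 = 0" by (simp only: add_left_cancel)
 have m: "\<phi> (- x) = - \<phi> x" for x using add[of "- x" x] z by (simp add: eq_neg_iff_add_eq_0)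
 show ?thesis by (induction w) (auto simp: z m add)
qed

definition gen :: "nat => fn" where "gen j = Abs_fn [(True, j)]"

lemma Rep_gen: "Rep_fn (gen j) = [(True, j)]"
 by (simp add: gen_def Abs_fn_inverse reduced_Cons)

lemma hx_gen: "reduced_word w ==> Rep_fn (hx gen w) = w"
proof (induction w)
 case (Cons l w)
 have "Rep_fn (if fst l then gen (snd l) else - gen (snd l)) = [l]"
  by (cases l) (simp add: Rep_gen uminus_fn.rep_eq winv_def inv_letter_def)
 hence "Rep_fn (hx gen (l # w)) = wmul [l] w" using Cons by (simp add: plus_fn.rep_eq reduced_Cons)
 thus ?case using reduced_cons_Cons[OF Cons.prems] by simp
qed (simp add: zero_fn.rep_eq)

lemma hx_gen_Rep: "hx gen (Rep_fn x) = x"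
 using hx_gen[of "Rep_fn x"] Rep_fn[of x] by (simp add: Rep_fn_inject)

definition shl :: "nat => letter => letter" where "shl i l = (fst l, 2 * i + snd l)"

definition emb :: "nat => fg => fn" where "emb i v = hx (\<lambda>j. gen (2 * i + j)) (Rep_fg v)"

lemma emb_add: "emb i (v + w) = emb i v + emb i w"
 by (simp add: emb_def plus_fg.rep_eq hx_wmul)

lemma emb_0 [simp]: "emb i 0 = 0"
 by (simp add: emb_def zero_fg.rep_eq)

lemma Rep_emb: "Rep_fn (emb i v) = map (shl i) (Rep_fg v)"
proof -
 have inv: "inv_letter (shl i l) = shl i (inv_letter l)" and inj: "shl i l = shl i l' \<longleftrightarrow> l = l'" for l l'
  by (auto simp: inv_letter_def shl_def prod_eq_iff)
 have "reduced_word w ==> reduced_word (map (shl i) w)" for w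
  by (induction w) (auto simp: reduced_Cons hd_map inv inj)
 hence "reduced_word (map (shl i) (Rep_fg v))" using Rep_fg[of v] by simp
 moreover have "emb i v = hx gen (map (shl i) (Rep_fg v))"
  unfolding emb_def by (rule hx_map[symmetric]) (auto simp: shl_def)
 ultimately show ?thesis by (simp add: hx_gen)
qed

lemma emb_inj: "emb i v = emb i w \<longleftrightarrow> v = w"
proof
 assume "emb i v = emb i w"
 hence "map (shl i) (Rep_fg v) = map (shl i) (Rep_fg w)" by (simp only: Rep_emb[symmetric])
 moreover have "inj (shl i)" by (auto simp: inj_on_def shl_def prod_eq_iff)
 ultimately show "v = w" by (simp add: Rep_fg_inject inj_map_eq_map)
qed simp

lemma emb_pow: "emb i (pow b 1) = gen (2 * i + of_bool b)"
 by (simp add: emb_def pow.rep_eq)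

definition tw :: "bool => nat => nat" where
 "tw e j = (if e then (if even j then j + 1 else j - 1) else j)"

lemma tw_div [simp]: "tw e j div 2 = j div 2"
 by (auto simp: tw_def elim!: oddE)

lemma tw_tw: "tw e (tw d j) = tw (e ~= d) j"
 by (auto simp: tw_def)

lemma tw_less: "tw e j < 2 * m \<longleftrightarrow> j < 2 * m"
proof -
 have "i < 2 * m \<longleftrightarrow> i div 2 < m" for i :: nat by auto
 thus ?thesis by simp
qed

lemma emb_sg: "emb i (sg e v) = hx (\<lambda>j. gen (tw e (2 * i + j))) (Rep_fg v)"
proof (cases e)
 case True
 have "emb i (swp v) = hx (\<lambda>j. gen (2 * i + (1 - j))) (Rep_fg v)"
  unfolding emb_def swp.rep_eq by (rule hx_map) (auto simp: swl_def)
 also have "\<dots> = hx (\<lambda>j. gen (tw True (2 * i + j))) (Rep_fg v)"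
 proof (rule hx_cong)
  fix l assume "l \<in> set (Rep_fg v)"
  hence "l \<in> UNIV \<times> {..<2}" using Rep_fg[of v] by blast
  hence "snd l = 0 \<or> snd l = 1" by (cases l) auto
  thus "gen (2 * i + (1 - snd l)) = gen (tw True (2 * i + snd l))" by (auto simp: tw_def)
 qed
 finally show ?thesis using True by (simp add: sg_def)
next
 case False
 thus ?thesis by (simp add: emb_def tw_def)
qed

text \<open>
 On the free factor generated by \<open>gen (2 * i)\<close> and \<open>gen (2 * i + 1)\<close> the automorphism \<open>gaut a\<close>
 swaps the generators if \<open>snd a\<close> and then conjugates by the \<open>i\<close>-th entry of \<open>fst a\<close>.
\<close>

definition gaut1 :: "gp => nat => fn" where
 "gaut1 a j = (if j < 2 * length (fst a)
   then emb (j div 2) (fst a ! (j div 2)) + gen (tw (snd a) j) - emb (j div 2) (fst a ! (j div 2)) else gen j)"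

definition gaut :: "gp => fn => fn" where "gaut a x = hx (gaut1 a) (Rep_fn x)"

lemma gaut_add: "gaut a (x + y) = gaut a x + gaut a y"
 by (simp add: gaut_def plus_fn.rep_eq hx_wmul)

lemma gaut_gen: "gaut a (gen j) = gaut1 a j"
 by (simp add: gaut_def Rep_gen)

lemma gaut_minus: "gaut a (- x) = - gaut a x"
proof -
 have "gaut a 0 = 0" by (simp add: gaut_def zero_fn.rep_eq)
 thus ?thesis using gaut_add[of a "- x" x] by (simp add: eq_neg_iff_add_eq_0)
qed

lemma additive_eq:
 fixes \<phi> \<psi> :: "fn => fn"
 assumes "\<And>x y. \<phi> (x + y) = \<phi> x + \<phi> y" "\<And>x y. \<psi> (x + y) = \<psi> x + \<psi> y" "\<And>j. \<phi> (gen j) = \<psi> (gen j)"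
 shows "\<phi> x = \<psi> x"
 using hx_additive[of \<phi> gen "Rep_fn x", OF assms(1)] hx_additive[of \<psi> gen "Rep_fn x", OF assms(2)]
 by (simp add: hx_gen_Rep assms(3))

lemma gaut_emb:
 assumes "i < length (fst a)"
 shows "gaut a (emb i v) = emb i (fst a ! i) + emb i (sg (snd a) v) - emb i (fst a ! i)"
proof -
 have "gaut a (emb i v) = hx (\<lambda>j. gaut a (gen (2 * i + j))) (Rep_fg v)"
  unfolding emb_def by (rule hx_additive) (rule gaut_add)
 also have "\<dots> = hx (\<lambda>j. emb i (fst a ! i) + gen (tw (snd a) (2 * i + j)) - emb i (fst a ! i)) (Rep_fg v)"
 proof (rule hx_cong)
  fix l assume "l \<in> set (Rep_fg v)"
  hence "l \<in> UNIV \<times> {..<2}" using Rep_fg[of v] by blast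
  hence "snd l < 2" by (cases l) auto
  hence "(2 * i + snd l) div 2 = i" "2 * i + snd l < 2 * length (fst a)" using assms by auto
  thus "gaut a (gen (2 * i + snd l)) = emb i (fst a ! i) + gen (tw (snd a) (2 * i + snd l)) - emb i (fst a ! i)"
   by (simp add: gaut_gen gaut1_def)
 qed
 finally show ?thesis unfolding hx_conj emb_sg .
qed

text \<open>Both sides are additive, so generators suffice. Conjugation by \<open>v\<close> is
  turned by \<open>gaut a\<close> into conjugation by the image of \<open>v\<close>, which is the
  swapped \<open>v\<close> conjugated by the entry \<open>U\<close> of \<open>a\<close>; together
  with \<open>U\<close> the conjugator becomes \<open>U + V\<close>, as in the semidirect
  product.\<close>

lemma gaut_mult:
 assumes a: "a \<in> VV m" and b: "b \<in> VV m"
 shows "gaut a (gaut b x) = gaut (gmul a b) x"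
proof (rule additive_eq[where \<phi> = "\<lambda>x. gaut a (gaut b x)"])
 have len: "length (fst a) = m" "length (fst b) = m" "length (fst (gmul a b)) = m" using a b by (auto simp: VV_def gmul_def)
 fix j
 show "gaut a (gaut b (gen j)) = gaut (gmul a b) (gen j)"
 proof (cases "j < 2 * m")
  case True
  define i where "i = j div 2"
  have i: "i < m" using True by (auto simp: i_def)
  define U where "U = emb i (fst a ! i)"
  define V where "V = emb i (sg (snd a) (fst b ! i))"
  have ab: "fst (gmul a b) ! i = fst a ! i + sg (snd a) (fst b ! i)" using i len by (simp add: gmul_def)
  have e: "gaut a (emb i (fst b ! i)) = U + V - U" unfolding U_def V_def by (rule gaut_emb) (use i len in simp)
  have g: "gaut a (gen (tw (snd b) j)) = U + gen (tw (snd (gmul a b)) j) - U"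
   using True by (simp add: gaut_gen gaut1_def len tw_less tw_tw U_def i_def gmul_def)
  have "gaut b (gen j) = emb i (fst b ! i) + gen (tw (snd b) j) + - emb i (fst b ! i)"
   using True by (simp add: gaut_gen gaut1_def len i_def[symmetric])
  hence "gaut a (gaut b (gen j)) = gaut a (emb i (fst b ! i)) + gaut a (gen (tw (snd b) j)) + - gaut a (emb i (fst b ! i))"
   by (simp only: gaut_add gaut_minus)
  also have "\<dots> = (U + V) + gen (tw (snd (gmul a b)) j) - (U + V)"
   unfolding e g by (simp only: diff_conv_add_uminus minus_add minus_minus add.assoc minus_add_cancel)
  also have "\<dots> = gaut (gmul a b) (gen j)"
   using True by (simp add: gaut_gen gaut1_def len i_def[symmetric] ab emb_add U_def V_def)
  finally show ?thesis .
 qed (simp add: gaut_gen gaut1_def len)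
qed (simp_all add: gaut_add)

lemma gaut_gone: "gaut (gone m) x = x"
proof (rule additive_eq[where \<psi> = "\<lambda>x. x"])
 fix j show "gaut (gone m) (gen j) = gen j"
  by (auto simp: gaut_gen gaut1_def gone_def tw_def)
qed (simp_all add: gaut_add)

text \<open>Suppose that \<open>u\<close> is nontrivial. One of the two equations appends to
  \<open>u\<close> the generator different from its last one, so nothing cancels on the left and the
  word grows by one letter. The right-hand side then cannot cancel either and ends in the last
  letter of \<open>u\<close>, a contradiction. So the centre is trivial and the swap is not
  inner.\<close>

lemma fixes_generators:
 assumes eq: "u + pow e 1 = pow False 1 + u" "u + pow (\<not> e) 1 = pow True 1 + u"
 shows "u = 0 \<and> \<not> e"
proof -
 have u0: "u = 0"
 proof (rule ccontr)
  assume "u ~= 0"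
  hence ne: "Rep_fg u ~= []" by (simp add: Rep_fg_inject[symmetric] zero_fg.rep_eq)
  have "last (Rep_fg u) \<in> UNIV \<times> {..<2}" using Rep_fg[of u] last_in_set[OF ne] by blast
  hence "snd (last (Rep_fg u)) = 0 \<or> snd (last (Rep_fg u)) = 1" by (cases "last (Rep_fg u)") auto
  moreover define b where "b \<longleftrightarrow> snd (last (Rep_fg u)) = 1"
  ultimately have b: "snd (last (Rep_fg u)) = of_bool b" by auto
  obtain t where t: "u + pow (\<not> b) 1 = pow t 1 + u" using eq by (cases "b = e") auto
  have p: "Rep_fg (pow i 1) = [(True, of_bool i)]" for i by (simp add: pow.rep_eq)
  have "reduced_word (Rep_fg u @ Rep_fg (pow (\<not> b) 1))"
   unfolding reduced_append using Rep_fg[of u] b by (cases b) (auto simp: p reduced_Cons inv_letter_def prod_eq_iff)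
  from Rep_fg_add[OF this] have L: "Rep_fg (u + pow (\<not> b) 1) = Rep_fg u @ [(True, of_bool (\<not> b))]" by (simp add: p)
  have R: "Rep_fg (pow t 1 + u) = reduced_cons (True, of_bool t) (Rep_fg u)" by (simp add: plus_fg.rep_eq p)
  have "reduced_cons (True, of_bool t) (Rep_fg u) = Rep_fg u @ [(True, of_bool (\<not> b))]" using L R t by simp
  hence "(True, of_bool t) # Rep_fg u = Rep_fg u @ [(True, of_bool (\<not> b))]"
   by (cases "Rep_fg u") (auto split: if_splits dest: arg_cong[of _ _ length])
  hence "last ((True, of_bool t) # Rep_fg u) = (True, of_bool (\<not> b))" by simp
  hence "snd (last (Rep_fg u)) = of_bool (\<not> b)" using ne by simp
  thus False using b by (cases b) auto
 qed
 hence "Rep_fg (pow e 1) = Rep_fg (pow False 1)" using eq(1) by simp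
 hence "\<not> e" by (simp add: pow.rep_eq)
 thus ?thesis using u0 by simp
qed

lemma gaut_faithful:
 assumes a: "a \<in> VV m" "0 < m" and eq: "\<And>j. j < 2 * m ==> gaut a (gen j) = gen j"
 shows "a = gone m"
proof -
 have len: "length (fst a) = m" using a by (simp add: VV_def)
 have *: "fst a ! i = 0 \<and> \<not> snd a" if i: "i < m" for i
 proof (rule fixes_generators)
  have g: "emb i (fst a ! i) + emb i (pow (b ~= snd a) 1) - emb i (fst a ! i) = emb i (pow b 1)" for b
  proof -
   have "2 * i + of_bool b < 2 * m" using i by (cases b) auto
   from eq[OF this] have "gaut a (emb i (pow b 1)) = emb i (pow b 1)" by (simp only: emb_pow)
   moreover have "gaut a (emb i (pow b 1)) = emb i (fst a ! i) + emb i (sg (snd a) (pow b 1)) - emb i (fst a ! i)"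
    by (rule gaut_emb) (use i len in simp)
   ultimately show ?thesis by (simp only: sg_pow)
  qed
  have h: "fst a ! i + pow (b ~= snd a) 1 = pow b 1 + fst a ! i" for b
   using g[of b] unfolding diff_eq_eq emb_add[symmetric] emb_inj .
  show "fst a ! i + pow (snd a) 1 = pow False 1 + fst a ! i" "fst a ! i + pow (\<not> snd a) 1 = pow True 1 + fst a ! i"
   using h[of False] h[of True] by simp_all
 qed
 have "fst a = replicate m 0" by (rule nth_equalityI) (use * len in auto)
 moreover have "\<not> snd a" using *[OF a(2)] by simp
 ultimately show ?thesis by (simp add: gone_def prod_eq_iff)
qed

section \<open>Restriction to the free group of rank k\<close>

definition supp :: "nat => fn set" where "supp k = {x. set (Rep_fn x) \<subseteq> UNIV \<times> {..<k}}"

lemma supp_add: "x \<in> supp k ==> y \<in> supp k ==> x + y \<in> supp k"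
 using set_wmul[of "Rep_fn x" "Rep_fn y"] by (auto simp: supp_def plus_fn.rep_eq)

lemma supp_minus: "x \<in> supp k ==> - x \<in> supp k"
 using set_winv[of "Rep_fn x"] by (simp add: supp_def uminus_fn.rep_eq)

lemma supp_gen: "gen j \<in> supp k \<longleftrightarrow> j < k"
 by (auto simp: supp_def Rep_gen)

lemma supp_hx: "(\<And>l. l \<in> set w ==> f (snd l) \<in> supp k) ==> hx f w \<in> supp k"
proof (induction w)
 case Nil
 show ?case by (simp add: supp_def zero_fn.rep_eq)
next
 case (Cons l w)
 have "(if fst l then f (snd l) else - f (snd l)) \<in> supp k" using Cons.prems[of l] supp_minus by simp
 moreover have "hx f w \<in> supp k" using Cons by simp
 ultimately show ?case by (simp only: hx.simps supp_add)
qed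

lemma gaut_supp:
 assumes a: "a \<in> VV m" and k: "2 * m <= k" and x: "x \<in> supp k"
 shows "gaut a x \<in> supp k"
 unfolding gaut_def
proof (rule supp_hx)
 fix l assume "l \<in> set (Rep_fn x)"
 hence l: "snd l < k" using x by (auto simp: supp_def)
 have len: "length (fst a) = m" using a by (simp add: VV_def)
 show "gaut1 a (snd l) \<in> supp k"
 proof (cases "snd l < 2 * m")
  case True
  let ?i = "snd l div 2"
  have "emb ?i v \<in> supp k" for v
   unfolding emb_def
  proof (rule supp_hx)
   fix l' assume "l' \<in> set (Rep_fg v)"
   hence "l' \<in> UNIV \<times> {..<2}" using Rep_fg[of v] by blast
   hence "snd l' < 2" by (cases l') auto
   moreover have "?i < m" using True by auto
   ultimately have "2 * ?i + snd l' < 2 * m" by linarith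
   thus "gen (2 * ?i + snd l') \<in> supp k" using k by (simp add: supp_gen)
  qed
  moreover have "gen (tw (snd a) (snd l)) \<in> supp k" using True k tw_less[of "snd a" "snd l" m] by (simp add: supp_gen)
  ultimately show ?thesis using True by (simp add: gaut1_def len diff_conv_add_uminus supp_add supp_minus del: add_uminus_conv_diff)
 qed (use l in \<open>simp add: gaut1_def len supp_gen\<close>)
qed

abbreviation "FF k \<equiv> carrier (free_group k)"

lemma FF_iff: "w \<in> FF k \<longleftrightarrow> (\<exists>x\<in>supp k. w = Rep_fn x)"
proof
 assume w: "w \<in> FF k"
 hence "Rep_fn (Abs_fn w) = w" by (simp add: free_group_def Abs_fn_inverse)
 thus "\<exists>x\<in>supp k. w = Rep_fn x" using w by (intro bexI[of _ "Abs_fn w"]) (auto simp: supp_def free_group_def)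
next
 assume "\<exists>x\<in>supp k. w = Rep_fn x"
 thus "w \<in> FF k" using Rep_fn by (auto simp: supp_def free_group_def)
qed

definition gautk :: "nat => gp => letter list => letter list" where
 "gautk k a = (\<lambda>w\<in>FF k. Rep_fn (gaut a (Abs_fn w)))"

lemma gautk_Rep: "x \<in> supp k ==> gautk k a (Rep_fn x) = Rep_fn (gaut a x)"
 using FF_iff[of "Rep_fn x" k] by (auto simp: gautk_def Rep_fn_inverse)

lemma gautk_FF: "a \<in> VV m ==> 2 * m <= k ==> w \<in> FF k ==> gautk k a w \<in> FF k"
 using gaut_supp[of a m k] by (auto simp: FF_iff gautk_Rep)

lemma gautk_mult:
 assumes "a \<in> VV m" "b \<in> VV m" "2 * m <= k" "w \<in> FF k"
 shows "gautk k a (gautk k b w) = gautk k (gmul a b) w"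
proof -
 obtain x where x: "x \<in> supp k" "w = Rep_fn x" using assms(4) FF_iff by blast
 show ?thesis using gaut_supp[OF assms(2,3) x(1)] x gaut_mult[OF assms(1,2), of x] by (simp add: gautk_Rep)
qed

lemma gautk_gone: "w \<in> FF k ==> gautk k (gone m) w = w"
 by (auto simp: FF_iff gautk_Rep gaut_gone)

lemma gautk_auto:
 assumes a: "a \<in> VV m" and k: "2 * m <= k"
 shows "gautk k a \<in> auto (free_group k)"
proof -
 have "bij_betw (gautk k a) (FF k) (FF k)"
 proof (rule bij_betw_byWitness[where f' = "gautk k (ginv a)"])
  have inv: "gmul (ginv a) a = gone m" by (rule gmul_ginv[OF a])
  interpret group "GG m" by (rule group_GG)
  have "gmul a (ginv a) = gone m" using inv_comm[of "ginv a" a] a inv by (simp add: GG_def)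
  thus "\<forall>w\<in>FF k. gautk k a (gautk k (ginv a) w) = w"
   using gautk_mult[OF a ginv_VV[OF a] k] gautk_gone by simp
  show "\<forall>w\<in>FF k. gautk k (ginv a) (gautk k a w) = w"
   using gautk_mult[OF ginv_VV[OF a] a k] gautk_gone inv by simp
 qed (use gautk_FF[OF a k] gautk_FF[OF ginv_VV[OF a] k] in auto)
 moreover have "gautk k a \<in> hom (free_group k) (free_group k)"
 proof (rule homI)
  fix v w assume "v \<in> FF k" "w \<in> FF k"
  then obtain x y where xy: "x \<in> supp k" "v = Rep_fn x" "y \<in> supp k" "w = Rep_fn y" using FF_iff by blast
  have m: "Rep_fn p \<otimes>\<^bsub>free_group k\<^esub> Rep_fn q = Rep_fn (p + q)" for p q
   by (simp add: free_group_def plus_fn.rep_eq)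
  show "gautk k a (v \<otimes>\<^bsub>free_group k\<^esub> w) = gautk k a v \<otimes>\<^bsub>free_group k\<^esub> gautk k a w"
   using xy supp_add[OF xy(1,3)] by (simp add: m gautk_Rep gaut_add)
 qed (rule gautk_FF[OF a k])
 ultimately show ?thesis by (simp add: auto_def Bij_def) (simp add: gautk_def)
qed

lemma gautk_hom:
 assumes k: "2 * m <= k"
 shows "gautk k \<in> hom (HH m) (AutoGroup (free_group k))"
proof (rule homI)
 fix a assume "a \<in> carrier (HH m)"
 thus "gautk k a \<in> carrier (AutoGroup (free_group k))" using gautk_auto[OF _ k] by (simp add: AutoGroup_def HH_def)
 fix b assume "b \<in> carrier (HH m)"
 with \<open>a \<in> carrier (HH m)\<close> have ab: "a \<in> VV m" "b \<in> VV m" by (auto simp: HH_def)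
 have B: "gautk k a \<in> Bij (FF k)" "gautk k b \<in> Bij (FF k)" using gautk_auto[OF _ k] ab by (auto simp: auto_def)
 have "gautk k (gmul a b) = compose (FF k) (gautk k a) (gautk k b)"
 proof
  fix w show "gautk k (gmul a b) w = compose (FF k) (gautk k a) (gautk k b) w"
   by (cases "w \<in> FF k") (simp_all add: compose_def gautk_mult[OF ab k] gautk_def[of k "gmul a b"])
 qed
 thus "gautk k (a \<otimes>\<^bsub>HH m\<^esub> b) = gautk k a \<otimes>\<^bsub>AutoGroup (free_group k)\<^esub> gautk k b"
  using B by (simp add: HH_def AutoGroup_def BijGroup_def)
qed

lemma gautk_inj:
 assumes k: "2 * m <= k" and m: "0 < m"
 shows "inj_on (gautk k) (VV m)"
proof (rule inj_onI)
 fix a b assume ab: "a \<in> VV m" "b \<in> VV m" "gautk k a = gautk k b"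
 let ?c = "gmul (ginv b) a"
 have c: "?c \<in> VV m" using ab by simp
 have "gaut ?c (gen j) = gen j" if "j < 2 * m" for j
 proof -
  have j: "gen j \<in> supp k" using that k by (simp add: supp_gen)
  have "Rep_fn (gaut a (gen j)) = Rep_fn (gaut b (gen j))" using gautk_Rep[OF j] ab(3) by metis
  hence "gaut a (gen j) = gaut b (gen j)" by (simp add: Rep_fn_inject)
  hence "gaut (ginv b) (gaut a (gen j)) = gaut (ginv b) (gaut b (gen j))" by simp
  thus ?thesis
   using gaut_mult[OF ginv_VV[OF ab(2)] ab(1)] gaut_mult[OF ginv_VV[OF ab(2)] ab(2)] gmul_ginv[OF ab(2)] gaut_gone by simp
 qed
 hence "?c = gone m" by (rule gaut_faithful[OF c m])
 hence "gmul (ginv b) a = gmul (ginv b) b" using gmul_ginv[OF ab(2)] by simp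
 thus "a = b" using inj_onD[OF inj_gmul[OF ginv_VV[OF ab(2)]]] ab by blast
qed

text \<open>An element whose only nontrivial entry has the form \<open>v - swp v\<close>, together
  with the swap, squares to 1. With \<open>v\<close> a power of a generator the exponent sum
  cancels, so the element lies in the kernel.\<close>

definition invol :: "nat => nat => gp" where
 "invol m j = ((pow False (int j) - pow True (int j)) # replicate m 0, True)"

lemma invol_HH: "invol m j \<in> carrier (HH (Suc m))"
 by (simp add: HH_def VV_def invol_def hs_def sum_list_replicate diff_conv_add_uminus del: add_uminus_conv_diff)

lemma invol_order: "gmul (invol m j) (invol m j) = gone (Suc m)" "invol m j ~= gone (Suc m)"
proof -
 have "map2 (\<lambda>w v. w + swp v) (replicate m 0) (replicate m 0) = replicate m (0::fg)"
  by (simp add: zip_replicate)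
 moreover have "pow False (int j) - pow True (int j) + swp (pow False (int j) - pow True (int j)) = 0"
  using sg_pow[of True False "int j"] sg_pow[of True True "int j"]
  by (simp add: sg_def diff_conv_add_uminus add.assoc del: add_uminus_conv_diff)
 ultimately show "gmul (invol m j) (invol m j) = gone (Suc m)" by (simp add: gmul_def invol_def gone_def sg_def)
qed (simp add: invol_def gone_def)

text \<open>
 A conjugator between two of these involutions would have trivial entries except the first one,
 whose exponent sum is \<open>j' - j\<close>, because \<open>swp\<close> has no fixed points except \<open>0\<close>.
\<close>

lemma invol_conj:
 assumes a: "a \<in> carrier (HH (Suc m))" and eq: "gmul (invol m j') a = gmul a (invol m j)"
 shows "j = j'"
proof -
 have "a \<in> VV (Suc m)" using a by (simp add: HH_def)
 then obtain w ws e where a': "a = (w # ws, e)" "length ws = m" using VV_SucE[of a m] by (auto simp: VV_def)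
 let ?x = "pow False (int j)" and ?y = "pow False (int j')"
 have sx: "pow True n = swp (pow False n)" for n using sg_pow[of True False n] by (simp add: sg_def)
 have l: "map2 (\<lambda>w v. w + sg e v) ws (replicate m 0) = map2 (\<lambda>w v. w + swp v) (replicate m 0) ws"
  and h: "?y - swp ?y + swp w = w + sg e (?x - swp ?x)"
  using eq by (auto simp: gmul_def invol_def a'(1) sg_def sx)
 have "ws ! i = 0" if "i < m" for i
 proof -
  have "map2 (\<lambda>w v. w + sg e v) ws (replicate m 0) ! i = map2 (\<lambda>w v. w + swp v) (replicate m 0) ws ! i" using l by simp
  hence "swp (ws ! i) = ws ! i" using that a'(2) by simp
  thus ?thesis by (rule swp_fixed)
 qed
 hence "ws = replicate m 0" using a'(2) by (intro nth_equalityI) auto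
 hence w0: "fh w = 0" using a a'(1) by (simp add: HH_def hs_def sum_list_replicate)
 \<comment> \<open>Rearranged, \<open>h\<close> says exactly that \<open>z\<close> is fixed by
   \<open>swp\<close>.\<close>
 define z where "z = - ?y + w + sg e ?x"
 have h': "?y + (- swp ?y + swp w) = w + (sg e ?x + - sg e (swp ?x))"
  using h by (simp only: diff_conv_add_uminus add.assoc sg_simps)
 have s: "swp (sg e v) = sg e (swp v)" for v by (simp add: sg_def)
 have "swp z = - swp ?y + swp w + sg e (swp ?x)" by (simp only: z_def swp_add swp_minus s)
 also have "- swp ?y + swp w = - ?y + (w + (sg e ?x + - sg e (swp ?x)))"
  unfolding h'[symmetric] by (simp only: minus_add_cancel)
 also have "\<dots> + sg e (swp ?x) = z"
  unfolding z_def by (simp only: add.assoc left_minus add_0_right)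
 finally have "z = 0" by (rule swp_fixed)
 hence "fh z = 0" by simp
 thus "j = j'" using w0 by (simp add: z_def)
qed

lemma ord_eq_2I:
 assumes "group G" "x \<in> carrier G" "x \<otimes>\<^bsub>G\<^esub> x = \<one>\<^bsub>G\<^esub>" "x ~= \<one>\<^bsub>G\<^esub>"
 shows "group.ord G x = 2"
proof -
 interpret group G by fact
 have "x [^]\<^bsub>G\<^esub> (2::nat) = \<one>\<^bsub>G\<^esub>" using assms by (simp add: numeral_2_eq_2)
 hence "ord x dvd 2" using pow_eq_id[OF assms(2), of 2] by simp
 moreover have "ord x ~= 1"
 proof
  assume "ord x = 1"
  hence "x [^]\<^bsub>G\<^esub> (1::nat) = \<one>\<^bsub>G\<^esub>" using pow_eq_id[OF assms(2), of 1] by simp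
  thus False using assms by simp
 qed
 moreover have "prime (2::nat)" by simp
 ultimately show ?thesis by (metis prime_nat_iff)
qed

theorem theorem3p2:
  fixes k :: nat
  assumes "k \<ge> 2"
  shows "\<exists>H. subgroup H (AutoGroup (free_group k)) \<and>
    type_F (k div 2 - 1) (AutoGroup (free_group k) \<lparr>carrier := H\<rparr>) \<and>
    infinite {conjugacy_class (AutoGroup (free_group k) \<lparr>carrier := H\<rparr>) h | h.
      h \<in> H \<and> group.ord (AutoGroup (free_group k) \<lparr>carrier := H\<rparr>) h = 2}"
proof -
 define m where "m = k div 2"
 have m: "0 < m" "2 * m <= k" using assms by (auto simp: m_def)
 then obtain m' where m': "m = Suc m'" by (cases m) auto
 let ?A = "AutoGroup (free_group k)"
 interpret F: group "free_group k" by (rule group_free_group)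
 interpret A: group ?A by (rule F.AutoGroup)
 interpret HH: group "HH m" by (rule group_HH)
 interpret gh: group_hom "HH m" ?A "gautk k"
  by unfold_locales (rule gautk_hom[OF m(2)])
 define H where "H = gautk k ` carrier (HH m)"
 let ?K = "?A \<lparr>carrier := H\<rparr>"
 have sub: "subgroup H ?A" unfolding H_def by (rule gh.img_is_subgroup)
 interpret K: group ?K by (rule A.subgroup_imp_group[OF sub])
 have inj: "inj_on (gautk k) (carrier (HH m))"
  by (rule inj_on_subset[OF gautk_inj[OF m(2,1)]]) (auto simp: HH_def)
 have mult: "gautk k (gmul a b) = gautk k a \<otimes>\<^bsub>?K\<^esub> gautk k b" if "a \<in> carrier (HH m)" "b \<in> carrier (HH m)" for a b
  using gh.hom_mult[OF that] by (simp add: HH_def)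
 have one: "gautk k (gone m) = \<one>\<^bsub>?K\<^esub>" using gh.hom_one by (simp add: HH_def)
 have "gautk k \<in> iso (HH m) ?K"
  unfolding iso_def using inj gh.homh by (auto simp: H_def hom_def bij_betw_def)
 hence "HH m \<cong> ?K" by (rule is_isoI)
 \<comment> \<open>The elements of the subgroup are functions on words, and \<open>type_F\<close>
   prescribes lists of group elements as labels of points. The free type of labels in
   \<open>HH_complex\<close> is instantiated accordingly before passing along the
   isomorphism.\<close>
 moreover obtain X :: "((letter list => letter list) list \<times> rvec) topology" and C
  where X: "CW_complex X C" "Eilenberg_MacLane_1 X (HH m)" "finite_skeleton (m - 1) C"
  using HH_complex[OF m(1)] by blast
 ultimately have "Eilenberg_MacLane_1 X ?K"
  unfolding Eilenberg_MacLane_1_def using iso_trans by blast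
 hence F: "type_F (k div 2 - 1) ?K" unfolding type_F_def using X(1,3) m_def by blast
 let ?t = "\<lambda>j. gautk k (invol m' j)"
 have inv: "invol m' j \<in> carrier (HH m)" for j unfolding m' by (rule invol_HH)
 have tH: "?t j \<in> H" for j unfolding H_def using inv by blast
 have ord: "K.ord (?t j) = 2" for j
 proof (rule ord_eq_2I)
  show "?t j \<otimes>\<^bsub>?K\<^esub> ?t j = \<one>\<^bsub>?K\<^esub>" using mult[OF inv inv, of j j] invol_order(1)[of m' j] one m' by simp
  have "invol m' j ~= gone m" using invol_order(2) m' by simp
  moreover have "gone m \<in> carrier (HH m)" by (simp add: HH_def)
  ultimately show "?t j ~= \<one>\<^bsub>?K\<^esub>" using inj_onD[OF inj, of "invol m' j" "gone m"] inv one by auto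
 qed (use tH K.is_group in auto)
 have "inj (\<lambda>j. conjugacy_class ?K (?t j))"
 proof (rule injI)
  fix j j' assume eq: "conjugacy_class ?K (?t j) = conjugacy_class ?K (?t j')"
  have tK: "?t j \<in> carrier ?K" "?t j' \<in> carrier ?K" using tH by auto
  have e1: "?t j' = \<one>\<^bsub>?K\<^esub> \<otimes>\<^bsub>?K\<^esub> ?t j' \<otimes>\<^bsub>?K\<^esub> inv\<^bsub>?K\<^esub> \<one>\<^bsub>?K\<^esub>"
   using K.l_one[OF tK(2)] K.r_one[OF tK(2)] K.inv_one by simp
  have "?t j' \<in> conjugacy_class ?K (?t j')"
   unfolding conjugacy_class_def image_iff by (rule bexI[where x = "\<one>\<^bsub>?K\<^esub>"], rule e1, rule K.one_closed)
  hence "?t j' \<in> conjugacy_class ?K (?t j)" by (simp only: eq)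
  hence "\<exists>g\<in>carrier ?K. ?t j' = g \<otimes>\<^bsub>?K\<^esub> ?t j \<otimes>\<^bsub>?K\<^esub> inv\<^bsub>?K\<^esub> g"
   by (simp only: conjugacy_class_def image_iff)
  then obtain g where g: "g \<in> carrier ?K" "?t j' = g \<otimes>\<^bsub>?K\<^esub> ?t j \<otimes>\<^bsub>?K\<^esub> inv\<^bsub>?K\<^esub> g" by (elim bexE)
  then obtain a where a: "a \<in> carrier (HH m)" "g = gautk k a" by (auto simp: H_def)
  have "g \<otimes>\<^bsub>?K\<^esub> ?t j = ?t j' \<otimes>\<^bsub>?K\<^esub> g"
   by (rule K.inv_solve_right[OF tK(2) K.m_closed[OF g(1) tK(1)] g(1), THEN iffD1, OF g(2)])
  hence "gautk k (gmul (invol m' j') a) = gautk k (gmul a (invol m' j))"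
   using mult[OF inv a(1)] mult[OF a(1) inv] a(2) by simp
  moreover have "gmul (invol m' j') a \<in> carrier (HH m)" "gmul a (invol m' j) \<in> carrier (HH m)"
   using HH.m_closed[OF inv a(1)] HH.m_closed[OF a(1) inv] by (simp_all add: HH_def)
  ultimately have "gmul (invol m' j') a = gmul a (invol m' j)" by (rule inj_onD[OF inj])
  thus "j = j'" using invol_conj[of a m' j' j] a(1) m' by simp
 qed
 hence "infinite (range (\<lambda>j. conjugacy_class ?K (?t j)))" by (rule range_inj_infinite)
 moreover have "range (\<lambda>j. conjugacy_class ?K (?t j)) \<subseteq> {conjugacy_class ?K h | h. h \<in> H \<and> K.ord h = 2}"
  using tH ord by blast
 ultimately have "infinite {conjugacy_class ?K h | h. h \<in> H \<and> K.ord h = 2}" by (rule infinite_super[rotated])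
 thus ?thesis by (intro exI[of _ H] conjI sub F)
qed

end
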